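(* The problem of deciding, given an epistemic logic program (ELP) $P\in\mathsf{EHorn}$, whether $P$ admits a world view is (1) in $\mathrm P$ if $P$ is ground; (2) $\mathrm{coNP}$-complete if $P$ is non-ground and has bounded arity; and (3) $\mathrm{EXP}$-complete if $P$ is non-ground.
   Context: Syntax. Atoms are $p(t_1,\dots,t_n)$ with $p$ a predicate symbol of arity $n\ge 0$ and each $t_j$ a constant or a variable (no function symbols). A literal is an atom $a$ or its negation $\neg a$, with $\neg\neg a=a$. An epistemic literal is an expression $\mathbf{not}\,\ell$ with $\ell$ a literal; $\mathbf K\ell$ abbreviates $\neg\,\mathbf{not}\,\ell$ and $\mathbf M\ell$ abbreviates $\mathbf{not}\,\neg\ell$. An ELP is a finite set of rules $a_1\vee\dots\vee a_k\leftarrow \beta_1,\dots,\beta_n$ where the $a_j$ are atoms ($k=0$ is allowed: a constraint) and each body element $\beta_j$ is a literal, an epistemic literal, or a negated epistemic literal. A program without epistemic literals is a logic program. For a rule $r$: $H_r$ is the set of head atoms, $B_r^+$ (resp. $B_r^-$) the set of atoms occurring in the body as non-epistemic positive (resp. negated) literals. Safety is assumed: $\mathrm{vars}(H_r\cup B^-_r)\subseteq \mathrm{vars}(B^+_r)$ (this can be ensured by a unary domain predicate holding for all constants). $\mathrm{at}(\cdot)$ denotes the set of atoms occurring in an object, and $\mathrm{lits}(P)=\mathrm{at}(P)\cup\{\neg a: a\in \mathrm{at}(P)\}$. Class. $\mathsf{EHorn}$ is the class of ELPs with no negations (neither $\neg$ nor $\mathbf{not}$) and no disjunctions, except that the expressions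 $\mathbf K a$ and $\mathbf M a$ ($a$ an atom) are allowed in rule bodies. Grounding. The Herbrand universe is the set of constants occurring in $P$ (an arbitrary single constant if there are none); $\mathrm{grd}(P)$ is obtained by replacing in each rule all variables in all possible ways by elements of the Herbrand universe. A program is ground if it has no variables. Answer sets. For a ground logic program $P$, a set $M$ of ground atoms satisfies a rule $r$ if $(H_r\cup B_r^-)\cap M\ne\emptyset$ or $B_r^+\not\subseteq M$; $M$ is an answer set of $P$ if $M$ is a $\subseteq$-minimal model of $P^M=\{H_r\leftarrow B_r^+ : r\in P,\ B_r^-\cap M=\emptyset\}$. $AS(P)$ is the set of answer sets. World views. Let $P$ be a ground ELP. A world view interpretation (WVI) is a consistent set $I\subseteq\mathrm{lits}(P)$ (no $a,\neg a$ both in $I$). The epistemic reduct $P^I$ results from $P$ by replacing each epistemic literal $\mathbf{not}\,\ell$ by $\neg\ell$ if $\ell\in I$, and by $\top$ otherwise; double negation cancels. $I$ is a world view of $P$ if it is compatible with $\mathcal I=AS(P^I)$, i.e. (i) $\mathcal I\neq\emptyset$, and for each atom $a$: (ii) $a\in I$ implies $a\in J$ for all $J\in\mathcal I$; (iii) $\neg a\in I$ implies $a\notin J$ for all $J\in\mathcal I$; (iv) if $a\in\mathrm{at}(P)$ and neither $a$ nor $\neg a$ is in $I$, then $a\in J$ and $a\notin J'$ for some $J,J'\in\mathcal I$. The world views of a non-ground ELP $P$ are those of $\mathrm{grd}(P)$. "Bounded arity" means that all predicates of $P$ have arity at most $m$, for some arbitrary but fixed constant $m$. *)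

theory Defs
  imports Main
begin

section \<open>Epistemic logic programs\<close>

text \<open>Predicate symbols, constants and variables are named by binary words, so that programs
  have a finite encoding.  A predicate symbol is a name together with an arity: \<open>Atom p ts\<close> is built
  from the predicate symbol \<open>(p, length ts)\<close>.\<close>

type_synonym name = "bool list"

datatype trm = Const name | Var name

datatype atom = Atom (pred: name) (args: "trm list")

datatype 'a literal = Pos 'a | Neg 'a

fun compl :: "'a literal \<Rightarrow> 'a literal" where
  "compl (Pos a) = Neg a"
| "compl (Neg a) = Pos a"

text \<open>The three constructors stand for a literal \<open>l\<close>, an epistemic literal \<open>not l\<close>
  and a negated epistemic literal \<open>\<not> not l\<close>.\<close>

datatype 'a body_elem = Lit "'a literal" | ENot "'a literal" | NegENot "'a literal"

abbreviation Know :: "'a literal \<Rightarrow> 'a body_elem" where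
  "Know l \<equiv> NegENot l"

abbreviation May :: "'a literal \<Rightarrow> 'a body_elem" where
  "May l \<equiv> ENot (compl l)"

text \<open>The head list is a disjunction; the empty head gives a constraint.\<close>

datatype 'a rule = Rule (head: "'a list") (body: "'a body_elem list")

definition pos_body :: "'a rule \<Rightarrow> 'a set" where
  "pos_body r = {a. Lit (Pos a) \<in> set (body r)}"

definition neg_body :: "'a rule \<Rightarrow> 'a set" where
  "neg_body r = {a. Lit (Neg a) \<in> set (body r)}"

definition atoms :: "'a rule set \<Rightarrow> 'a set" where
  "atoms P = (\<Union>r\<in>P. set_rule r)"

definition lits :: "'a rule set \<Rightarrow> 'a literal set" where
  "lits P = Pos ` atoms P \<union> Neg ` atoms P"

definition vars_atom :: "atom \<Rightarrow> name set" where
  "vars_atom a = {x. Var x \<in> set (args a)}"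

definition consts_atom :: "atom \<Rightarrow> name set" where
  "consts_atom a = {c. Const c \<in> set (args a)}"

definition safe :: "atom rule \<Rightarrow> bool" where
  "safe r \<longleftrightarrow>
     (\<Union>a \<in> set (head r) \<union> neg_body r. vars_atom a) \<subseteq> (\<Union>a \<in> pos_body r. vars_atom a)"

definition ELP :: "atom rule set set" where
  "ELP = {P. finite P \<and> (\<forall>r\<in>P. safe r)}"

definition EHorn :: "atom rule set set" where
  "EHorn = {P \<in> ELP. \<forall>r\<in>P. length (head r) \<le> 1 \<and>
     (\<forall>b \<in> set (body r). \<exists>a. b = Lit (Pos a) \<or> b = Know (Pos a) \<or> b = May (Pos a))}"

definition ground :: "atom rule set \<Rightarrow> bool" where
  "ground P \<longleftrightarrow> (\<forall>a \<in> atoms P. vars_atom a = {})"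

definition arity_at_most :: "nat \<Rightarrow> atom rule set \<Rightarrow> bool" where
  "arity_at_most m P \<longleftrightarrow> (\<forall>a \<in> atoms P. length (args a) \<le> m)"


section \<open>Grounding\<close>

definition herbrand_universe :: "atom rule set \<Rightarrow> name set" where
  "herbrand_universe P =
     (let C = (\<Union>a \<in> atoms P. consts_atom a) in if C = {} then {undefined} else C)"

fun subst_trm :: "(name \<Rightarrow> name) \<Rightarrow> trm \<Rightarrow> trm" where
  "subst_trm \<sigma> (Const c) = Const c"
| "subst_trm \<sigma> (Var x) = Const (\<sigma> x)"

fun subst_atom :: "(name \<Rightarrow> name) \<Rightarrow> atom \<Rightarrow> atom" where
  "subst_atom \<sigma> (Atom p ts) = Atom p (map (subst_trm \<sigma>) ts)"

definition grd :: "atom rule set \<Rightarrow> atom rule set" where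
  "grd P = {map_rule (subst_atom \<sigma>) r | \<sigma> r. r \<in> P \<and> range \<sigma> \<subseteq> herbrand_universe P}"


section \<open>Answer sets and world views\<close>

definition satisfies :: "'a set \<Rightarrow> 'a rule \<Rightarrow> bool" where
  "satisfies M r \<longleftrightarrow> (set (head r) \<union> neg_body r) \<inter> M \<noteq> {} \<or> \<not> pos_body r \<subseteq> M"

definition is_model :: "'a set \<Rightarrow> 'a rule set \<Rightarrow> bool" where
  "is_model M P \<longleftrightarrow> (\<forall>r\<in>P. satisfies M r)"

definition positive_part :: "'a rule \<Rightarrow> 'a rule" where
  "positive_part r = Rule (head r) (filter (\<lambda>b. \<exists>a. b = Lit (Pos a)) (body r))"

definition gl_reduct :: "'a rule set \<Rightarrow> 'a set \<Rightarrow> 'a rule set" where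
  "gl_reduct P M = {positive_part r | r. r \<in> P \<and> neg_body r \<inter> M = {}}"

definition answer_sets :: "'a rule set \<Rightarrow> 'a set set" where
  "answer_sets P =
     {M. is_model M (gl_reduct P M) \<and> (\<forall>M'. M' \<subset> M \<longrightarrow> \<not> is_model M' (gl_reduct P M))}"

text \<open>In the epistemic reduct, a body element that becomes \<open>\<top>\<close> is dropped from the body, and a
  rule with a body element that becomes \<open>\<not>\<top>\<close> is deleted.\<close>

fun reduct_elem :: "'a literal set \<Rightarrow> 'a body_elem \<Rightarrow> 'a body_elem list" where
  "reduct_elem I (Lit l) = [Lit l]"
| "reduct_elem I (ENot l) = (if l \<in> I then [Lit (compl l)] else [])"
| "reduct_elem I (NegENot l) = [Lit l]"

definition epistemic_reduct :: "'a rule set \<Rightarrow> 'a literal set \<Rightarrow> 'a rule set" where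
  "epistemic_reduct P I =
     {Rule (head r) (concat (map (reduct_elem I) (body r))) | r.
        r \<in> P \<and> (\<forall>l. NegENot l \<in> set (body r) \<longrightarrow> l \<in> I)}"

definition is_WVI :: "'a rule set \<Rightarrow> 'a literal set \<Rightarrow> bool" where
  "is_WVI P I \<longleftrightarrow> I \<subseteq> lits P \<and> (\<forall>a. \<not> (Pos a \<in> I \<and> Neg a \<in> I))"

definition compatible :: "'a rule set \<Rightarrow> 'a literal set \<Rightarrow> 'a set set \<Rightarrow> bool" where
  "compatible P I \<J> \<longleftrightarrow>
     \<J> \<noteq> {} \<and>
     (\<forall>a. (Pos a \<in> I \<longrightarrow> (\<forall>J\<in>\<J>. a \<in> J)) \<and>
          (Neg a \<in> I \<longrightarrow> (\<forall>J\<in>\<J>. a \<notin> J)) \<and>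
          (a \<in> atoms P \<and> Pos a \<notin> I \<and> Neg a \<notin> I \<longrightarrow> (\<exists>J\<in>\<J>. a \<in> J) \<and> (\<exists>J'\<in>\<J>. a \<notin> J')))"

definition ground_world_view :: "'a rule set \<Rightarrow> 'a literal set \<Rightarrow> bool" where
  "ground_world_view P I \<longleftrightarrow> is_WVI P I \<and> compatible P I (answer_sets (epistemic_reduct P I))"

text \<open>For ground programs, \<open>grd\<close> is the identity (\<open>grd_ground\<close> below).\<close>

definition world_view :: "atom rule set \<Rightarrow> atom literal set \<Rightarrow> bool" where
  "world_view P I \<longleftrightarrow> ground_world_view (grd P) I"

lemma subst_atom_ground: "vars_atom a = {} \<Longrightarrow> subst_atom \<sigma> a = a"
proof (cases a)
  case (Atom p ts)
  assume "vars_atom a = {}"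
  then have "subst_trm \<sigma> t = t" if "t \<in> set ts" for t
    using that Atom by (cases t) (auto simp: vars_atom_def)
  then show ?thesis
    using Atom by (simp add: map_idI)
qed

lemma grd_ground:
  assumes "ground P"
  shows "grd P = P"
proof -
  have id: "map_rule (subst_atom \<sigma>) r = r" if "r \<in> P" for \<sigma> r
  proof -
    have "subst_atom \<sigma> a = a" if "a \<in> set_rule r" for a
      using that \<open>r \<in> P\<close> assms by (intro subst_atom_ground) (auto simp: ground_def atoms_def)
    then have "map_rule (subst_atom \<sigma>) r = map_rule id r"
      by (intro rule.map_cong) auto
    then show ?thesis
      by (simp add: rule.map_id)
  qed
  have "herbrand_universe P \<noteq> {}"
    by (simp add: herbrand_universe_def Let_def)
  then obtain c where "c \<in> herbrand_universe P"
    by blast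
  then have c: "range (\<lambda>_. c) \<subseteq> herbrand_universe P"
    by auto
  show ?thesis
  proof
    show "grd P \<subseteq> P"
      by (auto simp: grd_def id)
    show "P \<subseteq> grd P"
    proof
      fix r assume "r \<in> P"
      with c id[of r "\<lambda>_. c"] show "r \<in> grd P"
        unfolding grd_def mem_Collect_eq by metis
    qed
  qed
qed


section \<open>Encoding of programs as binary words\<close>

text \<open>A self-delimiting code: each list element is preceded by \<open>True\<close>, and \<open>False\<close> ends the list.\<close>

definition enc_list :: "('a \<Rightarrow> bool list) \<Rightarrow> 'a list \<Rightarrow> bool list" where
  "enc_list f xs = concat (map (\<lambda>x. True # f x) xs) @ [False]"

definition enc_word :: "bool list \<Rightarrow> bool list" where
  "enc_word = enc_list (\<lambda>b. [b])"

fun enc_trm :: "trm \<Rightarrow> bool list" where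
  "enc_trm (Const c) = False # enc_word c"
| "enc_trm (Var x) = True # enc_word x"

fun enc_atom :: "atom \<Rightarrow> bool list" where
  "enc_atom (Atom p ts) = enc_word p @ enc_list enc_trm ts"

fun enc_literal :: "atom literal \<Rightarrow> bool list" where
  "enc_literal (Pos a) = False # enc_atom a"
| "enc_literal (Neg a) = True # enc_atom a"

fun enc_body_elem :: "atom body_elem \<Rightarrow> bool list" where
  "enc_body_elem (Lit l) = False # enc_literal l"
| "enc_body_elem (ENot l) = True # False # enc_literal l"
| "enc_body_elem (NegENot l) = True # True # enc_literal l"

fun enc_rule :: "atom rule \<Rightarrow> bool list" where
  "enc_rule (Rule H B) = enc_list enc_atom H @ enc_list enc_body_elem B"

definition enc_program :: "atom rule list \<Rightarrow> bool list" where
  "enc_program = enc_list enc_rule"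

definition prefix_code :: "('a \<Rightarrow> bool list) \<Rightarrow> bool" where
  "prefix_code f \<longleftrightarrow> (\<forall>x y u v. f x @ u = f y @ v \<longrightarrow> x = y \<and> u = v)"

lemma prefix_codeD: "prefix_code f \<Longrightarrow> f x @ u = f y @ v \<Longrightarrow> x = y \<and> u = v"
  unfolding prefix_code_def by blast

lemma prefix_code_enc_list:
  assumes "prefix_code f"
  shows "prefix_code (enc_list f)"
proof -
  have "xs = ys \<and> u = v" if "enc_list f xs @ u = enc_list f ys @ v" for xs ys u v
    using that
  proof (induction xs arbitrary: ys)
    case Nil
    then show ?case by (cases ys) (auto simp: enc_list_def)
  next
    case (Cons x xs)
    then obtain y ys' where ys: "ys = y # ys'"
      by (cases ys) (auto simp: enc_list_def)
    with Cons.prems have "f x @ enc_list f xs @ u = f y @ enc_list f ys' @ v"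
      by (simp add: enc_list_def)
    then have "x = y" "enc_list f xs @ u = enc_list f ys' @ v"
      using prefix_codeD[OF assms] by blast+
    with Cons.IH ys show ?case by blast
  qed
  then show ?thesis unfolding prefix_code_def by blast
qed

lemma prefix_code_enc_word: "prefix_code enc_word"
  unfolding enc_word_def by (rule prefix_code_enc_list) (simp add: prefix_code_def)

lemma prefix_code_enc_trm: "prefix_code enc_trm"
  unfolding prefix_code_def
proof (intro allI impI)
  fix x y u v
  assume "enc_trm x @ u = enc_trm y @ v"
  then show "x = y \<and> u = v"
    by (cases x; cases y) (auto dest: prefix_codeD[OF prefix_code_enc_word])
qed

lemma prefix_code_enc_atom: "prefix_code enc_atom"
  unfolding prefix_code_def
proof (intro allI impI)
  fix x y u v
  assume "enc_atom x @ u = enc_atom y @ v"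
  then show "x = y \<and> u = v"
    by (cases x; cases y)
      (auto dest!: prefix_codeD[OF prefix_code_enc_word]
        prefix_codeD[OF prefix_code_enc_list[OF prefix_code_enc_trm]])
qed

lemma prefix_code_enc_literal: "prefix_code enc_literal"
  unfolding prefix_code_def
proof (intro allI impI)
  fix x y u v
  assume "enc_literal x @ u = enc_literal y @ v"
  then show "x = y \<and> u = v"
    by (cases x; cases y) (auto dest: prefix_codeD[OF prefix_code_enc_atom])
qed

lemma prefix_code_enc_body_elem: "prefix_code enc_body_elem"
  unfolding prefix_code_def
proof (intro allI impI)
  fix x y u v
  assume "enc_body_elem x @ u = enc_body_elem y @ v"
  then show "x = y \<and> u = v"
    by (cases x; cases y) (auto dest: prefix_codeD[OF prefix_code_enc_literal])
qed

lemma prefix_code_enc_rule: "prefix_code enc_rule"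
  unfolding prefix_code_def
proof (intro allI impI)
  fix x y u v
  assume "enc_rule x @ u = enc_rule y @ v"
  then show "x = y \<and> u = v"
    by (cases x; cases y)
      (auto dest!: prefix_codeD[OF prefix_code_enc_list[OF prefix_code_enc_atom]]
        prefix_codeD[OF prefix_code_enc_list[OF prefix_code_enc_body_elem]])
qed

lemma prefix_code_enc_program: "prefix_code enc_program"
  unfolding enc_program_def by (rule prefix_code_enc_list[OF prefix_code_enc_rule])

lemma inj_enc_program: "inj enc_program"
  by (rule injI) (metis prefix_codeD[OF prefix_code_enc_program])


section \<open>Deterministic multi-tape Turing machines\<close>

datatype dir = Leftwards | Stay | Rightwards

text \<open>A tape is two-way infinite and is given with its head position.  Symbol \<open>0\<close> is the blank,
  symbols \<open>1\<close> and \<open>2\<close> are the bits.  State \<open>0\<close> is initial; the halting states are \<open>1\<close> (accepting)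
  and \<open>2\<close> (rejecting).\<close>

type_synonym tape = "(int \<Rightarrow> nat) \<times> int"

type_synonym config = "nat \<times> tape list"

record turing_machine =
  num_tapes :: nat
  num_symbols :: nat
  num_states :: nat
  delta :: "nat \<Rightarrow> nat list \<Rightarrow> nat \<times> (nat \<times> dir) list"

definition wf_tm :: "turing_machine \<Rightarrow> bool" where
  "wf_tm M \<longleftrightarrow> num_tapes M \<ge> 1 \<and> num_symbols M \<ge> 3 \<and> num_states M \<ge> 3 \<and>
     (\<forall>q < num_states M. \<forall>ss. length ss = num_tapes M \<and> set ss \<subseteq> {..<num_symbols M} \<longrightarrow>
        (case delta M q ss of (q', acts) \<Rightarrow>
           q' < num_states M \<and> length acts = num_tapes M \<and>
           fst ` set acts \<subseteq> {..<num_symbols M}))"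

fun read :: "tape \<Rightarrow> nat" where
  "read (t, h) = t h"

fun move :: "dir \<Rightarrow> int \<Rightarrow> int" where
  "move Leftwards h = h - 1"
| "move Stay h = h"
| "move Rightwards h = h + 1"

fun act :: "nat \<times> dir \<Rightarrow> tape \<Rightarrow> tape" where
  "act (s, d) (t, h) = (t(h := s), move d h)"

fun halted :: "config \<Rightarrow> bool" where
  "halted (q, ts) \<longleftrightarrow> q = 1 \<or> q = 2"

fun step :: "turing_machine \<Rightarrow> config \<Rightarrow> config" where
  "step M (q, ts) =
     (if halted (q, ts) then (q, ts)
      else case delta M q (map read ts) of (q', acts) \<Rightarrow> (q', map2 act acts ts))"

definition bit_symbol :: "bool \<Rightarrow> nat" where
  "bit_symbol b = (if b then 2 else 1)"

definition input_tape :: "bool list \<Rightarrow> tape" where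
  "input_tape x =
     (\<lambda>i. if 0 \<le> i \<and> i < int (length x) then bit_symbol (x ! nat i) else 0, 0)"

definition init_config :: "turing_machine \<Rightarrow> bool list \<Rightarrow> config" where
  "init_config M x = (0, input_tape x # replicate (num_tapes M - 1) (\<lambda>_. 0, 0))"

definition run :: "turing_machine \<Rightarrow> bool list \<Rightarrow> nat \<Rightarrow> config" where
  "run M x t = (step M ^^ t) (init_config M x)"

text \<open>The output word of a tape starts at position \<open>0\<close> and ends before the next blank.\<close>

fun tape_output :: "tape \<Rightarrow> bool list \<Rightarrow> bool" where
  "tape_output (t, h) y \<longleftrightarrow>
     (\<forall>i < length y. t (int i) = bit_symbol (y ! i)) \<and> t (int (length y)) = 0"


section \<open>Complexity classes\<close>

type_synonym language = "bool list set"

definition decides_in_time :: "turing_machine \<Rightarrow> language \<Rightarrow> (nat \<Rightarrow> nat) \<Rightarrow> bool" where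
  "decides_in_time M A T \<longleftrightarrow>
     (\<forall>x. fst (run M x (T (length x))) = (if x \<in> A then 1 else 2))"

definition computes_in_time ::
  "turing_machine \<Rightarrow> (bool list \<Rightarrow> bool list) \<Rightarrow> (nat \<Rightarrow> nat) \<Rightarrow> bool" where
  "computes_in_time M f T \<longleftrightarrow>
     (\<forall>x. halted (run M x (T (length x))) \<and>
          tape_output (last (snd (run M x (T (length x))))) (f x))"

definition DTIME :: "(nat \<Rightarrow> nat) \<Rightarrow> language set" where
  "DTIME T = {A. \<exists>M c. wf_tm M \<and> decides_in_time M A (\<lambda>n. c * T n + c)}"

definition class_P :: "language set" where
  "class_P = (\<Union>k. DTIME (\<lambda>n. n ^ k))"

definition class_EXP :: "language set" where
  "class_EXP = (\<Union>k. DTIME (\<lambda>n. 2 ^ (n ^ k)))"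

definition pair_code :: "bool list \<Rightarrow> bool list \<Rightarrow> bool list" where
  "pair_code x y = enc_word x @ y"

definition class_NP :: "language set" where
  "class_NP = {A. \<exists>R \<in> class_P. \<exists>k c. \<forall>x.
     x \<in> A \<longleftrightarrow> (\<exists>y. length y \<le> c * length x ^ k + c \<and> pair_code x y \<in> R)}"

definition class_coNP :: "language set" where
  "class_coNP = {A. - A \<in> class_NP}"

definition poly_time_computable :: "(bool list \<Rightarrow> bool list) \<Rightarrow> bool" where
  "poly_time_computable f \<longleftrightarrow>
     (\<exists>M k c. wf_tm M \<and> computes_in_time M f (\<lambda>n. c * n ^ k + c))"

definition poly_reducible :: "language \<Rightarrow> language \<Rightarrow> bool" where
  "poly_reducible A B \<longleftrightarrow> (\<exists>f. poly_time_computable f \<and> (\<forall>x. x \<in> A \<longleftrightarrow> f x \<in> B))"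

definition hard_for :: "language set \<Rightarrow> language \<Rightarrow> bool" where
  "hard_for \<C> B \<longleftrightarrow> (\<forall>A \<in> \<C>. poly_reducible A B)"

definition complete_for :: "language set \<Rightarrow> language \<Rightarrow> bool" where
  "complete_for \<C> B \<longleftrightarrow> B \<in> \<C> \<and> hard_for \<C> B"


section \<open>The decision problem\<close>

text \<open>World view existence for input programs from the class \<open>\<P>\<close>.  A program is input as a list of
  its rules, in any order and possibly with
  repetitions; words that do not encode a program in \<open>\<P>\<close> are no-instances.\<close>

definition world_view_existence :: "atom rule set set \<Rightarrow> language" where
  "world_view_existence \<P> = {enc_program rs | rs. set rs \<in> \<P> \<and> (\<exists>I. world_view (set rs) I)}"

end

theory Submission
  imports Defs "HOL-Library.Countable"
begin

text \<open>In an \<open>EHorn\<close> program all epistemic literals are positive in rule bodies.  The world view, if there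
  is one, must decide every atom according to the least model of the Horn program that results from
  dropping the operators \<open>K\<close> and \<open>M\<close>, so a world view exists iff this model violates no constraint.

  Upper bounds: the least model of a ground program is computed by saturation.  The grounding of a
  program is exponential.  For bounded arity there are only polynomially many ground atoms, so that
  a violated constraint has a polynomial certificate, namely a derivation whose steps name their
  ground instances.

  Lower bounds: viewed relative to the heads, the cell contents of a Turing machine are determined by local
  constraints.  For bounded arity, a single constraint rule has one variable per cell and time and
  is violated iff its variables can be assigned an accepting computation.  For unbounded arity, times
  and positions are binary vectors, the rules compute the cell contents, and positions are taken
  modulo \<open>2 ^ N\<close>: the wrap-around does not reach the head within the time bound.

  Turing machines are obtained by compiling a structured language over tapes, in which every
  function on tree-shaped data built by composition and polynomially many iterations with
  intermediate values of polynomial size is computed in polynomial time.\<close>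

section \<open>Tape programs\<close>

text \<open>The operators are harmless because of compatibility: the epistemic reduct is Horn, so it
  has at most one answer set, and a single answer set leaves no atom undecided. World views need not
  be unique, as \<open>a\<close> \<leftarrow> \<open>M a\<close> supports both \<open>a\<close> and
  its negation. What holds in general is that the answer set of a world view contains the least
  model, and this suffices, since a larger set violates at least the same constraints.

  The complexity classes refer to concrete machines, so parsing, grounding, saturation and the
  construction of programs all have to be programmed. Iterating a polynomial-time step may square
  the size in each round; therefore the closure rules for iteration carry a bound on the
  intermediate values.

  In both reductions the machine \<open>M\<close> is fixed. Its table of cells enters as a constant
  and is never computed, so arbitrary enumerations and names serve. To stay within arity two, a
  quadruple of cells becomes one constant with binary projections.\<close>

datatype com =
    Mv nat dir
  | Wr nat nat dir
  | Seq com com (infixr ";;" 60)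
  | Cond nat "nat set" com com
  | Loop nat "nat set" com

type_synonym tapes = "nat \<Rightarrow> tape"

text \<open>The time index is an upper bound rather than the exact running time, so estimates can be
  weakened at any point of a derivation and loops can be analysed with rounded constants.\<close>

inductive exec :: "com \<Rightarrow> tapes \<Rightarrow> nat \<Rightarrow> tapes \<Rightarrow> bool" where
  Mv: "1 \<le> t \<Longrightarrow> exec (Mv r d) \<sigma> t (\<sigma>(r := act (read (\<sigma> r), d) (\<sigma> r)))"
| Wr: "1 \<le> t \<Longrightarrow> exec (Wr r s d) \<sigma> t (\<sigma>(r := act (s, d) (\<sigma> r)))"
| Seq: "exec a \<sigma> t \<sigma>' \<Longrightarrow> exec b \<sigma>' u \<sigma>'' \<Longrightarrow> t + u + 1 \<le> v \<Longrightarrow> exec (a ;; b) \<sigma> v \<sigma>''"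
| CondT: "read (\<sigma> r) \<in> S \<Longrightarrow> exec a \<sigma> t \<sigma>' \<Longrightarrow> t + 1 \<le> v \<Longrightarrow> exec (Cond r S a b) \<sigma> v \<sigma>'"
| CondF: "read (\<sigma> r) \<notin> S \<Longrightarrow> exec b \<sigma> t \<sigma>' \<Longrightarrow> t + 1 \<le> v \<Longrightarrow> exec (Cond r S a b) \<sigma> v \<sigma>'"
| LoopF: "read (\<sigma> r) \<notin> S \<Longrightarrow> 1 \<le> t \<Longrightarrow> exec (Loop r S c) \<sigma> t \<sigma>"
| LoopT: "read (\<sigma> r) \<in> S \<Longrightarrow> exec c \<sigma> t \<sigma>' \<Longrightarrow> exec (Loop r S c) \<sigma>' u \<sigma>'' \<Longrightarrow>
    t + u + 1 \<le> v \<Longrightarrow> exec (Loop r S c) \<sigma> v \<sigma>''"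

lemma exec_mono: "exec c \<sigma> t \<sigma>' \<Longrightarrow> t \<le> u \<Longrightarrow> exec c \<sigma> u \<sigma>'"
proof (induction arbitrary: u rule: exec.induct)
  case (Seq a \<sigma> t \<sigma>' b u' \<sigma>'' v)
  then show ?case using exec.Seq[of a \<sigma> t \<sigma>' b u' \<sigma>'' u] by auto
next
  case (CondT \<sigma> r S a t \<sigma>' v b)
  then show ?case using exec.CondT[of \<sigma> r S a t \<sigma>' u b] by auto
next
  case (CondF \<sigma> r S b t \<sigma>' v a)
  then show ?case using exec.CondF[of \<sigma> r S b t \<sigma>' u a] by auto
next
  case (LoopT \<sigma> r S c t \<sigma>' u' \<sigma>'' v)
  then show ?case using exec.LoopT[of \<sigma> r S c t \<sigma>' u' \<sigma>'' u] by auto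
qed (auto intro: exec.intros)

lemma exec_conv: "exec c \<sigma> t \<sigma>' \<Longrightarrow> t \<le> u \<Longrightarrow> \<sigma>' = \<tau> \<Longrightarrow> exec c \<sigma> u \<tau>"
  using exec_mono by blast

lemma exec_seq: "exec a \<sigma> t \<sigma>' \<Longrightarrow> exec b \<sigma>' u \<sigma>'' \<Longrightarrow> exec (a ;; b) \<sigma> (t + u + 1) \<sigma>''"
  by (rule exec.Seq) auto

fun wf_com :: "nat \<Rightarrow> com \<Rightarrow> bool" where
  "wf_com k (Mv r d) \<longleftrightarrow> r < k"
| "wf_com k (Wr r s d) \<longleftrightarrow> r < k \<and> s < 3"
| "wf_com k (a ;; b) \<longleftrightarrow> wf_com k a \<and> wf_com k b"
| "wf_com k (Cond r S a b) \<longleftrightarrow> r < k \<and> wf_com k a \<and> wf_com k b"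
| "wf_com k (Loop r S a) \<longleftrightarrow> r < k \<and> wf_com k a"

lemma wf_com_mono: "wf_com k c \<Longrightarrow> k \<le> l \<Longrightarrow> wf_com l c"
  by (induction c) auto

lemma snd_act: "\<bar>snd (act (s, d) T) - snd T\<bar> \<le> 1"
  by (cases T; cases d) auto

text \<open>A head moves at most one cell per time unit. As the head of a stack rests on its top,
  this later bounds the size of a result by the size of the argument plus the running time.\<close>

lemma exec_head: "exec c \<sigma> t \<sigma>' \<Longrightarrow> \<bar>snd (\<sigma>' r) - snd (\<sigma> r)\<bar> \<le> int t"
proof (induction rule: exec.induct)
  case (Mv t r' d \<sigma>)
  then show ?case using snd_act[of "read (\<sigma> r')" d "\<sigma> r'"] by auto
next
  case (Wr t r' s d \<sigma>)
  then show ?case using snd_act[of s d "\<sigma> r'"] by auto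
qed auto


subsection \<open>Small-step semantics on continuations\<close>

text \<open>The control state of a machine running a program is the list of commands still to be executed.\<close>

fun next_conf :: "com list \<Rightarrow> (nat \<Rightarrow> nat) \<Rightarrow> com list \<times> (nat \<Rightarrow> nat \<times> dir)" where
  "next_conf [] rd = ([], \<lambda>r. (rd r, Stay))"
| "next_conf (Mv r d # K) rd = (K, (\<lambda>r. (rd r, Stay))(r := (rd r, d)))"
| "next_conf (Wr r s d # K) rd = (K, (\<lambda>r. (rd r, Stay))(r := (s, d)))"
| "next_conf ((a ;; b) # K) rd = (a # b # K, \<lambda>r. (rd r, Stay))"
| "next_conf (Cond r S a b # K) rd = ((if rd r \<in> S then a # K else b # K), \<lambda>r. (rd r, Stay))"
| "next_conf (Loop r S a # K) rd = ((if rd r \<in> S then a # Loop r S a # K else K), \<lambda>r. (rd r, Stay))"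

fun cstep :: "com list \<times> tapes \<Rightarrow> com list \<times> tapes" where
  "cstep (K, \<sigma>) = (let (K', a) = next_conf K (\<lambda>r. read (\<sigma> r)) in (K', \<lambda>r. act (a r) (\<sigma> r)))"

lemma act_stay: "act (read T, Stay) T = T"
  by (cases T) auto

lemma cstep_simps:
  "cstep (Mv r d # K, \<sigma>) = (K, \<sigma>(r := act (read (\<sigma> r), d) (\<sigma> r)))"
  "cstep (Wr r s d # K, \<sigma>) = (K, \<sigma>(r := act (s, d) (\<sigma> r)))"
  "cstep ((a ;; b) # K, \<sigma>) = (a # b # K, \<sigma>)"
  "cstep (Cond r S a b # K, \<sigma>) = ((if read (\<sigma> r) \<in> S then a # K else b # K), \<sigma>)"
  "cstep (Loop r S a # K, \<sigma>) = ((if read (\<sigma> r) \<in> S then a # Loop r S a # K else K), \<sigma>)"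
  by (auto simp: act_stay fun_eq_iff)

declare cstep.simps [simp del]

lemma funpow_trans: "(f ^^ m) x = y \<Longrightarrow> (f ^^ n) y = z \<Longrightarrow> (f ^^ (m + n)) x = z"
  by (simp add: add.commute[of m n] funpow_add)

lemma exec_csteps: "exec c \<sigma> t \<sigma>' \<Longrightarrow> \<exists>n\<le>t. (cstep ^^ n) (c # K, \<sigma>) = (K, \<sigma>')"
proof (induction arbitrary: K rule: exec.induct)
  case (Mv t r d \<sigma>)
  then show ?case by (intro exI[of _ 1]) (simp add: cstep_simps fun_upd_def)
next
  case (Wr t r s d \<sigma>)
  then show ?case by (intro exI[of _ 1]) (simp add: cstep_simps fun_upd_def)
next
  case (Seq a \<sigma> t \<sigma>' b u \<sigma>'' v)
  obtain m n where "m \<le> t" "(cstep ^^ m) (a # b # K, \<sigma>) = (b # K, \<sigma>')"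
    and "n \<le> u" "(cstep ^^ n) (b # K, \<sigma>') = (K, \<sigma>'')"
    using Seq.IH by metis
  then have "(cstep ^^ (1 + (m + n))) ((a ;; b) # K, \<sigma>) = (K, \<sigma>'')"
    by (intro funpow_trans[where m = 1]) (auto simp: cstep_simps intro: funpow_trans)
  then show ?case using \<open>m \<le> t\<close> \<open>n \<le> u\<close> Seq.hyps by (intro exI[of _ "1 + (m + n)"]) auto
next
  case (CondT \<sigma> r S a t \<sigma>' v b)
  obtain n where "n \<le> t" "(cstep ^^ n) (a # K, \<sigma>) = (K, \<sigma>')" using CondT.IH by blast
  then have "(cstep ^^ (1 + n)) (Cond r S a b # K, \<sigma>) = (K, \<sigma>')"
    using CondT.hyps by (intro funpow_trans[where m = 1]) (auto simp: cstep_simps)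
  then show ?case using \<open>n \<le> t\<close> CondT.hyps by (intro exI[of _ "1 + n"]) auto
next
  case (CondF \<sigma> r S b t \<sigma>' v a)
  obtain n where "n \<le> t" "(cstep ^^ n) (b # K, \<sigma>) = (K, \<sigma>')" using CondF.IH by blast
  then have "(cstep ^^ (1 + n)) (Cond r S a b # K, \<sigma>) = (K, \<sigma>')"
    using CondF.hyps by (intro funpow_trans[where m = 1]) (auto simp: cstep_simps)
  then show ?case using \<open>n \<le> t\<close> CondF.hyps by (intro exI[of _ "1 + n"]) auto
next
  case (LoopF \<sigma> r S t c)
  then show ?case by (intro exI[of _ 1]) (simp add: cstep_simps)
next
  case (LoopT \<sigma> r S c t \<sigma>' u \<sigma>'' v)
  obtain m n where "m \<le> t" "(cstep ^^ m) (c # Loop r S c # K, \<sigma>) = (Loop r S c # K, \<sigma>')"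
    and "n \<le> u" "(cstep ^^ n) (Loop r S c # K, \<sigma>') = (K, \<sigma>'')"
    using LoopT.IH by metis
  then have "(cstep ^^ (1 + (m + n))) (Loop r S c # K, \<sigma>) = (K, \<sigma>'')"
    using LoopT.hyps by (intro funpow_trans[where m = 1]) (auto simp: cstep_simps intro: funpow_trans)
  then show ?case using \<open>m \<le> t\<close> \<open>n \<le> u\<close> LoopT.hyps by (intro exI[of _ "1 + (m + n)"]) auto
qed

text \<open>These are the control lists that occur while \<open>c\<close> runs with \<open>K\<close>
  left to do. The set is finite because the body of a loop always returns to the same list
  \<open>Loop r S a # K\<close>; hence a finite set of machine states is enough.\<close>

fun conts :: "com \<Rightarrow> com list \<Rightarrow> com list set" where
  "conts (Mv r d) K = {Mv r d # K}"
| "conts (Wr r s d) K = {Wr r s d # K}"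
| "conts (a ;; b) K = insert ((a ;; b) # K) (conts a (b # K) \<union> conts b K)"
| "conts (Cond r S a b) K = insert (Cond r S a b # K) (conts a K \<union> conts b K)"
| "conts (Loop r S a) K = insert (Loop r S a # K) (conts a (Loop r S a # K))"

lemma finite_conts: "finite (conts c K)"
  by (induction c arbitrary: K) auto

lemma Cons_in_conts: "c # K \<in> conts c K"
  by (induction c arbitrary: K) auto

text \<open>The list \<open>K\<close> has to be added because it is reached when \<open>c\<close>
  ends, while \<open>conts c K\<close> contains only the lists at which \<open>c\<close> is still
  active.\<close>

lemma conts_closed: "L \<in> conts c K \<Longrightarrow> fst (next_conf L rd) \<in> insert K (conts c K)"
proof (induction c arbitrary: K L)
  case (Seq a b)
  from Seq.prems consider "L = (a ;; b) # K" | "L \<in> conts a (b # K)" | "L \<in> conts b K" by auto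
  then show ?case
  proof cases
    case 2
    then show ?thesis using Seq.IH(1)[OF 2] Cons_in_conts[of b K] by auto
  next
    case 3
    then show ?thesis using Seq.IH(2)[OF 3] by auto
  qed (auto simp: Cons_in_conts)
next
  case (Cond r S a b)
  from Cond.prems consider "L = Cond r S a b # K" | "L \<in> conts a K" | "L \<in> conts b K" by auto
  then show ?case
  proof cases
    case 2
    then show ?thesis using Cond.IH(1)[OF 2] by auto
  next
    case 3
    then show ?thesis using Cond.IH(2)[OF 3] by auto
  qed (auto simp: Cons_in_conts)
next
  case (Loop r S a)
  from Loop.prems consider "L = Loop r S a # K" | "L \<in> conts a (Loop r S a # K)" by auto
  then show ?case
  proof cases
    case 2
    then show ?thesis using Loop.IH[OF 2] by auto
  qed (auto simp: Cons_in_conts)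
qed auto

lemma conts_wf: "wf_com k c \<Longrightarrow> \<forall>d\<in>set K. wf_com k d \<Longrightarrow> L \<in> conts c K \<Longrightarrow> \<forall>d\<in>set L. wf_com k d"
proof (induction c arbitrary: K L)
  case (Seq a b)
  from Seq.prems(3) consider "L = (a ;; b) # K" | "L \<in> conts a (b # K)" | "L \<in> conts b K" by auto
  then show ?case
  proof cases
    case 2
    show ?thesis using Seq.prems by (intro Seq.IH(1)[OF _ _ 2]) auto
  next
    case 3
    show ?thesis using Seq.prems by (intro Seq.IH(2)[OF _ _ 3]) auto
  qed (use Seq.prems in auto)
next
  case (Cond r S a b)
  from Cond.prems(3) consider "L = Cond r S a b # K" | "L \<in> conts a K" | "L \<in> conts b K" by auto
  then show ?case
  proof cases
    case 2
    show ?thesis using Cond.prems by (intro Cond.IH(1)[OF _ _ 2]) auto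
  next
    case 3
    show ?thesis using Cond.prems by (intro Cond.IH(2)[OF _ _ 3]) auto
  qed (use Cond.prems in auto)
next
  case (Loop r S a)
  from Loop.prems(3) consider "L = Loop r S a # K" | "L \<in> conts a (Loop r S a # K)" by auto
  then show ?case
  proof cases
    case 2
    show ?thesis using Loop.prems by (intro Loop.IH[OF _ _ 2]) auto
  qed (use Loop.prems in auto)
qed auto

text \<open>Programs act on infinitely many tapes and a machine has only \<open>k\<close>. The lemma
  shows that the symbols on the first \<open>k\<close> tapes determine a step of a program that
  names no other tape.\<close>

lemma next_conf_cong:
  assumes "\<forall>d\<in>set K. wf_com k d" and "\<And>r. r < k \<Longrightarrow> rd r = rd' r"
  shows "fst (next_conf K rd) = fst (next_conf K rd') \<and>
    (\<forall>r<k. snd (next_conf K rd) r = snd (next_conf K rd') r)"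
proof (cases K)
  case (Cons c K')
  then show ?thesis using assms by (cases c) auto
qed (use assms in auto)

lemma next_conf_symbols:
  assumes "\<forall>d\<in>set K. wf_com k d" and "\<And>r. r < k \<Longrightarrow> rd r < 3" and "r < k"
  shows "fst (snd (next_conf K rd) r) < 3"
proof (cases K)
  case (Cons c K')
  then show ?thesis using assms by (cases c) auto
qed (use assms in auto)


subsection \<open>Compilation to Turing machines\<close>

definition states_of :: "com \<Rightarrow> com list set" where
  "states_of c = insert [] (conts c [])"

definition state_index :: "com \<Rightarrow> com list \<Rightarrow> nat" where
  "state_index c = (SOME f. bij_betw f (states_of c) {0..<card (states_of c)})"

lemma finite_states_of: "finite (states_of c)"
  by (simp add: states_of_def finite_conts)

lemma state_index: "bij_betw (state_index c) (states_of c) {0..<card (states_of c)}"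
  unfolding state_index_def by (rule someI_ex[OF ex_bij_betw_finite_nat[OF finite_states_of]])

text \<open>The initial control list must be state 0, and the offset 3 keeps the halting states 1
  and 2 free. The empty list is an ordinary state: from it the machine takes one further step into a
  halting state.\<close>

definition state_of :: "com \<Rightarrow> com list \<Rightarrow> nat" where
  "state_of c K = (if K = [c] then 0 else state_index c K + 3)"

definition cont_of :: "com \<Rightarrow> nat \<Rightarrow> com list" where
  "cont_of c q = (if q = 0 then [c] else inv_into (states_of c) (state_index c) (q - 3))"

lemma state_of_less: "K \<in> states_of c \<Longrightarrow> state_of c K < card (states_of c) + 3"
  using bij_betwE[OF state_index, of c] by (auto simp: state_of_def)

lemma state_of_active: "state_of c K \<noteq> 1 \<and> state_of c K \<noteq> 2"
  by (simp add: state_of_def)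

lemma cont_of_state_of: "K \<in> states_of c \<Longrightarrow> cont_of c (state_of c K) = K"
  using bij_betw_inv_into_left[OF state_index, of K c] by (auto simp: state_of_def cont_of_def)

lemma cont_of_in_states: "q < card (states_of c) + 3 \<Longrightarrow> cont_of c q \<in> states_of c"
proof -
  assume "q < card (states_of c) + 3"
  moreover have "card (states_of c) > 0"
    using finite_states_of[of c] by (simp add: card_gt_0_iff states_of_def)
  \<comment> \<open>For the halting states \<open>q - 3\<close> is 0 by truncated subtraction. They
    thus denote some control list as well, which is needed since well-formedness speaks of all
    states.\<close>
  ultimately have "q - 3 \<in> state_index c ` states_of c"
    using bij_betw_imp_surj_on[OF state_index, of c] by auto
  then show ?thesis
    by (simp add: cont_of_def inv_into_into) (simp add: states_of_def Cons_in_conts)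
qed

lemma states_of_closed: "K \<in> states_of c \<Longrightarrow> fst (next_conf K rd) \<in> states_of c"
  using conts_closed[of K c "[]" rd] by (auto simp: states_of_def)

text \<open>The machine accepts if it reads the symbol \<open>2\<close> on the first tape when the program ends.\<close>

definition tm_of :: "nat \<Rightarrow> com \<Rightarrow> turing_machine" where
  "tm_of k c = \<lparr>num_tapes = k, num_symbols = 3, num_states = card (states_of c) + 3,
     delta = \<lambda>q ss.
       (let K = cont_of c q; (K', a) = next_conf K (nth ss)
        in if K = [] then (if ss ! 0 = 2 then 1 else 2, map (\<lambda>r. (ss ! r, Stay)) [0..<k])
           else (state_of c K', map a [0..<k]))\<rparr>"

lemma states_of_wf: "wf_com k c \<Longrightarrow> K \<in> states_of c \<Longrightarrow> \<forall>d\<in>set K. wf_com k d"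
  using conts_wf[of k c "[]" K] by (auto simp: states_of_def)

lemma wf_tm_of:
  assumes "wf_com k c" "1 \<le> k"
  shows "wf_tm (tm_of k c)"
  unfolding wf_tm_def
proof (intro conjI allI impI)
  fix q ss
  assume q: "q < num_states (tm_of k c)"
    and ss: "length ss = num_tapes (tm_of k c) \<and> set ss \<subseteq> {..<num_symbols (tm_of k c)}"
  let ?K = "cont_of c q"
  have K: "?K \<in> states_of c" using q by (intro cont_of_in_states) (simp add: tm_of_def)
  note wf = states_of_wf[OF assms(1) K]
  have sym: "ss ! r < 3" if "r < k" for r
    using ss that subsetD[OF _ nth_mem[of r ss], of "{..<3}"] by (auto simp: tm_of_def)
  have out: "fst (snd (next_conf ?K (nth ss)) r) < 3" if "r < k" for r
    using next_conf_symbols[OF wf sym that] .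
  have st: "state_of c (fst (next_conf ?K (nth ss))) < card (states_of c) + 3"
    by (intro state_of_less states_of_closed K)
  show "case delta (tm_of k c) q ss of (q', acts) \<Rightarrow>
      q' < num_states (tm_of k c) \<and> length acts = num_tapes (tm_of k c) \<and>
      fst ` set acts \<subseteq> {..<num_symbols (tm_of k c)}"
    using sym out st by (auto simp: tm_of_def Let_def split: prod.split)
qed (use assms in \<open>auto simp: tm_of_def\<close>)

definition conf_of :: "nat \<Rightarrow> com \<Rightarrow> com list \<Rightarrow> tapes \<Rightarrow> config" where
  "conf_of k c K \<sigma> = (state_of c K, map \<sigma> [0..<k])"

lemma step_tm_of:
  assumes "wf_com k c" "K \<in> states_of c" "K \<noteq> []" "cstep (K, \<sigma>) = (K', \<sigma>')"
  shows "step (tm_of k c) (conf_of k c K \<sigma>) = conf_of k c K' \<sigma>'"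
proof -
  let ?rd = "\<lambda>r. read (\<sigma> r)" and ?ss = "map read (map \<sigma> [0..<k])"
  have cong: "fst (next_conf K (nth ?ss)) = fst (next_conf K ?rd)"
      "\<And>r. r < k \<Longrightarrow> snd (next_conf K (nth ?ss)) r = snd (next_conf K ?rd) r"
    using next_conf_cong[OF states_of_wf[OF assms(1,2)], of "nth ?ss" ?rd] by auto
  have "K' = fst (next_conf K ?rd)" "\<sigma>' = (\<lambda>r. act (snd (next_conf K ?rd) r) (\<sigma> r))"
    using assms(4) by (auto simp: cstep.simps split: prod.splits)
  then show ?thesis
    using assms(3) cong state_of_active[of c K]
    by (auto simp: conf_of_def tm_of_def Let_def cont_of_state_of[OF assms(2)] split_beta map2_map_map
        simp del: map_map intro!: map_cong)
qed

lemma cstep_Nil: "cstep ([], \<sigma>) = ([], \<sigma>)"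
  by (simp add: cstep.simps act_stay)

lemma cstep_closed: "K \<in> states_of c \<Longrightarrow> fst (cstep (K, \<sigma>)) \<in> states_of c"
  using states_of_closed by (auto simp: cstep.simps split: prod.split) (metis fst_conv)

text \<open>On the empty list \<open>cstep\<close> idles whereas the machine moves on to a halting
  state. Therefore the simulation is followed only up to the first \<open>m\<close> \<le>
  \<open>n\<close> at which the list is empty.\<close>

lemma csteps_tm_of:
  assumes "wf_com k c" "K \<in> states_of c" "(cstep ^^ n) (K, \<sigma>) = ([], \<sigma>')"
  shows "\<exists>m\<le>n. (step (tm_of k c) ^^ m) (conf_of k c K \<sigma>) = conf_of k c [] \<sigma>'"
  using assms(2,3)
proof (induction n arbitrary: K \<sigma>)
  case (Suc n)
  show ?case
  proof (cases "K = []")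
    case True
    have "(cstep ^^ m) ([], \<sigma>) = ([], \<sigma>)" for m by (induction m) (auto simp: cstep_Nil)
    with True Suc.prems have "\<sigma>' = \<sigma>" by (metis prod.inject)
    with True show ?thesis by (intro exI[of _ 0]) auto
  next
    case False
    obtain K1 \<sigma>1 where s: "cstep (K, \<sigma>) = (K1, \<sigma>1)" by fastforce
    with Suc.prems have "(cstep ^^ n) (K1, \<sigma>1) = ([], \<sigma>')"
      by (simp add: funpow_Suc_right del: funpow.simps)
    moreover have "K1 \<in> states_of c" using cstep_closed[OF Suc.prems(1), of \<sigma>] s by simp
    ultimately obtain m where "m \<le> n" "(step (tm_of k c) ^^ m) (conf_of k c K1 \<sigma>1) = conf_of k c [] \<sigma>'"
      using Suc.IH by blast
    then have "(step (tm_of k c) ^^ Suc m) (conf_of k c K \<sigma>) = conf_of k c [] \<sigma>'"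
      using step_tm_of[OF assms(1) Suc.prems(1) False s]
      by (simp add: funpow_Suc_right del: funpow.simps)
    then show ?thesis using \<open>m \<le> n\<close> by (intro exI[of _ "Suc m"]) auto
  qed
qed auto

lemma step_halted: "halted C \<Longrightarrow> (step M ^^ n) C = C"
proof (induction n)
  case (Suc n)
  then show ?case by (cases C) auto
qed auto

definition init_tapes :: "bool list \<Rightarrow> tapes" where
  "init_tapes x = (\<lambda>_. (\<lambda>_. 0, 0))(0 := input_tape x)"

text \<open>The inequality is strict because after the program one more step leads from the empty
  control list to the verdict; from then on the configuration is frozen.\<close>

lemma run_tm_of:
  assumes wf: "wf_com k c" "1 \<le> k" and ex: "exec c (init_tapes x) t \<sigma>" and T: "t < T"
  shows "run (tm_of k c) x T = (if read (\<sigma> 0) = 2 then 1 else 2, map \<sigma> [0..<k])"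
proof -
  have K: "[c] \<in> states_of c" by (simp add: states_of_def Cons_in_conts)
  have "init_config (tm_of k c) x = conf_of k c [c] (init_tapes x)"
    using wf(2) by (auto simp: init_config_def conf_of_def state_of_def tm_of_def init_tapes_def
        upt_conv_Cons map_replicate_const)
  moreover obtain n where n: "n \<le> t" "(cstep ^^ n) ([c], init_tapes x) = ([], \<sigma>)"
    using exec_csteps[OF ex, of "[]"] by blast
  moreover from csteps_tm_of[OF wf(1) K n(2)] obtain m where m: "m \<le> n"
    "(step (tm_of k c) ^^ m) (conf_of k c [c] (init_tapes x)) = conf_of k c [] \<sigma>" by blast
  ultimately have "(step (tm_of k c) ^^ m) (init_config (tm_of k c) x) = conf_of k c [] \<sigma>" by simp
  moreover have "step (tm_of k c) (conf_of k c [] \<sigma>) = (if read (\<sigma> 0) = 2 then 1 else 2, map \<sigma> [0..<k])"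
    (is "_ = ?C")
    using wf(2) state_of_active[of c "[]"] cont_of_state_of[of "[]" c]
    by (auto simp: conf_of_def tm_of_def states_of_def map2_map_map act_stay intro!: map_cong)
  ultimately have "(step (tm_of k c) ^^ Suc m) (init_config (tm_of k c) x) = ?C" by simp
  then have "(step (tm_of k c) ^^ (Suc m + (T - Suc m))) (init_config (tm_of k c) x) = ?C"
    by (rule funpow_trans) (rule step_halted, simp)
  then show ?thesis using m n T by (simp add: run_def)
qed


section \<open>Stacks on tapes\<close>

text \<open>The head rests on the top of the stack; the bottom is at position \<open>0\<close>.\<close>

definition stk :: "nat list \<Rightarrow> tape" where
  "stk xs = (\<lambda>i. if 0 \<le> i \<and> i < int (length xs) then rev xs ! nat i else 0, int (length xs) - 1)"

lemma read_stk [simp]: "read (stk []) = 0" "read (stk (x # xs)) = x"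
  by (auto simp: stk_def nth_append)

text \<open>In the first equation \<open>0 # xs\<close> is a transitional stack: the head already
  stands on the new top, which is still blank.\<close>

lemma act_stk:
  "act (read (stk xs), Rightwards) (stk xs) = stk (0 # xs)"
  "act (s, Stay) (stk (x # xs)) = stk (s # xs)"
  "act (0, Leftwards) (stk (x # xs)) = stk xs"
  by (cases xs; auto simp: stk_def nth_append fun_eq_iff; linarith)
    (auto simp: stk_def nth_append fun_eq_iff)

lemma snd_stk: "snd (stk xs) = int (length xs) - 1"
  by (simp add: stk_def)

definition push :: "nat \<Rightarrow> nat \<Rightarrow> com" where
  "push r s = Mv r Rightwards ;; Wr r s Stay"

definition pop :: "nat \<Rightarrow> com" where
  "pop r = Wr r 0 Leftwards"

definition skip :: com where
  "skip = Mv 0 Stay"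

fun push_list :: "nat \<Rightarrow> nat list \<Rightarrow> com" where
  "push_list r [] = skip"
| "push_list r (s # ss) = push_list r ss ;; push r s"

text \<open>A transfer reverses the word, so saved values are restored by a second transfer. The
  loop stops at the blank below the bottom.\<close>

definition mv :: "nat \<Rightarrow> nat \<Rightarrow> com" where
  "mv i j = Loop i {1, 2} (Cond i {1} (push j 1) (push j 2) ;; pop i)"

definition mv2 :: "nat \<Rightarrow> nat \<Rightarrow> nat \<Rightarrow> com" where
  "mv2 i j l = Loop i {1, 2} (Cond i {1} (push j 1 ;; push l 1) (push j 2 ;; push l 2) ;; pop i)"

definition clear :: "nat \<Rightarrow> com" where
  "clear i = Loop i {1, 2} (pop i)"

lemma wf_com_stack [simp]:
  "wf_com k (push r s) \<longleftrightarrow> r < k \<and> s < 3"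
  "wf_com k (pop r) \<longleftrightarrow> r < k"
  "wf_com k skip \<longleftrightarrow> 0 < k"
  "wf_com k (mv i j) \<longleftrightarrow> i < k \<and> j < k"
  "wf_com k (mv2 i j l) \<longleftrightarrow> i < k \<and> j < k \<and> l < k"
  "wf_com k (clear i) \<longleftrightarrow> i < k"
  by (auto simp: push_def pop_def skip_def mv_def mv2_def clear_def)

lemma wf_com_push_list: "r < k \<Longrightarrow> set ss \<subseteq> {1, 2} \<Longrightarrow> wf_com k (push_list r ss)"
  by (induction ss) auto

lemma exec_skip: "exec skip \<sigma> 1 \<sigma>"
  unfolding skip_def by (rule exec_conv[OF exec.Mv]) (auto simp: act_stay)

lemma exec_push:
  assumes "\<sigma> r = stk xs" "\<sigma>' = \<sigma>(r := stk (s # xs))"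
  shows "exec (push r s) \<sigma> 3 \<sigma>'"
  unfolding push_def
  by (rule exec.Seq[OF exec.Mv[OF order_refl] exec.Wr[OF order_refl], THEN exec_conv])
    (auto simp: assms act_stk)

lemma exec_pop:
  assumes "\<sigma> r = stk (x # xs)" "\<sigma>' = \<sigma>(r := stk xs)"
  shows "exec (pop r) \<sigma> 1 \<sigma>'"
  unfolding pop_def by (rule exec_conv[OF exec.Wr]) (auto simp: assms act_stk)

lemma exec_push_list:
  "\<sigma> r = stk xs \<Longrightarrow> exec (push_list r ss) \<sigma> (4 * length ss + 1) (\<sigma>(r := stk (ss @ xs)))"
proof (induction ss)
  case Nil
  then have "\<sigma>(r := stk xs) = \<sigma>" by (metis fun_upd_triv)
  then show ?case using exec_skip[of \<sigma>] by simp
next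
  case (Cons s ss)
  then have "exec (push_list r ss) \<sigma> (4 * length ss + 1) (\<sigma>(r := stk (ss @ xs)))" by blast
  moreover have "exec (push r s) (\<sigma>(r := stk (ss @ xs))) 3 (\<sigma>(r := stk ((s # ss) @ xs)))"
    by (rule exec_push) auto
  ultimately show ?case unfolding push_list.simps by (rule exec.Seq) simp
qed

lemma exec_mv:
  assumes "\<sigma> i = stk xs" "\<sigma> j = stk ys" "i \<noteq> j" "set xs \<subseteq> {1, 2}"
    "\<sigma>' = \<sigma>(i := stk [], j := stk (rev xs @ ys))" "8 * length xs + 1 \<le> t"
  shows "exec (mv i j) \<sigma> t \<sigma>'"
  using assms
proof (induction xs arbitrary: \<sigma> ys t)
  case Nil
  then have "\<sigma>' = \<sigma>" by (auto simp: fun_eq_iff)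
  then show ?case using Nil unfolding mv_def by (auto intro: exec.LoopF)
next
  case (Cons x xs)
  let ?s1 = "\<sigma>(j := stk (x # ys))" and ?s2 = "\<sigma>(j := stk (x # ys), i := stk xs)"
  have p: "exec (push j x) \<sigma> 3 ?s1" by (rule exec_push) (use Cons.prems in auto)
  then have c: "exec (Cond i {1} (push j 1) (push j 2)) \<sigma> 4 ?s1"
  proof (cases "x = 1")
    case True
    then show ?thesis using p Cons.prems by (intro exec.CondT) auto
  next
    case False
    with Cons.prems(4) have "x = 2" by auto
    then show ?thesis using p Cons.prems by (intro exec.CondF) auto
  qed
  have q: "exec (pop i) ?s1 1 ?s2" by (rule exec_pop) (use Cons.prems in auto)
  have r: "exec (mv i j) ?s2 (8 * length xs + 1) \<sigma>'"
    by (rule Cons.IH[of _ "x # ys"]) (use Cons.prems in \<open>auto simp: fun_eq_iff\<close>)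
  show ?case unfolding mv_def
    by (rule exec.LoopT[OF _ exec_seq[OF c q] r[unfolded mv_def]]) (use Cons.prems in auto)
qed

lemma exec_mv2:
  assumes "\<sigma> i = stk xs" "\<sigma> j = stk ys" "\<sigma> l = stk zs" "i \<noteq> j" "i \<noteq> l" "j \<noteq> l" "set xs \<subseteq> {1, 2}"
    "\<sigma>' = \<sigma>(i := stk [], j := stk (rev xs @ ys), l := stk (rev xs @ zs))" "12 * length xs + 1 \<le> t"
  shows "exec (mv2 i j l) \<sigma> t \<sigma>'"
  using assms
proof (induction xs arbitrary: \<sigma> ys zs t)
  case Nil
  then have "\<sigma>' = \<sigma>" by (auto simp: fun_eq_iff)
  then show ?case using Nil unfolding mv2_def by (auto intro: exec.LoopF)
next
  case (Cons x xs)
  let ?s0 = "\<sigma>(j := stk (x # ys))"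
  let ?s1 = "\<sigma>(j := stk (x # ys), l := stk (x # zs))"
  let ?s2 = "\<sigma>(j := stk (x # ys), l := stk (x # zs), i := stk xs)"
  have p0: "exec (push j x) \<sigma> 3 ?s0" by (rule exec_push) (use Cons.prems in auto)
  have p1: "exec (push l x) ?s0 3 ?s1" by (rule exec_push) (use Cons.prems in auto)
  note p = exec_seq[OF p0 p1]
  then have c: "exec (Cond i {1} (push j 1 ;; push l 1) (push j 2 ;; push l 2)) \<sigma> 8 ?s1"
  proof (cases "x = 1")
    case True
    then show ?thesis using p Cons.prems by (intro exec.CondT) auto
  next
    case False
    with Cons.prems(7) have "x = 2" by auto
    then show ?thesis using p Cons.prems by (intro exec.CondF) auto
  qed
  have q: "exec (pop i) ?s1 1 ?s2" by (rule exec_pop) (use Cons.prems in auto)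
  have r: "exec (mv2 i j l) ?s2 (12 * length xs + 1) \<sigma>'"
    by (rule Cons.IH[of _ "x # ys" "x # zs"]) (use Cons.prems in \<open>auto simp: fun_eq_iff\<close>)
  show ?case unfolding mv2_def
    by (rule exec.LoopT[OF _ exec_seq[OF c q] r[unfolded mv2_def]]) (use Cons.prems in auto)
qed

lemma exec_clear:
  assumes "\<sigma> i = stk xs" "set xs \<subseteq> {1, 2}" "\<sigma>' = \<sigma>(i := stk [])" "2 * length xs + 1 \<le> t"
  shows "exec (clear i) \<sigma> t \<sigma>'"
  using assms
proof (induction xs arbitrary: \<sigma> t)
  case Nil
  then have "\<sigma>' = \<sigma>" by (auto simp: fun_eq_iff)
  then show ?case using Nil unfolding clear_def by (auto intro: exec.LoopF)
next
  case (Cons x xs)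
  have q: "exec (pop i) \<sigma> 1 (\<sigma>(i := stk xs))" by (rule exec_pop) (use Cons.prems in auto)
  have r: "exec (clear i) (\<sigma>(i := stk xs)) (2 * length xs + 1) \<sigma>'"
    by (rule Cons.IH) (use Cons.prems in \<open>auto simp: fun_eq_iff\<close>)
  show ?case unfolding clear_def
    by (rule exec.LoopT[OF _ q r[unfolded clear_def]]) (use Cons.prems in auto)
qed


section \<open>Binary trees on stacks\<close>

datatype tree = Leaf | Node tree tree

text \<open>This is Polish notation. It is a prefix code, so the components of a pair can lie on a
  stack without a separator.\<close>

fun code :: "tree \<Rightarrow> nat list" where
  "code Leaf = [1]"
| "code (Node l r) = 2 # code l @ code r"

lemma set_code [dest]: "x \<in> set (code t) \<Longrightarrow> x = Suc 0 \<or> x = 2"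
  by (induction t) auto

lemma code_prefix: "code s @ u = code t @ v \<Longrightarrow> s = t \<and> u = v"
proof (induction s arbitrary: t u v)
  case Leaf
  then show ?case by (cases t) auto
next
  case (Node l r)
  from Node.prems obtain l' r' where t: "t = Node l' r'" by (cases t) auto
  with Node.prems have "code l @ (code r @ u) = code l' @ (code r' @ v)" by simp
  from Node.IH(1)[OF this] have "l = l'" "code r @ u = code r' @ v" by auto
  with Node.IH(2) t show ?case by blast
qed

lemma code_inject: "code s = code t \<longleftrightarrow> s = t"
  using code_prefix[of s "[]" t "[]"] by auto

lemma length_code_pos: "0 < length (code t)"
  by (cases t) auto

text \<open>The loop of \<open>take_tree\<close> keeps the number of trees still to be moved in unary on stack \<open>c\<close>.\<close>

definition take_loop :: "nat \<Rightarrow> nat \<Rightarrow> nat \<Rightarrow> com" where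
  "take_loop a b c = Loop c {1} (Cond a {2} (push b 2 ;; push c 1) (push b 1 ;; pop c) ;; pop a)"

definition take_tree :: "nat \<Rightarrow> nat \<Rightarrow> nat \<Rightarrow> com" where
  "take_tree a b c = push c 1 ;; take_loop a b c"

lemma wf_com_take_tree [simp]: "wf_com k (take_tree a b c) \<longleftrightarrow> a < k \<and> b < k \<and> c < k"
  by (auto simp: take_tree_def take_loop_def)

text \<open>The induction is on the total length of the codes still to be moved, not on the number
  of trees: a node replaces one pending tree by two but consumes one symbol.\<close>

lemma exec_take_loop:
  assumes "\<sigma> a = stk (concat (map code ts) @ rest)" "\<sigma> b = stk ys" "\<sigma> c = stk (replicate (length ts) 1)"
    "a \<noteq> b" "a \<noteq> c" "b \<noteq> c"
    "\<sigma>' = \<sigma>(a := stk rest, b := stk (rev (concat (map code ts)) @ ys), c := stk [])"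
    "12 * length (concat (map code ts)) + 1 \<le> t"
  shows "exec (take_loop a b c) \<sigma> t \<sigma>'"
  using assms
proof (induction "length (concat (map code ts))" arbitrary: ts \<sigma> ys t rule: less_induct)
  case less
  show ?case
  proof (cases ts)
    case Nil
    then have "\<sigma>' = \<sigma>" using less.prems by (auto simp: fun_eq_iff)
    then show ?thesis using less.prems Nil unfolding take_loop_def by (auto intro: exec.LoopF)
  next
    case (Cons u us)
    show ?thesis
    proof (cases u)
      case Leaf
      let ?s1 = "\<sigma>(b := stk (1 # ys))"
      let ?s2 = "?s1(c := stk (replicate (length us) 1))"
      let ?s3 = "?s2(a := stk (concat (map code us) @ rest))"
      have "exec (push b 1) \<sigma> 3 ?s1" by (rule exec_push) (use less.prems in auto)
      moreover have "exec (pop c) ?s1 1 ?s2" by (rule exec_pop) (use less.prems Cons in auto)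
      ultimately have "exec (push b 1 ;; pop c) \<sigma> 5 ?s2" by (rule exec.Seq) simp
      then have "exec (Cond a {2} (push b 2 ;; push c 1) (push b 1 ;; pop c)) \<sigma> 6 ?s2"
        using less.prems Cons Leaf by (intro exec.CondF) auto
      moreover have "exec (pop a) ?s2 1 ?s3" by (rule exec_pop) (use less.prems Cons Leaf in auto)
      ultimately have body: "exec (Cond a {2} (push b 2 ;; push c 1) (push b 1 ;; pop c) ;; pop a) \<sigma> 8 ?s3"
        by (rule exec.Seq) simp
      have "exec (take_loop a b c) ?s3 (12 * length (concat (map code us)) + 1) \<sigma>'"
        by (rule less.hyps[of us _ "1 # ys"])
          (use less.prems Cons Leaf in \<open>auto simp: fun_eq_iff length_code_pos\<close>)
      with body show ?thesis unfolding take_loop_def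
        by (rule exec.LoopT[rotated 1]) (use less.prems Cons Leaf in auto)
    next
      case (Node l r)
      let ?s1 = "\<sigma>(b := stk (2 # ys))"
      let ?s2 = "?s1(c := stk (replicate (length (l # r # us)) 1))"
      let ?s3 = "?s2(a := stk (concat (map code (l # r # us)) @ rest))"
      have "exec (push b 2) \<sigma> 3 ?s1" by (rule exec_push) (use less.prems in auto)
      moreover have "exec (push c 1) ?s1 3 ?s2" by (rule exec_push) (use less.prems Cons in auto)
      ultimately have "exec (push b 2 ;; push c 1) \<sigma> 7 ?s2" by (rule exec.Seq) simp
      then have "exec (Cond a {2} (push b 2 ;; push c 1) (push b 1 ;; pop c)) \<sigma> 8 ?s2"
        using less.prems Cons Node by (intro exec.CondT) auto
      moreover have "exec (pop a) ?s2 1 ?s3" by (rule exec_pop) (use less.prems Cons Node in auto)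
      ultimately have body: "exec (Cond a {2} (push b 2 ;; push c 1) (push b 1 ;; pop c) ;; pop a) \<sigma> 10 ?s3"
        by (rule exec.Seq) simp
      have "exec (take_loop a b c) ?s3 (12 * length (concat (map code (l # r # us))) + 1) \<sigma>'"
        by (rule less.hyps[of "l # r # us" _ "2 # ys"])
          (use less.prems Cons Node in \<open>auto simp: fun_eq_iff\<close>)
      with body show ?thesis unfolding take_loop_def
        by (rule exec.LoopT[rotated 1]) (use less.prems Cons Node in auto)
    qed
  qed
qed

lemma exec_take_tree:
  assumes "\<sigma> a = stk (code t @ rest)" "\<sigma> b = stk ys" "\<sigma> c = stk []"
    "a \<noteq> b" "a \<noteq> c" "b \<noteq> c"
    "\<sigma>' = \<sigma>(a := stk rest, b := stk (rev (code t) @ ys))" "12 * length (code t) + 5 \<le> u"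
  shows "exec (take_tree a b c) \<sigma> u \<sigma>'"
proof -
  have "exec (push c 1) \<sigma> 3 (\<sigma>(c := stk [1]))" by (rule exec_push) (use assms in auto)
  moreover have "exec (take_loop a b c) (\<sigma>(c := stk [1])) (12 * length (code t) + 1) \<sigma>'"
    by (rule exec_take_loop[of _ _ "[t]" rest _ ys]) (use assms in \<open>auto simp: fun_eq_iff\<close>)
  ultimately show ?thesis unfolding take_tree_def by (rule exec.Seq) (use assms in auto)
qed


section \<open>Functions computed by tape programs\<close>

text \<open>Only injectivity within one type is required. Values of different types share trees on
  purpose, so that constructors and selectors which merely regroup data cost nothing.\<close>

class encodable =
  fixes tree_of :: "'a \<Rightarrow> tree"
  assumes tree_of_inject: "tree_of x = tree_of y \<Longrightarrow> x = y"

definition sz :: "'a::encodable \<Rightarrow> nat" where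
  "sz x = length (code (tree_of x))"

lemma sz_pos: "1 \<le> sz x"
  using length_code_pos[of "tree_of x"] unfolding sz_def by linarith

abbreviation stack_of :: "'a::encodable \<Rightarrow> tape" where
  "stack_of x \<equiv> stk (code (tree_of x))"

text \<open>The work stacks are empty before and after, and the tapes from \<open>k\<close> on are
  arbitrary and left unchanged. This makes programs composable: a caller keeps its own data on tapes
  above \<open>k\<close>.\<close>

definition computes_with :: "nat \<Rightarrow> com \<Rightarrow> ('a::encodable \<Rightarrow> 'b::encodable) \<Rightarrow> ('a \<Rightarrow> nat) \<Rightarrow> bool" where
  "computes_with k c f T \<longleftrightarrow> wf_com k c \<and> 1 \<le> k \<and>
     (\<forall>x \<sigma>. \<sigma> 0 = stack_of x \<longrightarrow> (\<forall>i. 0 < i \<and> i < k \<longrightarrow> \<sigma> i = stk []) \<longrightarrow>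
        exec c \<sigma> (T x) (\<sigma>(0 := stack_of (f x))))"

definition computes :: "('a::encodable \<Rightarrow> 'b::encodable) \<Rightarrow> ('a \<Rightarrow> nat) \<Rightarrow> bool" where
  "computes f T \<longleftrightarrow> (\<exists>k c. computes_with k c f T)"

lemma computes_with_mono:
  fixes f :: "'a::encodable \<Rightarrow> 'b::encodable"
  assumes "computes_with k c f T" "k \<le> l" "\<And>x. T x \<le> U x"
  shows "computes_with l c f U"
  unfolding computes_with_def
proof (intro conjI allI impI)
  fix x :: 'a and \<sigma> :: tapes
  assume s: "\<sigma> 0 = stack_of x" "\<forall>i. 0 < i \<and> i < l \<longrightarrow> \<sigma> i = stk []"
  then have "exec c \<sigma> (T x) (\<sigma>(0 := stack_of (f x)))"
    using assms(1,2) unfolding computes_with_def by (meson order_less_le_trans)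
  then show "exec c \<sigma> (U x) (\<sigma>(0 := stack_of (f x)))" using assms(3) by (rule exec_mono)
qed (use assms in \<open>auto simp: computes_with_def intro: wf_com_mono\<close>)

lemma computes_mono: "computes f T \<Longrightarrow> (\<And>x. T x \<le> U x) \<Longrightarrow> computes f U"
  unfolding computes_def using computes_with_mono[OF _ order_refl] by blast

lemma computes_with_exec:
  assumes "computes_with k c f T" "\<sigma> 0 = stack_of x" "\<And>i. 0 < i \<Longrightarrow> i < k \<Longrightarrow> \<sigma> i = stk []"
    "\<sigma>' = \<sigma>(0 := stack_of (f x))" "T x \<le> t"
  shows "exec c \<sigma> t \<sigma>'"
  using assms exec_mono unfolding computes_with_def by blast

lemma computesI:
  assumes "wf_com k c" "1 \<le> k"
    and "\<And>x \<sigma>. \<sigma> 0 = stack_of x \<Longrightarrow> (\<And>i. 0 < i \<Longrightarrow> i < k \<Longrightarrow> \<sigma> i = stk []) \<Longrightarrow>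
      exec c \<sigma> (T x) (\<sigma>(0 := stack_of (f x)))"
  shows "computes f T"
  unfolding computes_def computes_with_def using assms by blast

text \<open>The position of head 0 is the size of the value minus one, so its displacement, which
  the running time bounds, is the growth of the value.\<close>

lemma sz_computes:
  assumes "computes f T"
  shows "sz (f x) \<le> sz x + T x"
proof -
  obtain k c where "computes_with k c f T" using assms by (auto simp: computes_def)
  then have "exec c ((\<lambda>_. stk [])(0 := stack_of x)) (T x) ((\<lambda>_. stk [])(0 := stack_of (f x)))"
    by (rule computes_with_exec[where x = x]) auto
  from exec_head[OF this, of 0] show ?thesis by (simp add: snd_stk sz_def)
qed

lemma computes_coerce:
  fixes f :: "'a::encodable \<Rightarrow> 'b::encodable"
  assumes "\<And>x. tree_of (f x) = tree_of x"
  shows "computes f (\<lambda>_. 1)"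
proof (rule computesI[of 1 skip])
  fix x :: 'a and \<sigma> :: tapes
  assume "\<sigma> 0 = stack_of x"
  then have "\<sigma>(0 := stack_of (f x)) = \<sigma>" by (auto simp: fun_eq_iff assms)
  then show "exec skip \<sigma> 1 (\<sigma>(0 := stack_of (f x)))" using exec_skip[of \<sigma>] by simp
qed auto

lemma computes_const: "computes (\<lambda>_::'a::encodable. c) (\<lambda>x. 2 * sz x + 4 * sz c + 3)"
proof (rule computesI[of 1 "clear 0 ;; push_list 0 (code (tree_of c))"])
  fix x :: 'a and \<sigma> :: tapes
  assume "\<sigma> 0 = stack_of x"
  then have "exec (clear 0) \<sigma> (2 * sz x + 1) (\<sigma>(0 := stk []))"
    by (intro exec_clear) (auto simp: sz_def)
  moreover have "exec (push_list 0 (code (tree_of c))) (\<sigma>(0 := stk [])) (4 * sz c + 1)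
      (\<sigma>(0 := stk [], 0 := stk (code (tree_of c) @ [])))"
    unfolding sz_def by (rule exec_push_list) simp
  ultimately show "exec (clear 0 ;; push_list 0 (code (tree_of c))) \<sigma> (2 * sz x + 4 * sz c + 3)
      (\<sigma>(0 := stack_of c))"
    by (rule exec.Seq[THEN exec_conv]) auto
qed (auto intro!: wf_com_push_list)

lemma computes_compose:
  fixes f :: "'a::encodable \<Rightarrow> 'b::encodable" and g :: "'b \<Rightarrow> 'c::encodable"
  assumes "computes f T" "computes g U"
  shows "computes (\<lambda>x. g (f x)) (\<lambda>x. T x + U (f x) + 1)"
proof -
  obtain k c l d where "computes_with k c f T" "computes_with l d g U"
    using assms by (auto simp: computes_def)
  then have c: "computes_with (max k l) c f T" and d: "computes_with (max k l) d g U"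
    by (auto intro: computes_with_mono)
  show ?thesis
  proof (rule computesI[of "max k l" "c ;; d"])
    fix x :: 'a and \<sigma> :: tapes
    assume s: "\<sigma> 0 = stack_of x" "\<And>i. 0 < i \<Longrightarrow> i < max k l \<Longrightarrow> \<sigma> i = stk []"
    have "exec c \<sigma> (T x) (\<sigma>(0 := stack_of (f x)))"
      by (rule computes_with_exec[OF c]) (use s in auto)
    moreover have "exec d (\<sigma>(0 := stack_of (f x))) (U (f x)) (\<sigma>(0 := stack_of (g (f x))))"
      by (rule computes_with_exec[OF d]) (use s in auto)
    ultimately show "exec (c ;; d) \<sigma> (T x + U (f x) + 1) (\<sigma>(0 := stack_of (g (f x))))"
      by (rule exec_seq)
  qed (use c d in \<open>auto simp: computes_with_def\<close>)
qed

section \<open>Tree encodings of the basic types\<close>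

instantiation prod :: (encodable, encodable) encodable
begin
definition "tree_of p = Node (tree_of (fst p)) (tree_of (snd p))"
instance by standard (auto simp: tree_of_prod_def prod_eq_iff intro: tree_of_inject)
end

instantiation unit :: encodable
begin
definition "tree_of (u::unit) = Leaf"
instance by standard auto
end

text \<open>The code of \<open>True\<close> begins with 2 and that of \<open>False\<close> with 1,
  so the symbol on top of the stack is the acceptance test of \<open>tm_of\<close>.\<close>

instantiation bool :: encodable
begin
definition "tree_of b = (if b then Node Leaf Leaf else Leaf)"
instance by standard (auto simp: tree_of_bool_def split: if_splits)
end

text \<open>Numbers are unary. Their values are linear in their sizes, so a number of rounds
  computed in polynomial time is polynomial. A successor has the tree of the pair of
  \<open>()\<close> and its predecessor.\<close>

instantiation nat :: encodable
begin
fun tree_of_nat :: "nat \<Rightarrow> tree" where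
  "tree_of_nat 0 = Leaf"
| "tree_of_nat (Suc n) = Node Leaf (tree_of_nat n)"
instance
proof
  fix x y :: nat
  show "tree_of x = tree_of y \<Longrightarrow> x = y"
  proof (induction x arbitrary: y)
    case 0 then show ?case by (cases y) auto
  next
    case (Suc x) then show ?case by (cases y) auto
  qed
qed
end

instantiation list :: (encodable) encodable
begin
fun tree_of_list :: "'a list \<Rightarrow> tree" where
  "tree_of_list [] = Leaf"
| "tree_of_list (x # xs) = Node (tree_of x) (tree_of_list xs)"
instance
proof
  fix x y :: "'a list"
  show "tree_of x = tree_of y \<Longrightarrow> x = y"
  proof (induction x arbitrary: y)
    case Nil then show ?case by (cases y) auto
  next
    case (Cons a x) then show ?case by (cases y) (auto intro: tree_of_inject)
  qed
qed
end

lemma sz_simps [simp]: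
  "sz (a, b) = Suc (sz a + sz b)" "sz () = 1" "sz True = 3" "sz False = 1"
  "sz ([] :: 'a::encodable list) = 1" "sz (x # xs) = Suc (sz x + sz xs)" "sz (n::nat) = 2 * n + 1"
proof -
  show "sz (n::nat) = 2 * n + 1" by (induction n) (auto simp: sz_def)
qed (auto simp: sz_def tree_of_prod_def tree_of_unit_def tree_of_bool_def)

text \<open>Two tapes above those of both programs are used: one holds a copy of the argument while
  \<open>f\<close> runs, the other the value of \<open>f\<close> while \<open>g\<close> runs. A
  final 2 joins the two codes to that of a pair.\<close>

lemma computes_pair:
  fixes f :: "'a::encodable \<Rightarrow> 'b::encodable" and g :: "'a \<Rightarrow> 'c::encodable"
  assumes "computes f T" "computes g U"
  shows "computes (\<lambda>x. (f x, g x)) (\<lambda>x. T x + U x + 40 * sz x + 40 * sz (f x) + 40)"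
proof -
  obtain k c l d where "computes_with k c f T" "computes_with l d g U"
    using assms by (auto simp: computes_def)
  then obtain k where c: "computes_with k c f T" and d: "computes_with k d g U"
    using computes_with_mono by (metis max.cobounded1 max.cobounded2 order_refl)
  have k: "1 \<le> k" "wf_com k c" "wf_com k d" using c d by (auto simp: computes_with_def)
  let ?c = "mv2 0 k (k+1) ;; mv (k+1) 0 ;; c ;; mv 0 (k+1) ;; mv k 0 ;; d ;; mv (k+1) 0 ;; push 0 2"
  show ?thesis
  proof (rule computesI[of "k + 2" ?c])
    show "wf_com (k + 2) ?c" using k by (auto intro: wf_com_mono)
    fix x :: 'a and \<sigma> :: tapes
    assume s: "\<sigma> 0 = stack_of x" "\<And>i. 0 < i \<Longrightarrow> i < k + 2 \<Longrightarrow> \<sigma> i = stk []"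
    let ?x = "code (tree_of x)" and ?f = "code (tree_of (f x))" and ?g = "code (tree_of (g x))"
    have len: "length ?x = sz x" "length ?f = sz (f x)" by (auto simp: sz_def)
    let ?s1 = "\<sigma>(0 := stk [], k := stk (rev ?x), k + 1 := stk (rev ?x))"
    let ?s2 = "\<sigma>(k := stk (rev ?x))"
    let ?s3 = "\<sigma>(k := stk (rev ?x), 0 := stk ?f)"
    let ?s4 = "\<sigma>(k := stk (rev ?x), 0 := stk [], k + 1 := stk (rev ?f))"
    let ?s5 = "\<sigma>(k + 1 := stk (rev ?f))"
    let ?s6 = "\<sigma>(k + 1 := stk (rev ?f), 0 := stk ?g)"
    let ?s7 = "\<sigma>(0 := stk (?f @ ?g))"
    have e1: "exec (mv2 0 k (k+1)) \<sigma> (12 * sz x + 1) ?s1"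
      by (rule exec_mv2) (use s k len in auto)
    have e2: "exec (mv (k+1) 0) ?s1 (8 * sz x + 1) ?s2"
      by (rule exec_mv[of _ _ "rev ?x" _ "[]"]) (use s k len in \<open>auto simp: fun_eq_iff\<close>)
    have e3: "exec c ?s2 (T x) ?s3"
      by (rule computes_with_exec[OF c]) (use s k in \<open>auto simp: fun_eq_iff\<close>)
    have e4: "exec (mv 0 (k+1)) ?s3 (8 * sz (f x) + 1) ?s4"
      by (rule exec_mv[of _ _ ?f _ "[]"]) (use s k len in \<open>auto simp: fun_eq_iff\<close>)
    have e5: "exec (mv k 0) ?s4 (8 * sz x + 1) ?s5"
      by (rule exec_mv[of _ _ "rev ?x" _ "[]"]) (use s k len in \<open>auto simp: fun_eq_iff\<close>)
    have e6: "exec d ?s5 (U x) ?s6"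
      by (rule computes_with_exec[OF d]) (use s k in \<open>auto simp: fun_eq_iff\<close>)
    have e7: "exec (mv (k+1) 0) ?s6 (8 * sz (f x) + 1) ?s7"
      by (rule exec_mv[of _ _ "rev ?f" _ ?g]) (use s k len in \<open>auto simp: fun_eq_iff\<close>)
    have e8: "exec (push 0 2) ?s7 3 (\<sigma>(0 := stack_of (f x, g x)))"
      by (rule exec_push) (auto simp: tree_of_prod_def)
    show "exec ?c \<sigma> (T x + U x + 40 * sz x + 40 * sz (f x) + 40) (\<sigma>(0 := stack_of (f x, g x)))"
      by (rule exec_mono[OF exec_seq[OF e1 exec_seq[OF e2 exec_seq[OF e3 exec_seq[OF e4 exec_seq[OF e5
        exec_seq[OF e6 exec_seq[OF e7 e8]]]]]]]]) simp
  qed (use k in auto)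
qed

lemma exec_Loop_end: "read (\<sigma> r) \<notin> S \<Longrightarrow> \<sigma>' = \<sigma> \<Longrightarrow> 1 \<le> t \<Longrightarrow> exec (Loop r S c) \<sigma> t \<sigma>'"
  by (auto intro: exec.LoopF)

lemma exec_skip_conv: "\<sigma>' = \<sigma> \<Longrightarrow> exec skip \<sigma> 1 \<sigma>'"
  using exec_skip by simp

lemma computes_id: "computes (\<lambda>x. x) (\<lambda>_. 1)"
  by (rule computes_coerce) simp

section \<open>Projections, case distinction, equality, size and iteration\<close>

lemma computes_fst: "computes fst (\<lambda>p::'a::encodable \<times> 'b::encodable. 30 * sz p)"
proof (rule computesI[of 3 "pop 0 ;; take_tree 0 1 2 ;; clear 0 ;; mv 1 0"])
  fix p :: "'a \<times> 'b" and \<sigma> :: tapes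
  assume s: "\<sigma> 0 = stack_of p" "\<And>i. 0 < i \<Longrightarrow> i < 3 \<Longrightarrow> \<sigma> i = stk []"
  obtain a b where p: "p = (a, b)" by fastforce
  let ?a = "code (tree_of a)" and ?b = "code (tree_of b)"
  have len: "length ?a = sz a" "length ?b = sz b" by (auto simp: sz_def)
  let ?s1 = "\<sigma>(0 := stk (?a @ ?b))"
  let ?s2 = "\<sigma>(0 := stk ?b, 1 := stk (rev ?a))"
  let ?s3 = "\<sigma>(0 := stk [], 1 := stk (rev ?a))"
  have e1: "exec (pop 0) \<sigma> 1 ?s1" by (rule exec_pop) (use s in \<open>auto simp: p tree_of_prod_def\<close>)
  have e2: "exec (take_tree 0 1 2) ?s1 (12 * sz a + 5) ?s2"
    by (rule exec_take_tree[where ys = "[]"]) (use s len in \<open>auto simp: fun_eq_iff\<close>)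
  have e3: "exec (clear 0) ?s2 (2 * sz b + 1) ?s3"
    by (rule exec_clear) (use s len in \<open>auto simp: fun_eq_iff\<close>)
  have e4: "exec (mv 1 0) ?s3 (8 * sz a + 1) (\<sigma>(0 := stack_of (fst p)))"
    by (rule exec_mv[where xs = "rev ?a" and ys = "[]"]) (use s len p in \<open>auto simp: fun_eq_iff\<close>)
  show "exec (pop 0 ;; take_tree 0 1 2 ;; clear 0 ;; mv 1 0) \<sigma> (30 * sz p) (\<sigma>(0 := stack_of (fst p)))"
    by (rule exec_mono[OF exec_seq[OF e1 exec_seq[OF e2 exec_seq[OF e3 e4]]]])
      (use sz_pos[of a] sz_pos[of b] in \<open>simp add: p\<close>)
qed auto

lemma computes_snd: "computes snd (\<lambda>p::'a::encodable \<times> 'b::encodable. 30 * sz p)"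
proof (rule computesI[of 3 "pop 0 ;; take_tree 0 1 2 ;; clear 1"])
  fix p :: "'a \<times> 'b" and \<sigma> :: tapes
  assume s: "\<sigma> 0 = stack_of p" "\<And>i. 0 < i \<Longrightarrow> i < 3 \<Longrightarrow> \<sigma> i = stk []"
  obtain a b where p: "p = (a, b)" by fastforce
  let ?a = "code (tree_of a)" and ?b = "code (tree_of b)"
  have len: "length ?a = sz a" "length ?b = sz b" by (auto simp: sz_def)
  let ?s1 = "\<sigma>(0 := stk (?a @ ?b))"
  let ?s2 = "\<sigma>(0 := stk ?b, 1 := stk (rev ?a))"
  have e1: "exec (pop 0) \<sigma> 1 ?s1" by (rule exec_pop) (use s in \<open>auto simp: p tree_of_prod_def\<close>)
  have e2: "exec (take_tree 0 1 2) ?s1 (12 * sz a + 5) ?s2"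
    by (rule exec_take_tree[where ys = "[]"]) (use s len in \<open>auto simp: fun_eq_iff\<close>)
  have e3: "exec (clear 1) ?s2 (2 * sz a + 1) (\<sigma>(0 := stack_of (snd p)))"
    by (rule exec_clear[where xs = "rev ?a"]) (use s len p in \<open>auto simp: fun_eq_iff\<close>)
  show "exec (pop 0 ;; take_tree 0 1 2 ;; clear 1) \<sigma> (30 * sz p) (\<sigma>(0 := stack_of (snd p)))"
    by (rule exec_mono[OF exec_seq[OF e1 exec_seq[OF e2 e3]]])
      (use sz_pos[of a] sz_pos[of b] in \<open>simp add: p\<close>)
qed auto

text \<open>Case distinction on the constructor of the tree encoding \<open>h x\<close>: in the node case
  it is reread as a value \<open>m x\<close> of another type with the same encoding.\<close>

lemma computes_case:
  fixes h :: "'a::encodable \<Rightarrow> 'c::encodable" and m :: "'a \<Rightarrow> 'd::encodable" and r :: "'a \<Rightarrow> 'b::encodable"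
  assumes h: "computes h T" and f: "computes f U" and g: "computes g V"
    and leaf: "\<And>x. tree_of (h x) = Leaf \<Longrightarrow> r x = f x \<and> U x \<le> W x"
    and node: "\<And>x. tree_of (h x) \<noteq> Leaf \<Longrightarrow> tree_of (m x) = tree_of (h x) \<and> r x = g (m x, x) \<and> V (m x, x) \<le> W x"
  shows "computes r (\<lambda>x. T x + W x + 40 * sz x + 40 * sz (h x) + 60)"
proof -
  let ?W = "\<lambda>x. T x + 1 + 40 * sz x + 40 * sz (h x) + 40"
  obtain k c l d i e where "computes_with k c (\<lambda>x. (h x, x)) ?W" "computes_with l d f U" "computes_with i e g V"
    using computes_pair[OF h computes_id] f g by (auto simp: computes_def)
  then have "computes_with (k + l + i) c (\<lambda>x. (h x, x)) ?W" "computes_with (k + l + i) d f U"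
      "computes_with (k + l + i) e g V"
    by (auto elim!: computes_with_mono)
  then obtain k where c: "computes_with k c (\<lambda>x. (h x, x)) ?W" and d: "computes_with k d f U"
      and e: "computes_with k e g V"
    by blast
  have k: "1 \<le> k" "wf_com k c" "wf_com k d" "wf_com k e" using c d e by (auto simp: computes_with_def)
  let ?c = "c ;; pop 0 ;; Cond 0 {1} (pop 0 ;; d) (push 0 2 ;; e)"
  show ?thesis
  proof (rule computesI[of k ?c])
    show "wf_com k ?c" using k by auto
    fix x :: 'a and \<sigma> :: tapes
    assume s: "\<sigma> 0 = stack_of x" "\<And>i. 0 < i \<Longrightarrow> i < k \<Longrightarrow> \<sigma> i = stk []"
    let ?x = "code (tree_of x)" and ?h = "code (tree_of (h x))"
    let ?s1 = "\<sigma>(0 := stack_of (h x, x))"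
    let ?s2 = "\<sigma>(0 := stk (?h @ ?x))"
    let ?\<tau> = "\<sigma>(0 := stack_of (r x))"
    have e1: "exec c \<sigma> (?W x) ?s1"
      by (rule computes_with_exec[OF c]) (use s k in auto)
    have e2: "exec (pop 0) ?s1 1 ?s2" by (rule exec_pop) (auto simp: tree_of_prod_def)
    have e3: "exec (Cond 0 {1} (pop 0 ;; d) (push 0 2 ;; e)) ?s2 (W x + 5) ?\<tau>"
    proof (cases "tree_of (h x) = Leaf")
      case True
      have e4: "exec (pop 0) ?s2 1 (\<sigma>(0 := stk ?x))" by (rule exec_pop) (auto simp: True)
      have e5: "exec d (\<sigma>(0 := stk ?x)) (U x) ?\<tau>"
        by (rule computes_with_exec[OF d]) (use s leaf[OF True] in auto)
      show ?thesis
        by (rule exec.CondT[OF _ exec_seq[OF e4 e5]]) (use leaf[OF True] in \<open>auto simp: True\<close>)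
    next
      case False
      then obtain t1 t2 where t: "tree_of (h x) = Node t1 t2" by (cases "tree_of (h x)") auto
      have e4: "exec (push 0 2) ?s2 3 (\<sigma>(0 := stack_of (m x, x)))"
        by (rule exec_push) (use node[OF False] in \<open>auto simp: tree_of_prod_def\<close>)
      have e5: "exec e (\<sigma>(0 := stack_of (m x, x))) (V (m x, x)) ?\<tau>"
        by (rule computes_with_exec[OF e]) (use s node[OF False] in auto)
      show ?thesis
        by (rule exec.CondF[OF _ exec_seq[OF e4 e5]]) (use node[OF False] in \<open>auto simp: t\<close>)
    qed
    show "exec ?c \<sigma> (T x + W x + 40 * sz x + 40 * sz (h x) + 60) ?\<tau>"
      by (rule exec_mono[OF exec_seq[OF e1 exec_seq[OF e2 e3]]]) simp
  qed (use k in auto)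
qed

text \<open>Stack 0 is popped only on a match, and every mismatch leaves a mark on stack 3. After a
  mismatch the two words are out of step, but the mark already records that they differ. They are
  equal iff no mark and no rest remain.\<close>

lemma exec_compare:
  assumes "\<sigma> 0 = stk ys" "\<sigma> 2 = stk xs" "\<sigma> 3 = stk zs" "set xs \<subseteq> {1, 2}" "set ys \<subseteq> {1, 2}" "set zs \<subseteq> {1}"
    "8 * length xs + 1 \<le> t"
  shows "\<exists>ys' zs'. exec (Loop 2 {1, 2} (Cond 2 {1} (Cond 0 {1} (pop 0) (push 3 1)) (Cond 0 {2} (pop 0) (push 3 1)) ;; pop 2))
      \<sigma> t (\<sigma>(0 := stk ys', 2 := stk [], 3 := stk zs')) \<and> set ys' \<subseteq> {1, 2} \<and> set zs' \<subseteq> {1} \<and>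
      length ys' \<le> length ys \<and> length zs' \<le> length zs + length xs \<and>
      (ys' = [] \<and> zs' = [] \<longleftrightarrow> xs = ys \<and> zs = [])"
    (is "\<exists>ys' zs'. exec (Loop 2 {1, 2} ?body) _ _ _ \<and> _")
  using assms
proof (induction xs arbitrary: \<sigma> ys zs t)
  case Nil
  have "exec (Loop 2 {1, 2} ?body) \<sigma> t (\<sigma>(0 := stk ys, 2 := stk [], 3 := stk zs))"
    by (rule exec_Loop_end) (use Nil in \<open>auto simp: fun_eq_iff\<close>)
  moreover have "length zs \<le> length zs + length ([] :: nat list)" "(ys = [] \<and> zs = []) = ([] = ys \<and> zs = [])"
    by auto
  ultimately show ?case using Nil.prems(5,6) by blast
next
  case (Cons x xs)
  define eq where "eq \<longleftrightarrow> ys \<noteq> [] \<and> hd ys = x"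
  define ys1 where "ys1 = (if eq then tl ys else ys)"
  define zs1 where "zs1 = (if eq then zs else 1 # zs)"
  let ?s1 = "\<sigma>(0 := stk ys1, 3 := stk zs1)" and ?s2 = "\<sigma>(0 := stk ys1, 3 := stk zs1, 2 := stk xs)"
  have inner: "exec (Cond 0 {x} (pop 0) (push 3 1)) \<sigma> 4 ?s1"
  proof (cases eq)
    case True
    then obtain ys' where ys: "ys = x # ys'" by (cases ys) (auto simp: eq_def)
    have "exec (pop 0) \<sigma> 1 ?s1"
      by (rule exec_pop[of _ _ x ys']) (use Cons.prems True ys in \<open>auto simp: ys1_def zs1_def fun_eq_iff\<close>)
    then show ?thesis using Cons.prems ys by (intro exec.CondT) auto
  next
    case False
    have "exec (push 3 1) \<sigma> 3 ?s1"
      by (rule exec_push[of _ _ zs]) (use Cons.prems False in \<open>auto simp: ys1_def zs1_def fun_eq_iff\<close>)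
    moreover have "read (\<sigma> 0) \<notin> {x}" using Cons.prems False by (cases ys) (auto simp: eq_def)
    ultimately show ?thesis by (intro exec.CondF) auto
  qed
  have c: "exec (Cond 2 {1} (Cond 0 {1} (pop 0) (push 3 1)) (Cond 0 {2} (pop 0) (push 3 1))) \<sigma> 5 ?s1"
  proof (cases "x = 1")
    case True
    then show ?thesis
      by (intro exec.CondT[OF _ inner[unfolded True]]) (use Cons.prems in auto)
  next
    case False
    with Cons.prems have x: "x = 2" by auto
    then show ?thesis
      by (intro exec.CondF[OF _ inner[unfolded x]]) (use Cons.prems in auto)
  qed
  have q: "exec (pop 2) ?s1 1 ?s2" by (rule exec_pop) (use Cons.prems in auto)
  have set_tl: "set (tl ys) \<subseteq> set ys" by (cases ys) auto
  have "\<exists>ys' zs'. exec (Loop 2 {1, 2} ?body) ?s2 (8 * length xs + 1) (?s2(0 := stk ys', 2 := stk [], 3 := stk zs')) \<and>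
      set ys' \<subseteq> {1, 2} \<and> set zs' \<subseteq> {1} \<and> length ys' \<le> length ys1 \<and> length zs' \<le> length zs1 + length xs \<and>
      (ys' = [] \<and> zs' = [] \<longleftrightarrow> xs = ys1 \<and> zs1 = [])"
    by (rule Cons.IH) (use Cons.prems set_tl in \<open>auto simp: ys1_def zs1_def\<close>)
  then obtain ys' zs' where r: "exec (Loop 2 {1, 2} ?body) ?s2 (8 * length xs + 1) (?s2(0 := stk ys', 2 := stk [], 3 := stk zs'))"
    and ys': "set ys' \<subseteq> {1, 2}" "set zs' \<subseteq> {1}" "length ys' \<le> length ys1" "length zs' \<le> length zs1 + length xs"
      "ys' = [] \<and> zs' = [] \<longleftrightarrow> xs = ys1 \<and> zs1 = []"
    by blast
  have "exec (Loop 2 {1, 2} ?body) \<sigma> t (?s2(0 := stk ys', 2 := stk [], 3 := stk zs'))"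
    by (rule exec.LoopT[OF _ exec_seq[OF c q] r]) (use Cons.prems in auto)
  moreover have "?s2(0 := stk ys', 2 := stk [], 3 := stk zs') = \<sigma>(0 := stk ys', 2 := stk [], 3 := stk zs')"
    by (auto simp: fun_eq_iff)
  ultimately have e: "exec (Loop 2 {1, 2} ?body) \<sigma> t (\<sigma>(0 := stk ys', 2 := stk [], 3 := stk zs'))"
    by metis
  have "xs = ys1 \<and> zs1 = [] \<longleftrightarrow> x # xs = ys \<and> zs = []"
    by (cases ys) (auto simp: ys1_def zs1_def eq_def)
  moreover have "length ys1 \<le> length ys" "length zs1 \<le> length zs + 1" by (auto simp: ys1_def zs1_def)
  ultimately have "length ys' \<le> length ys" "length zs' \<le> length zs + length (x # xs)"
    "(ys' = [] \<and> zs' = []) = (x # xs = ys \<and> zs = [])"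
    using ys' by auto
  with e ys'(1,2) show ?case by blast
qed

lemma computes_eq: "computes (\<lambda>p::'a::encodable \<times> 'a. fst p = snd p) (\<lambda>p. 60 * sz p)"
proof -
  let ?loop = "Loop 2 {1, 2} (Cond 2 {1} (Cond 0 {1} (pop 0) (push 3 1)) (Cond 0 {2} (pop 0) (push 3 1)) ;; pop 2)"
  let ?out = "Cond 3 {1} (clear 3 ;; push 0 1) (push 0 1 ;; push 0 1 ;; push 0 2)"
  let ?c = "pop 0 ;; take_tree 0 1 2 ;; mv 1 2 ;; ?loop ;; Cond 0 {1, 2} (push 3 1) skip ;; clear 0 ;; ?out"
  show ?thesis
  proof (rule computesI[of 4 ?c])
    fix p :: "'a \<times> 'a" and \<sigma> :: tapes
    assume s: "\<sigma> 0 = stack_of p" "\<And>i. 0 < i \<Longrightarrow> i < 4 \<Longrightarrow> \<sigma> i = stk []"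
    obtain a b where p: "p = (a, b)" by fastforce
    let ?a = "code (tree_of a)" and ?b = "code (tree_of b)"
    have len: "length ?a = sz a" "length ?b = sz b" by (auto simp: sz_def)
    let ?s1 = "\<sigma>(0 := stk (?a @ ?b))"
    let ?s2 = "\<sigma>(0 := stk ?b, 1 := stk (rev ?a))"
    let ?s3 = "\<sigma>(0 := stk ?b, 2 := stk ?a)"
    have e1: "exec (pop 0) \<sigma> 1 ?s1" by (rule exec_pop) (use s in \<open>auto simp: p tree_of_prod_def\<close>)
    have e2: "exec (take_tree 0 1 2) ?s1 (12 * sz a + 5) ?s2"
      by (rule exec_take_tree[where ys = "[]"]) (use s len in \<open>auto simp: fun_eq_iff\<close>)
    have e3: "exec (mv 1 2) ?s2 (8 * sz a + 1) ?s3"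
      by (rule exec_mv[where xs = "rev ?a" and ys = "[]"]) (use s len p in \<open>auto simp: fun_eq_iff\<close>)
    have "\<exists>ys' zs'. exec ?loop ?s3 (8 * sz a + 1) (?s3(0 := stk ys', 2 := stk [], 3 := stk zs')) \<and>
      set ys' \<subseteq> {1, 2} \<and> set zs' \<subseteq> {1} \<and> length ys' \<le> length ?b \<and> length zs' \<le> length ([]::nat list) + length ?a \<and>
      (ys' = [] \<and> zs' = [] \<longleftrightarrow> ?a = ?b \<and> [] = ([]::nat list))"
      by (rule exec_compare) (use s len in auto)
    then obtain ys zs where e4: "exec ?loop ?s3 (8 * sz a + 1) (?s3(0 := stk ys, 2 := stk [], 3 := stk zs))"
      and ys: "set ys \<subseteq> {1, 2}" "set zs \<subseteq> {1}" "length ys \<le> length ?b" "length zs \<le> length ([]::nat list) + length ?a"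
      and yz: "ys = [] \<and> zs = [] \<longleftrightarrow> ?a = ?b \<and> [] = ([]::nat list)"
      by blast
    have "?a = ?b \<longleftrightarrow> a = b" using code_inject tree_of_inject by metis
    with ys yz have ys: "set ys \<subseteq> {1, 2}" "set zs \<subseteq> {1}" "length ys \<le> sz b" "length zs \<le> sz a"
      "ys = [] \<and> zs = [] \<longleftrightarrow> a = b" by (simp_all add: len)
    let ?s4 = "?s3(0 := stk ys, 2 := stk [], 3 := stk zs)"
    \<comment> \<open>Symbols left over on stack 0 mean that the second word was longer; they are
      turned into one more mark, so that \<open>us\<close> alone decides equality.\<close>
    define us where "us = (if ys = [] then zs else 1 # zs)"
    let ?s5 = "?s4(3 := stk us)" and ?s6 = "\<sigma>(0 := stk [], 3 := stk us)"
    have us: "us = [] \<longleftrightarrow> a = b" "set us \<subseteq> {1}" "length us \<le> sz a + 1" using ys by (auto simp: us_def)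
    have e5: "exec (Cond 0 {1, 2} (push 3 1) skip) ?s4 4 ?s5"
    proof (cases ys)
      case Nil
      have "exec skip ?s4 1 ?s5" by (rule exec_skip_conv) (auto simp: us_def Nil)
      then show ?thesis by (rule exec.CondF[rotated]) (auto simp: Nil)
    next
      case (Cons y ys')
      have "exec (push 3 1) ?s4 3 ?s5" by (rule exec_push) (auto simp: us_def Cons)
      then show ?thesis by (rule exec.CondT[rotated]) (use ys Cons in auto)
    qed
    have e6: "exec (clear 0) ?s5 (2 * sz b + 1) ?s6"
      by (rule exec_clear) (use s ys in \<open>auto simp: fun_eq_iff\<close>)
    have e7: "exec ?out ?s6 (2 * sz a + 20) (\<sigma>(0 := stack_of (fst p = snd p)))"
    proof (cases "a = b")
      case True
      have f1: "exec (push 0 1) ?s6 3 (\<sigma>(0 := stk [1]))"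
        by (rule exec_push) (use us True s in \<open>auto simp: fun_eq_iff\<close>)
      have f2: "exec (push 0 1) (\<sigma>(0 := stk [1])) 3 (\<sigma>(0 := stk [1, 1]))"
        by (rule exec_push) auto
      have f3: "exec (push 0 2) (\<sigma>(0 := stk [1, 1])) 3 (\<sigma>(0 := stk [2, 1, 1]))"
        by (rule exec_push) auto
      show ?thesis
        by (rule exec.CondF[OF _ exec_conv[OF exec_seq[OF f1 exec_seq[OF f2 f3]] order_refl]])
          (use us True in \<open>auto simp: p tree_of_bool_def\<close>)
    next
      case False
      then obtain us' where us': "us = 1 # us'" using us by (cases us) auto
      have f1: "exec (clear 3) ?s6 (2 * length us + 1) (\<sigma>(0 := stk []))"
        by (rule exec_clear) (use us s in \<open>auto simp: fun_eq_iff\<close>)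
      have f2: "exec (push 0 1) (\<sigma>(0 := stk [])) 3 (\<sigma>(0 := stk [1]))"
        by (rule exec_push) auto
      show ?thesis
        by (rule exec.CondT[OF _ exec_conv[OF exec_seq[OF f1 f2] order_refl]])
          (use us us' False in \<open>auto simp: p tree_of_bool_def\<close>)
    qed
    show "exec ?c \<sigma> (60 * sz p) (\<sigma>(0 := stack_of (fst p = snd p)))"
      by (rule exec_mono[OF exec_seq[OF e1 exec_seq[OF e2 exec_seq[OF e3 exec_seq[OF e4 exec_seq[OF e5 exec_seq[OF e6 e7]]]]]]])
        (use sz_pos[of a] sz_pos[of b] in \<open>simp add: p\<close>)
  qed auto
qed

text \<open>Each symbol of the argument puts \<open>2, 1\<close> in front of the result, which is
  the prefix added by a successor. The size serves later as a round counter that is always large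
  enough.\<close>

lemma computes_sz: "computes (sz :: 'a::encodable \<Rightarrow> nat) (\<lambda>x. 30 * sz x)"
proof -
  let ?loop = "Loop 1 {1, 2} (push 0 1 ;; push 0 2 ;; pop 1)"
  have loop: "exec ?loop \<sigma> t (\<sigma>(0 := stack_of (n + length xs), 1 := stk []))"
    if "\<sigma> 0 = stack_of n" "\<sigma> 1 = stk xs" "set xs \<subseteq> {1, 2}" "10 * length xs + 1 \<le> t" for \<sigma> n xs t
    using that
  proof (induction xs arbitrary: \<sigma> n t)
    case Nil
    show ?case by (rule exec_Loop_end) (use Nil in \<open>auto simp: fun_eq_iff\<close>)
  next
    case (Cons x xs)
    let ?s1 = "\<sigma>(0 := stk (1 # code (tree_of n)))" and ?s2 = "\<sigma>(0 := stack_of (Suc n))"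
    let ?s3 = "\<sigma>(0 := stack_of (Suc n), 1 := stk xs)"
    have e1: "exec (push 0 1) \<sigma> 3 ?s1" by (rule exec_push) (use Cons.prems in auto)
    have e2: "exec (push 0 2) ?s1 3 ?s2" by (rule exec_push) auto
    have e3: "exec (pop 1) ?s2 1 ?s3" by (rule exec_pop) (use Cons.prems in auto)
    have "exec ?loop ?s3 (10 * length xs + 1) (?s3(0 := stack_of (Suc n + length xs), 1 := stk []))"
      by (rule Cons.IH) (use Cons.prems in auto)
    then have e4: "exec ?loop ?s3 (10 * length xs + 1) (\<sigma>(0 := stack_of (n + length (x # xs)), 1 := stk []))"
      by (rule exec_conv) (auto simp: fun_eq_iff)
    show ?case
      by (rule exec.LoopT[OF _ exec_seq[OF e1 exec_seq[OF e2 e3]] e4]) (use Cons.prems in auto)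
  qed
  show ?thesis
  proof (rule computesI[of 2 "mv 0 1 ;; push 0 1 ;; ?loop"])
    fix x :: 'a and \<sigma> :: tapes
    assume s: "\<sigma> 0 = stack_of x" "\<And>i. 0 < i \<Longrightarrow> i < 2 \<Longrightarrow> \<sigma> i = stk []"
    let ?x = "code (tree_of x)"
    let ?s1 = "\<sigma>(0 := stk [], 1 := stk (rev ?x))"
    let ?s2 = "\<sigma>(0 := stack_of (0::nat), 1 := stk (rev ?x))"
    have e1: "exec (mv 0 1) \<sigma> (8 * sz x + 1) ?s1"
      by (rule exec_mv[where ys = "[]"]) (use s in \<open>auto simp: sz_def\<close>)
    have e2: "exec (push 0 1) ?s1 3 ?s2" by (rule exec_push) (auto simp: fun_eq_iff)
    have "exec ?loop ?s2 (10 * sz x + 1) (?s2(0 := stack_of (0 + length (rev ?x)), 1 := stk []))"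
      by (rule loop) (use s in \<open>auto simp: sz_def\<close>)
    then have e3: "exec ?loop ?s2 (10 * sz x + 1) (\<sigma>(0 := stack_of (sz x)))"
      by (rule exec_conv) (use s in \<open>auto simp: sz_def fun_eq_iff\<close>)
    show "exec (mv 0 1 ;; push 0 1 ;; ?loop) \<sigma> (30 * sz x) (\<sigma>(0 := stack_of (sz x)))"
      by (rule exec_mono[OF exec_seq[OF e1 exec_seq[OF e2 e3]]]) (use sz_pos[of x] in simp)
  qed auto
qed

text \<open>The counter is stripped off the pair by removing \<open>2, 1\<close> per successor and
  is kept in unary on tape \<open>k\<close>, out of reach of the iterated program. The remaining 1,
  the code of zero, is popped before the iteration starts.\<close>

lemma computes_funpow:
  fixes f :: "'a::encodable \<Rightarrow> 'a"
  assumes "computes f T"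
  shows "computes (\<lambda>p. (f ^^ fst p) (snd p))
    (\<lambda>p. (\<Sum>i<fst p. T ((f ^^ i) (snd p))) + 20 * fst p + 20)"
proof -
  obtain k c where c: "computes_with k c f T" using assms by (auto simp: computes_def)
  then have k: "1 \<le> k" "wf_com k c" by (auto simp: computes_with_def)
  let ?L1 = "Loop 0 {2} (pop 0 ;; pop 0 ;; push k 1)" and ?L2 = "Loop k {1} (pop k ;; c)"
  have L1: "exec ?L1 \<sigma> t (\<sigma>(0 := stk (1 # xs), k := stk (replicate (m + n) 1)))"
    if "\<sigma> 0 = stk (code (tree_of n) @ xs)" "\<sigma> k = stk (replicate m 1)" "8 * n + 1 \<le> t" for \<sigma> and n :: nat and m xs t
    using that
  proof (induction n arbitrary: \<sigma> m t)
    case 0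
    show ?case by (rule exec_Loop_end) (use 0 in \<open>auto simp: fun_eq_iff\<close>)
  next
    case (Suc n)
    let ?s1 = "\<sigma>(0 := stk (1 # code (tree_of n) @ xs))" and ?s2 = "\<sigma>(0 := stk (code (tree_of n) @ xs))"
    let ?s3 = "\<sigma>(0 := stk (code (tree_of n) @ xs), k := stk (replicate (Suc m) 1))"
    have e1: "exec (pop 0) \<sigma> 1 ?s1" by (rule exec_pop) (use Suc.prems in auto)
    have e2: "exec (pop 0) ?s1 1 ?s2" by (rule exec_pop) auto
    have e3: "exec (push k 1) ?s2 3 ?s3" by (rule exec_push) (use Suc.prems k in auto)
    have "exec ?L1 ?s3 (8 * n + 1) (?s3(0 := stk (1 # xs), k := stk (replicate (Suc m + n) 1)))"
      by (rule Suc.IH) (use k in auto)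
    then have e4: "exec ?L1 ?s3 (8 * n + 1) (\<sigma>(0 := stk (1 # xs), k := stk (replicate (m + Suc n) 1)))"
      by (rule exec_conv) (auto simp: fun_eq_iff)
    show ?case
      by (rule exec.LoopT[OF _ exec_seq[OF e1 exec_seq[OF e2 e3]] e4]) (use Suc.prems in auto)
  qed
  have L2: "exec ?L2 \<sigma> t (\<sigma>(0 := stack_of ((f ^^ n) x), k := stk []))"
    if "\<sigma> 0 = stack_of x" "\<sigma> k = stk (replicate n 1)" "\<And>i. 0 < i \<Longrightarrow> i < k \<Longrightarrow> \<sigma> i = stk []"
      "(\<Sum>i<n. T ((f ^^ i) x)) + 3 * n + 1 \<le> t" for \<sigma> x n t
    using that
  proof (induction n arbitrary: \<sigma> x t)
    case 0
    show ?case by (rule exec_Loop_end) (use 0 in \<open>auto simp: fun_eq_iff\<close>)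
  next
    case (Suc n)
    let ?s1 = "\<sigma>(k := stk (replicate n 1))" and ?s2 = "\<sigma>(k := stk (replicate n 1), 0 := stack_of (f x))"
    have e1: "exec (pop k) \<sigma> 1 ?s1" by (rule exec_pop) (use Suc.prems in auto)
    have e2: "exec c ?s1 (T x) ?s2" by (rule computes_with_exec[OF c]) (use Suc.prems k in auto)
    let ?t = "(\<Sum>i<n. T ((f ^^ i) (f x))) + 3 * n + 1"
    have "exec ?L2 ?s2 ?t (?s2(0 := stack_of ((f ^^ n) (f x)), k := stk []))"
      by (rule Suc.IH) (use Suc.prems k in auto)
    then have e3: "exec ?L2 ?s2 ?t (\<sigma>(0 := stack_of ((f ^^ Suc n) x), k := stk []))"
      by (rule exec_conv) (auto simp: fun_eq_iff funpow_swap1)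
    have "(\<Sum>i<Suc n. T ((f ^^ i) x)) = T x + (\<Sum>i<n. T ((f ^^ i) (f x)))"
      by (simp only: sum.lessThan_Suc_shift funpow_0 funpow_Suc_right o_apply)
    then show ?case
      by (intro exec.LoopT[OF _ exec_seq[OF e1 e2] e3]) (use Suc.prems in auto)
  qed
  show ?thesis
  proof (rule computesI[of "k + 1" "pop 0 ;; ?L1 ;; pop 0 ;; ?L2"])
    show "wf_com (k + 1) (pop 0 ;; ?L1 ;; pop 0 ;; ?L2)" using k by (auto intro: wf_com_mono)
    fix p :: "nat \<times> 'a" and \<sigma> :: tapes
    assume s: "\<sigma> 0 = stack_of p" "\<And>i. 0 < i \<Longrightarrow> i < k + 1 \<Longrightarrow> \<sigma> i = stk []"
    obtain n x where p: "p = (n, x)" by fastforce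
    let ?s1 = "\<sigma>(0 := stk (code (tree_of n) @ code (tree_of x)))"
    let ?s2 = "?s1(0 := stk (1 # code (tree_of x)), k := stk (replicate (0 + n) 1))"
    let ?s3 = "\<sigma>(0 := stack_of x, k := stk (replicate n 1))"
    let ?t = "(\<Sum>i<n. T ((f ^^ i) x)) + 3 * n + 1"
    have e1: "exec (pop 0) \<sigma> 1 ?s1" by (rule exec_pop) (use s in \<open>auto simp: p tree_of_prod_def\<close>)
    have e2: "exec ?L1 ?s1 (8 * n + 1) ?s2" by (rule L1) (use s k in auto)
    have e3: "exec (pop 0) ?s2 1 ?s3" by (rule exec_pop) (use s k in \<open>auto simp: fun_eq_iff\<close>)
    have "exec ?L2 ?s3 ?t (?s3(0 := stack_of ((f ^^ n) x), k := stk []))"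
      by (rule L2) (use s k in auto)
    then have e4: "exec ?L2 ?s3 ?t (\<sigma>(0 := stack_of ((f ^^ fst p) (snd p))))"
      by (rule exec_conv) (use s k in \<open>auto simp: fun_eq_iff p\<close>)
    show "exec (pop 0 ;; ?L1 ;; pop 0 ;; ?L2) \<sigma> ((\<Sum>i<fst p. T ((f ^^ i) (snd p))) + 20 * fst p + 20)
        (\<sigma>(0 := stack_of ((f ^^ fst p) (snd p))))"
      by (rule exec_mono[OF exec_seq[OF e1 exec_seq[OF e2 exec_seq[OF e3 e4]]]]) (simp add: p)
  qed auto
qed


section \<open>Machines for computable functions\<close>

text \<open>A blank tape of a starting machine has its head at 0, whereas the empty stack has it at
  -1.\<close>

fun heads_left :: "nat \<Rightarrow> com" where
  "heads_left 0 = skip"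
| "heads_left (Suc k) = heads_left k ;; Mv (Suc k) Leftwards"

definition blank_tape :: tape where
  "blank_tape = (\<lambda>_. 0, 0)"

lemma stk_Nil: "stk [] = (\<lambda>_. 0, - 1)"
  by (auto simp: stk_def fun_eq_iff)

lemma wf_com_heads_left: "k < l \<Longrightarrow> wf_com l (heads_left k)"
  by (induction k) auto

lemma exec_heads_left:
  "(\<And>i. 0 < i \<Longrightarrow> i \<le> k \<Longrightarrow> \<sigma> i = blank_tape) \<Longrightarrow>
    exec (heads_left k) \<sigma> (2 * k + 1) (\<lambda>i. if 0 < i \<and> i \<le> k then stk [] else \<sigma> i)"
proof (induction k)
  case 0
  show ?case unfolding heads_left.simps by (rule exec_conv[OF exec_skip]) (auto simp: fun_eq_iff)
next
  case (Suc k)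
  let ?\<tau> = "\<lambda>i. if 0 < i \<and> i \<le> k then stk [] else \<sigma> i"
  have e1: "exec (heads_left k) \<sigma> (2 * k + 1) ?\<tau>" using Suc by auto
  have e2: "exec (Mv (Suc k) Leftwards) ?\<tau> 1
      (?\<tau>(Suc k := act (read (?\<tau> (Suc k)), Leftwards) (?\<tau> (Suc k))))"
    by (rule exec.Mv) simp
  show ?case unfolding heads_left.simps
    by (rule exec_conv[OF exec_seq[OF e1 e2]])
      (use Suc.prems in \<open>auto simp: fun_eq_iff blank_tape_def stk_Nil\<close>)
qed

text \<open>The bits are consumed from the right end, so that the tree of the list is built by
  prepending. A bit contributes its own code, \<open>1\<close> or \<open>2, 1, 1\<close>, and then a
  2 for the list node. The last two transfers move the result to tape 0 in the right order.\<close>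

definition load_input :: com where
  "load_input = Loop 0 {1, 2} (Mv 0 Rightwards) ;; Mv 0 Leftwards ;; push 1 1 ;;
     Loop 0 {1, 2} (Cond 0 {1} (push 1 1) (push 1 1 ;; push 1 1 ;; push 1 2) ;; push 1 2 ;; pop 0) ;;
     mv 1 2 ;; mv 2 0"

lemma bit_symbol_cases: "bit_symbol b = 1 \<or> bit_symbol b = 2"
  by (simp add: bit_symbol_def)

lemma exec_scan_right:
  assumes "\<sigma> 0 = (fst (input_tape x), int i)" "i \<le> length x"
  shows "exec (Loop 0 {1, 2} (Mv 0 Rightwards)) \<sigma> (2 * (length x - i) + 1)
    (\<sigma>(0 := (fst (input_tape x), int (length x))))"
  using assms
proof (induction "length x - i" arbitrary: i \<sigma>)
  case 0
  show ?case by (rule exec_Loop_end) (use 0 in \<open>auto simp: fun_eq_iff input_tape_def\<close>)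
next
  case (Suc n)
  then have i: "i < length x" by simp
  let ?\<tau> = "\<sigma>(0 := (fst (input_tape x), int (Suc i)))"
  have e1: "exec (Mv 0 Rightwards) \<sigma> 1 ?\<tau>"
    by (rule exec_conv[OF exec.Mv]) (use Suc.prems in \<open>auto simp: fun_eq_iff\<close>)
  have "exec (Loop 0 {1, 2} (Mv 0 Rightwards)) ?\<tau> (2 * (length x - Suc i) + 1)
      (?\<tau>(0 := (fst (input_tape x), int (length x))))"
    by (rule Suc.hyps) (use Suc.hyps(2) i in auto)
  then have e2: "exec (Loop 0 {1, 2} (Mv 0 Rightwards)) ?\<tau> (2 * (length x - Suc i) + 1)
      (\<sigma>(0 := (fst (input_tape x), int (length x))))" by simp
  show ?case
    by (rule exec.LoopT[OF _ e1 e2])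
      (use Suc.prems i bit_symbol_cases[of "x ! i"] in \<open>auto simp: input_tape_def\<close>)
qed

text \<open>With the head on its last bit the raw input is already a stack, with the last bit on
  top.\<close>

lemma input_tape_stk: "(fst (input_tape x), int (length x) - 1) = stk (map bit_symbol (rev x))"
  by (auto simp: input_tape_def stk_def fun_eq_iff rev_map)

lemma exec_encode_loop:
  assumes "\<sigma> 0 = stk (map bit_symbol (rev u))" "\<sigma> 1 = stack_of v"
    "\<sigma>' = \<sigma>(0 := stk [], 1 := stack_of (u @ v))" "20 * length u + 1 \<le> t"
  shows "exec (Loop 0 {1, 2} (Cond 0 {1} (push 1 1) (push 1 1 ;; push 1 1 ;; push 1 2) ;; push 1 2 ;; pop 0)) \<sigma> t \<sigma>'"
  using assms
proof (induction u arbitrary: v \<sigma> t rule: rev_induct)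
  case Nil
  show ?case by (rule exec_Loop_end) (use Nil in \<open>auto simp: fun_eq_iff\<close>)
next
  case (snoc b u)
  let ?s1 = "\<sigma>(1 := stk (code (tree_of b) @ code (tree_of v)))"
  let ?s2 = "\<sigma>(1 := stack_of (b # v))"
  let ?s3 = "\<sigma>(1 := stack_of (b # v), 0 := stk (map bit_symbol (rev u)))"
  have e1: "exec (Cond 0 {1} (push 1 1) (push 1 1 ;; push 1 1 ;; push 1 2)) \<sigma> 13 ?s1"
  proof (cases b)
    case True
    have f1: "exec (push 1 1) \<sigma> 3 (\<sigma>(1 := stk (1 # code (tree_of v))))"
      by (rule exec_push) (use snoc.prems in auto)
    have f2: "exec (push 1 1) (\<sigma>(1 := stk (1 # code (tree_of v)))) 3 (\<sigma>(1 := stk (1 # 1 # code (tree_of v))))"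
      by (rule exec_push) auto
    have f3: "exec (push 1 2) (\<sigma>(1 := stk (1 # 1 # code (tree_of v)))) 3 ?s1"
      by (rule exec_push) (auto simp: True tree_of_bool_def)
    show ?thesis
      by (rule exec.CondF[OF _ exec_seq[OF f1 exec_seq[OF f2 f3]]])
        (use snoc.prems True in \<open>auto simp: bit_symbol_def\<close>)
  next
    case False
    have f1: "exec (push 1 1) \<sigma> 3 ?s1"
      by (rule exec_push) (use snoc.prems False in \<open>auto simp: tree_of_bool_def\<close>)
    show ?thesis
      by (rule exec.CondT[OF _ f1]) (use snoc.prems False in \<open>auto simp: bit_symbol_def\<close>)
  qed
  have e2: "exec (push 1 2) ?s1 3 ?s2" by (rule exec_push) auto
  have e3: "exec (pop 0) ?s2 1 ?s3" by (rule exec_pop) (use snoc.prems in auto)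
  have e4: "exec (Loop 0 {1, 2} (Cond 0 {1} (push 1 1) (push 1 1 ;; push 1 1 ;; push 1 2) ;; push 1 2 ;; pop 0))
      ?s3 (20 * length u + 1) \<sigma>'"
    by (rule snoc.IH[of _ "b # v"]) (use snoc.prems in \<open>auto simp: fun_eq_iff\<close>)
  show ?case
    by (rule exec.LoopT[OF _ exec_seq[OF e1 exec_seq[OF e2 e3]] e4])
      (use snoc.prems bit_symbol_cases[of b] in auto)
qed

lemma sz_bits: "sz (x :: bool list) \<le> 4 * length x + 1" "length x \<le> sz (x :: bool list)"
proof -
  have "sz x \<le> 4 * length x + 1 \<and> length x \<le> sz x"
  proof (induction x)
    case (Cons b x)
    then show ?case by (cases b) auto
  qed simp
  then show "sz x \<le> 4 * length x + 1" "length x \<le> sz x" by auto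
qed

lemma exec_load_input:
  assumes "\<sigma> 0 = input_tape x" "\<sigma> 1 = stk []" "\<sigma> 2 = stk []"
  shows "exec load_input \<sigma> (100 * length x + 50) (\<sigma>(0 := stack_of x))"
proof -
  let ?s1 = "\<sigma>(0 := (fst (input_tape x), int (length x)))"
  let ?s2 = "\<sigma>(0 := stk (map bit_symbol (rev x)))"
  let ?s3 = "\<sigma>(0 := stk (map bit_symbol (rev x)), 1 := stack_of ([]::bool list))"
  let ?s4 = "\<sigma>(0 := stk [], 1 := stack_of x)"
  let ?s5 = "\<sigma>(0 := stk [], 2 := stk (rev (code (tree_of x))))"
  have e1: "exec (Loop 0 {1, 2} (Mv 0 Rightwards)) \<sigma> (2 * (length x - 0) + 1) ?s1"
    by (rule exec_scan_right) (use assms in \<open>auto simp: input_tape_def\<close>)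
  have e2: "exec (Mv 0 Leftwards) ?s1 1 ?s2"
    by (rule exec_conv[OF exec.Mv]) (auto simp: fun_eq_iff input_tape_stk[symmetric])
  have e3: "exec (push 1 1) ?s2 3 ?s3" by (rule exec_push) (use assms in auto)
  have e4: "exec (Loop 0 {1, 2} (Cond 0 {1} (push 1 1) (push 1 1 ;; push 1 1 ;; push 1 2) ;; push 1 2 ;; pop 0))
      ?s3 (20 * length x + 1) ?s4"
    by (rule exec_encode_loop[where u = x and v = "[]"]) (auto simp: fun_eq_iff)
  have e5: "exec (mv 1 2) ?s4 (8 * sz x + 1) ?s5"
    by (rule exec_mv[where xs = "code (tree_of x)" and ys = "[]"]) (use assms in \<open>auto simp: fun_eq_iff sz_def\<close>)
  have e6: "exec (mv 2 0) ?s5 (8 * sz x + 1) (\<sigma>(0 := stack_of x))"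
    by (rule exec_mv[where xs = "rev (code (tree_of x))" and ys = "[]"])
      (use assms in \<open>auto simp: fun_eq_iff sz_def\<close>)
  show ?thesis unfolding load_input_def
    by (rule exec_mono[OF exec_seq[OF e1 exec_seq[OF e2 exec_seq[OF e3 exec_seq[OF e4 exec_seq[OF e5 e6]]]]]])
      (use sz_bits[of x] in linarith)
qed

definition start_tapes :: "nat \<Rightarrow> bool list \<Rightarrow> tapes" where
  "start_tapes k x = (\<lambda>i. if i = 0 then stack_of x else if i < k then stk [] else blank_tape)"

lemma exec_start:
  assumes "3 \<le> k"
  shows "exec (heads_left (k - 1) ;; load_input) (init_tapes x) (100 * length x + 2 * k + 60) (start_tapes k x)"
proof -
  have e1: "exec (heads_left (k - 1)) (init_tapes x) (2 * (k - 1) + 1)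
      (\<lambda>i. if 0 < i \<and> i \<le> k - 1 then stk [] else init_tapes x i)"
    by (rule exec_heads_left) (auto simp: init_tapes_def blank_tape_def)
  have e2: "exec load_input (\<lambda>i. if 0 < i \<and> i \<le> k - 1 then stk [] else init_tapes x i) (100 * length x + 50)
      ((\<lambda>i. if 0 < i \<and> i \<le> k - 1 then stk [] else init_tapes x i)(0 := stack_of x))"
    by (rule exec_load_input) (use assms in \<open>auto simp: init_tapes_def\<close>)
  show ?thesis
    by (rule exec_conv[OF exec_seq[OF e1 e2]])
      (use assms in \<open>auto simp: fun_eq_iff start_tapes_def init_tapes_def blank_tape_def\<close>)
qed

lemma decider_exists:
  fixes f :: "bool list \<Rightarrow> bool"
  assumes "computes f T"
  shows "\<exists>M C. wf_tm M \<and> (\<forall>x t. T x + C * length x + C \<le> t \<longrightarrow> fst (run M x t) = (if f x then 1 else 2))"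
proof -
  obtain k c where "computes_with k c f T" using assms by (auto simp: computes_def)
  then have c: "computes_with (k + 3) c f T" by (rule computes_with_mono) auto
  let ?k = "k + 3" and ?c = "(heads_left (k + 2) ;; load_input) ;; c"
  have wf: "wf_com ?k ?c"
    using c wf_com_heads_left by (auto simp: computes_with_def load_input_def)
  have "fst (run (tm_of ?k ?c) x t) = (if f x then 1 else 2)"
    if t: "T x + (2 * k + 100) * length x + (2 * k + 100) \<le> t" for x t
  proof -
    have e1: "exec (heads_left (k + 2) ;; load_input) (init_tapes x) (100 * length x + 2 * ?k + 60) (start_tapes ?k x)"
      using exec_start[of ?k x] by simp
    have e2: "exec c (start_tapes ?k x) (T x) ((start_tapes ?k x)(0 := stack_of (f x)))"
      by (rule computes_with_exec[OF c]) (auto simp: start_tapes_def)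
    from run_tm_of[OF wf _ exec_seq[OF e1 e2], of t] show ?thesis
      using t by (auto simp: tree_of_bool_def algebra_simps)
  qed
  then show ?thesis using wf_tm_of[OF wf] by (intro exI[of _ "tm_of ?k ?c"] exI[of _ "2 * k + 100"]) auto
qed

text \<open>The output goes to a tape beyond those shifted by \<open>heads_left\<close>: its head
  still stands at 0, where the output word has to begin. It is the last tape of the machine.\<close>

definition write_output :: "nat \<Rightarrow> com" where
  "write_output k = Loop 0 {2} (pop 0 ;; Cond 0 {1} (pop 0 ;; Wr k 1 Rightwards)
     (pop 0 ;; pop 0 ;; pop 0 ;; Wr k 2 Rightwards))"

definition written_tape :: "bool list \<Rightarrow> tape" where
  "written_tape y = (\<lambda>i. if 0 \<le> i \<and> i < int (length y) then bit_symbol (y ! nat i) else 0, int (length y))"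

lemma act_written_tape: "act (bit_symbol b, Rightwards) (written_tape y) = written_tape (y @ [b])"
  by (auto simp: written_tape_def fun_eq_iff nth_append)

lemma exec_write_output:
  assumes "\<sigma> 0 = stack_of v" "\<sigma> k = written_tape u" "0 < k" "20 * length v + 1 \<le> t"
  shows "exec (write_output k) \<sigma> t (\<sigma>(0 := stk [1], k := written_tape (u @ v)))"
  using assms
proof (induction v arbitrary: u \<sigma> t)
  case Nil
  show ?case unfolding write_output_def
    by (rule exec_Loop_end) (use Nil in \<open>auto simp: fun_eq_iff\<close>)
next
  case (Cons b v)
  let ?s1 = "\<sigma>(0 := stk (code (tree_of b) @ code (tree_of v)))"
  let ?s2 = "\<sigma>(0 := stack_of v)"
  let ?s3 = "\<sigma>(0 := stack_of v, k := written_tape (u @ [b]))"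
  have e1: "exec (pop 0) \<sigma> 1 ?s1" by (rule exec_pop) (use Cons.prems in auto)
  have w: "exec (Wr k (bit_symbol b) Rightwards) ?s2 1 ?s3"
    by (rule exec_conv[OF exec.Wr]) (use Cons.prems in \<open>auto simp: fun_eq_iff act_written_tape simp del: act.simps\<close>)
  have e2: "exec (Cond 0 {1} (pop 0 ;; Wr k 1 Rightwards) (pop 0 ;; pop 0 ;; pop 0 ;; Wr k 2 Rightwards)) ?s1 8 ?s3"
  proof (cases b)
    case True
    have f1: "exec (pop 0) ?s1 1 (\<sigma>(0 := stk (1 # 1 # code (tree_of v))))"
      by (rule exec_pop) (auto simp: True tree_of_bool_def)
    have f2: "exec (pop 0) (\<sigma>(0 := stk (1 # 1 # code (tree_of v)))) 1 (\<sigma>(0 := stk (1 # code (tree_of v))))"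
      by (rule exec_pop) auto
    have f3: "exec (pop 0) (\<sigma>(0 := stk (1 # code (tree_of v)))) 1 ?s2"
      by (rule exec_pop) auto
    have f4: "exec (Wr k 2 Rightwards) ?s2 1 ?s3" using w by (simp add: True bit_symbol_def)
    show ?thesis
      by (rule exec.CondF[OF _ exec_seq[OF f1 exec_seq[OF f2 exec_seq[OF f3 f4]]]])
        (auto simp: True tree_of_bool_def)
  next
    case False
    have f1: "exec (pop 0) ?s1 1 ?s2" by (rule exec_pop) (auto simp: False tree_of_bool_def)
    have f2: "exec (Wr k 1 Rightwards) ?s2 1 ?s3" using w by (simp add: False bit_symbol_def)
    show ?thesis
      by (rule exec.CondT[OF _ exec_seq[OF f1 f2]]) (auto simp: False tree_of_bool_def)
  qed
  have "exec (write_output k) ?s3 (20 * length v + 1) (?s3(0 := stk [1], k := written_tape ((u @ [b]) @ v)))"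
    by (rule Cons.IH) (use Cons.prems in auto)
  then have e3: "exec (write_output k) ?s3 (20 * length v + 1) (\<sigma>(0 := stk [1], k := written_tape (u @ b # v)))"
    by (rule exec_conv) (auto simp: fun_eq_iff)
  show ?case unfolding write_output_def
    by (rule exec.LoopT[OF _ exec_seq[OF e1 e2] e3[unfolded write_output_def]])
      (use Cons.prems in auto)
qed

text \<open>The factor on \<open>T x\<close> pays for writing the output, whose length is bounded
  through \<open>sz_computes\<close> by the argument and the running time.\<close>

lemma transducer_exists:
  fixes f :: "bool list \<Rightarrow> bool list"
  assumes "computes f T"
  shows "\<exists>M C. wf_tm M \<and> (\<forall>x t. C * T x + C * length x + C \<le> t \<longrightarrow> halted (run M x t) \<and>
    tape_output (last (snd (run M x t))) (f x))"
proof -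
  obtain k c where "computes_with k c f T" using assms by (auto simp: computes_def)
  then have c: "computes_with (k + 3) c f T" by (rule computes_with_mono) auto
  let ?k = "k + 3" and ?c = "(heads_left (k + 2) ;; load_input) ;; c ;; write_output (k + 3)"
  have wf: "wf_com (?k + 1) ?c"
    using c wf_com_heads_left
    by (auto simp: computes_with_def load_input_def write_output_def intro: wf_com_mono)
  have "halted (run (tm_of (?k + 1) ?c) x t) \<and> tape_output (last (snd (run (tm_of (?k + 1) ?c) x t))) (f x)"
    if t: "(2 * k + 300) * T x + (2 * k + 300) * length x + (2 * k + 300) \<le> t" for x t
  proof -
    have e1: "exec (heads_left (k + 2) ;; load_input) (init_tapes x) (100 * length x + 2 * ?k + 60) (start_tapes ?k x)"
      using exec_start[of ?k x] by simp
    let ?s = "(start_tapes ?k x)(0 := stack_of (f x))"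
    have e2: "exec c (start_tapes ?k x) (T x) ?s"
      by (rule computes_with_exec[OF c]) (auto simp: start_tapes_def)
    have e3: "exec (write_output ?k) ?s (20 * length (f x) + 1) (?s(0 := stk [1], ?k := written_tape ([] @ f x)))"
      by (rule exec_write_output) (auto simp: start_tapes_def blank_tape_def written_tape_def)
    have "length (f x) \<le> 4 * length x + 1 + T x"
      using sz_bits(2)[of "f x"] sz_bits(1)[of x] sz_computes[OF assms, of x] by linarith
    then have "100 * length x + 2 * ?k + 60 + (T x + (20 * length (f x) + 1) + 1) + 1 < t"
      using t by (auto simp: algebra_simps)
    from run_tm_of[OF wf _ exec_seq[OF e1 exec_seq[OF e2 e3]] this]
    have "run (tm_of (?k + 1) ?c) x t = (if read (stk [1]) = 2 then 1 else 2,
        map (?s(0 := stk [1], ?k := written_tape ([] @ f x))) [0..<?k + 1])" by simp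
    moreover have "last (map g [0..<?k + 1]) = g ?k" for g :: tapes by (simp add: last_map add.commute)
    ultimately have "halted (run (tm_of (?k + 1) ?c) x t)"
      "last (snd (run (tm_of (?k + 1) ?c) x t)) = written_tape (f x)" by simp_all
    then show ?thesis by (simp add: written_tape_def)
  qed
  then show ?thesis using wf_tm_of[OF wf] by (intro exI[of _ "tm_of (?k + 1) ?c"] exI[of _ "2 * k + 300"]) auto
qed


section \<open>Polynomial-time functions\<close>

text \<open>Bounds of the form \<open>(n + 2) ^ d\<close> have a single parameter and are closed under sums,
  products and composition.\<close>

definition poly_bounded :: "('a::encodable \<Rightarrow> nat) \<Rightarrow> bool" where
  "poly_bounded T \<longleftrightarrow> (\<exists>d. \<forall>x. T x \<le> (sz x + 2) ^ d)"

definition ptime :: "('a::encodable \<Rightarrow> 'b::encodable) \<Rightarrow> bool" where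
  "ptime f \<longleftrightarrow> (\<exists>T. computes f T \<and> poly_bounded T)"

named_theorems pb_intros
named_theorems ptime_intros

lemma poly_bounded_mono: "poly_bounded U \<Longrightarrow> (\<And>x. T x \<le> U x) \<Longrightarrow> poly_bounded T"
  unfolding poly_bounded_def by (meson order_trans)

lemma poly_bounded_const [pb_intros]: "poly_bounded (\<lambda>_. c)"
proof -
  have "c \<le> (sz x + 2) ^ c" for x :: 'a
    using less_exp[of c] power_mono[of 2 "sz x + 2" c] by simp
  then show ?thesis unfolding poly_bounded_def by blast
qed

lemma poly_bounded_sz [pb_intros]: "poly_bounded sz"
  unfolding poly_bounded_def by (intro exI[of _ 1]) simp

lemma poly_bounded_add [pb_intros]:
  assumes "poly_bounded T" "poly_bounded U"
  shows "poly_bounded (\<lambda>x. T x + U x)"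
proof -
  obtain d e where d: "\<And>x. T x \<le> (sz x + 2) ^ d" "\<And>x. U x \<le> (sz x + 2) ^ e"
    using assms unfolding poly_bounded_def by blast
  have "T x + U x \<le> (sz x + 2) ^ (d + e + 1)" for x
  proof -
    have "(sz x + 2) ^ d \<le> (sz x + 2) ^ (d + e)" "(sz x + 2) ^ e \<le> (sz x + 2) ^ (d + e)"
      by (auto intro!: power_increasing)
    then have "T x + U x \<le> 2 * (sz x + 2) ^ (d + e)" using d[of x] by linarith
    \<comment> \<open>The base is at least 2, so one additional power absorbs the factor 2.\<close>
    also have "\<dots> \<le> (sz x + 2) * (sz x + 2) ^ (d + e)" by (intro mult_right_mono) auto
    finally show ?thesis by simp
  qed
  then show ?thesis unfolding poly_bounded_def by blast
qed

lemma poly_bounded_mult [pb_intros]: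
  assumes "poly_bounded T" "poly_bounded U"
  shows "poly_bounded (\<lambda>x. T x * U x)"
proof -
  obtain d e where d: "\<And>x. T x \<le> (sz x + 2) ^ d" "\<And>x. U x \<le> (sz x + 2) ^ e"
    using assms unfolding poly_bounded_def by blast
  have "T x * U x \<le> (sz x + 2) ^ (d + e)" for x
    unfolding power_add by (intro mult_mono d) auto
  then show ?thesis unfolding poly_bounded_def by blast
qed

lemma poly_bounded_power [pb_intros]: "poly_bounded T \<Longrightarrow> poly_bounded (\<lambda>x. T x ^ d)"
  by (induction d) (auto intro: poly_bounded_const[of 1, simplified] poly_bounded_mult)

lemma poly_bounded_comp:
  assumes "poly_bounded T" "poly_bounded (\<lambda>x. sz (f x))"
  shows "poly_bounded (\<lambda>x. T (f x))"
proof -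
  obtain d where d: "\<And>x. T x \<le> (sz x + 2) ^ d" using assms(1) unfolding poly_bounded_def by blast
  have "poly_bounded (\<lambda>x. (sz (f x) + 2) ^ d)" by (intro pb_intros assms)
  then show ?thesis by (rule poly_bounded_mono) (rule d)
qed

lemma ptimeI: "computes f T \<Longrightarrow> poly_bounded T \<Longrightarrow> ptime f"
  unfolding ptime_def by blast

lemma ptimeE:
  assumes "ptime f"
  obtains T where "computes f T" "poly_bounded T"
  using assms unfolding ptime_def by blast

lemma poly_bounded_ptime [pb_intros]:
  assumes "ptime f"
  shows "poly_bounded (\<lambda>x. sz (f x))"
proof -
  obtain T where T: "computes f T" "poly_bounded T" using assms by (rule ptimeE)
  have "poly_bounded (\<lambda>x. sz x + T x)" by (intro pb_intros T)
  then show ?thesis by (rule poly_bounded_mono) (rule sz_computes[OF T(1)])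
qed

lemma poly_bounded_nat: "ptime (f :: 'a::encodable \<Rightarrow> nat) \<Longrightarrow> poly_bounded f"
  by (rule poly_bounded_mono[OF poly_bounded_ptime]) auto

section \<open>Closure properties of polynomial time\<close>

lemma ptime_id [ptime_intros]: "ptime (\<lambda>x. x)"
  by (rule ptimeI[OF computes_id]) (intro pb_intros)

lemma ptime_const [ptime_intros]: "ptime (\<lambda>_. c)"
  by (rule ptimeI[OF computes_const]) (intro pb_intros)

lemma ptime_comp:
  assumes "ptime g" "ptime f"
  shows "ptime (\<lambda>x. g (f x))"
proof -
  obtain T U where T: "computes f T" "poly_bounded T" and U: "computes g U" "poly_bounded U"
    using assms by (auto elim!: ptimeE)
  show ?thesis
    by (rule ptimeI[OF computes_compose[OF T(1) U(1)]])
      (intro pb_intros T poly_bounded_comp[OF U(2)] assms)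
qed

lemma ptime_coerce: "(\<And>x. tree_of (f x) = tree_of x) \<Longrightarrow> ptime f"
  by (rule ptimeI[OF computes_coerce]) (auto intro: pb_intros)

lemma ptime_Pair [ptime_intros]:
  assumes "ptime f" "ptime g"
  shows "ptime (\<lambda>x. (f x, g x))"
proof -
  obtain T U where T: "computes f T" "poly_bounded T" and U: "computes g U" "poly_bounded U"
    using assms by (auto elim!: ptimeE)
  show ?thesis
    by (rule ptimeI[OF computes_pair[OF T(1) U(1)]]) (intro pb_intros T U assms)
qed

lemma ptime_fst [ptime_intros]: "ptime f \<Longrightarrow> ptime (\<lambda>x. fst (f x))"
  by (rule ptime_comp[OF ptimeI[OF computes_fst]]) (intro pb_intros)

lemma ptime_snd [ptime_intros]: "ptime f \<Longrightarrow> ptime (\<lambda>x. snd (f x))"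
  by (rule ptime_comp[OF ptimeI[OF computes_snd]]) (intro pb_intros)

lemma ptime_eq [ptime_intros]: "ptime f \<Longrightarrow> ptime g \<Longrightarrow> ptime (\<lambda>x. f x = g x)"
  using ptime_comp[OF ptimeI[OF computes_eq poly_bounded_mult[OF poly_bounded_const poly_bounded_sz]] ptime_Pair[of f g]]
  by simp

lemma ptime_sz [ptime_intros]: "ptime f \<Longrightarrow> ptime (\<lambda>x. sz (f x))"
  by (rule ptime_comp[OF ptimeI[OF computes_sz]]) (intro pb_intros)

lemma ptime_case:
  fixes h :: "'a::encodable \<Rightarrow> 'c::encodable" and m :: "'a \<Rightarrow> 'd::encodable" and r :: "'a \<Rightarrow> 'b::encodable"
  assumes h: "ptime h" and f: "ptime f" and g: "ptime g"
    and leaf: "\<And>x. tree_of (h x) = Leaf \<Longrightarrow> r x = f x"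
    and node: "\<And>x. tree_of (h x) \<noteq> Leaf \<Longrightarrow> tree_of (m x) = tree_of (h x) \<and> r x = g (m x, x)"
  shows "ptime r"
proof -
  obtain T U V where T: "computes h T" "poly_bounded T" and U: "computes f U" "poly_bounded U"
      and V: "computes g V" "poly_bounded V"
    using h f g by (auto elim!: ptimeE)
  obtain d where d: "\<And>x. V x \<le> (sz x + 2) ^ d" using V(2) unfolding poly_bounded_def by blast
  let ?W = "\<lambda>x. U x + (Suc (sz (h x) + sz x) + 2) ^ d"
  have "computes r (\<lambda>x. T x + ?W x + 40 * sz x + 40 * sz (h x) + 60)"
  proof (rule computes_case[OF T(1) U(1) V(1), where m = m])
    fix x assume "tree_of (h x) \<noteq> Leaf"
    from node[OF this] have "tree_of (m x) = tree_of (h x)" "r x = g (m x, x)" by auto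
    \<comment> \<open>Equal trees have equal sizes, so the bound for the node branch can be stated
      in terms of \<open>h x\<close> alone.\<close>
    moreover from this(1) have "sz (m x) = sz (h x)" by (simp only: sz_def)
    ultimately show "tree_of (m x) = tree_of (h x) \<and> r x = g (m x, x) \<and> V (m x, x) \<le> ?W x"
      using d[of "(m x, x)"] by simp
  qed (use leaf in auto)
  moreover have "poly_bounded (\<lambda>x. T x + ?W x + 40 * sz x + 40 * sz (h x) + 60)"
    unfolding add_Suc_right[symmetric] Suc_eq_plus1 by (intro pb_intros T U h)
  ultimately show ?thesis by (rule ptimeI)
qed

text \<open>\<open>True\<close> has the same tree as the pair \<open>((), ())\<close>, so a
  conditional is a case distinction on a tree.\<close>

lemma ptime_if [ptime_intros]:
  assumes "ptime b" "ptime f" "ptime g"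
  shows "ptime (\<lambda>x. if b x then f x else g x)"
  by (rule ptime_case[OF assms(1,3) ptime_comp[OF assms(2) ptime_snd[OF ptime_id]], where m = "\<lambda>_. ((), ())"])
    (auto simp: tree_of_bool_def tree_of_prod_def tree_of_unit_def split: if_splits)

lemma ptime_Not [ptime_intros]: "ptime b \<Longrightarrow> ptime (\<lambda>x. \<not> b x)"
  using ptime_if[OF _ ptime_const ptime_const, of b False True]
  by (simp only: if_bool_eq_conj simp_thms)

lemma ptime_conj [ptime_intros]: "ptime b \<Longrightarrow> ptime c \<Longrightarrow> ptime (\<lambda>x. b x \<and> c x)"
  using ptime_if[OF _ _ ptime_const, of b c False] by (simp add: if_bool_eq_conj conj_commute cong: conj_cong)

lemma ptime_disj [ptime_intros]: "ptime b \<Longrightarrow> ptime c \<Longrightarrow> ptime (\<lambda>x. b x \<or> c x)"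
  using ptime_Not[OF ptime_conj[OF ptime_Not[of b] ptime_Not[of c]]] by simp

lemma ptime_imp [ptime_intros]: "ptime b \<Longrightarrow> ptime c \<Longrightarrow> ptime (\<lambda>x. b x \<longrightarrow> c x)"
  unfolding imp_conv_disj by (intro ptime_disj ptime_Not)

lemma ptime_Let [ptime_intros]:
  assumes "ptime f" "ptime (\<lambda>p. g (fst p) (snd p))"
  shows "ptime (\<lambda>x. let v = f x in g x v)"
  using ptime_comp[OF assms(2) ptime_Pair[OF ptime_id assms(1)]] by simp

lemma ptime_Cons [ptime_intros]: "ptime f \<Longrightarrow> ptime g \<Longrightarrow> ptime (\<lambda>x. f x # g x)"
  using ptime_comp[OF ptime_coerce[of "\<lambda>p. fst p # snd p"] ptime_Pair[of f g]]
  by (simp add: tree_of_prod_def)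

lemma ptime_Suc [ptime_intros]: "ptime f \<Longrightarrow> ptime (\<lambda>x. Suc (f x))"
  using ptime_comp[OF ptime_coerce[of "\<lambda>p. Suc (snd p)"] ptime_Pair[OF ptime_const[of "()"], of f]]
  by (simp add: tree_of_prod_def tree_of_unit_def)

lemma tree_of_eq_Leaf [simp]: "tree_of (n::nat) = Leaf \<longleftrightarrow> n = 0" "tree_of (xs::'a::encodable list) = Leaf \<longleftrightarrow> xs = []"
  by (cases n; simp) (cases xs; simp)

lemma ptime_case_list [ptime_intros]:
  assumes "ptime xs" "ptime f" "ptime (\<lambda>p. g (fst p) (fst (snd p)) (snd (snd p)))"
  shows "ptime (\<lambda>e. case xs e of [] \<Rightarrow> f e | y # ys \<Rightarrow> g e y ys)"
proof (rule ptime_case[OF assms(1,2), where m = "\<lambda>e. (hd (xs e), tl (xs e))"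
      and g = "\<lambda>q. g (snd q) (fst (fst q)) (snd (fst q))"])
  have "ptime (\<lambda>q. (snd q, fst q))" by (intro ptime_intros)
  from ptime_comp[OF assms(3) this] show "ptime (\<lambda>q. g (snd q) (fst (fst q)) (snd (fst q)))" by simp
qed (auto simp: tree_of_prod_def split: list.split)

lemma ptime_case_nat [ptime_intros]:
  assumes "ptime n" "ptime f" "ptime (\<lambda>p. g (fst p) (snd p))"
  shows "ptime (\<lambda>e. case n e of 0 \<Rightarrow> f e | Suc i \<Rightarrow> g e i)"
proof (rule ptime_case[OF assms(1,2), where m = "\<lambda>e. ((), n e - 1)"
      and g = "\<lambda>q. g (snd q) (snd (fst q))"])
  have "ptime (\<lambda>q. (snd q, snd (fst q)))" by (intro ptime_intros)
  from ptime_comp[OF assms(3) this] show "ptime (\<lambda>q. g (snd q) (snd (fst q)))" by simp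
qed (auto simp: tree_of_prod_def tree_of_unit_def gr0_conv_Suc split: nat.split)

subsection \<open>Bounded iteration\<close>

text \<open>The environment \<open>e\<close> is carried along in the state, because iteration is
  available only for a function of the state. The size bound \<open>B\<close> stays explicit, so
  that both polynomial and exponential bounds can be inserted.\<close>

lemma computes_funpow_env:
  fixes f :: "'a::encodable \<Rightarrow> 'b::encodable \<Rightarrow> 'b"
  assumes n: "ptime n" and s: "ptime s" and f: "ptime (\<lambda>p. f (fst p) (snd p))"
    and B: "\<And>e i. i \<le> n e \<Longrightarrow> sz ((f e ^^ i) (s e)) \<le> B e"
  shows "\<exists>U d. poly_bounded U \<and> computes (\<lambda>e. (f e ^^ n e) (s e)) (\<lambda>e. U e + U e * (sz e + B e + 3) ^ d)"
proof -
  let ?f = "\<lambda>p :: 'a \<times> 'b. (fst p, f (fst p) (snd p))"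
  have "ptime ?f" by (intro ptime_intros f)
  then obtain T where T: "computes ?f T" "poly_bounded T" by (rule ptimeE)
  then obtain d where d: "\<And>x. T x \<le> (sz x + 2) ^ d" unfolding poly_bounded_def by blast
  let ?a = "\<lambda>e. (n e, (e, s e))"
  have "ptime ?a" by (intro ptime_intros n s)
  then obtain U where U: "computes ?a U" "poly_bounded U" by (rule ptimeE)
  have iter: "(?f ^^ i) (e, x) = (e, (f e ^^ i) x)" for i e x by (induction i) auto
  let ?U = "\<lambda>e. U e + 20 * n e + 60" and ?X = "\<lambda>e. sz e + B e + 3"
  have "computes (\<lambda>e. snd ((?f ^^ fst (?a e)) (snd (?a e)))) (\<lambda>e. ?U e + ?U e * ?X e ^ (d + 1))"
  proof (rule computes_mono[OF computes_compose[OF computes_compose[OF U(1) computes_funpow[OF T(1)]] computes_snd]])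
    fix e
    have "(\<Sum>i<n e. T ((?f ^^ i) (e, s e))) \<le> (\<Sum>i<n e. ?X e ^ d)"
    proof (rule sum_mono)
      fix i assume "i \<in> {..<n e}"
      then have "sz ((?f ^^ i) (e, s e)) + 2 \<le> ?X e" using B[of i e] by (simp add: iter)
      then show "T ((?f ^^ i) (e, s e)) \<le> ?X e ^ d"
        by (rule order_trans[OF d power_mono]) simp
    qed
    also have "\<dots> \<le> n e * ?X e ^ (d + 1)" by simp
    finally have 1: "(\<Sum>i<n e. T ((?f ^^ i) (e, s e))) \<le> n e * ?X e ^ (d + 1)" .
    have "?X e \<le> ?X e ^ (d + 1)" using power_increasing[of 1 "d + 1" "?X e"] by simp
    moreover have "sz ((?f ^^ n e) (e, s e)) \<le> ?X e" using B[of "n e" e] by (simp add: iter)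
    ultimately have "sz ((?f ^^ n e) (e, s e)) \<le> ?X e ^ (d + 1)" by linarith
    with 1 show "U e + ((\<Sum>i<fst (?a e). T ((?f ^^ i) (snd (?a e)))) + 20 * fst (?a e) + 20) + 1 +
        30 * sz ((?f ^^ fst (?a e)) (snd (?a e))) + 1 \<le> ?U e + ?U e * ?X e ^ (d + 1)"
      by (simp add: algebra_simps)
  qed
  then have "computes (\<lambda>e. (f e ^^ n e) (s e)) (\<lambda>e. ?U e + ?U e * ?X e ^ (d + 1))" by (simp add: iter)
  moreover have "poly_bounded ?U" by (intro pb_intros U poly_bounded_nat[OF n])
  ultimately show ?thesis by blast
qed

text \<open>The hypothesis on \<open>B\<close> is essential: repeated squaring of the size is an
  iteration of a polynomial-time step with values of doubly exponential size.\<close>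

lemma ptime_funpow:
  fixes f :: "'a::encodable \<Rightarrow> 'b::encodable \<Rightarrow> 'b"
  assumes "ptime n" "ptime s" "ptime (\<lambda>p. f (fst p) (snd p))"
    and B: "poly_bounded B" "\<And>e i. i \<le> n e \<Longrightarrow> sz ((f e ^^ i) (s e)) \<le> B e"
  shows "ptime (\<lambda>e. (f e ^^ n e) (s e))"
proof -
  obtain U d where U: "poly_bounded U" "computes (\<lambda>e. (f e ^^ n e) (s e)) (\<lambda>e. U e + U e * (sz e + B e + 3) ^ d)"
    using computes_funpow_env[OF assms(1-3) B(2)] by blast
  show ?thesis by (rule ptimeI[OF U(2)]) (intro pb_intros U(1) B(1))
qed

lemma length_le_sz: "length xs \<le> sz xs"
  by (induction xs) auto

lemma sz_le_sz_list: "a \<in> set xs \<Longrightarrow> sz a \<le> sz xs"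
  by (induction xs) auto

text \<open>A fold is an iteration on the pair of the remaining list and the accumulator. It runs
  for \<open>sz\<close> many rounds, which is at least the length; the surplus rounds idle on the
  empty list.\<close>

lemma ptime_foldl_bounded:
  fixes f :: "'a::encodable \<Rightarrow> 'b::encodable \<Rightarrow> 'c::encodable \<Rightarrow> 'b"
  assumes xs: "ptime xs" and s: "ptime s"
    and f: "ptime (\<lambda>p. f (fst p) (fst (snd p)) (snd (snd p)))"
    and B: "poly_bounded B" "\<And>e i. i \<le> length (xs e) \<Longrightarrow> sz (foldl (f e) (s e) (take i (xs e))) \<le> B e"
  shows "ptime (\<lambda>e. foldl (f e) (s e) (xs e))"
proof -
  let ?g = "\<lambda>e (st :: 'c list \<times> 'b). case fst st of [] \<Rightarrow> st | y # ys \<Rightarrow> (ys, f e (snd st) y)"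
  have iter: "(?g e ^^ i) (ys, x) = (drop i ys, foldl (f e) x (take i ys))" for e i ys x
  proof (induction i arbitrary: ys x)
    case (Suc i)
    show ?case
    proof (cases ys)
      case Nil
      then show ?thesis using Suc.IH[of "[]"] by (simp add: funpow_Suc_right del: funpow.simps)
    next
      case (Cons y ys')
      then show ?thesis using Suc.IH by (simp add: funpow_Suc_right del: funpow.simps)
    qed
  qed simp
  have "sz (drop i ys) \<le> sz ys" for i and ys :: "'c list"
    by (induction ys arbitrary: i) (auto simp: drop_Cons split: nat.split intro: le_SucI trans_le_add2)
  then have bound: "sz ((?g e ^^ i) (xs e, s e)) \<le> Suc (sz (xs e) + B e)" for e i
  proof -
    have "take i (xs e) = take (min i (length (xs e))) (xs e)" by (simp add: min_def)
    then have "sz (foldl (f e) (s e) (take i (xs e))) \<le> B e" using B(2)[of "min i (length (xs e))" e] by simp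
    moreover have "sz (drop i (xs e)) \<le> sz (xs e)" by fact
    ultimately show ?thesis unfolding iter by simp
  qed
  have pf: "ptime (\<lambda>p. f (fst (fst p)) (snd (snd (fst p))) (fst (snd p)))"
    using ptime_comp[OF f, of "\<lambda>p. (fst (fst p), snd (snd (fst p)), fst (snd p))"]
    by (simp add: ptime_intros)
  have "ptime (\<lambda>e. (?g e ^^ sz (xs e)) (xs e, s e))"
  proof (rule ptime_funpow)
    show "ptime (\<lambda>p. ?g (fst p) (snd p))"
      by (intro ptime_intros) (use pf in simp)
    show "poly_bounded (\<lambda>e. sz (xs e) + B e + 1)" by (intro pb_intros xs B)
  qed (use bound xs s in \<open>auto intro: ptime_intros\<close>)
  from ptime_snd[OF this] show ?thesis
    by (simp add: iter length_le_sz)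
qed

text \<open>The increment \<open>B (e, a)\<close> does not depend on the accumulator. Growth is
  therefore additive over the list and cannot compound.\<close>

lemma ptime_foldl [ptime_intros]:
  fixes f :: "'a::encodable \<Rightarrow> 'b::encodable \<Rightarrow> 'c::encodable \<Rightarrow> 'b"
  assumes xs: "ptime xs" and s: "ptime s"
    and f: "ptime (\<lambda>p. f (fst p) (fst (snd p)) (snd (snd p)))"
    and B: "poly_bounded B" "\<And>e x a. a \<in> set (xs e) \<Longrightarrow> sz (f e x a) \<le> sz x + B (e, a)"
  shows "ptime (\<lambda>e. foldl (f e) (s e) (xs e))"
proof -
  obtain d where d: "\<And>x. B x \<le> (sz x + 2) ^ d" using B(1) unfolding poly_bounded_def by blast
  let ?B = "\<lambda>e. sz (s e) + sz (xs e) * (sz e + sz (xs e) + 3) ^ d"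
  show ?thesis
  proof (rule ptime_foldl_bounded[OF xs s f])
  show "poly_bounded ?B" by (intro pb_intros s xs)
  fix e and i assume i: "i \<le> length (xs e)"
  have "sz (foldl (f e) x ys) \<le> sz x + length ys * (sz e + sz (xs e) + 3) ^ d" if "set ys \<subseteq> set (xs e)" for x ys
    using that
  proof (induction ys arbitrary: x)
    case (Cons a ys)
    have "sz (e, a) + 2 \<le> sz e + sz (xs e) + 3" using sz_le_sz_list[of a "xs e"] Cons.prems by simp
    then have "B (e, a) \<le> (sz e + sz (xs e) + 3) ^ d" by (rule order_trans[OF d power_mono]) simp
    then show ?case using Cons.IH[of "f e x a"] B(2)[of a e x] Cons.prems by auto
  qed simp
  from this[of "take i (xs e)" "s e", OF set_take_subset] i
  have "sz (foldl (f e) (s e) (take i (xs e))) \<le> sz (s e) + i * (sz e + sz (xs e) + 3) ^ d"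
    by (simp add: min_absorb2)
  also have "\<dots> \<le> ?B e" using i length_le_sz[of "xs e"] by (intro add_mono mult_mono) auto
  finally show "sz (foldl (f e) (s e) (take i (xs e))) \<le> ?B e" .
  qed
qed

subsection \<open>Lists and numbers\<close>

lemma ptime_rev [ptime_intros]:
  assumes "ptime xs" shows "ptime (\<lambda>e. rev (xs e))"
proof -
  have "foldl (\<lambda>s a. a # s) zs ys = rev ys @ zs" for ys zs :: "'b list" by (induction ys arbitrary: zs) auto
  moreover have "ptime (\<lambda>e. foldl (\<lambda>s a. a # s) [] (xs e))"
    by (rule ptime_foldl[where B = "\<lambda>p. sz p + 1"]) (intro ptime_intros pb_intros assms | simp)+
  ultimately show ?thesis by simp
qed

lemma ptime_append [ptime_intros]:
  assumes "ptime xs" "ptime ys" shows "ptime (\<lambda>e. xs e @ ys e)"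
proof -
  have "foldl (\<lambda>s a. a # s) zs ys = rev ys @ zs" for ys zs :: "'b list" by (induction ys arbitrary: zs) auto
  moreover have "ptime (\<lambda>e. foldl (\<lambda>s a. a # s) (ys e) (rev (xs e)))"
    by (rule ptime_foldl[where B = "\<lambda>p. sz p + 1"]) (intro ptime_intros pb_intros assms | simp)+
  ultimately show ?thesis by simp
qed

lemma ptime_map [ptime_intros]:
  fixes g :: "'a::encodable \<Rightarrow> 'b::encodable \<Rightarrow> 'c::encodable"
  assumes "ptime xs" "ptime (\<lambda>p. g (fst p) (snd p))"
  shows "ptime (\<lambda>e. map (g e) (xs e))"
proof -
  have "foldl (\<lambda>s a. h a # s) zs ys = rev (map h ys) @ zs" for h :: "'b \<Rightarrow> 'c" and ys zs
    by (induction ys arbitrary: zs) auto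
  moreover have "ptime (\<lambda>e. rev (foldl (\<lambda>s a. g e a # s) [] (xs e)))"
  proof (rule ptime_rev, rule ptime_foldl[where B = "\<lambda>p. sz (g (fst p) (snd p)) + 1"])
    have "ptime (\<lambda>p. g (fst p) (snd (snd p)))"
      using ptime_comp[OF assms(2), of "\<lambda>p. (fst p, snd (snd p))"] by (simp add: ptime_intros)
    then show "ptime (\<lambda>p. g (fst p) (snd (snd p)) # fst (snd p))" by (intro ptime_intros)
  qed (intro ptime_intros pb_intros assms | simp)+
  ultimately show ?thesis by simp
qed

lemma sz_append: "sz (xs @ ys) + 1 = sz xs + sz ys"
  by (induction xs) auto

lemma ptime_concat [ptime_intros]:
  assumes "ptime xs" shows "ptime (\<lambda>e. concat (xs e))"
proof -
  have "foldl (\<lambda>s a. s @ a) zs ys = zs @ concat ys" for ys and zs :: "'b list" by (induction ys arbitrary: zs) auto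
  moreover have "ptime (\<lambda>e. foldl (\<lambda>s a. s @ a) [] (xs e))"
  proof (rule ptime_foldl[where B = "\<lambda>p. sz p"])
    fix x a :: "'b list" and e :: 'a
    show "sz (x @ a) \<le> sz x + sz (e, a)" using sz_append[of x a] by simp
  qed (intro ptime_intros pb_intros assms)+
  ultimately show ?thesis by simp
qed

lemma ptime_filter [ptime_intros]:
  assumes "ptime xs" "ptime (\<lambda>p. P (fst p) (snd p))"
  shows "ptime (\<lambda>e. filter (P e) (xs e))"
proof -
  have "filter Q ys = concat (map (\<lambda>a. if Q a then [a] else []) ys)" for Q and ys :: "'b list"
    by (induction ys) auto
  moreover have "ptime (\<lambda>e. concat (map (\<lambda>a. if P e a then [a] else []) (xs e)))"
    by (intro ptime_intros assms)
  ultimately show ?thesis by simp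
qed

lemma ptime_Ball [ptime_intros]:
  assumes "ptime xs" "ptime (\<lambda>p. P (fst p) (snd p))"
  shows "ptime (\<lambda>e. \<forall>a\<in>set (xs e). P e a)"
proof -
  have eq: "(\<forall>a\<in>set ys. Q a) \<longleftrightarrow> filter (\<lambda>a. \<not> Q a) ys = []" for Q and ys :: "'b list"
    by (auto simp: filter_empty_conv)
  show ?thesis unfolding eq by (intro ptime_intros assms)
qed

lemma ptime_Bex [ptime_intros]:
  assumes "ptime xs" "ptime (\<lambda>p. P (fst p) (snd p))"
  shows "ptime (\<lambda>e. \<exists>a\<in>set (xs e). P e a)"
  using ptime_Not[OF ptime_Ball[OF assms(1) ptime_Not[OF assms(2)]]] by simp

lemma ptime_member [ptime_intros]:
  assumes "ptime f" "ptime xs"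
  shows "ptime (\<lambda>e. f e \<in> set (xs e))"
proof -
  have "ptime (\<lambda>e. \<exists>a\<in>set (xs e). a = f e)"
    by (intro ptime_intros assms ptime_comp[OF assms(1)])
  then show ?thesis by simp
qed

lemma ptime_length [ptime_intros]:
  assumes "ptime xs" shows "ptime (\<lambda>e. length (xs e))"
proof -
  have "foldl (\<lambda>s a. Suc s) n ys = n + length ys" for n and ys :: "'b list" by (induction ys arbitrary: n) auto
  moreover have "ptime (\<lambda>e. foldl (\<lambda>s a. Suc s) 0 (xs e))"
    by (rule ptime_foldl[where B = "\<lambda>p. 2"]) (intro ptime_intros pb_intros assms | simp)+
  ultimately show ?thesis by simp
qed

lemma ptime_add [ptime_intros]:
  fixes m n :: "'a::encodable \<Rightarrow> nat"
  assumes "ptime m" "ptime n" shows "ptime (\<lambda>e. m e + n e)"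
proof -
  have "(Suc ^^ i) j = i + j" for i j by (induction i) auto
  moreover have "ptime (\<lambda>e. (Suc ^^ m e) (n e))"
    by (rule ptime_funpow[where B = "\<lambda>e. 2 * (m e + n e) + 1"])
      (intro ptime_intros pb_intros poly_bounded_nat assms | simp add: calculation)+
  ultimately show ?thesis by simp
qed

lemma ptime_mult [ptime_intros]:
  fixes m n :: "'a::encodable \<Rightarrow> nat"
  assumes "ptime m" "ptime n" shows "ptime (\<lambda>e. m e * n e)"
proof -
  have iter: "((\<lambda>s. s + k) ^^ i) 0 = i * k" for i k :: nat by (induction i) auto
  have "ptime (\<lambda>e. ((\<lambda>s. s + n e) ^^ m e) 0)"
  proof (rule ptime_funpow[where B = "\<lambda>e. 2 * (m e * n e) + 1"])
    show "ptime (\<lambda>p. snd p + n (fst p))" by (intro ptime_intros ptime_comp[OF assms(2)])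
  qed (intro ptime_intros pb_intros poly_bounded_nat assms | simp add: iter)+
  then show ?thesis by (simp add: iter)
qed

lemma ptime_power [ptime_intros]: "ptime m \<Longrightarrow> ptime (\<lambda>e. m e ^ k :: nat)"
  by (induction k) (auto intro!: ptime_intros)

lemma ptime_diff [ptime_intros]:
  fixes m n :: "'a::encodable \<Rightarrow> nat"
  assumes "ptime m" "ptime n" shows "ptime (\<lambda>e. m e - n e)"
proof -
  have iter: "((\<lambda>s. case s of 0 \<Rightarrow> 0 | Suc i \<Rightarrow> i) ^^ i) k = k - i" for i k :: nat
    by (induction i) (auto split: nat.split)
  have "ptime (\<lambda>e. ((\<lambda>s. case s of 0 \<Rightarrow> 0 | Suc i \<Rightarrow> i) ^^ n e) (m e))"
    by (rule ptime_funpow[where B = "\<lambda>e. 2 * m e + 1"])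
      (intro ptime_intros pb_intros poly_bounded_nat assms | simp add: iter)+
  then show ?thesis by (simp add: iter)
qed

lemma ptime_le [ptime_intros]:
  fixes m n :: "'a::encodable \<Rightarrow> nat"
  assumes "ptime m" "ptime n" shows "ptime (\<lambda>e. m e \<le> n e)"
proof -
  have "ptime (\<lambda>e. m e - n e = 0)" by (intro ptime_intros assms)
  then show ?thesis by simp
qed

lemma ptime_upt0:
  assumes "ptime n" shows "ptime (\<lambda>e. [0..<n e])"
proof -
  have iter: "((\<lambda>s. s @ [length s]) ^^ i) [] = [0..<i]" for i by (induction i) auto
  have size: "sz [0..<i] \<le> 2 * i * i + 2 * i + 1" for i
  proof (induction i)
    case (Suc i)
    then show ?case using sz_append[of "[0..<i]" "[i]"] by simp
  qed simp
  have "ptime (\<lambda>e. ((\<lambda>s. s @ [length s]) ^^ n e) [])"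
  proof (rule ptime_funpow[where B = "\<lambda>e. 2 * n e * n e + 2 * n e + 1"])
    fix e i assume "i \<le> n e"
    then have "2 * i * i + 2 * i + 1 \<le> 2 * n e * n e + 2 * n e + 1"
      by (intro add_mono mult_mono) auto
    then show "sz (((\<lambda>s. s @ [length s]) ^^ i) []) \<le> 2 * n e * n e + 2 * n e + 1"
      using size[of i] by (simp add: iter)
  qed (intro ptime_intros pb_intros poly_bounded_nat assms)+
  then show ?thesis by (simp add: iter)
qed

lemma ptime_upt [ptime_intros]:
  assumes "ptime m" "ptime n" shows "ptime (\<lambda>e. [m e..<n e])"
proof -
  have eq: "[i..<j] = map (\<lambda>k. k + i) [0..<j - i]" for i j by (auto intro: nth_equalityI)
  have "ptime (\<lambda>e. map (\<lambda>k. k + m e) [0..<n e - m e])"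
    by (intro ptime_intros ptime_upt0 assms ptime_comp[OF assms(1)])
  then show ?thesis by (simp only: eq[symmetric])
qed

lemma ptime_replicate [ptime_intros]:
  assumes "ptime n" "ptime f" shows "ptime (\<lambda>e. replicate (n e) (f e))"
proof -
  have "replicate k a = map (\<lambda>_. a) [0..<k]" for k and a :: 'b by (simp add: map_replicate_const)
  moreover have "ptime (\<lambda>e. map (\<lambda>_. f e) [0..<n e])"
    by (intro ptime_intros assms ptime_comp[OF assms(2)])
  ultimately show ?thesis by simp
qed

lemma ptime_zip [ptime_intros]:
  fixes xs :: "'a::encodable \<Rightarrow> 'b::encodable list" and ys :: "'a \<Rightarrow> 'c::encodable list"
  assumes "ptime xs" "ptime ys" shows "ptime (\<lambda>e. zip (xs e) (ys e))"
proof -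
  let ?f = "\<lambda>(st :: 'c list \<times> ('b \<times> 'c) list) (x :: 'b). case fst st of [] \<Rightarrow> st | y # ys \<Rightarrow> (ys, (x, y) # snd st)"
  have fold: "rev (snd (foldl ?f (ys, zs) xs)) = rev zs @ zip xs ys" for xs :: "'b list" and ys :: "'c list" and zs
  proof (induction xs arbitrary: ys zs)
    case (Cons x xs)
    then show ?case by (cases ys) auto
  qed simp
  have "ptime (\<lambda>e. rev (snd (foldl ?f (ys e, []) (xs e))))"
  proof (rule ptime_rev, rule ptime_snd, rule ptime_foldl[where B = "\<lambda>p. sz p + 5"])
    fix e :: 'a and st and x :: 'b
    show "sz (?f st x) \<le> sz st + (sz (e, x) + 5)" by (cases st) (auto split: list.split)
  qed (intro ptime_intros pb_intros assms)+
  then show ?thesis by (simp add: fold)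
qed

text \<open>The value \<open>hd []\<close> is unspecified but fixed, hence a constant function in
  the empty case.\<close>

lemma ptime_hd [ptime_intros]:
  assumes "ptime xs" shows "ptime (\<lambda>e. hd (xs e))"
proof -
  have "hd ys = (case ys of [] \<Rightarrow> hd [] | y # _ \<Rightarrow> y)" for ys :: "'b list" by (cases ys) auto
  moreover have "ptime (\<lambda>e. case xs e of [] \<Rightarrow> hd [] | y # _ \<Rightarrow> y)" by (intro ptime_intros assms)
  ultimately show ?thesis by (metis (no_types, lifting) ext)
qed

lemma ptime_tl [ptime_intros]:
  assumes "ptime xs" shows "ptime (\<lambda>e. tl (xs e))"
  unfolding tl_def by (intro ptime_intros assms)


section \<open>Complexity classes\<close>

text \<open>Translates a bound in the tree size into the shape \<open>c * n ^ k + c\<close> used by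
  the complexity classes. The empty word needs its own case, since there \<open>n ^ k\<close> may
  vanish.\<close>

lemma poly_bound_in_length:
  fixes T :: "bool list \<Rightarrow> nat"
  assumes "poly_bounded T"
  shows "\<exists>c k. \<forall>x. C * T x + C * length x + C \<le> c * length x ^ k + c"
proof -
  obtain d where d: "\<And>x. T x \<le> (sz x + 2) ^ d" using assms unfolding poly_bounded_def by blast
  \<comment> \<open>For nonempty words the base of the bound is at most \<open>4 * n + 3\<close>
    \<le> \<open>7 * n\<close>. The exponent is \<open>d + 1\<close> rather than \<open>d\<close>,
    so that \<open>n\<close> itself is dominated even if \<open>d\<close> is 0.\<close>
  let ?c = "C * 7 ^ d + 2 * C"
  have "C * T x + C * length x + C \<le> ?c * length x ^ (d + 1) + ?c" for x
  proof (cases "length x = 0")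
    case True
    have "T x \<le> 3 ^ d" using d[of x] True by (simp add: numeral_3_eq_3)
    also have "\<dots> \<le> 7 ^ d" by (rule power_mono) auto
    finally have "C * T x \<le> C * 7 ^ d" by (rule mult_le_mono2)
    moreover have "C * length x = 0" using True by simp
    ultimately show ?thesis by linarith
  next
    case False
    define n N where "n = length x" and "N = n ^ (d + 1)"
    have n: "1 \<le> n" using False unfolding n_def by linarith
    have "T x \<le> (7 * n) ^ d"
      by (rule order_trans[OF d power_mono]) (use sz_bits(1)[of x] n n_def in linarith, simp)
    also have "\<dots> \<le> 7 ^ d * N"
      unfolding power_mult_distrib N_def by (intro mult_le_mono2 power_increasing n) simp
    finally have 1: "C * T x \<le> C * (7 ^ d * N)" by (rule mult_le_mono2)
    have "n \<le> N" using power_increasing[OF _ n, of 1 "d + 1"] by (simp add: N_def)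
    then have 2: "C * n \<le> C * N" by (rule mult_le_mono2)
    have 3: "C \<le> C * N" using n by (simp add: N_def)
    have "?c * N = C * (7 ^ d * N) + C * N + C * N" by (simp add: algebra_simps)
    then show ?thesis using 1 2 3 unfolding n_def[symmetric] N_def[symmetric] by linarith
  qed
  then show ?thesis by blast
qed

lemma ptime_class_P:
  assumes "ptime f"
  shows "{x. f x} \<in> class_P"
proof -
  obtain T where T: "computes f T" "poly_bounded T" using assms by (rule ptimeE)
  obtain M C where M: "wf_tm M"
    "\<And>x t. T x + C * length x + C \<le> t \<Longrightarrow> fst (run M x t) = (if f x then 1 else 2)"
    using decider_exists[OF T(1)] by blast
  obtain c k where c: "\<And>x. Suc C * T x + Suc C * length x + Suc C \<le> c * length x ^ k + c"
    using poly_bound_in_length[OF T(2)] by blast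
  have "decides_in_time M {x. f x} (\<lambda>n. c * n ^ k + c)"
    unfolding decides_in_time_def
  proof (intro allI)
    fix x
    have "T x + C * length x + C \<le> c * length x ^ k + c" using c[of x] by simp
    then show "fst (run M x (c * length x ^ k + c)) = (if x \<in> {x. f x} then 1 else 2)"
      using M(2) by simp
  qed
  then show ?thesis using M(1) unfolding class_P_def DTIME_def by blast
qed

lemma ptime_poly_time_computable:
  assumes "ptime f"
  shows "poly_time_computable f"
proof -
  obtain T where T: "computes f T" "poly_bounded T" using assms by (rule ptimeE)
  obtain M C where M: "wf_tm M" "\<And>x t. C * T x + C * length x + C \<le> t \<Longrightarrow> halted (run M x t) \<and>
    tape_output (last (snd (run M x t))) (f x)"
    using transducer_exists[OF T(1)] by blast
  obtain c k where "\<And>x. C * T x + C * length x + C \<le> c * length x ^ k + c"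
    using poly_bound_in_length[OF T(2)] by blast
  then have "computes_in_time M f (\<lambda>n. c * n ^ k + c)"
    unfolding computes_in_time_def using M(2) by blast
  then show ?thesis using M(1) unfolding poly_time_computable_def by blast
qed

section \<open>Functions computable in exponential time\<close>

definition etime :: "('a::encodable \<Rightarrow> 'b::encodable) \<Rightarrow> bool" where
  "etime f \<longleftrightarrow> (\<exists>T P. computes f T \<and> poly_bounded P \<and> (\<forall>x. T x \<le> 2 ^ P x))"

lemma etimeI: "computes f T \<Longrightarrow> poly_bounded P \<Longrightarrow> (\<And>x. T x \<le> 2 ^ P x) \<Longrightarrow> etime f"
  unfolding etime_def by blast

text \<open>A polynomial in \<open>2 ^ P\<close> is again a power of two whose exponent is
  polynomial in the parameters, so one exponential stage leads to a single exponential.\<close>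

lemma exp_bound_power:
  fixes s U P d :: nat
  shows "U + U * (s + 2 ^ P + 3) ^ d \<le> 2 ^ (U + 1 + (s + P + 4) * d)"
proof -
  have "s + 2 ^ P + 3 \<le> 2 ^ (s + P + 4)"
  proof -
    have "s < 2 ^ s" "P < 2 ^ P" by (rule less_exp)+
    then have "s * 1 \<le> 2 ^ s * 2 ^ P" by (intro mult_mono) auto
    moreover have "1 * 2 ^ P \<le> (2::nat) ^ s * 2 ^ P" by (intro mult_mono) auto
    moreover have "1 \<le> (2::nat) ^ s * 2 ^ P" by simp
    ultimately have "s + 2 ^ P + 3 \<le> 16 * (2 ^ s * 2 ^ P)" by linarith
    then show ?thesis by (simp add: power_add)
  qed
  then have "(s + 2 ^ P + 3) ^ d \<le> 2 ^ ((s + P + 4) * d)"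
    by (simp add: power_mult power_mono)
  then have "U + U * (s + 2 ^ P + 3) ^ d \<le> 2 * U * 2 ^ ((s + P + 4) * d)"
    by (simp add: mult_2 add_mono distrib_right)
  also have "\<dots> \<le> 2 * 2 ^ U * 2 ^ ((s + P + 4) * d)"
    by (intro mult_right_mono mult_left_mono) (auto intro: less_imp_le less_exp)
  finally show ?thesis by (simp add: power_add mult_ac)
qed

text \<open>The number of rounds is polynomial and each round is polynomial in the current value;
  only the value may become exponentially large.\<close>

lemma etime_funpow:
  fixes f :: "'a::encodable \<Rightarrow> 'b::encodable \<Rightarrow> 'b"
  assumes "ptime n" "ptime s" "ptime (\<lambda>p. f (fst p) (snd p))"
    and B: "poly_bounded P" "\<And>e i. i \<le> n e \<Longrightarrow> sz ((f e ^^ i) (s e)) \<le> 2 ^ P e"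
  shows "etime (\<lambda>e. (f e ^^ n e) (s e))"
proof -
  obtain U d where U: "poly_bounded U" "computes (\<lambda>e. (f e ^^ n e) (s e)) (\<lambda>e. U e + U e * (sz e + 2 ^ P e + 3) ^ d)"
    using computes_funpow_env[OF assms(1-3) B(2)] by blast
  show ?thesis
  proof (rule etimeI[OF U(2)])
    show "poly_bounded (\<lambda>e. U e + 1 + (sz e + P e + 4) * d)" by (intro pb_intros U B)
  qed (rule exp_bound_power)
qed

lemma etime_comp:
  assumes g: "ptime g" and f: "etime f"
  shows "etime (\<lambda>x. g (f x))"
proof -
  obtain T P where T: "computes f T" "poly_bounded P" "\<And>x. T x \<le> 2 ^ P x"
    using f unfolding etime_def by blast
  obtain U where U: "computes g U" "poly_bounded U" using g by (rule ptimeE)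
  obtain d where d: "\<And>x. U x \<le> (sz x + 2) ^ d" using U(2) unfolding poly_bounded_def by blast
  show ?thesis
  proof (rule etimeI[OF computes_compose[OF T(1) U(1)]])
    show "poly_bounded (\<lambda>x. P x + 1 + (1 + 1 + (sz x + P x + 4) * d))" by (intro pb_intros T)
    fix x
    have "sz (f x) + 2 \<le> sz x + 2 ^ P x + 3" using sz_computes[OF T(1), of x] T(3)[of x] by linarith
    then have "U (f x) \<le> (sz x + 2 ^ P x + 3) ^ d" by (rule order_trans[OF d power_mono]) simp
    then have "1 + U (f x) \<le> 2 ^ (1 + 1 + (sz x + P x + 4) * d)"
      using exp_bound_power[of 1 "sz x" "P x" d] by linarith
    moreover have "(a::nat) \<ge> 1 \<Longrightarrow> b \<ge> 1 \<Longrightarrow> a + b \<le> 2 * a * b" for a b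
      by (metis add_mono mult.assoc mult.commute mult_2 mult_le_mono2 nat_mult_1_right)
    from this[of "2 ^ P x" "2 ^ (1 + 1 + (sz x + P x + 4) * d)"]
    have "2 ^ P x + 2 ^ (1 + 1 + (sz x + P x + 4) * d) \<le> (2::nat) ^ (P x + 1 + (1 + 1 + (sz x + P x + 4) * d))"
      by (simp add: power_add)
    ultimately show "T x + U (f x) + 1 \<le> 2 ^ (P x + 1 + (1 + 1 + (sz x + P x + 4) * d))"
      using T(3)[of x] by linarith
  qed
qed

lemma etime_class_EXP:
  fixes f :: "bool list \<Rightarrow> bool"
  assumes "etime f"
  shows "{x. f x} \<in> class_EXP"
proof -
  obtain T P where T: "computes f T" "poly_bounded P" "\<And>x. T x \<le> 2 ^ P x"
    using assms unfolding etime_def by blast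
  obtain d where d: "\<And>x. P x \<le> (sz x + 2) ^ d" using T(2) unfolding poly_bounded_def by blast
  obtain M C where M: "wf_tm M"
    "\<And>x t. T x + C * length x + C \<le> t \<Longrightarrow> fst (run M x t) = (if f x then 1 else 2)"
    using decider_exists[OF T(1)] by blast
  \<comment> \<open>The class allows no constant inside the exponent. If \<open>n\<close> \<ge> 2,
    then \<open>4 * n + 3\<close> \<le> \<open>n ^ 4\<close>, which gives the exponent
    \<open>4 * d\<close>; for \<open>n\<close> \<le> 1 the base is at most 7 and the constant
    \<open>2 ^ (7 ^ d)\<close> takes over. The extra 1 makes \<open>n\<close> \<le>
    \<open>n ^ k\<close> hold.\<close>
  let ?c = "1 + C + 2 ^ (7 ^ d)" and ?k = "4 * d + 1"
  have bound: "T x + C * length x + C \<le> ?c * 2 ^ (length x ^ ?k) + ?c" for x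
  proof -
    let ?n = "length x"
    have P: "P x \<le> (4 * ?n + 3) ^ d"
      by (rule order_trans[OF d power_mono]) (use sz_bits(1)[of x] in auto)
    have "T x \<le> 2 ^ (?n ^ ?k) + 2 ^ (7 ^ d)"
    proof (cases "?n \<le> 1")
      case True
      have "P x \<le> 7 ^ d" by (rule order_trans[OF P power_mono]) (use True in auto)
      then have "2 ^ P x \<le> (2::nat) ^ (7 ^ d)" by (intro power_increasing) auto
      then show ?thesis using T(3)[of x] by linarith
    next
      case False
      have "4 * ?n + 3 \<le> 2 ^ 3 * ?n" using False by simp
      also have "\<dots> \<le> ?n ^ 3 * ?n" by (intro mult_right_mono power_mono) (use False in auto)
      finally have "(4 * ?n + 3) ^ d \<le> (?n ^ 4) ^ d"
        by (intro power_mono) (auto simp: power_numeral_reduce)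
      also have "\<dots> \<le> ?n ^ ?k" unfolding power_mult[symmetric] by (rule power_increasing) (use False in auto)
      finally have "2 ^ P x \<le> (2::nat) ^ (?n ^ ?k)" using P by (intro power_increasing) auto
      then show ?thesis using T(3)[of x] by linarith
    qed
    moreover have "?n \<le> 2 ^ (?n ^ ?k)"
    proof (cases "?n = 0")
      case False
      have "?n \<le> 2 ^ ?n" by (rule less_imp_le[OF less_exp])
      also have "?n \<le> ?n ^ ?k" by (rule self_le_power) (use False in linarith, simp)
      then have "2 ^ ?n \<le> (2::nat) ^ (?n ^ ?k)" by (intro power_increasing) auto
      finally show ?thesis .
    qed simp
    then have "C * ?n \<le> C * 2 ^ (?n ^ ?k)" by (rule mult_le_mono2)
    moreover have "?c * 2 ^ (?n ^ ?k) = 2 ^ (?n ^ ?k) + C * 2 ^ (?n ^ ?k) + 2 ^ (7 ^ d) * 2 ^ (?n ^ ?k)"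
      by (simp only: distrib_right mult_1)
    moreover have "2 ^ (7 ^ d) \<le> (2::nat) ^ (7 ^ d) * 2 ^ (?n ^ ?k)" by simp
    ultimately show ?thesis by linarith
  qed
  have "decides_in_time M {x. f x} (\<lambda>n. ?c * 2 ^ (n ^ ?k) + ?c)"
    unfolding decides_in_time_def using M(2)[OF bound] by simp
  then show ?thesis using M(1) unfolding class_EXP_def DTIME_def by blast
qed


section \<open>World views and Horn derivations\<close>

fun literal_atom :: "'a literal \<Rightarrow> 'a" where
  "literal_atom (Pos a) = a"
| "literal_atom (Neg a) = a"

fun elem_atom :: "'a body_elem \<Rightarrow> 'a" where
  "elem_atom (Lit l) = literal_atom l"
| "elem_atom (ENot l) = literal_atom l"
| "elem_atom (NegENot l) = literal_atom l"

text \<open>The operators are erased here. The expression \<open>May (Pos a)\<close> is the element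
  \<open>ENot (Neg a)\<close> and also contributes \<open>a\<close>.\<close>

definition body_atoms :: "'a rule \<Rightarrow> 'a list" where
  "body_atoms r = map elem_atom (body r)"

definition horn :: "'a rule \<Rightarrow> bool" where
  "horn r \<longleftrightarrow> length (head r) \<le> 1 \<and>
     (\<forall>b \<in> set (body r). \<exists>a. b = Lit (Pos a) \<or> b = Know (Pos a) \<or> b = May (Pos a))"

inductive_set derived :: "'a rule set \<Rightarrow> 'a set" for Q where
  derivedI: "r \<in> Q \<Longrightarrow> head r = [a] \<Longrightarrow> (\<And>b. b \<in> set (body_atoms r) \<Longrightarrow> b \<in> derived Q) \<Longrightarrow> a \<in> derived Q"

definition inconsistent :: "'a rule set \<Rightarrow> bool" where
  "inconsistent Q \<longleftrightarrow> (\<exists>r\<in>Q. head r = [] \<and> set (body_atoms r) \<subseteq> derived Q)"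

definition reduct_rule :: "'a literal set \<Rightarrow> 'a rule \<Rightarrow> 'a rule" where
  "reduct_rule I r = Rule (head r) (concat (map (reduct_elem I) (body r)))"

lemma epistemic_reduct_eq:
  "epistemic_reduct P I = reduct_rule I ` {r \<in> P. \<forall>l. NegENot l \<in> set (body r) \<longrightarrow> l \<in> I}"
  by (auto simp: epistemic_reduct_def reduct_rule_def)

lemma horn_elem:
  assumes "horn r" "b \<in> set (body r)"
  obtains a where "b = Lit (Pos a)" | a where "b = NegENot (Pos a)" | a where "b = ENot (Neg a)"
  using assms unfolding horn_def by fastforce

lemma horn_head:
  assumes "horn r"
  obtains "head r = []" | a where "head r = [a]"
  using assms unfolding horn_def by (cases "head r") auto

lemma neg_body_reduct_rule: "horn r \<Longrightarrow> neg_body (reduct_rule I r) = {}"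
  by (auto simp: reduct_rule_def neg_body_def elim!: horn_elem split: if_splits)

lemma positive_part_reduct_rule:
  assumes "horn r"
  shows "positive_part (reduct_rule I r) = reduct_rule I r"
proof -
  have "\<exists>a. e = Lit (Pos a)" if "b \<in> set (body r)" "e \<in> set (reduct_elem I b)" for b e
    using horn_elem[OF assms that(1)] that(2) by (cases; auto split: if_splits)
  then show ?thesis by (auto simp: reduct_rule_def positive_part_def intro!: filter_True)
qed

lemma gl_reduct_epistemic:
  assumes "\<forall>r\<in>Q. horn r"
  shows "gl_reduct (epistemic_reduct Q I) M = epistemic_reduct Q I"
proof -
  have "neg_body r = {}" "positive_part r = r" if "r \<in> epistemic_reduct Q I" for r
    using that assms by (auto simp: epistemic_reduct_eq neg_body_reduct_rule positive_part_reduct_rule)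
  then show ?thesis unfolding gl_reduct_def by force
qed

text \<open>In a surviving rule \<open>K a\<close> always becomes \<open>a\<close>, while
  \<open>M a\<close> becomes \<open>a\<close> by cancellation of the double negation iff
  \<open>Neg a\<close> is in \<open>I\<close> and is dropped otherwise.\<close>

lemma satisfies_reduct:
  assumes "horn r"
  shows "satisfies M (reduct_rule I r) \<longleftrightarrow> set (head r) \<inter> M \<noteq> {} \<or>
    \<not> (\<forall>a. (Lit (Pos a) \<in> set (body r) \<or> Know (Pos a) \<in> set (body r) \<or>
           May (Pos a) \<in> set (body r) \<and> Neg a \<in> I) \<longrightarrow> a \<in> M)"
proof -
  have "pos_body (reduct_rule I r) = {a. Lit (Pos a) \<in> set (body r) \<or> Know (Pos a) \<in> set (body r) \<or>
      May (Pos a) \<in> set (body r) \<and> Neg a \<in> I}"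
  proof (intro set_eqI iffI)
    fix a assume "a \<in> pos_body (reduct_rule I r)"
    then obtain b where b: "b \<in> set (body r)" "Lit (Pos a) \<in> set (reduct_elem I b)"
      by (auto simp: pos_body_def reduct_rule_def)
    from assms b(1) show "a \<in> {a. Lit (Pos a) \<in> set (body r) \<or> Know (Pos a) \<in> set (body r) \<or>
      May (Pos a) \<in> set (body r) \<and> Neg a \<in> I}"
      by (cases rule: horn_elem) (use b in \<open>auto split: if_splits\<close>)
  next
    fix a assume "a \<in> {a. Lit (Pos a) \<in> set (body r) \<or> Know (Pos a) \<in> set (body r) \<or>
      May (Pos a) \<in> set (body r) \<and> Neg a \<in> I}"
    then obtain b where "b \<in> set (body r)" "Lit (Pos a) \<in> set (reduct_elem I b)" by force
    then show "a \<in> pos_body (reduct_rule I r)" by (auto simp: pos_body_def reduct_rule_def)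
  qed
  then show ?thesis using neg_body_reduct_rule[OF assms, of I]
    by (auto simp: satisfies_def reduct_rule_def)
qed

lemma set_body_atoms:
  assumes "horn r"
  shows "a \<in> set (body_atoms r) \<longleftrightarrow>
    Lit (Pos a) \<in> set (body r) \<or> Know (Pos a) \<in> set (body r) \<or> May (Pos a) \<in> set (body r)"
proof
  assume "a \<in> set (body_atoms r)"
  then obtain b where b: "b \<in> set (body r)" "a = elem_atom b" by (auto simp: body_atoms_def)
  from assms b(1) show "Lit (Pos a) \<in> set (body r) \<or> Know (Pos a) \<in> set (body r) \<or> May (Pos a) \<in> set (body r)"
    by (cases rule: horn_elem) (use b in auto)
qed (force simp: body_atoms_def image_iff)

lemma horn_NegENot:
  assumes "horn r" "NegENot l \<in> set (body r)"
  obtains c where "l = Pos c" "c \<in> set (body_atoms r)"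
proof -
  obtain a where "l = Pos a" using assms by (cases rule: horn_elem) auto
  then show thesis using that[of a] assms(2) by (simp add: set_body_atoms[OF assms(1)])
qed

lemma set_body_elem_atom: "set_body_elem b = {elem_atom b}"
proof (cases b)
  case (Lit l) then show ?thesis by (cases l) auto
next
  case (ENot l) then show ?thesis by (cases l) auto
next
  case (NegENot l) then show ?thesis by (cases l) auto
qed

lemma set_rule_atoms: "set_rule r = set (head r) \<union> set (body_atoms r)"
  by (cases r) (auto simp: body_atoms_def set_body_elem_atom)

lemma derived_atoms: "derived Q \<subseteq> atoms Q"
proof
  fix a assume "a \<in> derived Q"
  then show "a \<in> atoms Q"
    by cases (auto simp: atoms_def set_rule_atoms intro!: bexI)
qed

text \<open>Induction on derivations. The body atoms lie in \<open>M\<close> by induction, hence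
  they are known in \<open>I\<close>, so the rule is not deleted. What the reduct keeps of its body
  consists of these atoms, and \<open>M\<close> must contain the head.\<close>

lemma derived_least:
  assumes horn: "\<forall>r\<in>Q. horn r" and M: "is_model M (epistemic_reduct Q I)"
    and I: "\<And>a. a \<in> atoms Q \<Longrightarrow> a \<in> derived Q \<Longrightarrow> a \<in> M \<Longrightarrow> Pos a \<in> I \<and> Neg a \<notin> I"
  shows "derived Q \<subseteq> M"
proof
  fix a assume "a \<in> derived Q"
  then show "a \<in> M"
  proof induction
    case (derivedI r a)
    have at: "b \<in> atoms Q" if "b \<in> set (body_atoms r)" for b
      using derivedI(1) that by (auto simp: atoms_def set_rule_atoms)
    have hr: "horn r" using horn derivedI(1) by blast
    have "l \<in> I" if "NegENot l \<in> set (body r)" for l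
    proof -
      obtain c where "l = Pos c" "c \<in> set (body_atoms r)" using horn_NegENot[OF hr \<open>NegENot l \<in> set (body r)\<close>] .
      then show ?thesis using I[of c] at[of c] derivedI.IH[of c] derivedI.hyps(3)[of c] by blast
    qed
    then have "satisfies M (reduct_rule I r)"
      using M derivedI(1) unfolding is_model_def epistemic_reduct_eq by blast
    then show ?case using derivedI.hyps(2) derivedI.IH by (auto simp: satisfies_reduct[OF hr] set_body_atoms[OF hr])
  qed
qed

text \<open>From a world view one obtains a unique answer set that contains the least model, and a
  constraint violated by the least model would be violated by it as well. Conversely the least model
  with its complement is a world view: a derived \<open>M a\<close> is dropped but true anyway, and
  an underived one is kept and false.\<close>

theorem world_view_iff_consistent:
  assumes horn: "\<forall>r\<in>Q. horn r"
  shows "(\<exists>I. ground_world_view Q I) \<longleftrightarrow> \<not> inconsistent Q"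
proof
  assume "\<exists>I. ground_world_view Q I"
  then obtain I where wvi: "is_WVI Q I" and comp: "compatible Q I (answer_sets (epistemic_reduct Q I))"
    by (auto simp: ground_world_view_def)
  let ?R = "epistemic_reduct Q I"
  have AS: "answer_sets ?R = {M. is_model M ?R \<and> (\<forall>M'. M' \<subset> M \<longrightarrow> \<not> is_model M' ?R)}"
    by (simp add: answer_sets_def gl_reduct_epistemic[OF horn])
  \<comment> \<open>Horn rules have models closed under intersection, so a minimal model is
    unique.\<close>
  have inter: "is_model (M \<inter> N) ?R" if "is_model M ?R" "is_model N ?R" for M N
    unfolding is_model_def
  proof
    fix r' assume r': "r' \<in> ?R"
    then obtain r where r: "r \<in> Q" "r' = reduct_rule I r" unfolding epistemic_reduct_eq by blast
    have hr: "horn r" using horn r(1) by blast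
    have sat: "satisfies M r'" "satisfies N r'" using that r' by (auto simp: is_model_def)
    from hr show "satisfies (M \<inter> N) r'"
      by (cases rule: horn_head) (use sat in \<open>auto simp: r(2) satisfies_reduct[OF hr]\<close>)
  qed
  obtain J where J: "J \<in> answer_sets ?R" using comp by (auto simp: compatible_def)
  have uniq: "J' = J" if "J' \<in> answer_sets ?R" for J'
  proof -
    have m: "is_model (J \<inter> J') ?R" "\<not> J \<inter> J' \<subset> J" "\<not> J \<inter> J' \<subset> J'"
      using inter[of J J'] that J unfolding AS by auto
    then show ?thesis by blast
  qed
  \<comment> \<open>With only one answer set no atom can be true in one and false in another, so
    clause (iv) excludes undecided atoms and clauses (ii) and (iii) fix the sign.\<close>
  have total: "Pos a \<in> I \<and> Neg a \<notin> I" if "a \<in> atoms Q" "a \<in> J" for a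
    using comp J uniq that unfolding compatible_def by metis
  have model: "is_model J ?R" using J unfolding AS by blast
  \<comment> \<open>Equality may fail here: in a world view containing \<open>a\<close>, the rule
    \<open>a\<close> \<leftarrow> \<open>M a\<close> becomes a fact and supports itself.\<close>
  have D: "derived Q \<subseteq> J" by (rule derived_least[OF horn model]) (use total in blast)
  show "\<not> inconsistent Q"
  proof
    assume "inconsistent Q"
    then obtain r where r: "r \<in> Q" "head r = []" "set (body_atoms r) \<subseteq> J"
      using D by (auto simp: inconsistent_def)
    have hr: "horn r" using horn r(1) by blast
    have "l \<in> I" if "NegENot l \<in> set (body r)" for l
    proof -
      obtain c where c: "l = Pos c" "c \<in> set (body_atoms r)" using horn_NegENot[OF hr \<open>NegENot l \<in> set (body r)\<close>] .
      then have "c \<in> atoms Q" "c \<in> J" using r by (auto simp: atoms_def set_rule_atoms)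
      then show ?thesis using total c(1) by blast
    qed
    then have "satisfies J (reduct_rule I r)"
      using model r(1) unfolding is_model_def epistemic_reduct_eq by blast
    then show False using r(2,3) by (auto simp: satisfies_reduct[OF hr] set_body_atoms[OF hr] subset_eq)
  qed
next
  assume con: "\<not> inconsistent Q"
  define I where "I = Pos ` derived Q \<union> Neg ` (atoms Q - derived Q)"
  let ?R = "epistemic_reduct Q I"
  have AS: "answer_sets ?R = {M. is_model M ?R \<and> (\<forall>M'. M' \<subset> M \<longrightarrow> \<not> is_model M' ?R)}"
    by (simp add: answer_sets_def gl_reduct_epistemic[OF horn])
  have model: "is_model (derived Q) ?R"
    unfolding is_model_def
  proof
    fix r' assume "r' \<in> ?R"
    then obtain r where r: "r \<in> Q" "r' = reduct_rule I r" unfolding epistemic_reduct_eq by blast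
    have hr: "horn r" using horn r(1) by blast
    show "satisfies (derived Q) r'"
    proof (cases "set (body_atoms r) \<subseteq> derived Q")
      case True
      then have "head r \<noteq> []" using con r(1) unfolding inconsistent_def by blast
      moreover have "length (head r) \<le> 1" using hr by (simp add: horn_def)
      ultimately obtain a where a: "head r = [a]" by (cases "head r") auto
      then have "a \<in> derived Q" using derivedI[OF r(1) a] True by blast
      then show ?thesis using a by (simp add: r(2) satisfies_reduct[OF hr])
    next
      case False
      then obtain a where a: "a \<in> set (body_atoms r)" "a \<notin> derived Q" by blast
      \<comment> \<open>Since \<open>Neg a\<close> is in \<open>I\<close>, the atom stays in the
        body of the reduct even if it occurs only under \<open>M\<close>, so the false body atom
        satisfies the reduced rule.\<close>
      then have "Neg a \<in> I" using r(1) by (auto simp: I_def atoms_def set_rule_atoms)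
      then show ?thesis using a set_body_atoms[OF hr, of a] by (auto simp: r(2) satisfies_reduct[OF hr])
    qed
  qed
  have least: "derived Q \<subseteq> M" if "is_model M ?R" for M
    by (rule derived_least[OF horn that]) (auto simp: I_def)
  have "answer_sets ?R = {derived Q}"
    unfolding AS using model least by blast
  moreover have "is_WVI Q I" using derived_atoms[of Q] by (auto simp: is_WVI_def I_def lits_def)
  ultimately have "ground_world_view Q I"
    by (auto simp: ground_world_view_def compatible_def I_def)
  then show "\<exists>I. ground_world_view Q I" by blast
qed

lemma head_map_rule: "head (map_rule f r) = map f (head r)"
  by (cases r) auto

lemma body_map_rule: "body (map_rule f r) = map (map_body_elem f) (body r)"
  by (cases r) auto

lemma elem_atom_map: "elem_atom (map_body_elem f b) = f (elem_atom b)"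
proof (cases b)
  case (Lit l) then show ?thesis by (cases l) auto
next
  case (ENot l) then show ?thesis by (cases l) auto
next
  case (NegENot l) then show ?thesis by (cases l) auto
qed

lemma body_atoms_map_rule: "body_atoms (map_rule f r) = map f (body_atoms r)"
  by (simp add: body_atoms_def body_map_rule elem_atom_map)

lemma horn_map_rule: "horn r \<Longrightarrow> horn (map_rule f r)"
  unfolding horn_def head_map_rule body_map_rule by fastforce

lemma EHorn_iff: "P \<in> EHorn \<longleftrightarrow> finite P \<and> (\<forall>r\<in>P. safe r \<and> horn r)"
  by (auto simp: EHorn_def ELP_def horn_def)

lemma world_view_EHorn:
  assumes "P \<in> EHorn"
  shows "(\<exists>I. world_view P I) \<longleftrightarrow> \<not> inconsistent (grd P)"
proof -
  have "\<forall>r\<in>grd P. horn r" using assms by (auto simp: grd_def EHorn_iff intro: horn_map_rule)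
  then show ?thesis unfolding world_view_def by (rule world_view_iff_consistent)
qed


section \<open>Saturation\<close>

fun fire :: "bool \<times> 'a list \<Rightarrow> 'a rule \<Rightarrow> bool \<times> 'a list" where
  "fire (b, D) r = (if \<forall>a\<in>set (body_atoms r). a \<in> set D
     then (case head r of [] \<Rightarrow> (True, D) | a # _ \<Rightarrow> (b, a # D)) else (b, D))"

definition saturate :: "'a rule list \<Rightarrow> bool \<times> 'a list" where
  "saturate w = foldl fire (False, []) w"

lemma saturate_append: "saturate (v @ w) = foldl fire (saturate v) w"
  by (simp add: saturate_def)

lemma saturate_sound:
  assumes "set w \<subseteq> Q" "\<forall>r\<in>Q. horn r"
  shows "set (snd (saturate w)) \<subseteq> derived Q \<and> (fst (saturate w) \<longrightarrow> inconsistent Q)"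
  using assms(1)
proof (induction w rule: rev_induct)
  case Nil
  then show ?case by (simp add: saturate_def)
next
  case (snoc r w)
  obtain b D where bD: "saturate w = (b, D)" by fastforce
  have IH: "set D \<subseteq> derived Q" "b \<longrightarrow> inconsistent Q" using snoc bD by auto
  have "horn r" using snoc.prems assms(2) by auto
  then show ?case
  proof (cases rule: horn_head)
    case 1
    have "inconsistent Q" if "\<forall>a\<in>set (body_atoms r). a \<in> set D"
      using that IH snoc.prems 1 by (auto simp: inconsistent_def intro!: bexI[of _ r])
    with 1 IH show ?thesis by (auto simp: saturate_append bD)
  next
    case (2 a)
    have "a \<in> derived Q" if "\<forall>a\<in>set (body_atoms r). a \<in> set D"
      using that IH snoc.prems 2 by (intro derivedI[OF _ 2]) auto
    with 2 IH show ?thesis by (auto simp: saturate_append bD)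
  qed
qed

text \<open>A pass guarantees the effect of those rules whose bodies hold at its beginning. Rules
  enabled during the pass may fire or not, depending on the order; for counting rounds this is
  enough.\<close>

lemma foldl_fire:
  assumes "foldl fire (b, D) w = (b', D')"
  shows "set D \<subseteq> set D' \<and> (b \<longrightarrow> b') \<and> (\<forall>r\<in>set w. set (body_atoms r) \<subseteq> set D \<longrightarrow>
    (head r = [] \<longrightarrow> b') \<and> (\<forall>a. head r = [a] \<longrightarrow> a \<in> set D'))"
  using assms
proof (induction w arbitrary: b D)
  case (Cons r w)
  obtain b1 D1 where 1: "fire (b, D) r = (b1, D1)" by fastforce
  then have sub: "set D \<subseteq> set D1" "b \<longrightarrow> b1" "set (body_atoms r) \<subseteq> set D \<longrightarrow>
      (head r = [] \<longrightarrow> b1) \<and> (\<forall>a. head r = [a] \<longrightarrow> a \<in> set D1)"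
    by (auto split: if_splits list.splits)
  have IH: "set D1 \<subseteq> set D' \<and> (b1 \<longrightarrow> b') \<and> (\<forall>r\<in>set w. set (body_atoms r) \<subseteq> set D1 \<longrightarrow>
    (head r = [] \<longrightarrow> b') \<and> (\<forall>a. head r = [a] \<longrightarrow> a \<in> set D'))"
    using Cons.IH[of b1 D1] Cons.prems 1 by simp
  show ?case
  proof (intro conjI ballI impI allI)
    fix r' assume r': "r' \<in> set (r # w)" "set (body_atoms r') \<subseteq> set D"
    { assume "head r' = []" with r' IH sub show b' by (cases "r' = r") auto }
    { fix a assume "head r' = [a]" with r' IH sub show "a \<in> set D'" by (cases "r' = r") auto }
  qed (use IH sub in auto)
qed simp

lemma derived_closed:
  assumes "\<And>r a. r \<in> Q \<Longrightarrow> set (body_atoms r) \<subseteq> D \<Longrightarrow> head r = [a] \<Longrightarrow> a \<in> D"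
  shows "derived Q \<subseteq> D"
proof
  fix a assume "a \<in> derived Q"
  then show "a \<in> D" by induction (use assms in blast)
qed

lemma finite_derived: "finite Q \<Longrightarrow> finite (derived Q) \<and> card (derived Q) \<le> card Q"
proof -
  assume fin: "finite Q"
  have "derived Q \<subseteq> (\<lambda>r. hd (head r)) ` Q" by (rule derived_closed) force
  then show ?thesis using fin by (meson card_image_le finite_imageI card_mono finite_subset le_trans)
qed

text \<open>Every round before a stable one adds an atom, and there are at most as many derivable
  atoms as rules. So some round among the first \<open>n\<close> is stable; by then everything
  derivable is present, and that round detects a violated constraint.\<close>

lemma saturate_rounds:
  assumes horn: "\<forall>r\<in>set w. horn r" and n: "length w < n"
  shows "fst (saturate (concat (replicate n w))) \<longleftrightarrow> inconsistent (set w)"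
proof
  assume "fst (saturate (concat (replicate n w)))"
  moreover have "set (concat (replicate n w)) \<subseteq> set w" by auto
  ultimately show "inconsistent (set w)" using saturate_sound horn by blast
next
  assume inc: "inconsistent (set w)"
  define S where "S i = saturate (concat (replicate i w))" for i
  have S: "S (Suc i) = foldl fire (fst (S i), snd (S i)) w" for i
    unfolding S_def replicate.simps(2) replicate_append_same[symmetric] concat_append by (simp add: saturate_append)
  note st = foldl_fire[OF trans[OF S[symmetric] prod.collapse[symmetric]]]
  have mono: "set (snd (S i)) \<subseteq> set (snd (S j)) \<and> (fst (S i) \<longrightarrow> fst (S j))" if "i \<le> j" for i j
    using that by (induction rule: dec_induct) (use st in blast)+
  \<comment> \<open>As long as no round has been stable, the number of derived atoms is at least the
    number of rounds.\<close>
  have "(\<exists>k<i. set (snd (S (Suc k))) = set (snd (S k))) \<or> i \<le> card (set (snd (S i)))" for i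
  proof (induction i)
    case (Suc i)
    show ?case
    proof (cases "set (snd (S (Suc i))) = set (snd (S i))")
      case False
      then have "set (snd (S i)) \<subset> set (snd (S (Suc i)))" using st[of i] by blast
      then have "card (set (snd (S i))) < card (set (snd (S (Suc i))))" by (simp add: psubset_card_mono)
      then show ?thesis using Suc by (auto intro: less_SucI)
    qed blast
  qed simp
  moreover have "card (set (snd (S n))) < n"
  proof -
    have "set (concat (replicate n w)) \<subseteq> set w" by auto
    then have "set (snd (S n)) \<subseteq> derived (set w)" unfolding S_def using saturate_sound horn by blast
    then have "card (set (snd (S n))) \<le> card (set w)"
      using finite_derived[of "set w"] by (meson List.finite_set card_mono le_trans)
    then show ?thesis using n card_length[of w] by linarith
  qed
  ultimately obtain k where k: "k < n" "set (snd (S (Suc k))) = set (snd (S k))"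
    by (meson not_le)
  have "derived (set w) \<subseteq> set (snd (S k))"
    by (rule derived_closed) (use st[of k] k(2) in blast)
  then have "fst (S (Suc k))" using inc st[of k] unfolding inconsistent_def by blast
  then show "fst (saturate (concat (replicate n w)))" using mono[of "Suc k" n] k(1) by (simp add: S_def)
qed

text \<open>Take a longest sequence in which every rule adds a new atom. By maximality it derives
  everything, and one violated constraint is appended. Its length depends on the number of derivable
  atoms and not on the possibly exponential number of ground rules.\<close>

lemma short_derivation:
  assumes horn: "\<forall>r\<in>Q. horn r" and fin: "finite (derived Q)" and inc: "inconsistent Q"
  shows "\<exists>w. set w \<subseteq> Q \<and> length w \<le> Suc (card (derived Q)) \<and> fst (saturate w)"
proof -
  let ?W = "\<lambda>w. set w \<subseteq> Q \<and> distinct (snd (saturate w)) \<and> length w = length (snd (saturate w))"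
  have bound: "length w \<le> card (derived Q)" if "?W w" for w
  proof -
    have "card (set (snd (saturate w))) \<le> card (derived Q)"
      using that saturate_sound[OF _ horn] by (intro card_mono fin) blast
    then show ?thesis using that by (simp add: distinct_card)
  qed
  have "?W []" by (simp add: saturate_def)
  moreover have "\<forall>v. ?W v \<longrightarrow> length v < Suc (card (derived Q))" using bound by (simp add: less_Suc_eq_le)
  ultimately have "\<exists>w. ?W w \<and> (\<forall>v. ?W v \<longrightarrow> length v \<le> length w)" by (rule ex_has_greatest_nat)
  then obtain w where w: "?W w" "\<And>v. ?W v \<Longrightarrow> length v \<le> length w" by blast
  let ?D = "set (snd (saturate w))"
  have "derived Q \<subseteq> ?D"
  proof (rule derived_closed, rule ccontr)
    fix r a assume r: "r \<in> Q" "set (body_atoms r) \<subseteq> ?D" "head r = [a]" "a \<notin> ?D"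
    obtain b D where "saturate w = (b, D)" by fastforce
    with r w(1) have "?W (w @ [r])" by (auto simp: saturate_append)
    from w(2)[OF this] show False by simp
  qed
  with inc obtain r where r: "r \<in> Q" "head r = []" "set (body_atoms r) \<subseteq> ?D"
    unfolding inconsistent_def by blast
  obtain b D where "saturate w = (b, D)" by fastforce
  with r have "fst (saturate (w @ [r]))" by (auto simp: saturate_append)
  moreover have "length (w @ [r]) \<le> Suc (card (derived Q))" using bound[OF w(1)] by simp
  ultimately show ?thesis using w(1) r(1) by (intro exI[of _ "w @ [r]"]) auto
qed


section \<open>Ground instances\<close>

fun trm_name :: "trm \<Rightarrow> name" where
  "trm_name (Const c) = c"
| "trm_name (Var x) = x"

fun is_var :: "trm \<Rightarrow> bool" where
  "is_var (Const c) = False"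
| "is_var (Var x) = True"

definition rule_atoms :: "'a rule \<Rightarrow> 'a list" where
  "rule_atoms r = head r @ body_atoms r"

definition prog_terms :: "atom rule list \<Rightarrow> trm list" where
  "prog_terms rs = concat (map (\<lambda>r. concat (map args (rule_atoms r))) rs)"

definition prog_vars :: "atom rule list \<Rightarrow> name list" where
  "prog_vars rs = map trm_name (filter is_var (prog_terms rs))"

definition prog_consts :: "atom rule list \<Rightarrow> name list" where
  "prog_consts rs = map trm_name (filter (\<lambda>t. \<not> is_var t) (prog_terms rs))"

definition universe :: "atom rule list \<Rightarrow> name list" where
  "universe rs = (let cs = prog_consts rs in if cs = [] then [undefined] else cs)"

lemma set_rule_atoms_list: "set_rule r = set (rule_atoms r)"
  by (simp add: set_rule_atoms rule_atoms_def)

lemma set_prog_terms: "set (prog_terms rs) = (\<Union>a\<in>atoms (set rs). set (args a))"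
  by (auto simp: prog_terms_def atoms_def set_rule_atoms_list)

lemma set_prog_consts: "set (prog_consts rs) = (\<Union>a\<in>atoms (set rs). consts_atom a)"
proof -
  have "c \<in> set (prog_consts rs) \<longleftrightarrow> Const c \<in> set (prog_terms rs)" for c
    unfolding prog_consts_def by (auto simp: image_iff elim!: is_var.elims trm_name.elims)
  then show ?thesis by (auto simp: set_prog_terms consts_atom_def)
qed

lemma set_prog_vars: "set (prog_vars rs) = (\<Union>a\<in>atoms (set rs). vars_atom a)"
proof -
  have "c \<in> set (prog_vars rs) \<longleftrightarrow> Var c \<in> set (prog_terms rs)" for c
    unfolding prog_vars_def by (auto simp: image_iff elim!: is_var.elims trm_name.elims)
  then show ?thesis by (auto simp: set_prog_terms vars_atom_def)
qed

lemma set_universe: "set (universe rs) = herbrand_universe (set rs)"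
  unfolding universe_def herbrand_universe_def Let_def set_prog_consts[symmetric] by simp

lemma universe_nonempty: "universe rs \<noteq> []"
  by (simp add: universe_def Let_def)

text \<open>The first entry for a variable wins and missing variables get the default. Thus every
  list of constants, of whatever length, determines a total substitution, also if
  \<open>prog_vars\<close> has repetitions.\<close>

definition assign :: "name \<Rightarrow> (name \<times> name) list \<Rightarrow> name \<Rightarrow> name" where
  "assign c ps x = (case filter (\<lambda>p. fst p = x) ps of [] \<Rightarrow> c | p # _ \<Rightarrow> snd p)"

definition inst :: "atom rule list \<Rightarrow> name list \<Rightarrow> atom rule \<Rightarrow> atom rule" where
  "inst rs s r = map_rule (subst_atom (assign (hd (universe rs)) (zip (prog_vars rs) s))) r"

lemma assign_in: "c \<in> U \<Longrightarrow> snd ` set ps \<subseteq> U \<Longrightarrow> assign c ps x \<in> U"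
proof (cases "filter (\<lambda>p. fst p = x) ps")
  case (Cons p qs)
  then have "p \<in> set (filter (\<lambda>p. fst p = x) ps)" by simp
  then have "p \<in> set ps" by simp
  moreover assume "snd ` set ps \<subseteq> U"
  ultimately show ?thesis using Cons by (auto simp: assign_def)
qed (auto simp: assign_def)

lemma assign_zip: "x \<in> set vs \<Longrightarrow> assign c (zip vs (map f vs)) x = f x"
proof -
  assume x: "x \<in> set vs"
  have zip: "zip vs (map f vs) = map (\<lambda>v. (v, f v)) vs" by (simp add: zip_map2 zip_same_conv_map)
  have "(x, f x) \<in> set (filter (\<lambda>p. fst p = x) (zip vs (map f vs)))" using x by (simp add: zip)
  then obtain p qs where p: "filter (\<lambda>p. fst p = x) (zip vs (map f vs)) = p # qs"
    by (cases "filter (\<lambda>p. fst p = x) (zip vs (map f vs))") auto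
  then have "p \<in> set (filter (\<lambda>p. fst p = x) (zip vs (map f vs)))" by simp
  then have "p \<in> set (zip vs (map f vs))" "fst p = x" by simp_all
  then show ?thesis using p unfolding zip by (auto simp: assign_def)
qed

lemma inst_in_grd:
  assumes "r \<in> set rs" "set s \<subseteq> set (universe rs)"
  shows "inst rs s r \<in> grd (set rs)"
proof -
  have "range (assign (hd (universe rs)) (zip (prog_vars rs) s)) \<subseteq> herbrand_universe (set rs)"
  proof clarify
    fix x show "assign (hd (universe rs)) (zip (prog_vars rs) s) x \<in> herbrand_universe (set rs)"
      unfolding set_universe[symmetric]
      by (rule assign_in) (use assms universe_nonempty[of rs] in \<open>auto dest: set_zip_rightD\<close>)
  qed
  then show ?thesis using assms(1) unfolding grd_def inst_def by blast
qed

lemma subst_atom_cong: "(\<And>x. x \<in> vars_atom a \<Longrightarrow> \<sigma> x = \<tau> x) \<Longrightarrow> subst_atom \<sigma> a = subst_atom \<tau> a"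
proof (cases a)
  case (Atom p ts)
  assume "\<And>x. x \<in> vars_atom a \<Longrightarrow> \<sigma> x = \<tau> x"
  then have "subst_trm \<sigma> t = subst_trm \<tau> t" if "t \<in> set ts" for t
    using that Atom by (cases t) (auto simp: vars_atom_def)
  then show ?thesis using Atom by simp
qed

text \<open>Substitutions on all names are replaced by finite lists of values for the variables of
  the program, which can be enumerated. One list serves all rules at once.\<close>

lemma grd_eq_inst:
  "grd (set rs) = {inst rs s r | r s. r \<in> set rs \<and> length s = length (prog_vars rs) \<and> set s \<subseteq> set (universe rs)}"
proof
  show "{inst rs s r | r s. r \<in> set rs \<and> length s = length (prog_vars rs) \<and> set s \<subseteq> set (universe rs)} \<subseteq> grd (set rs)"
    using inst_in_grd by blast
  show "grd (set rs) \<subseteq> {inst rs s r | r s. r \<in> set rs \<and> length s = length (prog_vars rs) \<and> set s \<subseteq> set (universe rs)}"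
  proof
    fix q assume "q \<in> grd (set rs)"
    then obtain \<sigma> r where q: "q = map_rule (subst_atom \<sigma>) r" "r \<in> set rs" "range \<sigma> \<subseteq> set (universe rs)"
      by (auto simp: grd_def set_universe)
    have "map_rule (subst_atom \<sigma>) r = inst rs (map \<sigma> (prog_vars rs)) r"
      unfolding inst_def
    proof (intro rule.map_cong refl subst_atom_cong)
      fix a x assume "a \<in> set_rule r" "x \<in> vars_atom a"
      then have "x \<in> set (prog_vars rs)" using q(2) by (auto simp: set_prog_vars atoms_def)
      then show "\<sigma> x = assign (hd (universe rs)) (zip (prog_vars rs) (map \<sigma> (prog_vars rs))) x"
        by (simp add: assign_zip)
    qed
    then show "q \<in> {inst rs s r | r s. r \<in> set rs \<and> length s = length (prog_vars rs) \<and> set s \<subseteq> set (universe rs)}"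
      using q by (intro CollectI exI[of _ r] exI[of _ "map \<sigma> (prog_vars rs)"]) auto
  qed
qed


section \<open>Programs as encodable data\<close>

fun is_neg :: "'a literal \<Rightarrow> bool" where
  "is_neg (Pos a) = False"
| "is_neg (Neg a) = True"

definition mk_literal :: "bool \<Rightarrow> 'a \<Rightarrow> 'a literal" where
  "mk_literal b a = (if b then Neg a else Pos a)"

definition mk_trm :: "bool \<Rightarrow> name \<Rightarrow> trm" where
  "mk_trm b x = (if b then Var x else Const x)"

fun elem_kind :: "'a body_elem \<Rightarrow> bool \<times> bool" where
  "elem_kind (Lit l) = (False, False)"
| "elem_kind (ENot l) = (True, False)"
| "elem_kind (NegENot l) = (True, True)"

fun elem_lit :: "'a body_elem \<Rightarrow> 'a literal" where
  "elem_lit (Lit l) = l"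
| "elem_lit (ENot l) = l"
| "elem_lit (NegENot l) = l"

text \<open>A total constructor from tag bits. The tag \<open>(False, True)\<close>, which
  \<open>elem_kind\<close> never yields, is also mapped to a plain literal.\<close>

definition mk_elem :: "bool \<times> bool \<Rightarrow> 'a literal \<Rightarrow> 'a body_elem" where
  "mk_elem k l = (if fst k then if snd k then NegENot l else ENot l else Lit l)"

instantiation trm :: encodable
begin
definition "tree_of t = tree_of (is_var t, trm_name t)"
instance
proof
  fix x y :: trm assume "tree_of x = tree_of y"
  then have "is_var x = is_var y \<and> trm_name x = trm_name y"
    using tree_of_inject[of "(is_var x, trm_name x)" "(is_var y, trm_name y)"] by (simp add: tree_of_trm_def)
  then show "x = y" by (cases x; cases y) auto
qed
end

instantiation atom :: encodable
begin
definition "tree_of a = tree_of (pred a, args a)"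
instance
proof
  fix x y :: atom assume "tree_of x = tree_of y"
  then show "x = y"
    using tree_of_inject[of "(pred x, args x)" "(pred y, args y)"] by (simp add: tree_of_atom_def atom.expand)
qed
end

instantiation literal :: (encodable) encodable
begin
definition "tree_of l = tree_of (is_neg l, literal_atom l)"
instance
proof
  fix x y :: "'a literal" assume "tree_of x = tree_of y"
  then have "is_neg x = is_neg y \<and> literal_atom x = literal_atom y"
    using tree_of_inject[of "(is_neg x, literal_atom x)" "(is_neg y, literal_atom y)"]
    by (simp add: tree_of_literal_def)
  then show "x = y" by (cases x; cases y) auto
qed
end

instantiation body_elem :: (encodable) encodable
begin
definition "tree_of b = tree_of (elem_kind b, elem_lit b)"
instance
proof
  fix x y :: "'a body_elem" assume "tree_of x = tree_of y"
  then have "elem_kind x = elem_kind y \<and> elem_lit x = elem_lit y"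
    using tree_of_inject[of "(elem_kind x, elem_lit x)" "(elem_kind y, elem_lit y)"]
    by (simp add: tree_of_body_elem_def)
  then show "x = y" by (cases x; cases y) auto
qed
end

instantiation rule :: (encodable) encodable
begin
definition "tree_of r = tree_of (head r, body r)"
instance
proof
  fix x y :: "'a rule" assume "tree_of x = tree_of y"
  then show "x = y"
    using tree_of_inject[of "(head x, body x)" "(head y, body y)"] by (simp add: tree_of_rule_def rule.expand)
qed
end

lemma ptime_selectors [ptime_intros]:
  "ptime t \<Longrightarrow> ptime (\<lambda>e. is_var (t e))"
  "ptime t \<Longrightarrow> ptime (\<lambda>e. trm_name (t e))"
  using ptime_fst[OF ptime_comp[OF ptime_coerce[of "\<lambda>t. (is_var t, trm_name t)"], of t]]
    ptime_snd[OF ptime_comp[OF ptime_coerce[of "\<lambda>t. (is_var t, trm_name t)"], of t]]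
  by (simp_all add: tree_of_trm_def)

lemma ptime_atom_selectors [ptime_intros]:
  "ptime t \<Longrightarrow> ptime (\<lambda>e. pred (t e))"
  "ptime t \<Longrightarrow> ptime (\<lambda>e. args (t e))"
  using ptime_fst[OF ptime_comp[OF ptime_coerce[of "\<lambda>t. (pred t, args t)"], of t]]
    ptime_snd[OF ptime_comp[OF ptime_coerce[of "\<lambda>t. (pred t, args t)"], of t]]
  by (simp_all add: tree_of_atom_def)

lemma ptime_literal_selectors [ptime_intros]:
  "ptime t \<Longrightarrow> ptime (\<lambda>e. is_neg (t e))"
  "ptime t \<Longrightarrow> ptime (\<lambda>e. literal_atom (t e))"
  using ptime_fst[OF ptime_comp[OF ptime_coerce[of "\<lambda>t. (is_neg t, literal_atom t)"], of t]]
    ptime_snd[OF ptime_comp[OF ptime_coerce[of "\<lambda>t. (is_neg t, literal_atom t)"], of t]]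
  by (simp_all add: tree_of_literal_def)

lemma ptime_elem_selectors [ptime_intros]:
  "ptime t \<Longrightarrow> ptime (\<lambda>e. elem_kind (t e))"
  "ptime t \<Longrightarrow> ptime (\<lambda>e. elem_lit (t e))"
  using ptime_fst[OF ptime_comp[OF ptime_coerce[of "\<lambda>t. (elem_kind t, elem_lit t)"], of t]]
    ptime_snd[OF ptime_comp[OF ptime_coerce[of "\<lambda>t. (elem_kind t, elem_lit t)"], of t]]
  by (simp_all add: tree_of_body_elem_def)

lemma ptime_rule_selectors [ptime_intros]:
  "ptime t \<Longrightarrow> ptime (\<lambda>e. head (t e))"
  "ptime t \<Longrightarrow> ptime (\<lambda>e. body (t e))"
  using ptime_fst[OF ptime_comp[OF ptime_coerce[of "\<lambda>t. (head t, body t)"], of t]]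
    ptime_snd[OF ptime_comp[OF ptime_coerce[of "\<lambda>t. (head t, body t)"], of t]]
  by (simp_all add: tree_of_rule_def)

lemma ptime_constructors [ptime_intros]:
  "ptime b \<Longrightarrow> ptime x \<Longrightarrow> ptime (\<lambda>e. mk_trm (b e) (x e))"
  "ptime p \<Longrightarrow> ptime ts \<Longrightarrow> ptime (\<lambda>e. Atom (p e) (ts e))"
  "ptime b \<Longrightarrow> ptime a \<Longrightarrow> ptime (\<lambda>e. mk_literal (b e) (a e))"
  "ptime k \<Longrightarrow> ptime l \<Longrightarrow> ptime (\<lambda>e. mk_elem (k e) (l e))"
  "ptime H \<Longrightarrow> ptime B \<Longrightarrow> ptime (\<lambda>e. Rule (H e) (B e))"
proof -
  show "ptime b \<Longrightarrow> ptime x \<Longrightarrow> ptime (\<lambda>e. mk_trm (b e) (x e))"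
    using ptime_comp[OF ptime_coerce[of "\<lambda>p. mk_trm (fst p) (snd p)"] ptime_Pair[of b x]]
    by (simp add: tree_of_trm_def mk_trm_def tree_of_prod_def)
  show "ptime p \<Longrightarrow> ptime ts \<Longrightarrow> ptime (\<lambda>e. Atom (p e) (ts e))"
    using ptime_comp[OF ptime_coerce[of "\<lambda>p. Atom (fst p) (snd p)"] ptime_Pair[of p ts]]
    by (simp add: tree_of_atom_def)
  show "ptime b \<Longrightarrow> ptime a \<Longrightarrow> ptime (\<lambda>e. mk_literal (b e) (a e))"
    using ptime_comp[OF ptime_coerce[of "\<lambda>p. mk_literal (fst p) (snd p)"] ptime_Pair[of b a]]
    by (simp add: tree_of_literal_def mk_literal_def tree_of_prod_def)
  show "ptime H \<Longrightarrow> ptime B \<Longrightarrow> ptime (\<lambda>e. Rule (H e) (B e))"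
    using ptime_comp[OF ptime_coerce[of "\<lambda>p. Rule (fst p) (snd p)"] ptime_Pair[of H B]]
    by (simp add: tree_of_rule_def)
  assume k: "ptime k" and l: "ptime l"
  let ?k = "\<lambda>e. (fst (k e), fst (k e) \<and> snd (k e))"
  define m where "m b l = (case b of (x, y) \<Rightarrow> mk_elem (x, x \<and> y) l)" for b and l :: "'i literal"
  \<comment> \<open>Because of the tag \<open>(False, True)\<close>, \<open>mk_elem\<close> does not
    preserve trees and is no mere regrouping. Each of the three constructors does: a program for the
    tagged pair computes it unchanged.\<close>
  have L: "ptime (\<lambda>e. Lit (l e))"
  proof -
    have "ptime (\<lambda>e. ((False, False), l e))" by (intro ptime_intros l)
    then obtain T where T: "computes (\<lambda>e. ((False, False), l e)) T" "poly_bounded T" by (rule ptimeE)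
    have "computes (\<lambda>e. Lit (l e)) T"
      using T(1) unfolding computes_def computes_with_def by (simp add: tree_of_body_elem_def)
    then show ?thesis using T(2) by (rule ptimeI)
  qed
  have E: "ptime (\<lambda>e. ENot (l e))"
  proof -
    have "ptime (\<lambda>e. ((True, False), l e))" by (intro ptime_intros l)
    then obtain T where T: "computes (\<lambda>e. ((True, False), l e)) T" "poly_bounded T" by (rule ptimeE)
    have "computes (\<lambda>e. ENot (l e)) T"
      using T(1) unfolding computes_def computes_with_def by (simp add: tree_of_body_elem_def)
    then show ?thesis using T(2) by (rule ptimeI)
  qed
  have N: "ptime (\<lambda>e. NegENot (l e))"
  proof -
    have "ptime (\<lambda>e. ((True, True), l e))" by (intro ptime_intros l)
    then obtain T where T: "computes (\<lambda>e. ((True, True), l e)) T" "poly_bounded T" by (rule ptimeE)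
    have "computes (\<lambda>e. NegENot (l e)) T"
      using T(1) unfolding computes_def computes_with_def by (simp add: tree_of_body_elem_def)
    then show ?thesis using T(2) by (rule ptimeI)
  qed
  show "ptime (\<lambda>e. mk_elem (k e) (l e))" unfolding mk_elem_def by (intro ptime_intros k L E N)
qed

lemma ptime_trm_constructors [ptime_intros]:
  "ptime x \<Longrightarrow> ptime (\<lambda>e. Const (x e))" "ptime x \<Longrightarrow> ptime (\<lambda>e. Var (x e))"
  using ptime_constructors(1)[OF ptime_const[of False], of x]
    ptime_constructors(1)[OF ptime_const[of True], of x]
  by (simp_all add: mk_trm_def)

lemma ptime_elem_atom [ptime_intros]:
  assumes "ptime b" shows "ptime (\<lambda>e. elem_atom (b e))"
proof -
  have eq: "elem_atom b = literal_atom (elem_lit b)" for b :: "'b body_elem" by (cases b) auto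
  show ?thesis unfolding eq by (intro ptime_intros assms)
qed

lemma ptime_Lit_Pos [ptime_intros]: "ptime a \<Longrightarrow> ptime (\<lambda>e. Lit (Pos (a e)))"
  using ptime_constructors(4)[OF ptime_const[of "(False, False)"] ptime_constructors(3)[OF ptime_const[of False], of a]]
  by (simp add: mk_elem_def mk_literal_def)

lemma ptime_body_atoms [ptime_intros]: "ptime r \<Longrightarrow> ptime (\<lambda>e. body_atoms (r e))"
  unfolding body_atoms_def by (intro ptime_intros)

lemma ptime_rule_atoms [ptime_intros]: "ptime r \<Longrightarrow> ptime (\<lambda>e. rule_atoms (r e))"
  unfolding rule_atoms_def by (intro ptime_intros)

lemma ptime_prog_terms [ptime_intros]: "ptime rs \<Longrightarrow> ptime (\<lambda>e. prog_terms (rs e))"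
  unfolding prog_terms_def by (intro ptime_intros)

lemma ptime_prog_vars [ptime_intros]: "ptime rs \<Longrightarrow> ptime (\<lambda>e. prog_vars (rs e))"
  unfolding prog_vars_def by (intro ptime_intros)

lemma ptime_universe [ptime_intros]: "ptime rs \<Longrightarrow> ptime (\<lambda>e. universe (rs e))"
  unfolding universe_def prog_consts_def by (intro ptime_intros)

lemma ptime_inst [ptime_intros]:
  assumes "ptime rs" "ptime s" "ptime r"
  shows "ptime (\<lambda>e. inst (rs e) (s e) (r e))"
proof -
  have trm: "subst_trm \<sigma> t = (if is_var t then Const (\<sigma> (trm_name t)) else t)" for \<sigma> t by (cases t) auto
  have atom: "subst_atom \<sigma> a = Atom (pred a) (map (subst_trm \<sigma>) (args a))" for \<sigma> a by (cases a) auto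
  have elem: "map_body_elem f b = mk_elem (elem_kind b) (mk_literal (is_neg (elem_lit b)) (f (literal_atom (elem_lit b))))"
    for f :: "'i \<Rightarrow> 'j" and b
  proof (cases b)
    case (Lit l) then show ?thesis by (cases l) (auto simp: mk_elem_def mk_literal_def)
  next
    case (ENot l) then show ?thesis by (cases l) (auto simp: mk_elem_def mk_literal_def)
  next
    case (NegENot l) then show ?thesis by (cases l) (auto simp: mk_elem_def mk_literal_def)
  qed
  have rule: "map_rule f r = Rule (map f (head r)) (map (map_body_elem f) (body r))" for f :: "'i \<Rightarrow> 'j" and r
    by (cases r) auto
  have "ptime (\<lambda>p. inst (fst p) (fst (snd p)) (snd (snd p)))"
    unfolding inst_def rule elem atom trm assign_def by (intro ptime_intros)
  from ptime_comp[OF this ptime_Pair[OF assms(1) ptime_Pair[OF assms(2,3)]]] show ?thesis by simp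
qed

text \<open>Firing a rule adds at most its head atom to the state. The growth is bounded by the size
  of the rule alone, as required for folds.\<close>

lemma ptime_saturate [ptime_intros]:
  assumes "ptime w"
  shows "ptime (\<lambda>e. saturate (w e :: 'b::encodable rule list))"
proof -
  have fire: "fire st r = (if \<forall>a\<in>set (body_atoms r). a \<in> set (snd st)
     then (case head r of [] \<Rightarrow> (True, snd st) | a # _ \<Rightarrow> (fst st, a # snd st)) else st)"
    for st and r :: "'b rule" by (cases st) (auto split: list.split)
  have "sz (fire st r) \<le> sz st + (sz (e, r) + 5)" for st e and r :: "'b rule"
  proof -
    have "sz r = Suc (sz (head r) + sz (body r))" by (cases r) (simp add: sz_def tree_of_rule_def tree_of_prod_def)
    then show ?thesis by (cases st; cases "fst st"; cases "head r") (auto simp: fire)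
  qed
  then have "ptime (\<lambda>e. foldl fire (False, []) (w e))"
    by (intro ptime_foldl[where B = "\<lambda>p. sz p + 5"]) (unfold fire, (intro ptime_intros pb_intros assms)+)
  then show ?thesis by (simp add: saturate_def)
qed


section \<open>Reading programs\<close>

lemma ptime_encode_list:
  assumes f: "ptime f" and xs: "ptime xs"
  shows "ptime (\<lambda>e. Defs.enc_list f (xs e))"
  unfolding Defs.enc_list_def by (intro ptime_intros xs ptime_comp[OF f])

lemma ptime_enc_word [ptime_intros]: "ptime w \<Longrightarrow> ptime (\<lambda>e. enc_word (w e))"
  unfolding enc_word_def by (intro ptime_encode_list ptime_intros)

lemma ptime_enc_trm: "ptime enc_trm"
proof -
  have "enc_trm t = is_var t # enc_word (trm_name t)" for t by (cases t) auto
  then have eq: "enc_trm = (\<lambda>t. is_var t # enc_word (trm_name t))" by blast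
  show ?thesis unfolding eq by (intro ptime_intros)
qed

lemma ptime_enc_atom: "ptime enc_atom"
proof -
  have "enc_atom a = enc_word (pred a) @ Defs.enc_list enc_trm (args a)" for a by (cases a) auto
  then have eq: "enc_atom = (\<lambda>a. enc_word (pred a) @ Defs.enc_list enc_trm (args a))" by blast
  show ?thesis unfolding eq by (intro ptime_intros ptime_encode_list ptime_enc_trm)
qed

lemma ptime_enc_body_elem: "ptime enc_body_elem"
proof -
  have lit: "enc_literal l = is_neg l # enc_atom (literal_atom l)" for l by (cases l) auto
  have "enc_body_elem b = (if fst (elem_kind b) then [True, snd (elem_kind b)] else [False]) @
      is_neg (elem_lit b) # enc_atom (literal_atom (elem_lit b))" for b
    by (cases b) (auto simp: lit)
  then have eq: "enc_body_elem = (\<lambda>b. (if fst (elem_kind b) then [True, snd (elem_kind b)] else [False]) @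
      is_neg (elem_lit b) # enc_atom (literal_atom (elem_lit b)))" by blast
  show ?thesis unfolding eq by (intro ptime_intros ptime_comp[OF ptime_enc_atom])
qed

lemma ptime_enc_rule: "ptime enc_rule"
proof -
  have "enc_rule r = Defs.enc_list enc_atom (head r) @ Defs.enc_list enc_body_elem (body r)" for r
    by (cases r) auto
  then have eq: "enc_rule = (\<lambda>r. Defs.enc_list enc_atom (head r) @ Defs.enc_list enc_body_elem (body r))" by blast
  show ?thesis unfolding eq
    by (intro ptime_append ptime_encode_list ptime_enc_atom ptime_enc_body_elem ptime_intros)
qed

lemma ptime_enc_program [ptime_intros]: "ptime rs \<Longrightarrow> ptime (\<lambda>e. enc_program (rs e))"
  unfolding enc_program_def by (rule ptime_encode_list[OF ptime_enc_rule])

text \<open>The last component records that the end marker has been seen or that the input has run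
  out. On words that are no encodings the result is some list without meaning; such words are sorted
  out by encoding again.\<close>

fun parse_step :: "(bool list \<Rightarrow> 'a \<times> bool list) \<Rightarrow> 'a list \<times> bool list \<times> bool \<Rightarrow> 'a list \<times> bool list \<times> bool" where
  "parse_step p (acc, w, fin) = (if fin then (acc, w, fin) else
     (case w of [] \<Rightarrow> (acc, [], True)
      | b # u \<Rightarrow> if b then (fst (p u) # acc, snd (p u), False) else (acc, u, True)))"

definition parse_list :: "(bool list \<Rightarrow> 'a \<times> bool list) \<Rightarrow> bool list \<Rightarrow> 'a list \<times> bool list" where
  "parse_list p w = (let st = (parse_step p ^^ sz w) ([], w, False) in (rev (fst st), fst (snd st)))"

definition reads :: "(bool list \<Rightarrow> 'a \<times> bool list) \<Rightarrow> ('a \<Rightarrow> bool list) \<Rightarrow> bool" where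
  "reads p f \<longleftrightarrow> (\<forall>x u. p (f x @ u) = (x, u))"

text \<open>A parser that never enlarges the rest of the input can be repeated: each item is then
  parsed from a word no larger than the original one.\<close>

definition shrinks :: "(bool list \<Rightarrow> 'a \<times> bool list) \<Rightarrow> bool" where
  "shrinks p \<longleftrightarrow> (\<forall>w. sz (snd (p w)) \<le> sz w)"

lemma reads_list:
  assumes "reads p f"
  shows "reads (parse_list p) (Defs.enc_list f)"
proof -
  have fin: "(parse_step p ^^ n) (acc, w, True) = (acc, w, True)" for n acc w by (induction n) auto
  have "(parse_step p ^^ n) (acc, Defs.enc_list f xs @ u, False) = (rev xs @ acc, u, True)"
    if "length xs < n" for n acc xs u
    using that
  proof (induction xs arbitrary: n acc)
    case Nil
    then obtain k where "n = Suc k" by (cases n) auto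
    then show ?case using fin by (simp add: Defs.enc_list_def funpow_Suc_right del: funpow.simps)
  next
    case (Cons x xs)
    then obtain k where k: "n = Suc k" "length xs < k" by (cases n) auto
    have "Defs.enc_list f (x # xs) @ u = True # f x @ Defs.enc_list f xs @ u" by (simp add: Defs.enc_list_def)
    moreover have "p (f x @ Defs.enc_list f xs @ u) = (x, Defs.enc_list f xs @ u)"
      using assms by (simp add: reads_def)
    ultimately show ?case using Cons.IH[OF k(2), of "x # acc"]
      by (simp add: k(1) funpow_Suc_right del: funpow.simps)
  qed
  moreover have "length xs < sz (Defs.enc_list f xs @ u)" for xs u
  proof -
    have "length xs < length (Defs.enc_list f xs @ u)" by (induction xs) (auto simp: Defs.enc_list_def)
    then show ?thesis using sz_bits(2) order_less_le_trans by blast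
  qed
  ultimately show ?thesis by (simp add: reads_def parse_list_def)
qed

lemma shrinks_iterate:
  assumes "shrinks p"
  shows "sz (fst (snd ((parse_step p ^^ n) (acc, w, fin)))) \<le> sz w"
proof (induction n)
  case (Suc n)
  obtain acc' w' fin' where st: "(parse_step p ^^ n) (acc, w, fin) = (acc', w', fin')" by (metis prod_cases3)
  have "sz (snd (p v)) \<le> sz v" for v using assms by (simp add: shrinks_def)
  from this[of "tl w'"] show ?case using Suc st by (auto split: list.split)
qed simp

lemma shrinks_list: "shrinks p \<Longrightarrow> shrinks (parse_list p)"
  using shrinks_iterate unfolding shrinks_def[of "parse_list p"] by (auto simp: parse_list_def Let_def)

text \<open>After \<open>i\<close> rounds there are at most \<open>i\<close> items, each of size
  polynomial in the original input because the rest never grows. This yields the bound on the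
  intermediate states.\<close>

lemma ptime_parse_list:
  assumes p: "ptime p" and shr: "shrinks p"
  shows "ptime (parse_list p)"
proof -
  have step: "parse_step p st = (if snd (snd st) then st else
     (case fst (snd st) of [] \<Rightarrow> (fst st, [], True)
      | b # u \<Rightarrow> if b then (fst (p u) # fst st, snd (p u), False) else (fst st, u, True)))" for st
    by (cases st) (auto split: list.split)
  obtain d where d: "\<And>w. sz (p w) \<le> (sz w + 2) ^ d"
    using poly_bounded_ptime[OF p] unfolding poly_bounded_def by blast
  have bound: "sz (fst ((parse_step p ^^ i) ([], w, False))) \<le> i * ((sz w + 2) ^ d + 1) + 1" for w i
  proof (induction i)
    case (Suc i)
    obtain acc v fin where st: "(parse_step p ^^ i) ([], w, False) = (acc, v, fin)" by (metis prod_cases3)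
    have v: "sz v \<le> sz w" using shrinks_iterate[OF shr, of i "[]" w False] st by simp
    show ?case
    proof (cases "fin \<or> v = []")
      case True
      then show ?thesis using Suc st by auto
    next
      case False
      then obtain b u where u: "v = b # u" by (cases v) auto
      have "sz (fst (p u)) \<le> sz (p u)" by (cases "p u") auto
      also have "\<dots> \<le> (sz u + 2) ^ d" by (rule d)
      also have "\<dots> \<le> (sz w + 2) ^ d" by (rule power_mono) (use v u in auto)
      finally show ?thesis using Suc st u False by auto
    qed
  qed simp
  have "ptime (\<lambda>w. (parse_step p ^^ sz w) ([], w, False))"
  proof (rule ptime_funpow)
    show "ptime (\<lambda>q. parse_step p (snd q))"
      unfolding step by (intro ptime_intros ptime_comp[OF p])
    show "poly_bounded (\<lambda>w. sz w * ((sz w + 2) ^ d + 1) + 1 + sz w + 5)" by (intro pb_intros)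
    fix w :: "bool list" and i assume i: "i \<le> sz w"
    obtain acc v fin where st: "(parse_step p ^^ i) ([], w, False) = (acc, v, fin)" by (metis prod_cases3)
    have "sz v \<le> sz w" using shrinks_iterate[OF shr, of i "[]" w False] st by simp
    moreover have "sz acc \<le> i * ((sz w + 2) ^ d + 1) + 1" using bound[of i w] st by simp
    moreover have "i * ((sz w + 2) ^ d + 1) \<le> sz w * ((sz w + 2) ^ d + 1)" using i by (rule mult_le_mono1)
    ultimately show "sz ((parse_step p ^^ i) ([], w, False)) \<le> sz w * ((sz w + 2) ^ d + 1) + 1 + sz w + 5"
      unfolding st by (cases fin) auto
  qed (intro ptime_intros)+
  then show ?thesis unfolding parse_list_def[abs_def] Let_def by (intro ptime_intros)
qed

definition parse_bit :: "bool list \<Rightarrow> bool \<times> bool list" where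
  "parse_bit w = (case w of [] \<Rightarrow> (False, []) | b # u \<Rightarrow> (b, u))"

definition parse_pair ::
  "(bool list \<Rightarrow> 'a \<times> bool list) \<Rightarrow> (bool list \<Rightarrow> 'b \<times> bool list) \<Rightarrow> ('a \<Rightarrow> 'b \<Rightarrow> 'c) \<Rightarrow> bool list \<Rightarrow> 'c \<times> bool list" where
  "parse_pair p q h w = (let s = p w; t = q (snd s) in (h (fst s) (fst t), snd t))"

definition parser :: "(bool list \<Rightarrow> 'a::encodable \<times> bool list) \<Rightarrow> ('a \<Rightarrow> bool list) \<Rightarrow> bool" where
  "parser p f \<longleftrightarrow> ptime p \<and> shrinks p \<and> reads p f"

lemma parser_bit: "parser parse_bit (\<lambda>b. [b])"
  unfolding parser_def
proof (intro conjI)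
  show "ptime parse_bit" unfolding parse_bit_def[abs_def] by (intro ptime_intros)
qed (auto simp: parse_bit_def shrinks_def reads_def split: list.split)

lemma parser_list: "parser p f \<Longrightarrow> parser (parse_list p) (Defs.enc_list f)"
  by (simp add: parser_def ptime_parse_list shrinks_list reads_list)

lemma parser_pair:
  assumes p: "parser p f" and q: "parser q g" and h: "ptime (\<lambda>x. h (fst x) (snd x))"
    and eq: "\<And>x. k x = f (a x) @ g (b x) \<and> h (a x) (b x) = x"
  shows "parser (parse_pair p q h) k"
  unfolding parser_def
proof (intro conjI)
  have pq: "ptime p" "ptime q" "shrinks p" "shrinks q" "reads p f" "reads q g"
    using p q by (auto simp: parser_def)
  have h': "ptime u \<Longrightarrow> ptime v \<Longrightarrow> ptime (\<lambda>e. h (u e) (v e))" for u v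
    using ptime_comp[OF h ptime_Pair[of u v]] by simp
  show "ptime (parse_pair p q h)"
    unfolding parse_pair_def[abs_def] by (intro ptime_intros h' ptime_comp[OF pq(1)] ptime_comp[OF pq(2)])
  show "shrinks (parse_pair p q h)"
    using pq(3,4) unfolding shrinks_def parse_pair_def Let_def by (auto intro: order_trans)
  show "reads (parse_pair p q h) k"
    using pq(5,6) eq unfolding reads_def parse_pair_def Let_def by simp
qed

definition parse_word where "parse_word = parse_list parse_bit"
definition parse_trm where "parse_trm = parse_pair parse_bit parse_word mk_trm"
definition parse_atom where "parse_atom = parse_pair parse_word (parse_list parse_trm) Atom"
definition parse_literal where "parse_literal = parse_pair parse_bit parse_atom mk_literal"
definition parse_kind :: "bool list \<Rightarrow> (bool \<times> bool) \<times> bool list" where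
  "parse_kind w = (case w of [] \<Rightarrow> ((False, False), []) | b # u \<Rightarrow>
     if b then (case u of [] \<Rightarrow> ((True, False), []) | c # v \<Rightarrow> ((True, c), v)) else ((False, False), u))"
definition parse_body_elem where "parse_body_elem = parse_pair parse_kind parse_literal mk_elem"
definition parse_rule where "parse_rule = parse_pair (parse_list parse_atom) (parse_list parse_body_elem) Rule"
definition parse_program where "parse_program = parse_list parse_rule"

lemma parser_word: "parser parse_word enc_word"
  unfolding parse_word_def enc_word_def by (rule parser_list[OF parser_bit])

lemma parser_trm: "parser parse_trm enc_trm"
  unfolding parse_trm_def
proof (rule parser_pair[OF parser_bit parser_word])
  show "enc_trm t = [is_var t] @ enc_word (trm_name t) \<and> mk_trm (is_var t) (trm_name t) = t" for t
    by (cases t) (auto simp: mk_trm_def)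
qed (intro ptime_intros)

lemma parser_atom: "parser parse_atom enc_atom"
  unfolding parse_atom_def
proof (rule parser_pair[OF parser_word parser_list[OF parser_trm]])
  show "enc_atom a = enc_word (pred a) @ Defs.enc_list enc_trm (args a) \<and> Atom (pred a) (args a) = a" for a
    by (cases a) auto
qed (intro ptime_intros)

lemma parser_literal: "parser parse_literal enc_literal"
  unfolding parse_literal_def
proof (rule parser_pair[OF parser_bit parser_atom])
  show "enc_literal l = [is_neg l] @ enc_atom (literal_atom l) \<and> mk_literal (is_neg l) (literal_atom l) = l" for l
    by (cases l) (auto simp: mk_literal_def)
qed (intro ptime_intros)

text \<open>The tag of a body element is read through a code of all pairs of bits that identifies
  \<open>(False, True)\<close> with \<open>(False, False)\<close>, so \<open>parse_kind\<close> is not a parser in the above sense.\<close>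

lemma parser_body_elem: "parser parse_body_elem enc_body_elem"
  unfolding parser_def
proof (intro conjI)
  have lit: "ptime parse_literal" "shrinks parse_literal" "reads parse_literal enc_literal"
    using parser_literal by (auto simp: parser_def)
  have k: "ptime parse_kind" unfolding parse_kind_def[abs_def] by (intro ptime_intros)
  have k': "sz (snd (parse_kind w)) \<le> sz w" for w
    by (auto simp: parse_kind_def split: list.split)
  show "ptime parse_body_elem"
    unfolding parse_body_elem_def parse_pair_def[abs_def]
    by (intro ptime_intros ptime_comp[OF lit(1)] ptime_comp[OF k])
  show "shrinks parse_body_elem"
    using lit(2) k' unfolding shrinks_def parse_body_elem_def parse_pair_def Let_def by (auto intro: order_trans)
  have "parse_body_elem (enc_body_elem b @ u) = (b, u)" for b u
    using lit(3) by (cases b) (auto simp: parse_body_elem_def parse_pair_def parse_kind_def reads_def mk_elem_def)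
  then show "reads parse_body_elem enc_body_elem" by (simp add: reads_def)
qed

lemma parser_rule: "parser parse_rule enc_rule"
  unfolding parse_rule_def
proof (rule parser_pair[OF parser_list[OF parser_atom] parser_list[OF parser_body_elem]])
  show "enc_rule r = Defs.enc_list enc_atom (head r) @ Defs.enc_list enc_body_elem (body r) \<and>
    Rule (head r) (body r) = r" for r :: "atom rule"
    by (cases r) auto
qed (intro ptime_intros)

lemma parser_program: "parser parse_program enc_program"
  unfolding parse_program_def enc_program_def by (rule parser_list[OF parser_rule])

text \<open>Total on all words. A word encodes a program iff encoding its decoding gives the word
  back.\<close>

definition decode :: "bool list \<Rightarrow> atom rule list" where
  "decode w = fst (parse_program w)"

lemma ptime_decode [ptime_intros]: "ptime w \<Longrightarrow> ptime (\<lambda>e. decode (w e))"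
  unfolding decode_def using parser_program by (simp add: parser_def ptime_fst ptime_comp[of parse_program w])

lemma decode_enc_program: "decode (enc_program rs) = rs"
  using parser_program unfolding decode_def parser_def reads_def by (metis append.right_neutral fst_conv)

lemma ptime_parse_word [ptime_intros]: "ptime w \<Longrightarrow> ptime (\<lambda>e. parse_word (w e))"
  using parser_word by (simp add: parser_def ptime_comp[of parse_word w])

lemma parse_pair_code: "parse_word (pair_code x y) = (x, y)"
  using parser_word unfolding parser_def reads_def pair_code_def by metis


section \<open>Membership\<close>

text \<open>The third alternative is \<open>M a\<close>, which is stored as the negation-as-failure
  of a negative literal.\<close>

definition horn_check :: "atom rule \<Rightarrow> bool" where
  "horn_check r \<longleftrightarrow> length (head r) \<le> 1 \<and> (\<forall>b\<in>set (body r).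
     (elem_kind b = (False, False) \<and> \<not> is_neg (elem_lit b)) \<or>
     (elem_kind b = (True, True) \<and> \<not> is_neg (elem_lit b)) \<or>
     (elem_kind b = (True, False) \<and> is_neg (elem_lit b)))"

text \<open>In a Horn rule no body element is a plain negated literal, so only head variables have
  to be covered. Occurrences under \<open>K\<close> or \<open>M\<close> do not count as covering,
  hence the restriction to the tag \<open>(False, False)\<close>.\<close>

definition safe_check :: "atom rule \<Rightarrow> bool" where
  "safe_check r \<longleftrightarrow> (\<forall>a\<in>set (head r). \<forall>t\<in>set (args a). is_var t \<longrightarrow>
     (\<exists>b\<in>set (body r). elem_kind b = (False, False) \<and> t \<in> set (args (elem_atom b))))"

lemma horn_check: "horn_check r \<longleftrightarrow> horn r"
proof -
  have "(elem_kind b = (False, False) \<and> \<not> is_neg (elem_lit b)) \<or>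
     (elem_kind b = (True, True) \<and> \<not> is_neg (elem_lit b)) \<or>
     (elem_kind b = (True, False) \<and> is_neg (elem_lit b)) \<longleftrightarrow>
     (\<exists>a. b = Lit (Pos a) \<or> b = Know (Pos a) \<or> b = May (Pos a))" for b :: "atom body_elem"
  proof (cases b)
    case (Lit l) then show ?thesis by (cases l) auto
  next
    case (ENot l) then show ?thesis by (cases l) auto
  next
    case (NegENot l) then show ?thesis by (cases l) auto
  qed
  then show ?thesis by (simp add: horn_check_def horn_def)
qed

lemma safe_check:
  assumes "horn r"
  shows "safe_check r \<longleftrightarrow> safe r"
proof -
  have pos: "b = Lit (Pos (elem_atom b))" if "b \<in> set (body r)" "elem_kind b = (False, False)" for b
    using assms that(1) by (cases rule: horn_elem) (use that in auto)
  have "pos_body r = elem_atom ` {b \<in> set (body r). elem_kind b = (False, False)}"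
    using pos unfolding pos_body_def by force
  then have "(\<exists>a\<in>pos_body r. t \<in> set (args a)) \<longleftrightarrow>
      (\<exists>b\<in>set (body r). elem_kind b = (False, False) \<and> t \<in> set (args (elem_atom b)))" for t by auto
  moreover have "neg_body r = {}"
    using assms by (auto simp: neg_body_def elim!: horn_elem)
  then have "safe r \<longleftrightarrow> (\<forall>a\<in>set (head r). \<forall>x. Var x \<in> set (args a) \<longrightarrow> (\<exists>c\<in>pos_body r. Var x \<in> set (args c)))"
    unfolding safe_def vars_atom_def by blast
  moreover have "(\<forall>t\<in>A. is_var t \<longrightarrow> Q t) \<longleftrightarrow> (\<forall>x. Var x \<in> A \<longrightarrow> Q (Var x))" for A Q
    by (metis is_var.elims(2) is_var.simps(2))
  ultimately show ?thesis unfolding safe_check_def by simp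
qed

lemma EHorn_check: "set rs \<in> EHorn \<longleftrightarrow> (\<forall>r\<in>set rs. horn_check r \<and> safe_check r)"
  by (auto simp: EHorn_iff horn_check safe_check)

lemma ground_check: "ground (set rs) \<longleftrightarrow> (\<forall>t\<in>set (prog_terms rs). \<not> is_var t)"
proof -
  have "is_var t \<longleftrightarrow> (\<exists>x. t = Var x)" for t by (cases t) auto
  then show ?thesis by (auto simp: ground_def set_prog_terms vars_atom_def)
qed

lemma arity_check: "arity_at_most m (set rs) \<longleftrightarrow> (\<forall>r\<in>set rs. \<forall>a\<in>set (rule_atoms r). length (args a) \<le> m)"
  by (auto simp: arity_at_most_def atoms_def set_rule_atoms_list)

lemma ptime_EHorn [ptime_intros]: "ptime rs \<Longrightarrow> ptime (\<lambda>e. set (rs e) \<in> EHorn)"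
  unfolding EHorn_check horn_check_def safe_check_def by (intro ptime_intros)

lemma ptime_ground [ptime_intros]: "ptime rs \<Longrightarrow> ptime (\<lambda>e. ground (set (rs e)))"
  unfolding ground_check by (intro ptime_intros)

lemma ptime_arity [ptime_intros]: "ptime rs \<Longrightarrow> ptime (\<lambda>e. arity_at_most m (set (rs e)))"
  unfolding arity_check by (intro ptime_intros)

text \<open>Turns the existential description of the language into a test on the word itself, to
  which the closure rules for polynomial time apply.\<close>

lemma world_view_existence_eq:
  "world_view_existence {P \<in> EHorn. Q P} =
    {x. enc_program (decode x) = x \<and> set (decode x) \<in> EHorn \<and> Q (set (decode x)) \<and>
        \<not> inconsistent (grd (set (decode x)))}"
  unfolding world_view_existence_def
  using world_view_EHorn decode_enc_program by (auto; metis)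

definition refuted :: "atom rule list \<Rightarrow> bool" where
  "refuted w = fst (saturate (concat (replicate (Suc (length w)) w)))"

lemma refuted_iff: "\<forall>r\<in>set w. horn r \<Longrightarrow> refuted w \<longleftrightarrow> inconsistent (set w)"
  unfolding refuted_def by (rule saturate_rounds) auto

lemma ptime_refuted [ptime_intros]: "ptime w \<Longrightarrow> ptime (\<lambda>e. refuted (w e))"
  unfolding refuted_def by (intro ptime_intros)

theorem ground_in_P: "world_view_existence {P \<in> EHorn. ground P} \<in> class_P"
proof -
  have "world_view_existence {P \<in> EHorn. ground P} =
      {x. enc_program (decode x) = x \<and> set (decode x) \<in> EHorn \<and> ground (set (decode x)) \<and> \<not> refuted (decode x)}"
    unfolding world_view_existence_eq using refuted_iff by (auto simp: grd_ground EHorn_iff)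
  also have "\<dots> \<in> class_P" by (rule ptime_class_P) (intro ptime_intros)
  finally show ?thesis .
qed


text \<open>One application adds one coordinate in all possible ways. The exponential list of all
  words of length \<open>k\<close> thus arises from only \<open>k\<close> rounds of a
  polynomial-time step.\<close>

definition extend_all :: "'a list \<Rightarrow> 'a list list \<Rightarrow> 'a list list" where
  "extend_all cs S = concat (map (\<lambda>s. map (\<lambda>c. c # s) cs) S)"

lemma set_extend_all: "set ((extend_all cs ^^ k) [[]]) = {s. length s = k \<and> set s \<subseteq> set cs}"
proof (induction k)
  case (Suc k)
  have "set (extend_all cs S) = {c # s | c s. c \<in> set cs \<and> s \<in> set S}" for S
    by (auto simp: extend_all_def)
  then have "set ((extend_all cs ^^ Suc k) [[]]) = {c # s | c s. c \<in> set cs \<and> length s = k \<and> set s \<subseteq> set cs}"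
    by (simp add: Suc)
  also have "\<dots> = {s. length s = Suc k \<and> set s \<subseteq> set cs}"
    by (auto simp: length_Suc_conv)
  finally show ?case .
qed auto

lemma sz_extend_all: "sz (extend_all cs S) \<le> 2 * sz cs * sz S"
proof (induction S)
  case Nil
  show ?case using sz_pos[of cs] by (simp add: extend_all_def)
next
  case (Cons s S)
  have "sz (map (\<lambda>c. c # s) cs) \<le> sz cs * (2 + sz s)"
  proof (induction cs)
    case (Cons c cs)
    have "sz (map (\<lambda>c. c # s) (c # cs)) = 2 + sz c + sz s + sz (map (\<lambda>c. c # s) cs)" by simp
    also have "\<dots> \<le> (1 + sz c) * (2 + sz s) + sz cs * (2 + sz s)"
      using Cons by (intro add_mono) (auto simp: algebra_simps)
    finally show ?case by (simp add: algebra_simps)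
  qed simp
  moreover have "sz (extend_all cs (s # S)) + 1 = sz (map (\<lambda>c. c # s) cs) + sz (extend_all cs S)"
    using sz_append by (simp add: extend_all_def)
  ultimately have "sz (extend_all cs (s # S)) \<le> sz cs * (2 + sz s) + 2 * sz cs * sz S" using Cons by linarith
  also have "\<dots> \<le> 2 * sz cs * sz (s # S)" by (simp add: algebra_simps)
  finally show ?case .
qed

definition instances :: "atom rule list \<Rightarrow> name list list \<Rightarrow> atom rule list" where
  "instances rs S = concat (map (\<lambda>r. map (\<lambda>s. inst rs s r) S) rs)"

lemma set_instances:
  "set (instances rs ((extend_all (universe rs) ^^ length (prog_vars rs)) [[]])) = grd (set rs)"
  unfolding grd_eq_inst by (auto simp: instances_def set_extend_all)

lemma exp_add_le: "(a::nat) \<le> 2 ^ i \<Longrightarrow> b \<le> 2 ^ j \<Longrightarrow> a + b \<le> 2 ^ (i + j + 1)"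
proof -
  assume "a \<le> 2 ^ i" "b \<le> 2 ^ j"
  moreover have "(2::nat) ^ i * 1 \<le> 2 ^ i * 2 ^ j" "1 * (2::nat) ^ j \<le> 2 ^ i * 2 ^ j"
    by (intro mult_mono; simp)+
  ultimately have "a + b \<le> 2 * (2 ^ i * 2 ^ j)" by linarith
  then show ?thesis by (simp add: power_add)
qed

theorem nonground_in_EXP: "world_view_existence {P \<in> EHorn. \<not> ground P} \<in> class_EXP"
proof -
  define f where "f st = (fst st, extend_all (universe (decode (fst st))) (snd st))"
    for st :: "bool list \<times> name list list"
  define n where "n x = length (prog_vars (decode x))" for x
  define u where "u x = sz (universe (decode x))" for x
  have iter: "(f ^^ i) (x, S) = (x, (extend_all (universe (decode x)) ^^ i) S)" for i x S
    by (induction i) (auto simp: f_def)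
  have n: "ptime n" and u: "ptime u" unfolding n_def[abs_def] u_def[abs_def] by (intro ptime_intros)+
  have "etime (\<lambda>x. (f ^^ n x) (x, [[]]))"
  proof (rule etime_funpow[OF n])
    show "ptime (\<lambda>p. f (snd p))" unfolding f_def extend_all_def by (intro ptime_intros)
    show "poly_bounded (\<lambda>x. (sz x + 1) + (2 + (1 + u x) * n x) + 1)"
      by (intro pb_intros poly_bounded_nat n u)
    fix x i assume i: "i \<le> n x"
    \<comment> \<open>The factor 3 is the size of the initial list \<open>[[]]\<close>; each round
      multiplies the size by at most twice the size of the universe.\<close>
    have "sz ((extend_all (universe (decode x)) ^^ i) [[]]) \<le> 3 * (2 * u x) ^ i"
    proof (induction i)
      case (Suc i)
      have "sz ((extend_all (universe (decode x)) ^^ Suc i) [[]]) \<le> 2 * u x * sz ((extend_all (universe (decode x)) ^^ i) [[]])"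
        unfolding u_def using sz_extend_all by simp
      also have "\<dots> \<le> 2 * u x * (3 * (2 * u x) ^ i)" by (rule mult_le_mono2[OF Suc])
      finally show ?case by (simp add: mult_ac)
    qed simp
    also have "\<dots> \<le> 2 ^ 2 * 2 ^ ((1 + u x) * n x)"
    proof (intro mult_mono)
      have "2 * u x \<le> 2 ^ (1 + u x)" using less_exp[of "u x"] by simp
      then have "(2 * u x) ^ i \<le> (2 ^ (1 + u x)) ^ i" by (rule power_mono) simp
      also have "\<dots> \<le> 2 ^ ((1 + u x) * n x)"
        unfolding power_mult[symmetric] by (rule power_increasing[OF mult_le_mono2[OF i]]) simp
      finally show "(2 * u x) ^ i \<le> 2 ^ ((1 + u x) * n x)" .
    qed auto
    finally have "sz ((extend_all (universe (decode x)) ^^ i) [[]]) \<le> 2 ^ (2 + (1 + u x) * n x)"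
      by (simp only: power_add)
    moreover have "sz x + 1 \<le> 2 ^ (sz x + 1)" by (rule less_imp_le[OF less_exp])
    moreover have "sz ((f ^^ i) (x, [[]])) = (sz x + 1) + sz ((extend_all (universe (decode x)) ^^ i) [[]])"
      by (simp add: iter)
    ultimately show "sz ((f ^^ i) (x, [[]])) \<le> 2 ^ ((sz x + 1) + (2 + (1 + u x) * n x) + 1)"
      by (simp only: exp_add_le)
  qed (intro ptime_intros)
  moreover have "ptime (\<lambda>q. enc_program (decode (fst q)) = fst q \<and> set (decode (fst q)) \<in> EHorn \<and>
      \<not> ground (set (decode (fst q))) \<and> \<not> refuted (instances (decode (fst q)) (snd q)))" (is "ptime ?g")
    unfolding instances_def by (intro ptime_intros)
  \<comment> \<open>The test is polynomial in the exponentially large list of instances. The input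
    word is kept in the state because the test reads it too.\<close>
  ultimately have "etime (\<lambda>x. ?g ((f ^^ n x) (x, [[]])))" by (rule etime_comp[rotated])
  then have "{x. ?g ((f ^^ n x) (x, [[]]))} \<in> class_EXP" by (rule etime_class_EXP)
  also have "{x. ?g ((f ^^ n x) (x, [[]]))} = world_view_existence {P \<in> EHorn. \<not> ground P}"
    unfolding world_view_existence_eq
  proof (intro Collect_cong)
    fix x
    let ?ws = "instances (decode x) ((extend_all (universe (decode x)) ^^ length (prog_vars (decode x))) [[]])"
    have "refuted ?ws \<longleftrightarrow> inconsistent (grd (set (decode x)))" if "set (decode x) \<in> EHorn"
    proof -
      have "\<forall>r\<in>set ?ws. horn r"
        using that unfolding set_instances by (auto simp: grd_def EHorn_iff intro: horn_map_rule)
      from refuted_iff[OF this] show ?thesis by (simp only: set_instances)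
    qed
    then show "?g ((f ^^ n x) (x, [[]])) \<longleftrightarrow> enc_program (decode x) = x \<and> set (decode x) \<in> EHorn \<and>
        \<not> ground (set (decode x)) \<and> \<not> inconsistent (grd (set (decode x)))"
      unfolding iter n_def fst_conv snd_conv by blast
  qed
  finally show ?thesis .
qed

subsection \<open>Bounded arity\<close>

text \<open>A derivation is certified by a list of rules: a rule with head \<open>A # H\<close> stands for the instance
  of the rule with head \<open>H\<close> that assigns the arguments of \<open>A\<close> to the variables of the program.\<close>

definition cert_rule :: "atom rule list \<Rightarrow> atom rule \<Rightarrow> atom rule" where
  "cert_rule rs q = inst rs (map trm_name (args (hd (head q)))) (Rule (tl (head q)) (body q))"

text \<open>No length is checked, since every list of constants of the universe determines a ground
  instance. An empty head is harmless too: the list is then read off a fixed unspecified atom and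
  still has to pass the test.\<close>

definition cert_ok :: "atom rule list \<Rightarrow> atom rule \<Rightarrow> bool" where
  "cert_ok rs q \<longleftrightarrow> Rule (tl (head q)) (body q) \<in> set rs \<and>
     (\<forall>t\<in>set (args (hd (head q))). trm_name t \<in> set (universe rs))"

text \<open>A certificate is itself a list of rules, so the code and the parser for programs serve
  for certificates as well. The predicate name of the added atom carries no information.\<close>

definition cert_of :: "name list \<Rightarrow> atom rule \<Rightarrow> atom rule" where
  "cert_of s r = Rule (Atom [] (map Const s) # head r) (body r)"

lemma cert_rule_in_grd: "cert_ok rs q \<Longrightarrow> cert_rule rs q \<in> grd (set rs)"
  unfolding cert_ok_def cert_rule_def by (rule inst_in_grd) auto

lemma cert_of:
  assumes "r \<in> set rs" "set s \<subseteq> set (universe rs)"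
  shows "cert_ok rs (cert_of s r)" "cert_rule rs (cert_of s r) = inst rs s r"
  using assms by (auto simp: cert_ok_def cert_rule_def cert_of_def comp_def)

definition refutation :: "atom rule list \<Rightarrow> atom rule list \<Rightarrow> bool" where
  "refutation rs ws \<longleftrightarrow> (\<forall>q\<in>set ws. cert_ok rs q) \<and> fst (saturate (map (cert_rule rs) ws))"

lemma ptime_refutation [ptime_intros]:
  assumes "ptime rs" "ptime ws"
  shows "ptime (\<lambda>e. refutation (rs e) (ws e))"
proof -
  have "ptime (\<lambda>p. refutation (fst p) (snd p))"
    unfolding refutation_def cert_ok_def cert_rule_def by (intro ptime_intros)
  from ptime_comp[OF this ptime_Pair[OF assms]] show ?thesis by simp
qed

section \<open>Lengths of encodings and of certificates\<close>

lemma length_enc_list_mem: "x \<in> set xs \<Longrightarrow> length (f x) \<le> length (Defs.enc_list f xs)"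
  by (induction xs) (auto simp: Defs.enc_list_def)

lemma length_enc_list_sum:
  "(\<And>x. x \<in> set xs \<Longrightarrow> g x \<le> length (f x)) \<Longrightarrow> sum_list (map g xs) + length xs \<le> length (Defs.enc_list f xs)"
  by (induction xs) (force simp: Defs.enc_list_def)+

lemma length_enc_list_le:
  "(\<And>x. x \<in> set xs \<Longrightarrow> length (f x) \<le> b) \<Longrightarrow> length (Defs.enc_list f xs) \<le> length xs * (b + 1) + 1"
  by (induction xs) (force simp: Defs.enc_list_def)+

lemma length_enc_body_elem: "length (enc_atom (elem_atom b)) \<le> length (enc_body_elem b)"
proof (cases b)
  case (Lit l) then show ?thesis by (cases l) auto
next
  case (ENot l) then show ?thesis by (cases l) auto
next
  case (NegENot l) then show ?thesis by (cases l) auto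
qed

lemma length_enc_atom:
  "length (args a) \<le> length (enc_atom a)" "t \<in> set (args a) \<Longrightarrow> length (enc_trm t) \<le> length (enc_atom a)"
proof -
  obtain p ts where a: "a = Atom p ts" by (cases a)
  show "length (args a) \<le> length (enc_atom a)"
    using length_enc_list_sum[of ts "\<lambda>_. 0" enc_trm] by (simp add: a)
  show "t \<in> set (args a) \<Longrightarrow> length (enc_trm t) \<le> length (enc_atom a)"
    using length_enc_list_mem[of t ts enc_trm] by (simp add: a)
qed

lemma length_enc_rule:
  "(\<Sum>a\<leftarrow>rule_atoms r. length (enc_atom a) + 1) \<le> length (enc_rule r)"
proof -
  obtain H B where r: "r = Rule H B" by (cases r)
  have "(\<Sum>a\<leftarrow>H. length (enc_atom a)) + length H \<le> length (Defs.enc_list enc_atom H)"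
    by (rule length_enc_list_sum) simp
  moreover have "(\<Sum>b\<leftarrow>B. length (enc_atom (elem_atom b))) + length B \<le> length (Defs.enc_list enc_body_elem B)"
    by (rule length_enc_list_sum) (rule length_enc_body_elem)
  ultimately show ?thesis
    by (simp add: r rule_atoms_def body_atoms_def comp_def sum_list_Suc)
qed

lemma length_enc_program:
  fixes rs :: "atom rule list"
  defines "n \<equiv> length (enc_program rs)"
  shows "r \<in> set rs \<Longrightarrow> length (enc_rule r) \<le> n"
    and "length (prog_terms rs) \<le> n"
    and "t \<in> set (prog_terms rs) \<Longrightarrow> length (enc_trm t) \<le> n"
    and "card (pred ` atoms (set rs)) \<le> n"
proof -
  show rule: "r \<in> set rs \<Longrightarrow> length (enc_rule r) \<le> n" for r
    unfolding n_def enc_program_def by (rule length_enc_list_mem)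
  have sum: "(\<Sum>r\<leftarrow>rs. \<Sum>a\<leftarrow>rule_atoms r. length (enc_atom a) + 1) + length rs \<le> n"
    unfolding n_def enc_program_def by (rule length_enc_list_sum) (rule length_enc_rule)
  have "length (prog_terms rs) = (\<Sum>r\<leftarrow>rs. \<Sum>a\<leftarrow>rule_atoms r. length (args a))"
    by (simp add: prog_terms_def length_concat comp_def)
  also have "\<dots> \<le> (\<Sum>r\<leftarrow>rs. \<Sum>a\<leftarrow>rule_atoms r. length (enc_atom a) + 1)"
    by (intro sum_list_mono) (use length_enc_atom(1) le_SucI in fastforce)
  finally show "length (prog_terms rs) \<le> n" using sum by linarith
  show "length (enc_trm t) \<le> n" if t: "t \<in> set (prog_terms rs)"
  proof -
    obtain r a where ra: "r \<in> set rs" "a \<in> set (rule_atoms r)" "t \<in> set (args a)"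
      using t by (auto simp: prog_terms_def)
    have "length (enc_trm t) \<le> length (enc_atom a)" using length_enc_atom(2) ra(3) .
    also have "\<dots> \<le> (\<Sum>a\<leftarrow>rule_atoms r. length (enc_atom a) + 1)"
      using member_le_sum_list[of "length (enc_atom a) + 1" "map (\<lambda>a. length (enc_atom a) + 1) (rule_atoms r)"] ra(2)
      by auto
    also have "\<dots> \<le> length (enc_rule r)" by (rule length_enc_rule)
    finally show ?thesis using rule[OF ra(1)] by linarith
  qed
  have "atoms (set rs) = set (concat (map rule_atoms rs))"
    by (auto simp: atoms_def set_rule_atoms_list)
  then have "card (pred ` atoms (set rs)) \<le> length (concat (map rule_atoms rs))"
    by (metis card_length length_map list.set_map)
  also have "\<dots> \<le> (\<Sum>r\<leftarrow>rs. \<Sum>a\<leftarrow>rule_atoms r. length (enc_atom a) + 1)"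
    unfolding length_concat map_map comp_def
  proof (intro sum_list_mono)
    fix r show "length (rule_atoms r) \<le> (\<Sum>a\<leftarrow>rule_atoms r. length (enc_atom a) + 1)"
      by (simp add: sum_list_Suc)
  qed
  finally show "card (pred ` atoms (set rs)) \<le> n" using sum by linarith
qed

text \<open>A derivable atom consists of a predicate name of the program and a list of at most
  \<open>m\<close> constants. There are at most \<open>n\<close> names, and at most
  \<open>(n + 1) ^ m\<close> lists of each of the \<open>m + 1\<close> possible lengths.\<close>

lemma card_derived:
  assumes arity: "arity_at_most m (set rs)" and n: "n = length (enc_program rs)"
  shows "finite (derived (grd (set rs)))" "card (derived (grd (set rs))) \<le> n * ((m + 1) * (n + 1) ^ m)"
proof -
  let ?U = "Const ` set (universe rs)" and ?P = "pred ` atoms (set rs)"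
  let ?T = "{ts. set ts \<subseteq> ?U \<and> length ts \<le> m}"
  let ?A = "(\<lambda>(p, ts). Atom p ts) ` (?P \<times> ?T)"
  have "derived (grd (set rs)) \<subseteq> ?A"
  proof
    fix a assume "a \<in> derived (grd (set rs))"
    then obtain r where r: "r \<in> grd (set rs)" "a \<in> set_rule r"
      using derived_atoms[of "grd (set rs)"] by (auto simp: atoms_def)
    then obtain \<sigma> r0 where r0: "r = map_rule (subst_atom \<sigma>) r0" "r0 \<in> set rs" "range \<sigma> \<subseteq> set (universe rs)"
      by (auto simp: grd_def set_universe)
    then obtain a0 where a0: "a = subst_atom \<sigma> a0" "a0 \<in> set_rule r0" using r(2) by (auto simp: rule.set_map)
    then have at: "a0 \<in> atoms (set rs)" using r0(2) by (auto simp: atoms_def)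
    obtain p ts where p: "a0 = Atom p ts" by (cases a0)
    have "subst_trm \<sigma> t \<in> ?U" if t: "t \<in> set ts" for t
    proof (cases t)
      case (Const c)
      then have "c \<in> set (prog_consts rs)"
        using t at p by (auto simp: set_prog_consts consts_atom_def intro!: bexI[of _ a0])
      then show ?thesis using Const by (auto simp: universe_def Let_def)
    next
      case (Var x) then show ?thesis using r0(3) by auto
    qed
    moreover have "length ts \<le> m" using arity at p by (auto simp: arity_at_most_def)
    moreover have "p \<in> ?P" using at p by force
    ultimately show "a \<in> ?A" by (intro image_eqI[of _ _ "(p, map (subst_trm \<sigma>) ts)"]) (auto simp: a0 p)
  qed
  moreover have fin: "finite ?A"
  proof -
    have "finite (atoms (set rs))" by (simp add: atoms_def set_rule_atoms_list)
    then show ?thesis by (intro finite_imageI finite_cartesian_product finite_lists_length_le) auto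
  qed
  ultimately show "finite (derived (grd (set rs)))" by (rule finite_subset)
  have "length (prog_consts rs) \<le> length (prog_terms rs)" by (simp add: prog_consts_def)
  also have "\<dots> \<le> n" unfolding n by (rule length_enc_program(2))
  \<comment> \<open>The summand 1 accounts for the default constant of a program without
    constants.\<close>
  finally have "length (universe rs) \<le> n + 1" by (auto simp: universe_def Let_def)
  then have U: "card ?U \<le> n + 1"
    using card_image_le[of "set (universe rs)" Const] card_length[of "universe rs"] by simp
  have "card ?T = (\<Sum>i\<le>m. card ?U ^ i)" by (rule card_lists_length_le) simp
  also have "\<dots> \<le> (\<Sum>i\<le>m. (n + 1) ^ m)"
  proof (rule sum_mono)
    fix i assume "i \<in> {..m}"
    then have "(n + 1) ^ i \<le> (n + 1) ^ m" by (intro power_increasing) auto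
    then show "card ?U ^ i \<le> (n + 1) ^ m" using power_mono[OF U, of i] by simp
  qed
  finally have T: "card ?T \<le> (m + 1) * (n + 1) ^ m" by simp
  have "card (derived (grd (set rs))) \<le> card ?A" by (rule card_mono[OF fin]) fact
  also have "\<dots> \<le> card (?P \<times> ?T)"
    by (intro card_image_le finite_cartesian_product finite_lists_length_le)
      (auto simp: atoms_def set_rule_atoms_list)
  also have "\<dots> = card ?P * card ?T" by (rule card_cartesian_product)
  also have "\<dots> \<le> n * ((m + 1) * (n + 1) ^ m)"
    by (intro mult_mono T) (auto simp: n length_enc_program(4))
  finally show "card (derived (grd (set rs))) \<le> n * ((m + 1) * (n + 1) ^ m)" .
qed

text \<open>The default constant is unspecified, but its code has a fixed length, which enters the
  bound as a constant. The 3 counts the list marker of the added atom, its empty name and the end of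
  its arguments.\<close>

lemma length_cert:
  assumes r: "r \<in> set rs" and s: "length s = length (prog_vars rs)" "set s \<subseteq> set (universe rs)"
    and n: "n = length (enc_program rs)"
  shows "length (enc_rule (cert_of s r)) \<le> 3 + n * (n + length (enc_word undefined) + 2) + n"
proof -
  let ?K = "length (enc_word undefined)"
  obtain H B where HB: "r = Rule H B" by (cases r)
  have "length (enc_rule (cert_of s r)) = 2 + length (Defs.enc_list enc_trm (map Const s)) + length (enc_rule r)"
    by (simp add: cert_of_def HB enc_word_def Defs.enc_list_def)
  moreover have "length (enc_rule r) \<le> n" unfolding n by (rule length_enc_program(1)[OF r])
  moreover have "length (Defs.enc_list enc_trm (map Const s)) \<le> length (map Const s) * ((n + ?K + 1) + 1) + 1"
  proof (rule length_enc_list_le)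
    fix t assume "t \<in> set (map Const s)"
    then obtain c where c: "t = Const c" "c \<in> set (universe rs)" using s(2) by auto
    then consider "c = undefined" | "c \<in> set (prog_consts rs)" by (auto simp: universe_def Let_def split: if_splits)
    then show "length (enc_trm t) \<le> n + ?K + 1"
    proof cases
      case 2
      then have "Const c \<in> set (prog_terms rs)" by (auto simp: set_prog_consts set_prog_terms consts_atom_def)
      then have "length (enc_trm (Const c)) \<le> n" unfolding n by (rule length_enc_program(3))
      then show ?thesis by (simp add: c(1))
    qed (simp add: c(1))
  qed
  moreover have "length s \<le> n"
  proof -
    have "length (prog_vars rs) \<le> length (prog_terms rs)" by (simp add: prog_vars_def)
    then show ?thesis using s(1) length_enc_program(2)[of rs] n by linarith
  qed
  then have "length s * ((n + ?K + 1) + 1) \<le> n * (n + ?K + 2)" by (intro mult_mono) auto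
  ultimately show ?thesis by simp
qed

theorem bounded_arity_in_coNP:
  "world_view_existence {P \<in> EHorn. \<not> ground P \<and> arity_at_most m P} \<in> class_coNP"
proof -
  define valid where "valid x \<longleftrightarrow> enc_program (decode x) = x \<and> set (decode x) \<in> EHorn \<and>
    (\<not> ground (set (decode x)) \<and> arity_at_most m (set (decode x)))" for x
  let ?A = "world_view_existence {P \<in> EHorn. \<not> ground P \<and> arity_at_most m P}"
  \<comment> \<open>The complement also contains the words that encode no program of the class;
    these are accepted with any certificate.\<close>
  let ?R = "{v. \<not> valid (fst (parse_word v)) \<or> refutation (decode (fst (parse_word v))) (decode (snd (parse_word v)))}"
  have A: "x \<in> ?A \<longleftrightarrow> valid x \<and> \<not> inconsistent (grd (set (decode x)))" for x
    unfolding world_view_existence_eq valid_def by blast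
  have R: "?R \<in> class_P" unfolding valid_def by (rule ptime_class_P) (intro ptime_intros)
  let ?K = "length (enc_word undefined)"
  \<comment> \<open>Number of rules in a short derivation times the length of a certified rule;
    polynomial in \<open>n\<close> because \<open>m\<close> is fixed.\<close>
  define B where "B n = (n * ((m + 1) * (n + 1) ^ m) + 1) * (3 + n * (n + ?K + 2) + n + 1) + 1" for n :: nat
  have short: "\<exists>ws. refutation rs ws \<and> length (enc_program ws) \<le> B (length (enc_program rs))"
    if rs: "set rs \<in> EHorn" "arity_at_most m (set rs)" "inconsistent (grd (set rs))" for rs
  proof -
    let ?n = "length (enc_program rs)"
    have horn: "\<forall>r\<in>grd (set rs). horn r" using rs(1) by (auto simp: grd_def EHorn_iff intro: horn_map_rule)
    obtain w where w: "set w \<subseteq> grd (set rs)" "length w \<le> Suc (card (derived (grd (set rs))))" "fst (saturate w)"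
      using short_derivation[OF horn card_derived(1)[OF rs(2) refl] rs(3)] by blast
    have "\<forall>q\<in>set w. \<exists>p. cert_ok rs p \<and> cert_rule rs p = q \<and>
        length (enc_rule p) \<le> 3 + ?n * (?n + ?K + 2) + ?n"
    proof
      fix q assume "q \<in> set w"
      then obtain r s where "q = inst rs s r" "r \<in> set rs" "length s = length (prog_vars rs)" "set s \<subseteq> set (universe rs)"
        using w(1) unfolding grd_eq_inst by blast
      then show "\<exists>p. cert_ok rs p \<and> cert_rule rs p = q \<and> length (enc_rule p) \<le> 3 + ?n * (?n + ?K + 2) + ?n"
        using cert_of[of r rs s] length_cert[of r rs s ?n] by blast
    qed
    then obtain p where p: "\<And>q. q \<in> set w \<Longrightarrow> cert_ok rs (p q) \<and> cert_rule rs (p q) = q \<and>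
        length (enc_rule (p q)) \<le> 3 + ?n * (?n + ?K + 2) + ?n"
      by (metis (no_types, lifting))
    have "map (cert_rule rs) (map p w) = w" using p by (simp add: map_idI)
    then have "refutation rs (map p w)" using p w(3) by (simp add: refutation_def)
    moreover have "length (enc_program (map p w)) \<le> length (map p w) * ((3 + ?n * (?n + ?K + 2) + ?n) + 1) + 1"
    proof -
      have "enc_program (map p w) = Defs.enc_list enc_rule (map p w)" by (simp add: enc_program_def)
      moreover have "length (Defs.enc_list enc_rule (map p w)) \<le> length (map p w) * ((3 + ?n * (?n + ?K + 2) + ?n) + 1) + 1"
        by (rule length_enc_list_le) (use p in auto)
      ultimately show ?thesis by simp
    qed
    moreover have "length w \<le> ?n * ((m + 1) * (?n + 1) ^ m) + 1"
      using w(2) card_derived(2)[OF rs(2) refl] by linarith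
    then have "length (map p w) * ((3 + ?n * (?n + ?K + 2) + ?n) + 1) \<le>
        (?n * ((m + 1) * (?n + 1) ^ m) + 1) * (3 + ?n * (?n + ?K + 2) + ?n + 1)"
      by (intro mult_mono) auto
    ultimately show ?thesis unfolding B_def by (intro exI[of _ "map p w"]) auto
  qed
  have sound: "inconsistent (grd (set rs))" if "set rs \<in> EHorn" "refutation rs ws" for rs ws
  proof -
    have horn: "\<forall>r\<in>grd (set rs). horn r" using that(1) by (auto simp: grd_def EHorn_iff intro: horn_map_rule)
    have "set (map (cert_rule rs) ws) \<subseteq> grd (set rs)"
      using that(2) cert_rule_in_grd by (auto simp: refutation_def)
    from saturate_sound[OF this horn] show ?thesis using that(2) by (auto simp: refutation_def)
  qed
  have "poly_bounded (\<lambda>x::bool list. length x)"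
    by (rule poly_bounded_mono[OF poly_bounded_sz sz_bits(2)])
  then have "poly_bounded (\<lambda>x::bool list. B (length x))" unfolding B_def by (intro pb_intros)
  from poly_bound_in_length[OF this, of 1] obtain c k
    where ck: "\<And>x::bool list. B (length x) \<le> c * length x ^ k + c"
    by (metis add_leD1 mult_1)
  have "x \<in> - ?A \<longleftrightarrow> (\<exists>y. length y \<le> c * length x ^ k + c \<and> pair_code x y \<in> ?R)" for x
  proof
    assume x: "x \<in> - ?A"
    show "\<exists>y. length y \<le> c * length x ^ k + c \<and> pair_code x y \<in> ?R"
    proof (cases "valid x")
      case False
      then show ?thesis by (intro exI[of _ "[]"]) (simp add: parse_pair_code)
    next
      case True
      then have "inconsistent (grd (set (decode x)))" using x A by simp
      then obtain ws where ws: "refutation (decode x) ws" "length (enc_program ws) \<le> B (length x)"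
        using short[of "decode x"] True unfolding valid_def by metis
      then have "length (enc_program ws) \<le> c * length x ^ k + c" using ck[of x] by linarith
      then show ?thesis using ws(1)
        by (intro exI[of _ "enc_program ws"]) (simp add: parse_pair_code decode_enc_program)
    qed
  next
    assume "\<exists>y. length y \<le> c * length x ^ k + c \<and> pair_code x y \<in> ?R"
    then have "\<not> valid x \<or> inconsistent (grd (set (decode x)))"
      using sound valid_def by (auto simp: parse_pair_code)
    then show "x \<in> - ?A" using A by simp
  qed
  then have "- ?A \<in> class_NP" unfolding class_NP_def using R by blast
  then show ?thesis by (simp add: class_coNP_def)
qed


section \<open>Turing machine computations as local constraints\<close>

text \<open>Cell \<open>i\<close> at time \<open>t\<close> holds the state and the symbols of all tapes at distance \<open>i\<close> from their
  heads, so the tapes move while the heads stay at cell \<open>0\<close>.  With a flag for cell \<open>0\<close>, the content of a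
  cell is a fixed function of the previous contents of cell \<open>0\<close>, the cell itself and its neighbours.\<close>

type_synonym cell = "nat \<times> nat list \<times> bool"

definition cell_at :: "turing_machine \<Rightarrow> bool list \<Rightarrow> nat \<Rightarrow> int \<Rightarrow> cell" where
  "cell_at M x t i = (fst (run M x t), map (\<lambda>T. fst T (snd T + i)) (snd (run M x t)), i = 0)"

definition pick :: "dir \<Rightarrow> 'a \<Rightarrow> 'a \<Rightarrow> 'a \<Rightarrow> 'a" where
  "pick d l c r = (case d of Leftwards \<Rightarrow> l | Stay \<Rightarrow> c | Rightwards \<Rightarrow> r)"

text \<open>Here \<open>z\<close> is the previous content of the head cell. If the head of a tape
  moves in direction \<open>d\<close>, the symbol now at distance \<open>i\<close> was previously at
  the neighbour that \<open>pick d\<close> selects, separately for each tape. If that neighbour was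
  the head cell, it holds the symbol just written. In a halting state nothing changes.\<close>

definition update :: "turing_machine \<Rightarrow> cell \<Rightarrow> cell \<Rightarrow> cell \<Rightarrow> cell \<Rightarrow> cell" where
  "update M z l c r =
    (if fst z = 1 \<or> fst z = 2 then c else
       let da = delta M (fst z) (fst (snd z)) in
       (fst da,
        map (\<lambda>k. let s = snd (pick (snd (snd da ! k)) l c r) in if snd s then fst (snd da ! k) else fst s ! k)
          [0..<num_tapes M],
        snd (snd c)))"

definition cells :: "turing_machine \<Rightarrow> cell set" where
  "cells M = {..<num_states M} \<times> {ss. set ss \<subseteq> {..<num_symbols M} \<and> length ss = num_tapes M} \<times> UNIV"

lemma finite_cells: "finite (cells M)"
  unfolding cells_def by (intro finite_cartesian_product finite_lists_length_eq) auto

text \<open>An invariant of runs. It is needed because a well-formed machine restricts its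
  transition function only on legal states and symbols.\<close>

definition conf_ok :: "turing_machine \<Rightarrow> config \<Rightarrow> bool" where
  "conf_ok M C \<longleftrightarrow> fst C < num_states M \<and> length (snd C) = num_tapes M \<and>
     (\<forall>T\<in>set (snd C). \<forall>i. fst T i < num_symbols M)"

lemma conf_ok_reads:
  "conf_ok M (q, ts) \<Longrightarrow> length (map read ts) = num_tapes M \<and> set (map read ts) \<subseteq> {..<num_symbols M}"
  by (force simp: conf_ok_def)

lemma wf_delta:
  assumes "wf_tm M" "conf_ok M (q, ts)" "delta M q (map read ts) = (q', acts)"
  shows "q' < num_states M" "length acts = num_tapes M" "fst ` set acts \<subseteq> {..<num_symbols M}"
proof -
  have "q < num_states M" using assms(2) by (simp add: conf_ok_def)
  moreover have "\<forall>q<num_states M. \<forall>ss. length ss = num_tapes M \<and> set ss \<subseteq> {..<num_symbols M} \<longrightarrow>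
      (case delta M q ss of (q', acts) \<Rightarrow> q' < num_states M \<and> length acts = num_tapes M \<and>
         fst ` set acts \<subseteq> {..<num_symbols M})"
    using assms(1) unfolding wf_tm_def by (elim conjE)
  ultimately have "case delta M q (map read ts) of (q', acts) \<Rightarrow>
           q' < num_states M \<and> length acts = num_tapes M \<and> fst ` set acts \<subseteq> {..<num_symbols M}"
    using conf_ok_reads[OF assms(2)] by (simp only:)
  then show "q' < num_states M" "length acts = num_tapes M" "fst ` set acts \<subseteq> {..<num_symbols M}"
    using assms(3) by auto
qed

lemma conf_ok_step:
  assumes "wf_tm M" "conf_ok M C"
  shows "conf_ok M (step M C)"
proof -
  obtain q ts where C: "C = (q, ts)" by fastforce
  obtain q' acts where d: "delta M q (map read ts) = (q', acts)" by fastforce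
  note w = wf_delta[OF assms(1) assms(2)[unfolded C] d]
  have "fst T i < num_symbols M" if "T \<in> set (map2 act acts ts)" for T i
  proof -
    obtain k where "k < length (map2 act acts ts)" "T = map2 act acts ts ! k"
      using \<open>T \<in> set (map2 act acts ts)\<close> by (metis in_set_conv_nth)
    then have k: "k < num_tapes M" "T = act (acts ! k) (ts ! k)"
      using w(2) assms(2) C by (auto simp: conf_ok_def)
    obtain s e where a: "acts ! k = (s, e)" by fastforce
    have "s < num_symbols M" using w(2,3) k(1) a by (metis fst_conv image_subset_iff lessThan_iff nth_mem)
    moreover have "fst (ts ! k) i < num_symbols M" using assms(2) C k(1) by (auto simp: conf_ok_def)
    ultimately show ?thesis by (cases "ts ! k") (auto simp: k(2) a)
  qed
  then show ?thesis using w(1,2) assms(2) d C by (auto simp: conf_ok_def)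
qed

lemma conf_ok_run:
  assumes "wf_tm M"
  shows "conf_ok M (run M x t)"
proof (induction t)
  case 0
  have "num_symbols M \<ge> 3" "num_states M \<ge> 3" "num_tapes M \<ge> 1" using assms by (auto simp: wf_tm_def)
  then show ?case
    by (auto simp: run_def conf_ok_def init_config_def input_tape_def bit_symbol_def)
next
  case (Suc t)
  then show ?case using conf_ok_step[OF assms] by (simp add: run_def)
qed

lemma cell_at_in_cells: "wf_tm M \<Longrightarrow> cell_at M x t i \<in> cells M"
  using conf_ok_run[of M x t] by (auto simp: cells_def cell_at_def conf_ok_def)

lemma cell_at_Suc:
  assumes "wf_tm M"
  shows "cell_at M x (Suc t) i =
    update M (cell_at M x t 0) (cell_at M x t (i - 1)) (cell_at M x t i) (cell_at M x t (i + 1))"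
proof -
  obtain q ts where C: "run M x t = (q, ts)" by fastforce
  have C': "run M x (Suc t) = step M (q, ts)" using C by (simp add: run_def)
  show ?thesis
  proof (cases "halted (q, ts)")
    case True
    then show ?thesis by (auto simp: cell_at_def update_def C C')
  next
    case False
    obtain q' acts where d: "delta M q (map read ts) = (q', acts)" by fastforce
    note ok = conf_ok_run[OF assms, of x t, unfolded C]
    note w = wf_delta[OF assms ok d]
    have len: "length ts = num_tapes M" using ok by (simp add: conf_ok_def)
    have tapes: "map (\<lambda>T. fst T (snd T + i)) (map2 act acts ts) =
      map (\<lambda>k. let s = snd (pick (snd (acts ! k)) (cell_at M x t (i - 1)) (cell_at M x t i) (cell_at M x t (i + 1)))
        in if snd s then fst (acts ! k) else fst s ! k) [0..<num_tapes M]"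
    proof (rule nth_equalityI)
      fix k assume "k < length (map (\<lambda>T. fst T (snd T + i)) (map2 act acts ts))"
      then have k: "k < num_tapes M" using w(2) len by simp
      obtain s e where a: "acts ! k = (s, e)" by fastforce
      obtain tp h where T: "ts ! k = (tp, h)" by fastforce
      show "map (\<lambda>T. fst T (snd T + i)) (map2 act acts ts) ! k =
        map (\<lambda>k. let s = snd (pick (snd (acts ! k)) (cell_at M x t (i - 1)) (cell_at M x t i) (cell_at M x t (i + 1)))
        in if snd s then fst (acts ! k) else fst s ! k) [0..<num_tapes M] ! k"
        using k w(2) len by (cases e) (auto simp: a T cell_at_def C pick_def algebra_simps)
    qed (use w(2) len in simp)
    have 1: "cell_at M x (Suc t) i = (q', map (\<lambda>T. fst T (snd T + i)) (map2 act acts ts), i = 0)"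
      using False by (simp add: cell_at_def C' d)
    have "fst (cell_at M x t 0) = q" "snd (snd (cell_at M x t i)) = (i = 0)"
      "fst (snd (cell_at M x t 0)) = map read ts"
      by (auto simp: cell_at_def C)
    then have 2: "update M (cell_at M x t 0) (cell_at M x t (i - 1)) (cell_at M x t i) (cell_at M x t (i + 1)) =
      (q', map (\<lambda>k. let s = snd (pick (snd (acts ! k)) (cell_at M x t (i - 1)) (cell_at M x t i) (cell_at M x t (i + 1)))
        in if snd s then fst (acts ! k) else fst s ! k) [0..<num_tapes M], i = 0)"
      using False by (simp add: update_def d Let_def)
    show ?thesis unfolding 1 2 tapes ..
  qed
qed

lemma run_halted:
  assumes "halted (run M x s)" "s \<le> t"
  shows "run M x t = run M x s"
proof -
  have "run M x t = (step M ^^ (t - s)) (run M x s)"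
    using assms(2) by (simp add: run_def flip: funpow_add o_apply[of "step M ^^ (t - s)"])
  then show ?thesis using step_halted[OF assms(1)] by simp
qed

text \<open>Halted configurations are frozen, so the verdict may be read at any later time. The
  reductions can therefore use convenient clocks larger than the time bound.\<close>

lemma decides_state:
  assumes "decides_in_time M A T" "T (length x) \<le> t"
  shows "fst (run M x t) = (if x \<in> A then 1 else 2)"
proof -
  have "fst (run M x (T (length x))) = (if x \<in> A then 1 else 2)" using assms(1) by (simp add: decides_in_time_def)
  then have "halted (run M x (T (length x)))" by (cases "run M x (T (length x))") (auto split: if_splits)
  then show ?thesis using run_halted[OF _ assms(2)] \<open>fst _ = _\<close> by simp
qed

definition start_cell :: "turing_machine \<Rightarrow> nat \<Rightarrow> bool \<Rightarrow> cell" where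
  "start_cell M s f = (0, s # replicate (num_tapes M - 1) 0, f)"

lemma cell_at_0:
  "cell_at M x 0 i = start_cell M (if 0 \<le> i \<and> i < int (length x) then bit_symbol (x ! nat i) else 0) (i = 0)"
  by (auto simp: cell_at_def run_def init_config_def start_cell_def input_tape_def map_replicate_const)

lemma start_cell_inject: "start_cell M s f = start_cell M s' f' \<longleftrightarrow> s = s' \<and> f = f'"
  by (auto simp: start_cell_def)

text \<open>An arbitrary enumeration suffices, since it depends only on the fixed machine and is a
  constant of the reductions.\<close>

definition cell_list :: "turing_machine \<Rightarrow> cell list" where
  "cell_list M = (SOME cs. set cs = cells M)"

lemma set_cell_list: "set (cell_list M) = cells M"
  unfolding cell_list_def by (rule someI_ex) (rule finite_list[OF finite_cells])

definition unary :: "nat \<Rightarrow> name" where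
  "unary n = replicate n True"

lemma unary_inject [simp]: "unary m = unary n \<longleftrightarrow> m = n"
  by (auto simp: unary_def dest: arg_cong[of _ _ length])

text \<open>The names may be very long, but only finitely many cells and quadruples of the fixed
  machine are ever named, so their lengths do not depend on the input.\<close>

definition symbol :: "'a::countable \<Rightarrow> name" where
  "symbol a = unary (to_nat a)"

lemma symbol_inject [simp]: "symbol a = symbol b \<longleftrightarrow> a = b"
  by (simp add: symbol_def)

lemma ptime_unary [ptime_intros]: "ptime n \<Longrightarrow> ptime (\<lambda>e. unary (n e))"
  unfolding unary_def by (intro ptime_intros)


section \<open>Hardness for bounded arity\<close>

definition constraint :: "atom list \<Rightarrow> atom rule" where
  "constraint bs = Rule [] (map (\<lambda>a. Lit (Pos a)) bs)"

definition fact_rule :: "atom \<Rightarrow> atom rule" where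
  "fact_rule a = Rule [a] []"

lemma body_atoms_Pos: "body_atoms (Rule H (map (\<lambda>a. Lit (Pos a)) bs)) = bs"
  by (simp add: body_atoms_def comp_def)

lemma horn_Pos: "length H \<le> 1 \<Longrightarrow> horn (Rule H (map (\<lambda>a. Lit (Pos a)) bs))"
  by (auto simp: horn_def)

lemma herbrand_universe_nonempty: "\<exists>c. c \<in> herbrand_universe P"
  by (auto simp: herbrand_universe_def Let_def)

text \<open>With facts and a single constraint nothing but the facts is derivable, so the constraint
  is a Boolean conjunctive query over the database \<open>F\<close>. Its evaluation is where the
  nondeterminism of the reduction resides.\<close>

lemma inconsistent_facts:
  assumes P: "P = fact_rule ` F \<union> {constraint bs}" and ground: "\<And>a. a \<in> F \<Longrightarrow> vars_atom a = {}"
  shows "inconsistent (grd P) \<longleftrightarrow> (\<exists>\<sigma>. range \<sigma> \<subseteq> herbrand_universe P \<and> (\<forall>b\<in>set bs. subst_atom \<sigma> b \<in> F))"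
proof -
  have subst: "subst_atom \<sigma> a = a" if "a \<in> F" for \<sigma> a using ground[OF that] by (rule subst_atom_ground)
  have grd: "grd P = fact_rule ` F \<union> {constraint (map (subst_atom \<sigma>) bs) | \<sigma>. range \<sigma> \<subseteq> herbrand_universe P}"
  proof -
    obtain c where "c \<in> herbrand_universe P" using herbrand_universe_nonempty by blast
    then have c: "range (\<lambda>_. c) \<subseteq> herbrand_universe P" by auto
    have f: "map_rule (subst_atom \<sigma>) (fact_rule a) = fact_rule a" if "a \<in> F" for \<sigma> a
      using subst[OF that] by (simp add: fact_rule_def)
    have k: "map_rule (subst_atom \<sigma>) (constraint bs) = constraint (map (subst_atom \<sigma>) bs)" for \<sigma>
      by (simp add: constraint_def comp_def)
    show ?thesis
    proof (intro set_eqI iffI)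
      fix r assume "r \<in> grd P"
      then show "r \<in> fact_rule ` F \<union> {constraint (map (subst_atom \<sigma>) bs) | \<sigma>. range \<sigma> \<subseteq> herbrand_universe P}"
        unfolding grd_def P using f k by auto
    next
      fix r assume "r \<in> fact_rule ` F \<union> {constraint (map (subst_atom \<sigma>) bs) | \<sigma>. range \<sigma> \<subseteq> herbrand_universe P}"
      then show "r \<in> grd P"
      proof
        assume "r \<in> fact_rule ` F"
        then obtain a where "a \<in> F" "r = fact_rule a" by blast
        then show ?thesis unfolding grd_def using f[of a "\<lambda>_. c"] c P by (intro CollectI exI[of _ "\<lambda>_. c"] exI[of _ r]) auto
      next
        assume "r \<in> {constraint (map (subst_atom \<sigma>) bs) | \<sigma>. range \<sigma> \<subseteq> herbrand_universe P}"
        then obtain \<sigma> where "r = constraint (map (subst_atom \<sigma>) bs)" "range \<sigma> \<subseteq> herbrand_universe P" by blast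
        then show ?thesis unfolding grd_def using k[of \<sigma>] P by (intro CollectI exI[of _ \<sigma>] exI[of _ "constraint bs"]) auto
      qed
    qed
  qed
  have hf: "head (fact_rule a) = [a]" "body_atoms (fact_rule a) = []" for a by (auto simp: fact_rule_def body_atoms_def)
  have hk: "head (constraint cs) = []" "body_atoms (constraint cs) = cs" for cs
    by (auto simp: constraint_def body_atoms_Pos)
  have "derived (grd P) = F"
  proof
    show "derived (grd P) \<subseteq> F" by (rule derived_closed) (auto simp: grd hf hk)
    show "F \<subseteq> derived (grd P)"
    proof
      fix a assume "a \<in> F"
      then have "fact_rule a \<in> grd P" by (simp add: grd)
      then show "a \<in> derived (grd P)" by (rule derivedI[OF _ hf(1)]) (simp add: hf)
    qed
  qed
  moreover have k: "r \<in> grd P \<and> head r = [] \<longleftrightarrow>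
      (\<exists>\<sigma>. range \<sigma> \<subseteq> herbrand_universe P \<and> r = constraint (map (subst_atom \<sigma>) bs))" for r
    unfolding grd using hf(1) hk(1) by auto
  have "inconsistent (grd P) \<longleftrightarrow> (\<exists>r. (r \<in> grd P \<and> head r = []) \<and> set (body_atoms r) \<subseteq> derived (grd P))"
    unfolding inconsistent_def by blast
  then have "inconsistent (grd P) \<longleftrightarrow> (\<exists>\<sigma>. range \<sigma> \<subseteq> herbrand_universe P \<and>
      set (body_atoms (constraint (map (subst_atom \<sigma>) bs))) \<subseteq> derived (grd P))"
    unfolding k by blast
  ultimately show ?thesis unfolding hk set_map image_subset_iff by simp
qed

text \<open>The position \<open>i\<close> of a cell is shifted to the natural number \<open>i + T\<close>.\<close>

definition grid_var :: "bool \<Rightarrow> nat \<Rightarrow> nat \<Rightarrow> name" where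
  "grid_var b t i = b # replicate t True @ False # replicate i True"

definition bin :: "nat \<Rightarrow> trm \<Rightarrow> trm \<Rightarrow> atom" where
  "bin k s t = Atom (unary k) [s, t]"

lemma bin_inject [simp]: "bin k s t = bin k' s' t' \<longleftrightarrow> k = k' \<and> s = s' \<and> t = t'"
  by (auto simp: bin_def)

text \<open>Each quadruple will be named by one constant. The five-place graph of
  \<open>update\<close> is then described by binary facts: four projections and the result.\<close>

definition quads :: "turing_machine \<Rightarrow> (cell \<times> cell \<times> cell \<times> cell) list" where
  "quads M = List.product (cell_list M) (List.product (cell_list M) (List.product (cell_list M) (cell_list M)))"

lemma set_quads: "set (quads M) = cells M \<times> cells M \<times> cells M \<times> cells M"
  by (simp add: quads_def set_cell_list)

definition quad_update :: "turing_machine \<Rightarrow> cell \<times> cell \<times> cell \<times> cell \<Rightarrow> cell" where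
  "quad_update M q = update M (fst q) (fst (snd q)) (fst (snd (snd q))) (snd (snd (snd q)))"

text \<open>The admissible neighbours on the guessed part of the input: after a blank only a blank
  may follow, so the bits form an initial segment.\<close>

definition guess_pairs :: "(nat \<times> nat) list" where
  "guess_pairs = [(0, 0), (1, 0), (2, 0), (1, 1), (1, 2), (2, 1), (2, 2)]"

text \<open>Predicates 1 to 5 describe quadruples and their updates, 6 is equality and pins a
  variable to a constant, 7 relates neighbouring guessed cells, and 8 marks accepting cells.\<close>

definition grid_facts :: "turing_machine \<Rightarrow> atom list" where
  "grid_facts M =
     concat (map (\<lambda>q.
       [bin 1 (Const (symbol q)) (Const (symbol (fst q))), bin 2 (Const (symbol q)) (Const (symbol (fst (snd q)))),
        bin 3 (Const (symbol q)) (Const (symbol (fst (snd (snd q))))),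
        bin 4 (Const (symbol q)) (Const (symbol (snd (snd (snd q))))),
        bin 5 (Const (symbol q)) (Const (symbol (quad_update M q)))]) (quads M)) @
     map (\<lambda>c. bin 6 (Const (symbol c)) (Const (symbol c))) (cell_list M) @
     map (\<lambda>p. bin 7 (Const (symbol (start_cell M (fst p) False))) (Const (symbol (start_cell M (snd p) False)))) guess_pairs @
     map (\<lambda>c. bin 8 (Const (symbol c)) (Const (symbol c))) (filter (\<lambda>c. fst c = 1) (cell_list M))"

lemma grid_facts_iff:
  "b \<in> set (grid_facts M) \<longleftrightarrow>
    (\<exists>q\<in>set (quads M). b = bin 1 (Const (symbol q)) (Const (symbol (fst q))) \<or>
      b = bin 2 (Const (symbol q)) (Const (symbol (fst (snd q)))) \<or>
      b = bin 3 (Const (symbol q)) (Const (symbol (fst (snd (snd q))))) \<or>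
      b = bin 4 (Const (symbol q)) (Const (symbol (snd (snd (snd q))))) \<or>
      b = bin 5 (Const (symbol q)) (Const (symbol (quad_update M q)))) \<or>
    (\<exists>c\<in>cells M. b = bin 6 (Const (symbol c)) (Const (symbol c))) \<or>
    (\<exists>p\<in>set guess_pairs. b = bin 7 (Const (symbol (start_cell M (fst p) False))) (Const (symbol (start_cell M (snd p) False)))) \<or>
    (\<exists>c\<in>cells M. fst c = 1 \<and> b = bin 8 (Const (symbol c)) (Const (symbol c)))"
  unfolding grid_facts_def set_append set_concat set_map set_filter set_cell_list
    image_iff Un_iff UN_iff bex_simps list.set insert_iff empty_iff simp_thms mem_Collect_eq
  by blast

lemma bin_grid_facts:
  "bin 1 (Const a) (Const b) \<in> set (grid_facts M) \<longleftrightarrow> (\<exists>q\<in>set (quads M). a = symbol q \<and> b = symbol (fst q))"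
  "bin 2 (Const a) (Const b) \<in> set (grid_facts M) \<longleftrightarrow> (\<exists>q\<in>set (quads M). a = symbol q \<and> b = symbol (fst (snd q)))"
  "bin 3 (Const a) (Const b) \<in> set (grid_facts M) \<longleftrightarrow> (\<exists>q\<in>set (quads M). a = symbol q \<and> b = symbol (fst (snd (snd q))))"
  "bin 4 (Const a) (Const b) \<in> set (grid_facts M) \<longleftrightarrow> (\<exists>q\<in>set (quads M). a = symbol q \<and> b = symbol (snd (snd (snd q))))"
  "bin 5 (Const a) (Const b) \<in> set (grid_facts M) \<longleftrightarrow> (\<exists>q\<in>set (quads M). a = symbol q \<and> b = symbol (quad_update M q))"
  "bin 6 (Const a) (Const b) \<in> set (grid_facts M) \<longleftrightarrow> (\<exists>c\<in>cells M. a = symbol c \<and> b = symbol c)"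
  "bin 7 (Const a) (Const b) \<in> set (grid_facts M) \<longleftrightarrow> (\<exists>p\<in>set guess_pairs.
     a = symbol (start_cell M (fst p) False) \<and> b = symbol (start_cell M (snd p) False))"
  "bin 8 (Const a) (Const b) \<in> set (grid_facts M) \<longleftrightarrow> (\<exists>c\<in>cells M. fst c = 1 \<and> a = symbol c \<and> b = symbol c)"
  by (simp_all add: grid_facts_iff)

lemma grid_facts_form: "a \<in> set (grid_facts M) \<Longrightarrow> \<exists>k c d. a = bin k (Const c) (Const d)"
  unfolding grid_facts_def set_append set_concat set_map by auto

text \<open>The variable \<open>W\<close> stands for the quadruple that justifies one update. The
  column \<open>T\<close> occurs in every window because it is the shifted position of the
  head.\<close>

definition window :: "nat \<Rightarrow> nat \<Rightarrow> nat \<Rightarrow> atom list" where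
  "window T t i =
     (let V = \<lambda>t i. Var (grid_var True t i); W = Var (grid_var False t i) in
      [bin 1 W (V t T), bin 2 W (V t (i - 1)), bin 3 W (V t i), bin 4 W (V t (i + 1)), bin 5 W (V (t + 1) i)])"

text \<open>\<open>l\<close> is the length of the fixed part \<open>w\<close> of the input, \<open>L\<close> the maximal length of the guessed part.\<close>

definition grid_body :: "turing_machine \<Rightarrow> nat \<Rightarrow> nat \<Rightarrow> bool list \<Rightarrow> atom list" where
  "grid_body M T L w =
     (let V = \<lambda>t i. Var (grid_var True t i); l = length w;
          blank = Const (symbol (start_cell M 0 False)) in
      concat (map (\<lambda>t. concat (map (window T t) [1..<2 * T])) [0..<T]) @
      map (\<lambda>i. bin 6 (V 0 i) blank) [0..<T] @
      map (\<lambda>p. bin 6 (V 0 (fst p)) (Const (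
         if snd p then if fst p = T then symbol (start_cell M 2 True) else symbol (start_cell M 2 False)
         else if fst p = T then symbol (start_cell M 1 True) else symbol (start_cell M 1 False))))
        (zip [T..<T + l] w) @
      map (\<lambda>i. bin 7 (V 0 i) (V 0 (i + 1))) [T + l..<T + l + L] @
      map (\<lambda>i. bin 6 (V 0 i) blank) [T + l + L..<2 * T + 1] @
      [bin 8 (V T T) (V T T)])"

text \<open>The four cases for fixed input cells in the definition apply \<open>symbol\<close> only
  to constants, so that no machine has to compute \<open>symbol\<close>. Here they are merged into
  one formula.\<close>

lemma grid_body_iff:
  "b \<in> set (grid_body M T L w) \<longleftrightarrow>
    (\<exists>t<T. \<exists>i. 0 < i \<and> i < 2 * T \<and> b \<in> set (window T t i)) \<or>
    (\<exists>i. (i < T \<or> T + length w + L \<le> i \<and> i < 2 * T + 1) \<and>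
      b = bin 6 (Var (grid_var True 0 i)) (Const (symbol (start_cell M 0 False)))) \<or>
    (\<exists>j<length w. b = bin 6 (Var (grid_var True 0 (T + j))) (Const (symbol (start_cell M (bit_symbol (w ! j)) (j = 0))))) \<or>
    (\<exists>j<L. b = bin 7 (Var (grid_var True 0 (T + length w + j))) (Var (grid_var True 0 (T + length w + j + 1)))) \<or>
    b = bin 8 (Var (grid_var True T T)) (Var (grid_var True T T))"
proof -
  have "zip [T..<T + length w] w = map (\<lambda>j. (T + j, w ! j)) [0..<length w]"
    by (rule nth_equalityI) auto
  then have zip: "f ` set (zip [T..<T + length w] w) = {f (T + j, w ! j) | j. j < length w}" for f :: "nat \<times> bool \<Rightarrow> atom"
    by auto
  have eq: "[T + length w..<T + length w + L] = map (\<lambda>j. T + length w + j) [0..<L]"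
    by (rule nth_equalityI) auto
  have upt: "f ` set [T + length w..<T + length w + L] = {f (T + length w + j) | j. j < L}" for f :: "nat \<Rightarrow> atom"
  proof -
    have "set [0..<L] = {j. j < L}" by auto
    then show ?thesis unfolding eq set_map by blast
  qed
  have upt0: "set [0..<T] = {i. i < T}" by auto
  have upt2: "set [T + length w + L..<2 * T + 1] = {i. T + length w + L \<le> i \<and> i < 2 * T + 1}" by auto
  have fixed: "(if w ! j then if T + j = T then symbol (start_cell M 2 True) else symbol (start_cell M 2 False)
         else if T + j = T then symbol (start_cell M 1 True) else symbol (start_cell M 1 False)) =
     symbol (start_cell M (bit_symbol (w ! j)) (j = 0))" for j
    by (auto simp: bit_symbol_def)
  have win: "set (concat (map (\<lambda>t. concat (map (window T t) [1..<2 * T])) [0..<T])) =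
      {b. \<exists>t<T. \<exists>i. 0 < i \<and> i < 2 * T \<and> b \<in> set (window T t i)}"
    by (rule set_eqI) (simp add: Bex_def Suc_le_eq conj_assoc)
  show ?thesis
    unfolding grid_body_def Let_def set_append win set_map zip upt fst_conv snd_conv fixed upt0 upt2 list.set by blast
qed

definition grid_program :: "turing_machine \<Rightarrow> nat \<Rightarrow> nat \<Rightarrow> bool list \<Rightarrow> atom rule list" where
  "grid_program M T L w = map fact_rule (grid_facts M) @ [constraint (grid_body M T L w)]"

text \<open>A sequence that respects the admissible pairs and ends in a blank spells a word of
  length at most \<open>L\<close> padded with blanks; the proof splits off the first symbol.\<close>

lemma guess_word:
  assumes "s L = 0" "\<And>j. j < L \<Longrightarrow> (s j, s (Suc j)) \<in> set guess_pairs"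
  shows "\<exists>y. length y \<le> L \<and> (\<forall>j\<le>L. s j = (if j < length y then bit_symbol (y ! j) else 0))"
  using assms
proof (induction L arbitrary: s)
  case 0
  then show ?case by (intro exI[of _ "[]"]) auto
next
  case (Suc L)
  have "\<exists>y. length y \<le> L \<and> (\<forall>j\<le>L. s (Suc j) = (if j < length y then bit_symbol (y ! j) else 0))"
    by (rule Suc.IH) (use Suc.prems in auto)
  then obtain y where y: "length y \<le> L" "\<And>j. j \<le> L \<Longrightarrow> s (Suc j) = (if j < length y then bit_symbol (y ! j) else 0)"
    by blast
  have p: "(s 0, s (Suc 0)) \<in> set guess_pairs" using Suc.prems(2)[of 0] by simp
  show ?case
  proof (cases "s 0 = 0")
    case True
    then have "s (Suc 0) = 0" using p by (auto simp: guess_pairs_def)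
    then have "y = []" using y(2)[of 0] by (cases y) (auto simp: bit_symbol_def split: if_splits)
    then have "s j = 0" if "j \<le> Suc L" for j using y(2)[of "j - 1"] that True by (cases j) auto
    then show ?thesis by (intro exI[of _ "[]"]) simp
  next
    case False
    then have "s 0 = bit_symbol (s 0 = 2)" using p by (auto simp: guess_pairs_def bit_symbol_def)
    then have "s j = (if j < length ((s 0 = 2) # y) then bit_symbol (((s 0 = 2) # y) ! j) else 0)" if "j \<le> Suc L" for j
      using y(2)[of "j - 1"] that by (cases j) auto
    moreover have "length ((s 0 = 2) # y) \<le> Suc L" using y(1) by simp
    ultimately show ?thesis by blast
  qed
qed

text \<open>The grid has columns 0 to \<open>2 * T\<close> with the head at \<open>T\<close>. The
  outermost columns lack a neighbour and are unconstrained after time 0, so the values are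
  determined only in a cone that shrinks by one column on each side per step; at time
  \<open>T\<close> it is exactly the head. Nonemptiness of \<open>w\<close> puts the flagged cell
  into the fixed part, so guessed cells are unflagged.\<close>

lemma grid_correct:
  assumes M: "wf_tm M" and w: "w \<noteq> []" and T: "length w + L \<le> T"
  shows "inconsistent (grd (set (grid_program M T L w))) \<longleftrightarrow>
    (\<exists>y. length y \<le> L \<and> fst (run M (w @ y) T) = 1)"
proof -
  let ?P = "set (grid_program M T L w)" and ?F = "set (grid_facts M)" and ?l = "length w"
  have P: "?P = fact_rule ` ?F \<union> {constraint (grid_body M T L w)}" by (simp add: grid_program_def)
  have ground: "vars_atom a = {}" if "a \<in> ?F" for a
    using grid_facts_form[OF that] by (auto simp: bin_def vars_atom_def)
  have subst: "subst_atom \<sigma> (bin k s t) = bin k (subst_trm \<sigma> s) (subst_trm \<sigma> t)" for \<sigma> k s t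
    by (simp add: bin_def)
  have "inconsistent (grd ?P) \<longleftrightarrow>
      (\<exists>\<sigma>. range \<sigma> \<subseteq> herbrand_universe ?P \<and> (\<forall>b\<in>set (grid_body M T L w). subst_atom \<sigma> b \<in> ?F))"
    by (rule inconsistent_facts[OF P ground])
  also have "\<dots> \<longleftrightarrow> (\<exists>y. length y \<le> L \<and> fst (run M (w @ y) T) = 1)"
  proof
    assume "\<exists>\<sigma>. range \<sigma> \<subseteq> herbrand_universe ?P \<and> (\<forall>b\<in>set (grid_body M T L w). subst_atom \<sigma> b \<in> ?F)"
    then obtain \<sigma> where \<sigma>: "\<And>b. b \<in> set (grid_body M T L w) \<Longrightarrow> subst_atom \<sigma> b \<in> ?F" by blast
    define v where "v t i = \<sigma> (grid_var True t i)" for t i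
    have step: "v (Suc t) i = symbol (update M z l c r)"
      if "t < T" "0 < i" "i < 2 * T" "v t T = symbol z" "v t (i - 1) = symbol l" "v t i = symbol c" "v t (i + 1) = symbol r"
      for t i z l c r
    proof -
      let ?W = "\<sigma> (grid_var False t i)"
      have "\<forall>b\<in>set (window T t i). subst_atom \<sigma> b \<in> ?F"
      proof
        fix b assume "b \<in> set (window T t i)"
        then have "b \<in> set (grid_body M T L w)"
          unfolding grid_body_iff using \<open>t < T\<close> \<open>0 < i\<close> \<open>i < 2 * T\<close> by blast
        then show "subst_atom \<sigma> b \<in> ?F" by (rule \<sigma>)
      qed
      then have F: "bin 1 (Const ?W) (Const (v t T)) \<in> ?F" "bin 2 (Const ?W) (Const (v t (i - 1))) \<in> ?F"
        "bin 3 (Const ?W) (Const (v t i)) \<in> ?F" "bin 4 (Const ?W) (Const (v t (i + 1))) \<in> ?F"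
        "bin 5 (Const ?W) (Const (v (t + 1) i)) \<in> ?F"
        by (simp_all add: window_def Let_def subst v_def)
      from F(1) obtain q :: "cell \<times> cell \<times> cell \<times> cell" where q: "?W = symbol q" "v t T = symbol (fst q)" unfolding bin_grid_facts by blast
      have "v t (i - 1) = symbol (fst (snd q))" "v t i = symbol (fst (snd (snd q)))"
        "v t (i + 1) = symbol (snd (snd (snd q)))" "v (t + 1) i = symbol (quad_update M q)"
        using F(2-5) unfolding q(1) bin_grid_facts by auto
      then show ?thesis using that(4-7) q(2) by (simp add: quad_update_def)
    qed
    have eq: "v 0 i = c" if "bin 6 (Var (grid_var True 0 i)) (Const c) \<in> set (grid_body M T L w)" for i c
      using \<sigma>[OF that] by (auto simp: subst bin_grid_facts v_def)
    have blank: "v 0 i = symbol (start_cell M 0 False)" if "i < T \<or> T + ?l + L \<le> i \<and> i < 2 * T + 1" for i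
      by (rule eq) (use that in \<open>auto simp: grid_body_iff\<close>)
    have fixed: "v 0 (T + j) = symbol (start_cell M (bit_symbol (w ! j)) (j = 0))" if "j < ?l" for j
    proof (rule eq)
      show "bin 6 (Var (grid_var True 0 (T + j))) (Const (symbol (start_cell M (bit_symbol (w ! j)) (j = 0))))
          \<in> set (grid_body M T L w)"
        using that by (auto simp: grid_body_iff)
    qed
    have guess: "\<exists>p\<in>set guess_pairs. v 0 (T + ?l + j) = symbol (start_cell M (fst p) False) \<and>
        v 0 (T + ?l + Suc j) = symbol (start_cell M (snd p) False)" if "j < L" for j
    proof -
      have "subst_atom \<sigma> (bin 7 (Var (grid_var True 0 (T + ?l + j))) (Var (grid_var True 0 (T + ?l + j + 1)))) \<in> ?F"
        by (rule \<sigma>) (use that in \<open>auto simp: grid_body_iff\<close>)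
      then show ?thesis by (simp add: subst v_def bin_grid_facts)
    qed
    define s where "s j = (THE a. v 0 (T + ?l + j) = symbol (start_cell M a False))" for j
    have s: "s j = a" if "v 0 (T + ?l + j) = symbol (start_cell M a False)" for j a
      unfolding s_def by (rule the_equality) (use that in \<open>auto simp: start_cell_inject\<close>)
    \<comment> \<open>The cell after the guessed block is the first one forced to be blank; it lies
      inside the grid by the assumption on \<open>T\<close>.\<close>
    have sL: "s L = 0" by (rule s) (rule blank, use T in auto)
    have sG: "(s j, s (Suc j)) \<in> set guess_pairs \<and> v 0 (T + ?l + j) = symbol (start_cell M (s j) False)" if "j < L" for j
    proof -
      obtain p where p: "p \<in> set guess_pairs" "v 0 (T + ?l + j) = symbol (start_cell M (fst p) False)"
        "v 0 (T + ?l + Suc j) = symbol (start_cell M (snd p) False)" using guess[OF \<open>j < L\<close>] by blast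
      then show ?thesis using s[OF p(2)] s[OF p(3)] by simp
    qed
    obtain y where y: "length y \<le> L" "\<And>j. j \<le> L \<Longrightarrow> s j = (if j < length y then bit_symbol (y ! j) else 0)"
      using guess_word[of s L] sL sG by blast
    let ?X = "w @ y"
    obtain l' where l': "length w = Suc l'" using w by (cases w) auto
    have row0: "v 0 i = symbol (cell_at M ?X 0 (int i - int T))" if "i \<le> 2 * T" for i
    proof -
      consider "i < T" | "T \<le> i" "i < T + ?l" | "T + ?l \<le> i" "i < T + ?l + L" | "T + ?l + L \<le> i" by linarith
      then show ?thesis
      proof cases
        case 1
        then show ?thesis using blank by (auto simp: cell_at_0)
      next
        case 2
        then show ?thesis using fixed[of "i - T"] by (auto simp: cell_at_0 nth_append nat_diff_distrib)
      next
        case 3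
        define j where "j = i - (T + ?l)"
        have j: "i = T + ?l + j" "j < L" using 3 by (auto simp: j_def)
        have "nat (int i - int T) - ?l = j" "int i - int T = int (?l + j)" using j by auto
        then show ?thesis using sG[OF j(2)] y(2)[of j] j by (auto simp: cell_at_0 nth_append l')
      next
        case 4
        then show ?thesis using blank[of i] that y(1) by (auto simp: cell_at_0 l')
      qed
    qed
    \<comment> \<open>Induction over the shrinking cone: a cell of row \<open>t + 1\<close> needs
      its three predecessors and the head column, all of which lie in the cone of row
      \<open>t\<close>.\<close>
    have "\<forall>i. t \<le> i \<and> i + t \<le> 2 * T \<longrightarrow> v t i = symbol (cell_at M ?X t (int i - int T))" if "t \<le> T" for t
      using that
    proof (induction t)
      case 0
      then show ?case using row0 by auto
    next
      case (Suc t)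
      show ?case
      proof (intro allI impI)
        fix i assume i: "Suc t \<le> i \<and> i + Suc t \<le> 2 * T"
        have IH: "v t k = symbol (cell_at M ?X t (int k - int T))" if "t \<le> k" "k + t \<le> 2 * T" for k
          using Suc that by auto
        have "v t (i - 1) = symbol (cell_at M ?X t (int i - int T - 1))"
        proof -
          have k: "t \<le> i - 1" "i - 1 + t \<le> 2 * T" "int (i - 1) - int T = int i - int T - 1" using i by auto
          show ?thesis using IH[OF k(1,2)] unfolding k(3) .
        qed
        moreover have "v t (i + 1) = symbol (cell_at M ?X t (int i - int T + 1))"
          using IH[of "i + 1"] i by (simp add: algebra_simps)
        moreover have "v t T = symbol (cell_at M ?X t 0)" using IH[of T] Suc.prems by simp
        ultimately show "v (Suc t) i = symbol (cell_at M ?X (Suc t) (int i - int T))"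
          unfolding cell_at_Suc[OF M] using IH[of i] i Suc.prems by (intro step) auto
      qed
    qed
    then have "v T T = symbol (cell_at M ?X T 0)" by simp
    moreover have "subst_atom \<sigma> (bin 8 (Var (grid_var True T T)) (Var (grid_var True T T))) \<in> ?F"
      by (rule \<sigma>) (simp add: grid_body_iff)
    ultimately have "fst (cell_at M ?X T 0) = 1" by (auto simp: subst bin_grid_facts v_def)
    then show "\<exists>y. length y \<le> L \<and> fst (run M (w @ y) T) = 1"
      using y(1) by (intro exI[of _ y]) (simp add: cell_at_def)
  next
    assume "\<exists>y. length y \<le> L \<and> fst (run M (w @ y) T) = 1"
    then obtain y where y: "length y \<le> L" "fst (run M (w @ y) T) = 1" by blast
    let ?X = "w @ y"
    obtain l' where l': "length w = Suc l'" using w by (cases w) auto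
    define C where "C t i = cell_at M ?X t (int i - int T)" for t i
    define Q where "Q t i = (C t T, cell_at M ?X t (int i - int T - 1), C t i, cell_at M ?X t (int i - int T + 1))" for t i
    \<comment> \<open>The coordinates are recovered from the name of the variable. The assignment is
      total and always yields a cell or a quadruple of the run, hence a constant of the
      program.\<close>
    define \<sigma> where "\<sigma> n = (let t = length (takeWhile id (tl n)); i = length (dropWhile id (tl n)) - 1
      in if hd n then symbol (C t i) else symbol (Q t i))" for n
    have \<sigma>V: "\<sigma> (grid_var True t i) = symbol (C t i)" and \<sigma>W: "\<sigma> (grid_var False t i) = symbol (Q t i)" for t i
    proof -
      have "takeWhile id (replicate t True @ False # u) = replicate t True"
        "dropWhile id (replicate t True @ False # u) = False # u" for u by (induction t) auto
      then show "\<sigma> (grid_var True t i) = symbol (C t i)" "\<sigma> (grid_var False t i) = symbol (Q t i)"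
        by (simp_all add: \<sigma>_def grid_var_def Let_def)
    qed
    have C: "C t i \<in> cells M" and Q: "Q t i \<in> set (quads M)" for t i
      by (auto simp: C_def Q_def set_quads cell_at_in_cells[OF M])
    have const_in: "c \<in> herbrand_universe ?P" if "bin k (Const c) (Const d) \<in> ?F" for k c d
    proof -
      have "bin k (Const c) (Const d) \<in> atoms ?P" "c \<in> consts_atom (bin k (Const c) (Const d))"
        using that by (auto simp: P atoms_def fact_rule_def bin_def consts_atom_def)
      then show ?thesis unfolding herbrand_universe_def Let_def by auto
    qed
    have "range \<sigma> \<subseteq> herbrand_universe ?P"
    proof -
      have "symbol (C t i) \<in> herbrand_universe ?P" for t i
        using C by (intro const_in[of 6 _ "symbol (C t i)"]) (auto simp: bin_grid_facts)
      moreover have "symbol (Q t i) \<in> herbrand_universe ?P" for t i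
        by (intro const_in[of 1 _ "symbol (fst (Q t i))"]) (unfold bin_grid_facts, use Q[of t i] in blast)
      ultimately show ?thesis by (auto simp: \<sigma>_def Let_def)
    qed
    moreover have "subst_atom \<sigma> b \<in> ?F" if b: "b \<in> set (grid_body M T L w)" for b
    proof -
      have C0: "C 0 i = start_cell M (if T \<le> i \<and> i < T + length ?X then bit_symbol (?X ! (i - T)) else 0) (i = T)" for i
        by (auto simp: C_def cell_at_0 nat_diff_distrib)
      have u: "update M (C t T) (cell_at M ?X t (int i - int T - 1)) (C t i) (cell_at M ?X t (int i - int T + 1)) = C (Suc t) i" for t i
        unfolding C_def cell_at_Suc[OF M] by simp
      have m: "C t (i - 1) = cell_at M ?X t (int i - int T - 1)" if "0 < i" for t i
        using that by (simp add: C_def of_nat_diff algebra_simps)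
      have p: "C t (i + 1) = cell_at M ?X t (int i - int T + 1)" for t i by (simp add: C_def algebra_simps)
      from b consider (step) t i where "t < T" "0 < i" "i < 2 * T" "b \<in> set (window T t i)"
        | (blank) i where "i < T \<or> T + ?l + L \<le> i \<and> i < 2 * T + 1"
            "b = bin 6 (Var (grid_var True 0 i)) (Const (symbol (start_cell M 0 False)))"
        | (fixed) j where "j < ?l" "b = bin 6 (Var (grid_var True 0 (T + j))) (Const (symbol (start_cell M (bit_symbol (w ! j)) (j = 0))))"
        | (guess) j where "j < L" "b = bin 7 (Var (grid_var True 0 (T + ?l + j))) (Var (grid_var True 0 (T + ?l + j + 1)))"
        | (acc) "b = bin 8 (Var (grid_var True T T)) (Var (grid_var True T T))"
        unfolding grid_body_iff by blast
      then show ?thesis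
      proof cases
        case step
        let ?W = "Const (symbol (Q t i))"
        have "bin 1 ?W (Const (symbol (C t T))) \<in> ?F" "bin 2 ?W (Const (symbol (C t (i - 1)))) \<in> ?F"
          "bin 3 ?W (Const (symbol (C t i))) \<in> ?F" "bin 4 ?W (Const (symbol (C t (i + 1)))) \<in> ?F"
          "bin 5 ?W (Const (symbol (C (t + 1) i))) \<in> ?F"
          unfolding bin_grid_facts using Q[of t i] m[OF step(2), of t] p[of t i] u[of t i]
          by (auto simp: Q_def quad_update_def)
        then show ?thesis using step(4) by (auto simp: window_def Let_def subst \<sigma>V \<sigma>W)
      next
        case blank
        then have "C 0 i = start_cell M 0 False" using y(1) by (auto simp: C0 l')
        then show ?thesis using C[of 0 i] by (auto simp: blank subst \<sigma>V bin_grid_facts)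
      next
        case fixed
        then have "C 0 (T + j) = start_cell M (bit_symbol (w ! j)) (j = 0)" by (auto simp: C0 nth_append)
        then show ?thesis using C[of 0 "T + j"] by (auto simp: fixed subst \<sigma>V bin_grid_facts)
      next
        case guess
        let ?s = "\<lambda>j. if j < length y then bit_symbol (y ! j) else 0"
        have c: "C 0 (T + ?l + j) = start_cell M (?s j) False" for j by (auto simp: C0 nth_append l')
        moreover have "(?s j, ?s (Suc j)) \<in> set guess_pairs" by (auto simp: guess_pairs_def bit_symbol_def)
        ultimately show ?thesis by (auto simp: guess subst \<sigma>V bin_grid_facts c[of j] c[of "Suc j", simplified] intro!: bexI[of _ "(?s j, ?s (Suc j))"])
      next
        case acc
        have "fst (C T T) = 1" using y(2) by (simp add: C_def cell_at_def)
        then show ?thesis using C by (auto simp: acc subst \<sigma>V bin_grid_facts)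
      qed
    qed
    ultimately show "\<exists>\<sigma>. range \<sigma> \<subseteq> herbrand_universe ?P \<and> (\<forall>b\<in>set (grid_body M T L w). subst_atom \<sigma> b \<in> ?F)"
      by blast
  qed
  finally show ?thesis .
qed

lemma grid_program_class:
  "set (grid_program M T L w) \<in> EHorn" "\<not> ground (set (grid_program M T L w))"
  "2 \<le> m \<Longrightarrow> arity_at_most m (set (grid_program M T L w))"
proof -
  have P: "set (grid_program M T L w) = fact_rule ` set (grid_facts M) \<union> {constraint (grid_body M T L w)}"
    by (simp add: grid_program_def)
  have rule: "set_rule (fact_rule a) = {a}" "set_rule (constraint bs) = set bs" for a bs
    by (auto simp: set_rule_atoms fact_rule_def constraint_def body_atoms_Pos) (simp add: body_atoms_def)
  have atoms: "atoms (set (grid_program M T L w)) = set (grid_facts M) \<union> set (grid_body M T L w)"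
    by (auto simp: P atoms_def rule)
  have "safe (fact_rule a)" if "a \<in> set (grid_facts M)" for a
    using grid_facts_form[OF that] by (auto simp: safe_def fact_rule_def neg_body_def bin_def vars_atom_def)
  moreover have "safe (constraint bs)" for bs by (auto simp: safe_def constraint_def neg_body_def)
  moreover have "horn (fact_rule a)" "horn (constraint bs)" for a bs
    using horn_Pos[of "[a]" "[]"] horn_Pos[of "[]" bs] by (auto simp: fact_rule_def constraint_def)
  ultimately show "set (grid_program M T L w) \<in> EHorn" by (auto simp: EHorn_iff P)
  have "bin 8 (Var (grid_var True T T)) (Var (grid_var True T T)) \<in> set (grid_body M T L w)"
    by (simp add: grid_body_iff)
  then show "\<not> ground (set (grid_program M T L w))"
    by (force simp: ground_def atoms bin_def vars_atom_def)
  have "\<exists>k s t. a = bin k s t" if "a \<in> set (grid_body M T L w)" for a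
    using that unfolding grid_body_iff window_def Let_def by auto
  then show "2 \<le> m \<Longrightarrow> arity_at_most m (set (grid_program M T L w))"
    using grid_facts_form by (fastforce simp: arity_at_most_def atoms bin_def)
qed

text \<open>The fixed part of the input is the code of \<open>x\<close> and the guessed part the
  certificate \<open>y\<close>; together they form \<open>pair_code x y\<close>. A world view exists
  iff no certificate leads to acceptance.\<close>

theorem bounded_arity_coNP_hard:
  assumes "2 \<le> m"
  shows "hard_for class_coNP (world_view_existence {P \<in> EHorn. \<not> ground P \<and> arity_at_most m P})"
  unfolding hard_for_def
proof
  fix A assume "A \<in> class_coNP"
  then obtain R k c where R: "R \<in> class_P"
    and A: "\<And>x. x \<in> - A \<longleftrightarrow> (\<exists>y. length y \<le> c * length x ^ k + c \<and> pair_code x y \<in> R)"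
    unfolding class_coNP_def class_NP_def by blast
  then obtain M d e where M: "wf_tm M" "decides_in_time M R (\<lambda>n. e * n ^ d + e)"
    unfolding class_P_def DTIME_def by blast
  define L where "L x = c * length x ^ k + c" for x :: "bool list"
  \<comment> \<open>The time bound at the maximal input length, increased by that length, so that
    the whole input also fits into the right half of the grid.\<close>
  define T where "T x = e * (length (enc_word x) + L x) ^ d + e + length (enc_word x) + L x" for x
  define f where "f x = enc_program (grid_program M (T x) (L x) (enc_word x))" for x
  have L: "ptime L" unfolding L_def[abs_def] by (intro ptime_intros)
  have T: "ptime T" unfolding T_def[abs_def] by (intro ptime_intros L)
  have "ptime (\<lambda>q. grid_program M (fst q) (fst (snd q)) (snd (snd q)))"
    unfolding grid_program_def grid_body_def window_def Let_def constraint_def bin_def grid_var_def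
    by (intro ptime_intros)
  from ptime_comp[OF this, of "\<lambda>x. (T x, L x, enc_word x)"]
  have "ptime (\<lambda>x. grid_program M (T x) (L x) (enc_word x))" by (simp add: ptime_intros T L)
  then have "poly_time_computable f"
    unfolding f_def[abs_def] by (intro ptime_poly_time_computable ptime_enc_program)
  moreover have "x \<in> A \<longleftrightarrow> f x \<in> world_view_existence {P \<in> EHorn. \<not> ground P \<and> arity_at_most m P}" for x
  proof -
    have "f x \<in> world_view_existence {P \<in> EHorn. \<not> ground P \<and> arity_at_most m P} \<longleftrightarrow>
        \<not> inconsistent (grd (set (grid_program M (T x) (L x) (enc_word x))))"
      unfolding world_view_existence_eq f_def by (simp add: decode_enc_program grid_program_class assms)
    also have "\<dots> \<longleftrightarrow> \<not> (\<exists>y. length y \<le> L x \<and> fst (run M (enc_word x @ y) (T x)) = 1)"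
      by (subst grid_correct) (auto simp: M T_def enc_word_def Defs.enc_list_def)
    also have "\<dots> \<longleftrightarrow> \<not> (\<exists>y. length y \<le> L x \<and> pair_code x y \<in> R)"
    proof -
      have "fst (run M (enc_word x @ y) (T x)) = (if enc_word x @ y \<in> R then 1 else 2)" if "length y \<le> L x" for y
      proof (rule decides_state[OF M(2)])
        have "e * length (enc_word x @ y) ^ d \<le> e * (length (enc_word x) + L x) ^ d"
          using that by (intro mult_le_mono2 power_mono) auto
        then show "e * length (enc_word x @ y) ^ d + e \<le> T x" unfolding T_def by linarith
      qed
      then show ?thesis unfolding pair_code_def by (metis (full_types) numeral_eq_one_iff semiring_norm(85))
    qed
    also have "\<dots> \<longleftrightarrow> x \<in> A" using A[of x] by (auto simp: L_def)
    finally show ?thesis by blast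
  qed
  ultimately show "poly_reducible A (world_view_existence {P \<in> EHorn. \<not> ground P \<and> arity_at_most m P})"
    unfolding poly_reducible_def by blast
qed


section \<open>Binary counters\<close>

definition val :: "bool list \<Rightarrow> nat" where
  "val u = foldl (\<lambda>a b. 2 * a + of_bool b) 0 u"

lemma val_simps [simp]: "val [] = 0" "val (u @ [b]) = 2 * val u + of_bool b" "val (False # u) = val u"
  by (auto simp: val_def)

lemma val_less: "val u < 2 ^ length u"
  by (induction u rule: rev_induct) auto

lemma val_inject: "length u = length v \<Longrightarrow> val u = val v \<Longrightarrow> u = v"
proof (induction u arbitrary: v rule: rev_induct)
  case (snoc b u)
  then obtain v' c where v: "v = v' @ [c]" by (cases v rule: rev_cases) auto
  have eq: "2 * val u + of_bool b = 2 * val v' + of_bool c" using snoc.prems v by simp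
  then have "b = c" by (cases b; cases c; simp; presburger)
  moreover from this eq have "val u = val v'" by simp
  ultimately show ?case using snoc v by auto
qed simp

fun binary :: "nat \<Rightarrow> nat \<Rightarrow> bool list" where
  "binary 0 p = []"
| "binary (Suc n) p = binary n (p div 2) @ [odd p]"

lemma length_binary [simp]: "length (binary n p) = n"
  by (induction n arbitrary: p) auto

lemma val_binary [simp]: "p < 2 ^ n \<Longrightarrow> val (binary n p) = p"
  by (induction n arbitrary: p) auto

lemma val_replicate: "val (replicate n False) = 0" "val (replicate n True) + 1 = 2 ^ n"
  by (induction n) (auto simp: replicate_append_same[symmetric] simp del: replicate.simps(2) simp: replicate_Suc)

lemma val_carry: "val (w @ True # replicate m False) = val (w @ False # replicate m True) + 1"
proof (induction m)
  case (Suc m)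
  have e: "val (w @ b # replicate (Suc m) c) = 2 * val (w @ b # replicate m c) + of_bool c" for b c
    using val_simps(2)[of "w @ b # replicate m c" c] by (simp add: replicate_append_same)
  show ?case unfolding e Suc by simp
qed auto

text \<open>Adding one turns a final block \<open>0 1 ... 1\<close> into \<open>1 0 ... 0\<close>.
  The position of the carry takes only as many values as there are bits, so linearly many rules
  define the successor on exponentially many vectors.\<close>

lemma carry_decomposition:
  assumes "length u = length v" "val v = val u + 1"
  shows "\<exists>w m. u = w @ False # replicate m True \<and> v = w @ True # replicate m False"
  using assms
proof (induction u arbitrary: v rule: rev_induct)
  case (snoc b u)
  then obtain v' c where v: "v = v' @ [c]" by (cases v rule: rev_cases) auto
  have eq: "2 * val v' + of_bool c = 2 * val u + of_bool b + 1" using snoc.prems v by simp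
  show ?case
  proof (cases b)
    case False
    then have "c" "val v' = val u" using eq by (cases c; simp; presburger)+
    then have "v' = u" using snoc.prems v by (intro val_inject) auto
    then show ?thesis using v False \<open>c\<close> by (intro exI[of _ u] exI[of _ 0]) auto
  next
    case True
    then have "\<not> c" "val v' = val u + 1" using eq by (cases c; simp; presburger)+
    then obtain w m where "u = w @ False # replicate m True" "v' = w @ True # replicate m False"
      using snoc.IH[of v'] snoc.prems v by auto
    then show ?thesis using True \<open>\<not> c\<close> v
      by (intro exI[of _ w] exI[of _ "Suc m"]) (simp add: replicate_append_same)
  qed
qed simp


section \<open>Hardness for unbounded arity\<close>

definition slot :: "nat \<Rightarrow> nat \<Rightarrow> name" where
  "slot k j = replicate k True @ False # replicate j True"

definition vars :: "nat \<Rightarrow> nat \<Rightarrow> trm list" where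
  "vars l k = map (\<lambda>j. Var (slot k j)) [0..<l]"

definition cvec :: "bool list \<Rightarrow> trm list" where
  "cvec u = map (\<lambda>b. Const [b]) u"

lemma cvec_simps [simp]:
  "length (cvec u) = length u" "cvec u = cvec v \<longleftrightarrow> u = v" "cvec u @ cvec v = cvec (u @ v)"
  "map (subst_trm \<sigma>) (cvec u) = cvec u"
  by (auto simp: cvec_def comp_def intro: inj_onD[OF inj_on_mapI, of _ UNIV] map_inj_on inj_onI)

lemma length_vars [simp]: "length (vars l k) = l"
  by (simp add: vars_def)

text \<open>The names \<open>unary k\<close> contain no \<open>False\<close>, so the leading
  \<open>False\<close> of \<open>index_atom\<close> keeps its names apart from all the
  others.\<close>

definition bit_atom :: "trm \<Rightarrow> atom" where "bit_atom a = Atom (unary 1) [a]"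
definition succ_atom :: "trm list \<Rightarrow> trm list \<Rightarrow> atom" where "succ_atom u v = Atom (unary 2) (u @ v)"
definition circ_atom :: "trm list \<Rightarrow> trm list \<Rightarrow> atom" where "circ_atom u v = Atom (unary 3) (u @ v)"
definition update_atom :: "trm \<Rightarrow> trm \<Rightarrow> trm \<Rightarrow> trm \<Rightarrow> trm \<Rightarrow> atom" where
  "update_atom z l c r e = Atom (unary 4) [z, l, c, r, e]"
definition cell_atom :: "trm \<Rightarrow> trm list \<Rightarrow> trm list \<Rightarrow> atom" where
  "cell_atom a t p = Atom (unary 5) (a # t @ p)"
definition reject_atom :: "trm \<Rightarrow> atom" where "reject_atom a = Atom (unary 6) [a]"
definition index_atom :: "nat \<Rightarrow> trm list \<Rightarrow> atom" where "index_atom i u = Atom (False # unary i) u"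

lemmas atom_defs = bit_atom_def succ_atom_def circ_atom_def update_atom_def cell_atom_def reject_atom_def
  index_atom_def

lemma subst_atoms [simp]:
  "subst_atom \<sigma> (bit_atom a) = bit_atom (subst_trm \<sigma> a)"
  "subst_atom \<sigma> (succ_atom u v) = succ_atom (map (subst_trm \<sigma>) u) (map (subst_trm \<sigma>) v)"
  "subst_atom \<sigma> (circ_atom u v) = circ_atom (map (subst_trm \<sigma>) u) (map (subst_trm \<sigma>) v)"
  "subst_atom \<sigma> (update_atom z l c r e) =
     update_atom (subst_trm \<sigma> z) (subst_trm \<sigma> l) (subst_trm \<sigma> c) (subst_trm \<sigma> r) (subst_trm \<sigma> e)"
  "subst_atom \<sigma> (cell_atom a t p) = cell_atom (subst_trm \<sigma> a) (map (subst_trm \<sigma>) t) (map (subst_trm \<sigma>) p)"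
  "subst_atom \<sigma> (reject_atom a) = reject_atom (subst_trm \<sigma> a)"
  "subst_atom \<sigma> (index_atom i u) = index_atom i (map (subst_trm \<sigma>) u)"
  by (auto simp: atom_defs)

definition prule :: "atom list \<Rightarrow> atom list \<Rightarrow> atom rule" where
  "prule H B = Rule H (map (\<lambda>a. Lit (Pos a)) B)"

lemma prule_simps [simp]: "head (prule H B) = H" "body_atoms (prule H B) = B"
  by (simp_all add: prule_def body_atoms_Pos)

abbreviation cst :: "cell \<Rightarrow> trm" where
  "cst c \<equiv> Const (symbol c)"

text \<open>The predicates are bits, successor and cyclic successor on vectors, the update table,
  rejecting cells, the vectors of the numbers up to the input length, and cells with their time and
  position. The cases for input bits are spelled out so that \<open>symbol\<close> is applied only
  to fixed cells. The last rule is the only constraint; it inspects the head cell at time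
  \<open>0 1 ... 1\<close>.\<close>

definition clock_program :: "turing_machine \<Rightarrow> nat \<Rightarrow> bool list \<Rightarrow> atom rule list" where
  "clock_program M N x =
    (let X = vars N 0; Y = vars N 1; T = vars N 2; T' = vars N 3; P = vars N 4; P' = vars N 5; P'' = vars N 6;
         v = \<lambda>k. Var (slot k 0); zero = cvec (replicate N False); n = length x; blank = cst (start_cell M 0 False) in
     map (\<lambda>b. prule [bit_atom (Const [b])] []) [False, True] @
     map (\<lambda>k. prule [succ_atom (vars k 0 @ cvec (False # replicate (N - Suc k) True))
                               (vars k 0 @ cvec (True # replicate (N - Suc k) False))]
                    (map (\<lambda>j. bit_atom (Var (slot 0 j))) [0..<k])) [0..<N] @
     [prule [circ_atom X Y] [succ_atom X Y], prule [circ_atom (cvec (replicate N True)) zero] []] @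
     map (\<lambda>q. prule [update_atom (cst (fst q)) (cst (fst (snd q))) (cst (fst (snd (snd q))))
                       (cst (snd (snd (snd q)))) (cst (quad_update M q))] []) (quads M) @
     map (\<lambda>c. prule [reject_atom (cst c)] []) (filter (\<lambda>c. fst c = 2) (cell_list M)) @
     [prule [index_atom 0 zero] []] @
     map (\<lambda>i. prule [index_atom (Suc i) Y] [index_atom i X, succ_atom X Y]) [0..<n] @
     map (\<lambda>p. prule [cell_atom
          (if snd p then if fst p = 0 then cst (start_cell M 2 True) else cst (start_cell M 2 False)
           else if fst p = 0 then cst (start_cell M 1 True) else cst (start_cell M 1 False)) zero X]
          [index_atom (fst p) X]) (zip [0..<n] x) @
     [prule [cell_atom (if n = 0 then cst (start_cell M 0 True) else blank) zero X] [index_atom n X],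
      prule [cell_atom blank zero Y] [index_atom n X, succ_atom X Y],
      prule [cell_atom blank zero Y] [cell_atom blank zero X, succ_atom X Y],
      prule [cell_atom (v 11) T' P']
        [update_atom (v 7) (v 8) (v 9) (v 10) (v 11), cell_atom (v 7) T zero, cell_atom (v 8) T P,
         cell_atom (v 9) T P', cell_atom (v 10) T P'', circ_atom P P', circ_atom P' P'', succ_atom T T'],
      prule [] [cell_atom (v 7) (cvec (False # replicate (N - 1) True)) zero, reject_atom (v 7)]])"

lemma clock_program_iff:
  "r \<in> set (clock_program M N x) \<longleftrightarrow>
    (\<exists>b. r = prule [bit_atom (Const [b])] []) \<or>
    (\<exists>k<N. r = prule [succ_atom (vars k 0 @ cvec (False # replicate (N - Suc k) True))
                               (vars k 0 @ cvec (True # replicate (N - Suc k) False))]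
                    (map (\<lambda>j. bit_atom (Var (slot 0 j))) [0..<k])) \<or>
    r = prule [circ_atom (vars N 0) (vars N 1)] [succ_atom (vars N 0) (vars N 1)] \<or>
    r = prule [circ_atom (cvec (replicate N True)) (cvec (replicate N False))] [] \<or>
    (\<exists>q\<in>set (quads M). r = prule [update_atom (cst (fst q)) (cst (fst (snd q))) (cst (fst (snd (snd q))))
                       (cst (snd (snd (snd q)))) (cst (quad_update M q))] []) \<or>
    (\<exists>c\<in>cells M. fst c = 2 \<and> r = prule [reject_atom (cst c)] []) \<or>
    r = prule [index_atom 0 (cvec (replicate N False))] [] \<or>
    (\<exists>i<length x. r = prule [index_atom (Suc i) (vars N 1)] [index_atom i (vars N 0), succ_atom (vars N 0) (vars N 1)]) \<or>
    (\<exists>i<length x. r = prule [cell_atom (cst (start_cell M (bit_symbol (x ! i)) (i = 0))) (cvec (replicate N False)) (vars N 0)]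
       [index_atom i (vars N 0)]) \<or>
    r = prule [cell_atom (cst (start_cell M 0 (length x = 0))) (cvec (replicate N False)) (vars N 0)]
       [index_atom (length x) (vars N 0)] \<or>
    r = prule [cell_atom (cst (start_cell M 0 False)) (cvec (replicate N False)) (vars N 1)]
       [index_atom (length x) (vars N 0), succ_atom (vars N 0) (vars N 1)] \<or>
    r = prule [cell_atom (cst (start_cell M 0 False)) (cvec (replicate N False)) (vars N 1)]
       [cell_atom (cst (start_cell M 0 False)) (cvec (replicate N False)) (vars N 0), succ_atom (vars N 0) (vars N 1)] \<or>
    r = prule [cell_atom (Var (slot 11 0)) (vars N 3) (vars N 5)]
        [update_atom (Var (slot 7 0)) (Var (slot 8 0)) (Var (slot 9 0)) (Var (slot 10 0)) (Var (slot 11 0)),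
         cell_atom (Var (slot 7 0)) (vars N 2) (cvec (replicate N False)), cell_atom (Var (slot 8 0)) (vars N 2) (vars N 4),
         cell_atom (Var (slot 9 0)) (vars N 2) (vars N 5), cell_atom (Var (slot 10 0)) (vars N 2) (vars N 6),
         circ_atom (vars N 4) (vars N 5), circ_atom (vars N 5) (vars N 6), succ_atom (vars N 2) (vars N 3)] \<or>
    r = prule [] [cell_atom (Var (slot 7 0)) (cvec (False # replicate (N - 1) True)) (cvec (replicate N False)),
         reject_atom (Var (slot 7 0))]"
proof -
  have "zip [0..<length x] x = map (\<lambda>j. (j, x ! j)) [0..<length x]"
    by (rule nth_equalityI) auto
  then have zip: "f ` set (zip [0..<length x] x) = {f (j, x ! j) | j. j < length x}" for f :: "nat \<times> bool \<Rightarrow> atom rule"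
    by auto
  have cell: "(if x ! i then if i = 0 then cst (start_cell M 2 True) else cst (start_cell M 2 False)
       else if i = 0 then cst (start_cell M 1 True) else cst (start_cell M 1 False)) =
     cst (start_cell M (bit_symbol (x ! i)) (i = 0))" for i
    by (auto simp: bit_symbol_def)
  have blank: "(if length x = 0 then cst (start_cell M 0 True) else cst (start_cell M 0 False)) =
     cst (start_cell M 0 (length x = 0))" by auto
  have upt: "set [0..<n] = {i. i < n}" for n :: nat by auto
  have bool: "f ` {False, True} = {f b | b. True}" for f :: "bool \<Rightarrow> atom rule"
    by auto (metis (full_types))
  show ?thesis
    unfolding clock_program_def Let_def set_append set_map zip fst_conv snd_conv cell blank upt set_filter
      set_cell_list list.set bool
    by blast
qed

text \<open>Reads the vector and the component back from the name of a variable. The default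
  \<open>[False]\<close> is a constant of the program because of the facts about bits.\<close>

definition slot_value :: "(nat \<Rightarrow> name list) \<Rightarrow> name \<Rightarrow> name" where
  "slot_value asg v =
    (let k = length (takeWhile id v); j = length (dropWhile id v) - 1 in if j < length (asg k) then asg k ! j else [False])"

lemma slot_value_eq: "j < length (asg k) \<Longrightarrow> slot_value asg (slot k j) = asg k ! j"
proof -
  have "takeWhile id (replicate k True @ False # u) = replicate k True"
    "dropWhile id (replicate k True @ False # u) = False # u" for u by (induction k) auto
  then show "j < length (asg k) \<Longrightarrow> slot_value asg (slot k j) = asg k ! j"
    by (simp add: slot_value_def slot_def Let_def)
qed

lemma slot_value_vars: "length (asg k) = l \<Longrightarrow> map (subst_trm (slot_value asg)) (vars l k) = map Const (asg k)"
  by (rule nth_equalityI) (auto simp: vars_def slot_value_eq)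

definition words :: "(nat \<Rightarrow> bool list) \<Rightarrow> nat \<Rightarrow> name list" where
  "words w k = map (\<lambda>b. [b]) (w k)"

lemma slot_value_words: "length (w k) = l \<Longrightarrow> map (subst_trm (slot_value (words w))) (vars l k) = cvec (w k)"
  by (simp add: slot_value_vars words_def cvec_def)

text \<open>The positions from \<open>- B\<close> to \<open>B\<close> are pairwise distinct modulo
  \<open>2 * B + 2\<close>. With this modulus \<open>B\<close> is \<open>2 ^ (N - 1) - 1\<close>,
  the number with the vector \<open>0 1 ... 1\<close> that occurs in the constraint.\<close>

context
  fixes M :: turing_machine and N B :: nat and x :: "bool list"
  assumes M: "wf_tm M" and B: "2 ^ N = 2 * B + 2" and x: "length x \<le> B"
begin

text \<open>Derivable atoms are correct inside the light cone of the cells that are initialised faithfully;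
  nothing is claimed about cells outside.\<close>

inductive sound :: "atom \<Rightarrow> bool" where
  sound_bit: "sound (bit_atom (Const [b]))"
| sound_succ: "length u = N \<Longrightarrow> length v = N \<Longrightarrow> val v = val u + 1 \<Longrightarrow> sound (succ_atom (cvec u) (cvec v))"
| sound_circ: "length u = N \<Longrightarrow> length v = N \<Longrightarrow> val v = (val u + 1) mod 2 ^ N \<Longrightarrow>
    sound (circ_atom (cvec u) (cvec v))"
| sound_update: "sound (update_atom (cst (fst q)) (cst (fst (snd q))) (cst (fst (snd (snd q))))
    (cst (snd (snd (snd q)))) (cst (quad_update M q)))"
| sound_cell: "length t = N \<Longrightarrow> length p = N \<Longrightarrow>
    (\<And>i. \<bar>i\<bar> + int (val t) \<le> int B \<Longrightarrow> int (val p) = i mod 2 ^ N \<Longrightarrow> c = cell_at M x (val t) i) \<Longrightarrow>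
    sound (cell_atom (cst c) (cvec t) (cvec p))"
| sound_reject: "fst c = 2 \<Longrightarrow> sound (reject_atom (cst c))"
| sound_index: "length u = N \<Longrightarrow> val u \<le> length x \<Longrightarrow> sound (index_atom (val u) (cvec u))"

lemma unary_neq_Cons: "unary k \<noteq> False # u" "False # u \<noteq> unary k"
  by (cases k; simp add: unary_def)+

lemma soundD:
  "sound (succ_atom u v) \<Longrightarrow> length u = N \<Longrightarrow>
     \<exists>u' v'. u = cvec u' \<and> v = cvec v' \<and> length u' = N \<and> length v' = N \<and> val v' = val u' + 1"
  "sound (circ_atom u v) \<Longrightarrow> length u = N \<Longrightarrow>
     \<exists>u' v'. u = cvec u' \<and> v = cvec v' \<and> length u' = N \<and> length v' = N \<and> val v' = (val u' + 1) mod 2 ^ N"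
  "sound (cell_atom a t p) \<Longrightarrow> length t = N \<Longrightarrow> \<exists>c t' p'. a = cst c \<and> t = cvec t' \<and> p = cvec p' \<and> length t' = N \<and> length p' = N \<and>
       (\<forall>i. \<bar>i\<bar> + int (val t') \<le> int B \<and> int (val p') = i mod 2 ^ N \<longrightarrow> c = cell_at M x (val t') i)"
proof -
  have app: "us @ vs = us' @ vs' \<Longrightarrow> length us = N \<Longrightarrow> length us' = N \<Longrightarrow> us = us' \<and> vs = vs'" for us vs us' vs' :: "trm list"
    by simp
  show "sound (succ_atom u v) \<Longrightarrow> length u = N \<Longrightarrow>
     \<exists>u' v'. u = cvec u' \<and> v = cvec v' \<and> length u' = N \<and> length v' = N \<and> val v' = val u' + 1"
    by (cases rule: sound.cases, assumption) (auto simp: atom_defs unary_neq_Cons simp del: cvec_simps(3) dest!: app)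
  show "sound (circ_atom u v) \<Longrightarrow> length u = N \<Longrightarrow>
     \<exists>u' v'. u = cvec u' \<and> v = cvec v' \<and> length u' = N \<and> length v' = N \<and> val v' = (val u' + 1) mod 2 ^ N"
    by (cases rule: sound.cases, assumption) (auto simp: atom_defs unary_neq_Cons simp del: cvec_simps(3) dest!: app)
  show "sound (cell_atom a t p) \<Longrightarrow> length t = N \<Longrightarrow> \<exists>c t' p'. a = cst c \<and> t = cvec t' \<and> p = cvec p' \<and> length t' = N \<and> length p' = N \<and>
       (\<forall>i. \<bar>i\<bar> + int (val t') \<le> int B \<and> int (val p') = i mod 2 ^ N \<longrightarrow> c = cell_at M x (val t') i)"
    by (cases rule: sound.cases, assumption) (auto simp: atom_defs unary_neq_Cons simp del: cvec_simps(3) dest!: app)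
qed

lemma soundD':
  "sound (bit_atom a) \<Longrightarrow> \<exists>b. a = Const [b]"
  "sound (update_atom z l c r e) \<Longrightarrow> \<exists>q. z = cst (fst q) \<and> l = cst (fst (snd q)) \<and> c = cst (fst (snd (snd q))) \<and>
     r = cst (snd (snd (snd q))) \<and> e = cst (quad_update M q)"
  "sound (reject_atom a) \<Longrightarrow> \<exists>c. fst c = 2 \<and> a = cst c"
  "sound (index_atom i u) \<Longrightarrow> \<exists>u'. u = cvec u' \<and> i \<le> length x \<and> length u' = N \<and> val u' = i"
proof -
  show "sound (bit_atom a) \<Longrightarrow> \<exists>b. a = Const [b]"
    by (cases rule: sound.cases, assumption) (auto simp: atom_defs unary_neq_Cons)
  show "\<exists>q. z = cst (fst q) \<and> l = cst (fst (snd q)) \<and> c = cst (fst (snd (snd q))) \<and>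
     r = cst (snd (snd (snd q))) \<and> e = cst (quad_update M q)" if "sound (update_atom z l c r e)"
    using that
  proof (cases rule: sound.cases)
    case (sound_update q)
    then have "z = cst (fst q) \<and> l = cst (fst (snd q)) \<and> c = cst (fst (snd (snd q))) \<and>
     r = cst (snd (snd (snd q))) \<and> e = cst (quad_update M q)" by (simp only: update_atom_def) simp
    then show ?thesis by (rule exI)
  qed (simp_all add: atom_defs unary_neq_Cons)
  show "\<exists>c. fst c = 2 \<and> a = cst c" if "sound (reject_atom a)"
    using that
  proof (cases rule: sound.cases)
    case (sound_reject c)
    then show ?thesis by (intro exI[of _ c]) (simp add: reject_atom_def)
  qed (simp_all add: atom_defs unary_neq_Cons)
  show "sound (index_atom i u) \<Longrightarrow> \<exists>u'. u = cvec u' \<and> i \<le> length x \<and> length u' = N \<and> val u' = i"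
    by (cases rule: sound.cases, assumption) (auto simp: atom_defs unary_neq_Cons)
qed

text \<open>Positions between \<open>- B\<close> and \<open>B\<close> have explicit residues:
  nonnegative ones represent themselves and negative ones lie above \<open>B + 1\<close>.\<close>

lemma cone_position:
  assumes "\<bar>i\<bar> \<le> int B" "a < 2 ^ N" "int a = i mod 2 ^ N"
  shows "int a = (if 0 \<le> i then i else i + 2 ^ N)"
proof -
  have B': "(2::int) ^ N = 2 * int B + 2" using arg_cong[OF B, of int] by simp
  show ?thesis
  proof (cases "0 \<le> i")
    case True
    then show ?thesis using assms B' by simp
  next
    case False
    then have "0 \<le> i + 2 ^ N" "i + 2 ^ N < 2 ^ N" using assms(1) B' by auto
    then have "(i + 2 ^ N) mod 2 ^ N = i + 2 ^ N" by (rule mod_pos_pos_trivial)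
    then show ?thesis using assms(3) False by (simp only: mod_add_self2 if_False)
  qed
qed

text \<open>A negative position of the cone has a residue greater than \<open>B\<close> and so
  beyond the input. Its cell is blank, just as the rules for the first row assign.\<close>

lemma start_sound:
  assumes u: "length u = N"
    and c: "val u < length x \<Longrightarrow> c = start_cell M (bit_symbol (x ! val u)) (val u = 0)"
      "length x \<le> val u \<Longrightarrow> c = start_cell M 0 (val u = 0)"
  shows "sound (cell_atom (cst c) (cvec (replicate N False)) (cvec u))"
proof -
  have "c = cell_at M x 0 i" if "\<bar>i\<bar> \<le> int B" "int (val u) = i mod 2 ^ N" for i
  proof -
    have v: "int (val u) = (if 0 \<le> i then i else i + 2 ^ N)"
      using cone_position[OF that(1) _ that(2)] val_less[of u] u by simp
    show ?thesis
    proof (cases "0 \<le> i")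
      case True
      then have "i = int (val u)" using v by simp
      then show ?thesis using c by (cases "val u < length x") (auto simp: cell_at_0)
    next
      case False
      have "(2::int) ^ N = 2 * int B + 2" using arg_cong[OF B, of int] by simp
      then have "length x \<le> val u \<and> val u \<noteq> 0" using v False that(1) x by auto
      then show ?thesis using c False by (auto simp: cell_at_0)
    qed
  qed
  then show ?thesis using u by (intro sound_cell) (auto simp: val_replicate)
qed

text \<open>At a negative position the cell is blank anyway. Otherwise the predecessor is in the
  cone too; being blank and unflagged it lies at or beyond the end of the input, hence so does its
  successor.\<close>

lemma blank_step_sound:
  assumes "sound (cell_atom (cst (start_cell M 0 False)) (cvec (replicate N False)) (cvec u))"
    and uv: "length u = N" "length v = N" "val v = val u + 1"
  shows "sound (cell_atom (cst (start_cell M 0 False)) (cvec (replicate N False)) (cvec v))"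
proof (rule sound_cell)
  fix i assume i: "\<bar>i\<bar> + int (val (replicate N False)) \<le> int B" "int (val v) = i mod 2 ^ N"
  then have i': "\<bar>i\<bar> \<le> int B" by simp
  have pos: "int (val v) = (if 0 \<le> i then i else i + 2 ^ N)"
    using cone_position[OF i' _ i(2)] val_less[of v] uv(2) by simp
  have "\<not> (0 \<le> i \<and> i < int (length x)) \<and> i \<noteq> 0"
  proof (cases "0 \<le> i")
    case True
    then have "i = int (val u) + 1" using pos uv(3) by simp
    then have "\<bar>i - 1\<bar> \<le> int B" "int (val u) = (i - 1) mod 2 ^ N"
      using i' val_less[of u] uv(1) by auto
    with soundD(3)[OF assms(1)] have "start_cell M 0 False = cell_at M x 0 (i - 1)"
      by (auto simp: val_replicate)
    then show ?thesis using True \<open>i = int (val u) + 1\<close>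
      by (auto simp: cell_at_0 start_cell_inject bit_symbol_def split: if_splits)
  qed auto
  then show "start_cell M 0 False = cell_at M x (val (replicate N False)) i"
    by (auto simp: cell_at_0 val_replicate)
qed (use uv in auto)

text \<open>If \<open>i\<close> at the later time is in the cone, then \<open>i - 1\<close>,
  \<open>i\<close>, \<open>i + 1\<close> and 0 are in the cone one step earlier, because the cone
  shrinks by one per step. The cyclic successors identify the vectors with these positions.\<close>

lemma update_sound:
  assumes "sound (cell_atom (cst z) (cvec t) (cvec (replicate N False)))" "sound (cell_atom (cst l) (cvec t) (cvec p))"
    "sound (cell_atom (cst c) (cvec t) (cvec p'))" "sound (cell_atom (cst r) (cvec t) (cvec p''))"
    and len: "length t = N" "length t' = N" "length p = N" "length p' = N" "length p'' = N"
    and v: "val t' = val t + 1" "val p' = (val p + 1) mod 2 ^ N" "val p'' = (val p' + 1) mod 2 ^ N"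
  shows "sound (cell_atom (cst (update M z l c r)) (cvec t') (cvec p'))"
proof (rule sound_cell)
  fix i assume i: "\<bar>i\<bar> + int (val t') \<le> int B" "int (val p') = i mod 2 ^ N"
  have cellD: "a = cell_at M x (val t) j"
    if "sound (cell_atom (cst a) (cvec t) (cvec q))" "\<bar>j\<bar> + int (val t) \<le> int B" "int (val q) = j mod 2 ^ N" for a q j
    using soundD(3)[OF that(1)] that(2,3) len(1) by auto
  have "int (val p) = (int (val p) + 1 - 1) mod 2 ^ N" using val_less[of p] len(3) by simp
  also have "\<dots> = (i - 1) mod 2 ^ N"
    using i(2) arg_cong[OF v(2), of int] by (intro mod_diff_cong) (auto simp: zmod_int add.commute)
  finally have p: "int (val p) = (i - 1) mod 2 ^ N" .
  have "int (val p'') = (int (val p') + 1) mod 2 ^ N"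
    using arg_cong[OF v(3), of int] by (simp add: zmod_int add.commute)
  also have "\<dots> = (i + 1) mod 2 ^ N" unfolding i(2) by (rule mod_add_left_eq)
  finally have p'': "int (val p'') = (i + 1) mod 2 ^ N" .
  have "z = cell_at M x (val t) 0"
    by (rule cellD[OF assms(1)]) (use i v(1) in \<open>auto simp: val_replicate\<close>)
  moreover have "l = cell_at M x (val t) (i - 1)" by (rule cellD[OF assms(2) _ p]) (use i(1) v(1) in auto)
  moreover have "c = cell_at M x (val t) i" by (rule cellD[OF assms(3) _ i(2)]) (use i(1) v(1) in auto)
  moreover have "r = cell_at M x (val t) (i + 1)" by (rule cellD[OF assms(4) _ p'']) (use i(1) v(1) in auto)
  ultimately show "update M z l c r = cell_at M x (val t') i" using v(1) by (simp add: cell_at_Suc[OF M])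
qed (use len in auto)

text \<open>Variables range over all constants, including names of cells. Yet every vector in a head
  is forced to consist of bits by a bit, index or successor atom in the body, so that each rule
  preserves soundness.\<close>

lemma derived_sound:
  assumes "a \<in> derived (grd (set (clock_program M N x)))"
  shows "sound a"
proof -
  let ?zero = "cvec (replicate N False)"
  have "derived (grd (set (clock_program M N x))) \<subseteq> Collect sound"
  proof (rule derived_closed)
    fix r a assume r: "r \<in> grd (set (clock_program M N x))" "set (body_atoms r) \<subseteq> Collect sound" "head r = [a]"
    then obtain \<sigma> r0 where r0: "r0 \<in> set (clock_program M N x)" "r = map_rule (subst_atom \<sigma>) r0" by (auto simp: grd_def)
    have body: "\<forall>b\<in>set (body_atoms r0). sound (subst_atom \<sigma> b)" and head: "map (subst_atom \<sigma>) (head r0) = [a]"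
      using r r0 by (auto simp: body_atoms_map_rule head_map_rule)
    define V where "V k = map (subst_trm \<sigma>) (vars N k)" for k
    have V: "length (V k) = N" "map (subst_trm \<sigma>) (vars N k) = V k" for k by (simp_all add: V_def)
    from r0(1) show "a \<in> Collect sound"
      unfolding clock_program_iff
    proof (elim disjE exE conjE bexE)
      fix b assume "r0 = prule [bit_atom (Const [b])] []"
      then show ?thesis using head by (auto intro: sound_bit)
    next
      fix k assume k: "k < N" and r0: "r0 = prule [succ_atom (vars k 0 @ cvec (False # replicate (N - Suc k) True))
                               (vars k 0 @ cvec (True # replicate (N - Suc k) False))]
                    (map (\<lambda>j. bit_atom (Var (slot 0 j))) [0..<k])"
      have "\<exists>b. \<sigma> (slot 0 j) = [b]" if "j < k" for j
        using soundD'(1)[of "Const (\<sigma> (slot 0 j))"] body that r0 by auto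
      then obtain w where w: "\<And>j. j < k \<Longrightarrow> \<sigma> (slot 0 j) = [w j]" by metis
      then have pre: "map (subst_trm \<sigma>) (vars k 0) = cvec (map w [0..<k])"
        by (simp add: vars_def cvec_def)
      let ?u = "map w [0..<k] @ False # replicate (N - Suc k) True"
        and ?v = "map w [0..<k] @ True # replicate (N - Suc k) False"
      have "a = succ_atom (cvec ?u) (cvec ?v)" using head r0 by (simp add: pre)
      moreover have "length ?u = N" "length ?v = N" "val ?v = val ?u + 1" using k val_carry by auto
      ultimately show ?thesis by (simp add: sound_succ del: cvec_simps)
    next
      assume r0: "r0 = prule [circ_atom (vars N 0) (vars N 1)] [succ_atom (vars N 0) (vars N 1)]"
      then have "sound (succ_atom (V 0) (V 1))" using body by (simp_all add: V)
      from soundD(1)[OF this V(1)] obtain u v where uv: "V 0 = cvec u" "V 1 = cvec v" "length u = N" "length v = N" "val v = val u + 1"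
        by blast
      then have "val v = (val u + 1) mod 2 ^ N" using val_less[of v] by simp
      then show ?thesis using uv head r0 sound_circ by (auto simp: V)
    next
      assume "r0 = prule [circ_atom (cvec (replicate N True)) ?zero] []"
      then have "a = circ_atom (cvec (replicate N True)) ?zero" using head by simp
      moreover have "val (replicate N False) = (val (replicate N True) + 1) mod 2 ^ N"
        by (simp only: val_replicate mod_self)
      ultimately show ?thesis by (simp add: sound_circ)
    next
      fix q assume "r0 = prule [update_atom (cst (fst q)) (cst (fst (snd q))) (cst (fst (snd (snd q))))
                       (cst (snd (snd (snd q)))) (cst (quad_update M q))] []"
      then have "a = update_atom (cst (fst q)) (cst (fst (snd q))) (cst (fst (snd (snd q))))
                       (cst (snd (snd (snd q)))) (cst (quad_update M q))" using head by simp
      then show ?thesis by (simp only: mem_Collect_eq sound_update)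
    next
      fix c :: cell assume "fst c = 2" "r0 = prule [reject_atom (cst c)] []"
      then show ?thesis using head by (auto intro: sound_reject)
    next
      assume "r0 = prule [index_atom 0 ?zero] []"
      then have "a = index_atom 0 ?zero" using head by simp
      then show ?thesis using sound_index[of "replicate N False"] by (simp add: val_replicate)
    next
      fix i assume i: "i < length x" "r0 = prule [index_atom (Suc i) (vars N 1)] [index_atom i (vars N 0), succ_atom (vars N 0) (vars N 1)]"
      then have b: "sound (index_atom i (V 0))" "sound (succ_atom (V 0) (V 1))" using body by (simp_all add: V)
      obtain u v where uv: "V 0 = cvec u" "V 1 = cvec v" "length v = N" "val v = val u + 1"
        using soundD(1)[OF b(2) V(1)] by blast
      have "val u = i" using soundD'(4)[OF b(1)] uv(1) by auto
      then have "a = index_atom (Suc i) (cvec v)" "val v = Suc i" using uv head i by (auto simp: V)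
      then show ?thesis using sound_index[of v] uv(3) i(1) by simp
    next
      fix i assume i: "i < length x"
        "r0 = prule [cell_atom (cst (start_cell M (bit_symbol (x ! i)) (i = 0))) ?zero (vars N 0)] [index_atom i (vars N 0)]"
      then have "sound (index_atom i (V 0))" using body by (simp_all add: V)
      from soundD'(4)[OF this] obtain u where u: "V 0 = cvec u" "length u = N" "val u = i" by blast
      then have "a = cell_atom (cst (start_cell M (bit_symbol (x ! i)) (i = 0))) ?zero (cvec u)"
        using head i by (auto simp: V)
      then show ?thesis using start_sound[of u] u i by auto
    next
      assume i: "r0 = prule [cell_atom (cst (start_cell M 0 (length x = 0))) ?zero (vars N 0)] [index_atom (length x) (vars N 0)]"
      then have "sound (index_atom (length x) (V 0))" using body by (simp_all add: V)
      from soundD'(4)[OF this] obtain u where u: "V 0 = cvec u" "length u = N" "val u = length x" by blast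
      then have "a = cell_atom (cst (start_cell M 0 (length x = 0))) ?zero (cvec u)"
        using head i by (auto simp: V)
      then show ?thesis using start_sound[of u] u by auto
    next
      assume i: "r0 = prule [cell_atom (cst (start_cell M 0 False)) ?zero (vars N 1)]
         [index_atom (length x) (vars N 0), succ_atom (vars N 0) (vars N 1)]"
      then have b: "sound (index_atom (length x) (V 0))" "sound (succ_atom (V 0) (V 1))" using body by (simp_all add: V)
      obtain u v where uv: "V 0 = cvec u" "V 1 = cvec v" "length v = N" "val v = val u + 1"
        using soundD(1)[OF b(2) V(1)] by blast
      have "val u = length x" using soundD'(4)[OF b(1)] uv(1) by auto
      moreover have "a = cell_atom (cst (start_cell M 0 False)) ?zero (cvec v)" using head i uv by (auto simp: V)
      ultimately show ?thesis using start_sound[of v] uv by auto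
    next
      assume i: "r0 = prule [cell_atom (cst (start_cell M 0 False)) ?zero (vars N 1)]
         [cell_atom (cst (start_cell M 0 False)) ?zero (vars N 0), succ_atom (vars N 0) (vars N 1)]"
      then have b: "sound (cell_atom (cst (start_cell M 0 False)) ?zero (V 0))" "sound (succ_atom (V 0) (V 1))"
        using body by (simp_all add: V)
      obtain u v where uv: "V 0 = cvec u" "V 1 = cvec v" "length u = N" "length v = N" "val v = val u + 1"
        using soundD(1)[OF b(2) V(1)] by blast
      have "a = cell_atom (cst (start_cell M 0 False)) ?zero (cvec v)" using head i uv by (auto simp: V)
      then show ?thesis using blank_step_sound[of u v] b(1) uv by auto
    next
      assume i: "r0 = prule [cell_atom (Var (slot 11 0)) (vars N 3) (vars N 5)]
        [update_atom (Var (slot 7 0)) (Var (slot 8 0)) (Var (slot 9 0)) (Var (slot 10 0)) (Var (slot 11 0)),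
         cell_atom (Var (slot 7 0)) (vars N 2) ?zero, cell_atom (Var (slot 8 0)) (vars N 2) (vars N 4),
         cell_atom (Var (slot 9 0)) (vars N 2) (vars N 5), cell_atom (Var (slot 10 0)) (vars N 2) (vars N 6),
         circ_atom (vars N 4) (vars N 5), circ_atom (vars N 5) (vars N 6), succ_atom (vars N 2) (vars N 3)]"
      let ?s = "\<lambda>k. Const (\<sigma> (slot k 0))"
      have b: "sound (update_atom (?s 7) (?s 8) (?s 9) (?s 10) (?s 11))"
        "sound (cell_atom (?s 7) (V 2) ?zero)" "sound (cell_atom (?s 8) (V 2) (V 4))"
        "sound (cell_atom (?s 9) (V 2) (V 5))" "sound (cell_atom (?s 10) (V 2) (V 6))"
        "sound (circ_atom (V 4) (V 5))" "sound (circ_atom (V 5) (V 6))" "sound (succ_atom (V 2) (V 3))"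
        using body by (simp_all add: i V)
      obtain q :: "cell \<times> cell \<times> cell \<times> cell" where q: "?s 7 = cst (fst q)" "?s 8 = cst (fst (snd q))" "?s 9 = cst (fst (snd (snd q)))"
        "?s 10 = cst (snd (snd (snd q)))" "?s 11 = cst (quad_update M q)"
        using soundD'(2)[OF b(1)] by blast
      obtain t t' where t: "V 2 = cvec t" "V 3 = cvec t'" "length t = N" "length t' = N" "val t' = val t + 1"
        using soundD(1)[OF b(8) V(1)] by blast
      obtain p p' where p: "V 4 = cvec p" "V 5 = cvec p'" "length p = N" "length p' = N" "val p' = (val p + 1) mod 2 ^ N"
        using soundD(2)[OF b(6) V(1)] by blast
      obtain p'' where p'': "V 6 = cvec p''" "length p'' = N" "val p'' = (val p' + 1) mod 2 ^ N"
        using soundD(2)[OF b(7) V(1)] p(2) by auto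
      have "sound (cell_atom (cst (update M (fst q) (fst (snd q)) (fst (snd (snd q))) (snd (snd (snd q))))) (cvec t') (cvec p'))"
        by (rule update_sound[OF b(2)[unfolded q t] b(3)[unfolded q t p] b(4)[unfolded q t p] b(5)[unfolded q t p'']])
          (use t p p'' in auto)
      moreover have "a = cell_atom (?s 11) (V 3) (V 5)" using head by (simp add: i V)
      ultimately show ?thesis using q(5) t(2) p(2) by (simp add: quad_update_def)
    next
      assume "r0 = prule [] [cell_atom (Var (slot 7 0)) (cvec (False # replicate (N - 1) True)) ?zero, reject_atom (Var (slot 7 0))]"
      then show ?thesis using head by simp
    qed
  qed
  then show ?thesis using assms by blast
qed

section \<open>Completeness: the correct cells are derivable\<close>

abbreviation program where "program \<equiv> set (clock_program M N x)"
abbreviation consequences where "consequences \<equiv> derived (grd program)"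
abbreviation zero_vec where "zero_vec \<equiv> cvec (replicate N False)"

lemma fact_const: "prule [a] [] \<in> program \<Longrightarrow> Const c \<in> set (args a) \<Longrightarrow> c \<in> herbrand_universe program"
proof -
  assume a: "prule [a] [] \<in> program" "Const c \<in> set (args a)"
  then have "a \<in> atoms program" by (force simp: atoms_def prule_def)
  then show ?thesis using a(2) by (auto simp: herbrand_universe_def Let_def consts_atom_def)
qed

lemma bit_in_universe: "[b] \<in> herbrand_universe program"
  by (rule fact_const[of "bit_atom (Const [b])"]) (auto simp: clock_program_iff bit_atom_def)

lemma update_rule: "q \<in> set (quads M) \<Longrightarrow> prule [update_atom (cst (fst q)) (cst (fst (snd q))) (cst (fst (snd (snd q))))
                       (cst (snd (snd (snd q)))) (cst (quad_update M q))] [] \<in> program"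
  unfolding clock_program_iff by blast

lemma cell_in_universe:
  assumes "c \<in> cells M"
  shows "symbol c \<in> herbrand_universe program"
proof -
  have "(c, c, c, c) \<in> set (quads M)" using assms by (simp add: set_quads)
  from update_rule[OF this] show ?thesis by (rule fact_const) (simp add: update_atom_def)
qed

lemma derive_instance:
  assumes r: "prule [h] bs \<in> program" and asg: "\<And>k. set (asg k) \<subseteq> herbrand_universe program"
    and bs: "\<And>b. b \<in> set bs \<Longrightarrow> subst_atom (slot_value asg) b \<in> consequences"
  shows "subst_atom (slot_value asg) h \<in> consequences"
proof (rule derivedI)
  have "slot_value asg v \<in> herbrand_universe program" for v
    using subsetD[OF asg nth_mem] bit_in_universe by (auto simp: slot_value_def Let_def)
  then show "map_rule (subst_atom (slot_value asg)) (prule [h] bs) \<in> grd program"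
    using r unfolding grd_def by blast
qed (use bs in \<open>auto simp: head_map_rule body_atoms_map_rule\<close>)

lemma derive_fact: "prule [h] [] \<in> program \<Longrightarrow> (\<And>\<sigma>. subst_atom \<sigma> h = h) \<Longrightarrow> h \<in> consequences"
  using derive_instance[of h "[]" "\<lambda>_. []"] by simp

lemma words_in_universe: "set (words w k) \<subseteq> herbrand_universe program"
  using bit_in_universe by (auto simp: words_def)

lemma derived_bit: "bit_atom (Const [b]) \<in> consequences"
  by (rule derive_fact) (auto simp: clock_program_iff)

text \<open>The rule to use is the one for the position of the carry; its prefix variables take the
  common prefix \<open>w\<close>.\<close>

lemma derived_succ:
  assumes "length u = N" "length v = N" "val v = val u + 1"
  shows "succ_atom (cvec u) (cvec v) \<in> consequences"
proof -
  obtain w m where w: "u = w @ False # replicate m True" "v = w @ True # replicate m False"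
    using carry_decomposition assms by metis
  let ?k = "length w" and ?h = "\<lambda>k. succ_atom (vars k 0 @ cvec (False # replicate (N - Suc k) True))
      (vars k 0 @ cvec (True # replicate (N - Suc k) False))" and ?asg = "words (\<lambda>_. w)"
  have k: "?k < N" "N - Suc ?k = m" using w assms by auto
  have "prule [?h ?k] (map (\<lambda>j. bit_atom (Var (slot 0 j))) [0..<?k]) \<in> program"
    using k(1) unfolding clock_program_iff by blast
  then have "subst_atom (slot_value ?asg) (?h ?k) \<in> consequences"
  proof (rule derive_instance)
    fix b assume "b \<in> set (map (\<lambda>j. bit_atom (Var (slot 0 j))) [0..<?k])"
    then show "subst_atom (slot_value ?asg) b \<in> consequences"
      using derived_bit by (auto simp: slot_value_eq words_def)
  qed (rule words_in_universe)
  then show ?thesis using k(2) by (simp add: slot_value_words w)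
qed

lemma derived_circ:
  assumes uv: "length u = N" "length v = N" "val v = (val u + 1) mod 2 ^ N"
  shows "circ_atom (cvec u) (cvec v) \<in> consequences"
proof (cases "val u + 1 < 2 ^ N")
  case True
  then have s: "succ_atom (cvec u) (cvec v) \<in> consequences" using uv by (intro derived_succ) auto
  let ?asg = "words (\<lambda>k. if k = 0 then u else v)"
  have "prule [circ_atom (vars N 0) (vars N 1)] [succ_atom (vars N 0) (vars N 1)] \<in> program"
    unfolding clock_program_iff by blast
  then have "subst_atom (slot_value ?asg) (circ_atom (vars N 0) (vars N 1)) \<in> consequences"
    by (rule derive_instance[OF _ words_in_universe]) (use s uv in \<open>auto simp: slot_value_words\<close>)
  then show ?thesis using uv by (simp add: slot_value_words)
next
  case False
  then have "val u + 1 = 2 ^ N" using val_less[of u] uv(1) by simp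
  then have "u = replicate N True" "v = replicate N False"
    using uv val_replicate[of N] by (auto intro!: val_inject)
  moreover have "circ_atom (cvec (replicate N True)) zero_vec \<in> consequences"
    by (rule derive_fact) (auto simp: clock_program_iff)
  ultimately show ?thesis by simp
qed

lemma derived_index: "i \<le> length x \<Longrightarrow> length u = N \<Longrightarrow> val u = i \<Longrightarrow> index_atom i (cvec u) \<in> consequences"
proof (induction i arbitrary: u)
  case 0
  then have "u = replicate N False" by (intro val_inject) (auto simp: val_replicate)
  moreover have "index_atom 0 zero_vec \<in> consequences" by (rule derive_fact) (auto simp: clock_program_iff)
  ultimately show ?case by simp
next
  case (Suc i)
  define v where "v = binary N i"
  have v: "length v = N" "val v = i" using Suc.prems val_less[of u] by (auto simp: v_def)
  let ?asg = "words (\<lambda>k. if k = 0 then v else u)"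
  have s: "succ_atom (cvec v) (cvec u) \<in> consequences" using Suc.prems v by (intro derived_succ) simp_all
  have i: "index_atom i (cvec v) \<in> consequences" using Suc v by simp
  have "i < length x" using Suc.prems by simp
  then have "prule [index_atom (Suc i) (vars N 1)] [index_atom i (vars N 0), succ_atom (vars N 0) (vars N 1)] \<in> program"
    unfolding clock_program_iff by blast
  then have "subst_atom (slot_value ?asg) (index_atom (Suc i) (vars N 1)) \<in> consequences"
    by (rule derive_instance[OF _ words_in_universe])
      (use Suc.prems(2) v(1) s i in \<open>auto simp: slot_value_words\<close>)
  then show ?case using Suc.prems by (simp add: slot_value_words)
qed

text \<open>The blank propagates by the plain successor without wrap-around from the end of the
  input to the largest vector, and so covers the negative positions as well.\<close>

lemma derived_start:
  "length u = N \<Longrightarrow>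
    cell_atom (cst (start_cell M (if val u < length x then bit_symbol (x ! val u) else 0) (val u = 0))) zero_vec (cvec u) \<in> consequences"
proof (induction "val u" arbitrary: u rule: less_induct)
  case less
  note u = less.prems
  define v where "v = binary N (val u - 1)"
  have v: "length v = N" "val v = val u - 1" using val_less[of u] u by (auto simp: v_def)
  let ?asg = "words (\<lambda>k. if k = 0 then v else u)"
  have step: "cell_atom (cst (start_cell M 0 False)) zero_vec (cvec u) \<in> consequences"
    if "prule [cell_atom (cst (start_cell M 0 False)) zero_vec (vars N 1)] [a, succ_atom (vars N 0) (vars N 1)] \<in> program"
      "subst_atom (slot_value ?asg) a \<in> consequences" "0 < val u" for a
  proof -
    have "succ_atom (cvec v) (cvec u) \<in> consequences" using that(3) u v by (intro derived_succ) simp_all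
    with that(2) have "subst_atom (slot_value ?asg) (cell_atom (cst (start_cell M 0 False)) zero_vec (vars N 1)) \<in> consequences"
      using u v by (intro derive_instance[OF that(1) words_in_universe]) (auto simp: slot_value_words)
    then show ?thesis using u by (simp add: slot_value_words)
  qed
  have init: "cell_atom c zero_vec (cvec u) \<in> consequences"
    if "prule [cell_atom c zero_vec (vars N 0)] [index_atom (val u) (vars N 0)] \<in> program" "val u \<le> length x" "\<And>\<sigma>. subst_trm \<sigma> c = c" for c
  proof -
    have "index_atom (val u) (cvec u) \<in> consequences" using that(2) u by (intro derived_index) simp_all
    then have "subst_atom (slot_value (words (\<lambda>_. u))) (cell_atom c zero_vec (vars N 0)) \<in> consequences"
      using u by (intro derive_instance[OF that(1) words_in_universe]) (auto simp: slot_value_words)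
    then show ?thesis using u that(3) by (simp add: slot_value_words)
  qed
  consider "val u < length x" | "val u = length x" | "val u = Suc (length x)" | "Suc (length x) < val u" by linarith
  then show ?case
  proof cases
    case 1
    then have "prule [cell_atom (cst (start_cell M (bit_symbol (x ! val u)) (val u = 0))) zero_vec (vars N 0)]
       [index_atom (val u) (vars N 0)] \<in> program"
      unfolding clock_program_iff by blast
    then show ?thesis using init 1 by simp
  next
    case 2
    have "prule [cell_atom (cst (start_cell M 0 (length x = 0))) zero_vec (vars N 0)]
       [index_atom (length x) (vars N 0)] \<in> program"
      unfolding clock_program_iff by blast
    then show ?thesis using init[of "cst (start_cell M 0 (length x = 0))"] by (simp add: 2)
  next
    case 3
    have "index_atom (length x) (cvec v) \<in> consequences" using 3 v by (intro derived_index) simp_all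
    moreover have "prule [cell_atom (cst (start_cell M 0 False)) zero_vec (vars N 1)]
       [index_atom (length x) (vars N 0), succ_atom (vars N 0) (vars N 1)] \<in> program"
      unfolding clock_program_iff by blast
    ultimately have "cell_atom (cst (start_cell M 0 False)) zero_vec (cvec u) \<in> consequences"
      using 3 v by (intro step[of "index_atom (length x) (vars N 0)"]) (simp_all add: slot_value_words)
    then show ?thesis using 3 by simp
  next
    case 4
    have "prule [cell_atom (cst (start_cell M 0 False)) zero_vec (vars N 1)]
       [cell_atom (cst (start_cell M 0 False)) zero_vec (vars N 0), succ_atom (vars N 0) (vars N 1)] \<in> program"
      unfolding clock_program_iff by blast
    moreover have "cell_atom (cst (start_cell M 0 False)) zero_vec (cvec v) \<in> consequences"
    proof -
      have "\<not> val v < length x" "val v \<noteq> 0" "val v < val u" using 4 v by auto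
      then show ?thesis using less.hyps[of v] v(1) by simp
    qed
    ultimately have "cell_atom (cst (start_cell M 0 False)) zero_vec (cvec u) \<in> consequences"
      using 4 v by (intro step) (auto simp: slot_value_words)
    then show ?thesis using 4 by simp
  qed
qed

text \<open>Induction on the time within the same cone that soundness uses. A cell is obtained by
  instantiating the transition rule with the actual previous contents of the head cell and the three
  neighbours.\<close>

lemma derived_cell:
  "length u = N \<Longrightarrow> length p = N \<Longrightarrow> \<bar>i\<bar> + int (val u) \<le> int B \<Longrightarrow> int (val p) = i mod 2 ^ N \<Longrightarrow>
    cell_atom (cst (cell_at M x (val u) i)) (cvec u) (cvec p) \<in> consequences"
proof (induction "val u" arbitrary: u p i)
  case 0
  then have "u = replicate N False" by (intro val_inject) (auto simp: val_replicate)
  moreover have "cell_at M x (val u) i = start_cell M (if val p < length x then bit_symbol (x ! val p) else 0) (val p = 0)"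
  proof -
    have B': "(2::int) ^ N = 2 * int B + 2" using arg_cong[OF B, of int] by simp
    have "int (val p) = (if 0 \<le> i then i else i + 2 ^ N)"
      using cone_position[of i "val p"] val_less[of p] 0 by simp
    then show ?thesis using 0 B' x unfolding \<open>0 = val u\<close>[symmetric] cell_at_0
      by (cases "0 \<le> i") auto
  qed
  ultimately show ?case using derived_start[of p] 0 by simp
next
  case (Suc t)
  define w where "w = binary N t"
  have w: "length w = N" "val w = t" using Suc.hyps(2) val_less[of u] Suc.prems(1) by (auto simp: w_def)
  \<comment> \<open>The vector of a position, by its residue; it turns neighbouring positions into
    cyclic successors also across zero.\<close>
  define m where "m k = binary N (nat (k mod 2 ^ N))" for k :: int
  have m: "length (m k) = N" "int (val (m k)) = k mod 2 ^ N" for k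
    by (auto simp: m_def nat_less_iff)
  have IH: "cell_atom (cst (cell_at M x t k)) (cvec w) (cvec (m k)) \<in> consequences" if "\<bar>k\<bar> \<le> \<bar>i\<bar> + 1" for k
    using Suc.hyps(1)[of w "m k" k] w m that Suc.prems(3) Suc.hyps(2) by simp
  have m0: "m 0 = replicate N False" using m[of 0] by (intro val_inject) (auto simp: val_replicate)
  have mi: "m i = p" using m[of i] Suc.prems by (intro val_inject) auto
  have circ: "circ_atom (cvec (m k)) (cvec (m (k + 1))) \<in> consequences" for k
  proof (rule derived_circ)
    have "int (val (m (k + 1))) = int ((val (m k) + 1) mod 2 ^ N)"
      by (simp add: m zmod_int mod_simps add.commute)
    then show "val (m (k + 1)) = (val (m k) + 1) mod 2 ^ N" by (simp only: of_nat_eq_iff)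
  qed (rule m)+
  define C where "C k = cell_at M x t k" for k
  define q where "q = (C 0, C (i - 1), C i, C (i + 1))"
  have C: "C k \<in> cells M" for k by (simp add: C_def cell_at_in_cells[OF M])
  have q: "quad_update M q = cell_at M x (val u) i"
    by (simp add: q_def quad_update_def C_def cell_at_Suc[OF M] flip: Suc.hyps(2))
  have upd: "update_atom (cst (C 0)) (cst (C (i - 1))) (cst (C i)) (cst (C (i + 1))) (cst (cell_at M x (val u) i)) \<in> consequences"
  proof (rule derive_fact)
    have "q \<in> set (quads M)" using C by (simp add: q_def set_quads)
    from update_rule[OF this] show "prule [update_atom (cst (C 0)) (cst (C (i - 1))) (cst (C i)) (cst (C (i + 1)))
        (cst (cell_at M x (val u) i))] [] \<in> program"
      by (simp only: q) (simp add: q_def)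
  qed simp
  define asg where "asg k = (if k = 2 then words (\<lambda>_. w) k else if k = 3 then words (\<lambda>_. u) k
     else if k = 4 then words (\<lambda>_. m (i - 1)) k else if k = 5 then words (\<lambda>_. m i) k
     else if k = 6 then words (\<lambda>_. m (i + 1)) k else if k = 7 then [symbol (C 0)] else if k = 8 then [symbol (C (i - 1))]
     else if k = 9 then [symbol (C i)] else if k = 10 then [symbol (C (i + 1))] else [symbol (cell_at M x (val u) i)])" for k
  have V: "map (subst_trm (slot_value asg)) (vars N 2) = cvec w" "map (subst_trm (slot_value asg)) (vars N 3) = cvec u"
    "map (subst_trm (slot_value asg)) (vars N 4) = cvec (m (i - 1))" "map (subst_trm (slot_value asg)) (vars N 5) = cvec (m i)"
    "map (subst_trm (slot_value asg)) (vars N 6) = cvec (m (i + 1))"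
    using w m Suc.prems by (subst slot_value_vars; simp add: asg_def words_def cvec_def)+
  have S: "slot_value asg (slot 7 0) = symbol (C 0)" "slot_value asg (slot 8 0) = symbol (C (i - 1))"
    "slot_value asg (slot 9 0) = symbol (C i)" "slot_value asg (slot 10 0) = symbol (C (i + 1))"
    "slot_value asg (slot 11 0) = symbol (cell_at M x (val u) i)"
    by (subst slot_value_eq; simp add: asg_def)+
  have r: "prule [cell_atom (Var (slot 11 0)) (vars N 3) (vars N 5)]
        [update_atom (Var (slot 7 0)) (Var (slot 8 0)) (Var (slot 9 0)) (Var (slot 10 0)) (Var (slot 11 0)),
         cell_atom (Var (slot 7 0)) (vars N 2) zero_vec, cell_atom (Var (slot 8 0)) (vars N 2) (vars N 4),
         cell_atom (Var (slot 9 0)) (vars N 2) (vars N 5), cell_atom (Var (slot 10 0)) (vars N 2) (vars N 6),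
         circ_atom (vars N 4) (vars N 5), circ_atom (vars N 5) (vars N 6), succ_atom (vars N 2) (vars N 3)] \<in> program"
    unfolding clock_program_iff by blast
  have "subst_atom (slot_value asg) (cell_atom (Var (slot 11 0)) (vars N 3) (vars N 5)) \<in> consequences"
  proof (rule derive_instance[OF r])
    show "set (asg k) \<subseteq> herbrand_universe program" for k
      using words_in_universe cell_in_universe[OF C] cell_in_universe[OF cell_at_in_cells[OF M]] by (auto simp: asg_def)
    have "succ_atom (cvec w) (cvec u) \<in> consequences" using w Suc by (intro derived_succ) auto
    moreover have "circ_atom (cvec (m (i - 1))) (cvec (m i)) \<in> consequences" using circ[of "i - 1"] by simp
    ultimately show "subst_atom (slot_value asg) b \<in> consequences" if "b \<in> set [update_atom (Var (slot 7 0)) (Var (slot 8 0)) (Var (slot 9 0)) (Var (slot 10 0)) (Var (slot 11 0)),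
         cell_atom (Var (slot 7 0)) (vars N 2) zero_vec, cell_atom (Var (slot 8 0)) (vars N 2) (vars N 4),
         cell_atom (Var (slot 9 0)) (vars N 2) (vars N 5), cell_atom (Var (slot 10 0)) (vars N 2) (vars N 6),
         circ_atom (vars N 4) (vars N 5), circ_atom (vars N 5) (vars N 6), succ_atom (vars N 2) (vars N 3)]" for b
      using that upd IH[of 0, unfolded m0, folded C_def] IH[of "i - 1", folded C_def] IH[of i, folded C_def]
        IH[of "i + 1", folded C_def] circ[of i]
      unfolding list.set insert_iff empty_iff
      by (elim disjE FalseE) (simp_all add: V S )
  qed
  then show ?case by (simp add: V S mi)
qed

text \<open>The constraint tests for the rejecting state: for a deterministic machine non-rejection
  can stand for acceptance, so that violated constraints match no-instances.\<close>

lemma clock_correct: "inconsistent (grd program) \<longleftrightarrow> fst (run M x B) = 2"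
proof -
  let ?u = "False # replicate (N - 1) True" and ?z = "Var (slot 7 0)"
  have N: "N \<noteq> 0" using B by (intro notI) simp
  \<comment> \<open>The leading bit is 0 and the other \<open>N - 1\<close> bits are 1, which is the
    vector of \<open>2 ^ (N - 1) - 1\<close>.\<close>
  have u: "length ?u = N" "val ?u = B"
    using N val_replicate(2)[of "N - 1"] B power_Suc[of "2::nat" "N - 1"] by auto
  show ?thesis
  proof
    assume "inconsistent (grd program)"
    then obtain r' where r': "r' \<in> grd program" "head r' = []" "set (body_atoms r') \<subseteq> consequences" unfolding inconsistent_def by blast
    then obtain \<sigma> r where "r \<in> program" "r' = map_rule (subst_atom \<sigma>) r" unfolding grd_def by blast
    with r' have r: "r \<in> program" "head r = []" "\<And>b. b \<in> set (body_atoms r) \<Longrightarrow> subst_atom \<sigma> b \<in> consequences"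
      by (auto simp: head_map_rule body_atoms_map_rule)
    from r(1,2) have "r = prule [] [cell_atom ?z (cvec ?u) zero_vec, reject_atom ?z]"
      unfolding clock_program_iff by (elim disjE exE conjE bexE) (simp_all only: prule_simps list.simps)
    then have "sound (cell_atom (Const (\<sigma> (slot 7 0))) (cvec ?u) zero_vec)" "sound (reject_atom (Const (\<sigma> (slot 7 0))))"
      using derived_sound[OF r(3), of "cell_atom ?z (cvec ?u) zero_vec"] derived_sound[OF r(3), of "reject_atom ?z"]
      by simp_all
    then obtain c where "fst c = 2" "sound (cell_atom (cst c) (cvec ?u) zero_vec)" using soundD'(3) by metis
    then have "c = cell_at M x B 0"
      using soundD(3)[of "cst c" "cvec ?u" zero_vec] u by (auto simp: val_replicate)
    then show "fst (run M x B) = 2" using \<open>fst c = 2\<close> by (simp add: cell_at_def)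
  next
    assume rej: "fst (run M x B) = 2"
    define c where "c = cell_at M x B 0"
    have c: "c \<in> cells M" "fst c = 2" using rej by (simp_all add: c_def cell_at_in_cells[OF M]) (simp add: cell_at_def)
    have 1: "cell_atom (cst c) (cvec ?u) zero_vec \<in> consequences"
      using derived_cell[of ?u "replicate N False" 0] u by (simp add: val_replicate c_def)
    have 2: "reject_atom (cst c) \<in> consequences"
      by (rule derive_fact) (unfold clock_program_iff, use c in \<open>blast, simp\<close>)
    let ?r = "prule [] [cell_atom ?z (cvec ?u) zero_vec, reject_atom ?z]" and ?\<sigma> = "\<lambda>_. symbol c"
    have "?r \<in> program" unfolding clock_program_iff by blast
    moreover have "range ?\<sigma> \<subseteq> herbrand_universe program" using cell_in_universe[OF c(1)] by auto
    ultimately have "map_rule (subst_atom ?\<sigma>) ?r \<in> grd program" unfolding grd_def by blast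
    then show "inconsistent (grd program)" unfolding inconsistent_def
      using 1 2 by (intro bexI[of _ "map_rule (subst_atom ?\<sigma>) ?r"])
        (auto simp: head_map_rule body_atoms_map_rule simp del: cvec_simps(3))
  qed
qed

end

section \<open>The clock program belongs to the class, and the reduction\<close>

lemma safe_prule: "safe (prule H bs) \<longleftrightarrow> (\<forall>a\<in>set H. \<forall>v\<in>vars_atom a. \<exists>b\<in>set bs. v \<in> vars_atom b)"
proof -
  have "neg_body (prule H bs) = {}" "pos_body (prule H bs) = set bs"
    by (auto simp: neg_body_def pos_body_def prule_def)
  then show ?thesis by (auto simp: safe_def)
qed

lemma set_rule_prule: "set_rule (prule H bs) = set H \<union> set bs"
  by (auto simp: prule_def)

lemma horn_prule: "length H \<le> 1 \<Longrightarrow> horn (prule H bs)"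
  by (simp add: prule_def horn_Pos)

lemma vars_atoms [simp]:
  "vars_atom (bit_atom a) = {v. Var v = a}"
  "vars_atom (succ_atom u v) = {w. Var w \<in> set u \<union> set v}"
  "vars_atom (circ_atom u v) = {w. Var w \<in> set u \<union> set v}"
  "vars_atom (update_atom z l c r e) = {w. Var w \<in> {z, l, c, r, e}}"
  "vars_atom (cell_atom a t p) = {w. Var w \<in> insert a (set t \<union> set p)}"
  "vars_atom (reject_atom a) = {v. Var v = a}"
  "vars_atom (index_atom i u) = {w. Var w \<in> set u}"
  by (auto simp: vars_atom_def atom_defs)

lemma Var_in_vectors: "Var v \<in> set (vars l k) \<longleftrightarrow> (\<exists>j<l. v = slot k j)" "Var v \<notin> set (cvec u)"
  by (auto simp: vars_def cvec_def)

lemma clock_program_class: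
  "set (clock_program M N x) \<in> EHorn" "\<not> ground (set (clock_program M N x))"
proof -
  have "safe r" if "r \<in> set (clock_program M N x)" for r
    using that unfolding clock_program_iff
    by (elim disjE exE conjE bexE; hypsubst; force simp: safe_prule Var_in_vectors simp del: cvec_simps(3))
  moreover have "horn r" if "r \<in> set (clock_program M N x)" for r
    using that unfolding clock_program_iff
    by (elim disjE exE conjE bexE; hypsubst; simp add: horn_prule)
  ultimately show "set (clock_program M N x) \<in> EHorn" by (auto simp: EHorn_iff)
  let ?r = "prule [] [cell_atom (Var (slot 7 0)) (cvec (False # replicate (N - 1) True)) (cvec (replicate N False)),
         reject_atom (Var (slot 7 0))]"
  have "?r \<in> set (clock_program M N x)" unfolding clock_program_iff by blast
  then have "reject_atom (Var (slot 7 0)) \<in> atoms (set (clock_program M N x))"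
    unfolding atoms_def by (rule UN_I) (simp add: set_rule_prule)
  then show "\<not> ground (set (clock_program M N x))"
    unfolding ground_def by (intro notI) (drule (1) bspec, simp)
qed

lemma ptime_clock_program: "ptime (\<lambda>q. clock_program M (fst q) (snd q))"
  unfolding clock_program_def Let_def prule_def atom_defs vars_def slot_def cvec_def
  by (intro ptime_intros)

text \<open>Only the number \<open>N\<close> of bits has to be written down, and it is polynomial;
  the exponential time and space exist only as values of vectors.\<close>

theorem nonground_EXP_hard: "hard_for class_EXP (world_view_existence {P \<in> EHorn. \<not> ground P})"
  unfolding hard_for_def
proof
  fix A assume "A \<in> class_EXP"
  then obtain M k c where M: "wf_tm M" "decides_in_time M A (\<lambda>n. c * 2 ^ (n ^ k) + c)"
    unfolding class_EXP_def DTIME_def by blast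
  define N where "N x = length x ^ k + length x + c + 3" for x :: "bool list"
  define f where "f x = enc_program (clock_program M (N x) x)" for x
  have "ptime N" unfolding N_def[abs_def] by (intro ptime_intros)
  then have "ptime (\<lambda>x. clock_program M (N x) x)"
    using ptime_comp[OF ptime_clock_program, of "\<lambda>x. (N x, x)" M] by (simp add: ptime_intros)
  then have "poly_time_computable f"
    unfolding f_def[abs_def] by (intro ptime_poly_time_computable ptime_enc_program)
  moreover have "x \<in> A \<longleftrightarrow> f x \<in> world_view_existence {P \<in> EHorn. \<not> ground P}" for x
  proof -
    let ?n = "length x"
    \<comment> \<open>The summands \<open>n ^ k\<close>, \<open>n\<close> and \<open>c\<close> of
      \<open>N\<close> provide factors dominating the time bound, the input length and the constant;
      the 3 leaves the factor 4 after one bit is lost to \<open>N - 1\<close>.\<close>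
    define B :: nat where "B = 2 ^ (N x - 1) - 1"
    have "2 ^ (N x - 1) = (4::nat) * 2 ^ (?n ^ k) * 2 ^ ?n * 2 ^ c"
      by (simp add: N_def power_add)
    moreover have "?n + 1 \<le> 2 ^ ?n" "c + 1 \<le> 2 ^ c" "1 \<le> (2::nat) ^ (?n ^ k)"
      using less_exp[of ?n] less_exp[of c] by (simp_all only: Suc_eq_plus1[symmetric] Suc_le_eq) auto
    ultimately have B: "2 ^ N x = 2 * B + 2" "?n \<le> B" "c * 2 ^ (?n ^ k) + c \<le> B"
    proof -
      assume N: "2 ^ (N x - 1) = 4 * 2 ^ (?n ^ k) * 2 ^ ?n * (2::nat) ^ c"
        and le: "?n + 1 \<le> 2 ^ ?n" "c + 1 \<le> 2 ^ c" "1 \<le> (2::nat) ^ (?n ^ k)"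
      have "N x = Suc (N x - 1)" by (simp add: N_def)
      then have "2 ^ N x = 2 * (2::nat) ^ (N x - 1)" by (metis power_Suc)
      moreover have "1 \<le> (2::nat) ^ (N x - 1)" by simp
      ultimately show "2 ^ N x = 2 * B + 2" unfolding B_def by linarith
      have "1 * (?n + 1) * 1 \<le> 2 ^ (?n ^ k) * 2 ^ ?n * (2::nat) ^ c" using le by (intro mult_le_mono) simp_all
      then show "?n \<le> B" unfolding B_def N by simp
      define Z where "Z = 2 ^ (?n ^ k) * 2 ^ ?n * (2::nat) ^ c"
      have "2 ^ (?n ^ k) * 1 * (c + 1) \<le> Z" unfolding Z_def using le by (intro mult_le_mono) simp_all
      then have "c * 2 ^ (?n ^ k) + 2 ^ (?n ^ k) \<le> Z" by (simp add: algebra_simps)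
      moreover have "c * 1 \<le> c * 2 ^ (?n ^ k)" using le(3) by (intro mult_le_mono2)
      moreover have "B = 4 * Z - 1" unfolding B_def N Z_def by simp
      ultimately show "c * 2 ^ (?n ^ k) + c \<le> B" using le(3) by linarith
    qed
    have "f x \<in> world_view_existence {P \<in> EHorn. \<not> ground P} \<longleftrightarrow>
        \<not> inconsistent (grd (set (clock_program M (N x) x)))"
      unfolding world_view_existence_eq f_def by (simp add: decode_enc_program clock_program_class)
    also have "\<dots> \<longleftrightarrow> fst (run M x B) \<noteq> 2"
      by (simp add: clock_correct[OF M(1) B(1,2)])
    also have "\<dots> \<longleftrightarrow> x \<in> A" using decides_state[OF M(2) B(3)] by simp
    finally show ?thesis by blast
  qed
  ultimately show "poly_reducible A (world_view_existence {P \<in> EHorn. \<not> ground P})"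
    unfolding poly_reducible_def by blast
qed

text \<open>Membership in coNP is obtained for each arity bound, and hardness from 2 on because the
  grid program uses binary predicates.\<close>

theorem lemma5:
  shows "world_view_existence {P \<in> EHorn. ground P} \<in> class_P \<and>
    ((\<forall>m. world_view_existence {P \<in> EHorn. \<not> ground P \<and> arity_at_most m P} \<in> class_coNP) \<and>
     (\<forall>m \<ge> 2. complete_for class_coNP
        (world_view_existence {P \<in> EHorn. \<not> ground P \<and> arity_at_most m P}))) \<and>
    complete_for class_EXP (world_view_existence {P \<in> EHorn. \<not> ground P})"
  using ground_in_P bounded_arity_in_coNP bounded_arity_coNP_hard nonground_in_EXP nonground_EXP_hard
  by (simp add: complete_for_def)

end
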